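(* Let $1\le q<p\le\infty$, $k\in\mathbb N$, and $\alpha,\beta\ge0$. Then for every $n\in\mathbb N$, \[ \mathcal E(\mathbb M^k\cap\mathbb B_p^{\alpha,\beta},\mathcal P_n)_{w_{\alpha,\beta},q}\sim \begin{cases} n^{-2/q+2/p}, & k\ge2,\ (k,q,p)\ne(2,1,\infty),\\ n^{-2}, & k=2,\ q=1,\ p=\infty,\ \alpha=\beta=0,\\ n^{-\min\{2/q-2/p,\,1/q\}}, & k=1,\ p\ne2q. \end{cases} \] If $k=2$, $q=1$, $p=\infty$ and $(\alpha,\beta)\ne(0,0)$, then $c n^{-2}\le\mathcal E(\mathbb M^2\cap\mathbb B_\infty^{\alpha,\beta},\mathcal P_n)_{w_{\alpha,\beta},1}\le c n^{-2}\ln(n+1)$. If $k=1$ and $p=2q$, then $c n^{-1/q}\le\mathcal E(\mathbb M^1\cap\mathbb B_{2q}^{\alpha,\beta},\mathcal P_n)_{w_{\alpha,\beta},q}\le c n^{-1/q}[\ln(n+1)]^{1/(2q)}$. Additionally, if $q>1$, then for any $\varepsilon>0$, \[ \limsup_{n\to\infty}n^{1/q}[\ln(n+1)]^{-1/(2q)+\varepsilon}\,\mathcal E(\mathbb M^1\cap\mathbb B_{2q}^{\alpha,\beta},\mathcal P_n)_{w_{\alpha,\beta},q}=\infty. \]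
   Context: $w_{\alpha,\beta}(x)=(1+x)^\alpha(1-x)^\beta$ on $[-1,1]$; $\|\cdot\|_p$ is the $L_p[-1,1]$ norm. $\mathbb B_p^{\alpha,\beta}$ is the set of functions $f$ with $\|w_{\alpha,\beta}f\|_p=1$. $\mathbb M^k$ is the set of functions $f:(-1,1)\to\mathbb R$ whose $k$th divided differences at any $k+1$ distinct points of $(-1,1)$ are nonnegative. $\mathcal P_n$ is the set of algebraic polynomials of degree at most $n$; $E_n(f)_{w,q}=\inf_{P\in\mathcal P_n}\|w(f-P)\|_q$ and $\mathcal E(X,\mathcal P_n)_{w,q}=\sup_{f\in X}E_n(f)_{w,q}$. $F\sim G$ means $c_1F\le G\le c_2F$ with positive constants independent of $n$; $c$ denotes positive constants independent of $n$ (depending possibly on $k,\alpha,\beta,p,q$). *)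

theory Defs
  imports "HOL-Probability.Probability" "HOL-Computational_Algebra.Polynomial"
begin

definition jw :: "real \<Rightarrow> real \<Rightarrow> real \<Rightarrow> real" where
  "jw \<alpha> \<beta> x = (1 + x) powr \<alpha> * (1 - x) powr \<beta>"

definition I11 :: "real measure" where
  "I11 = restrict_space lborel {-1..1}"

definition Lp_norm :: "ereal \<Rightarrow> (real \<Rightarrow> real) \<Rightarrow> ennreal" where
  "Lp_norm p f =
     (if f \<notin> borel_measurable I11 then \<infinity>
      else if p = \<infinity> then esssup I11 (\<lambda>x. ennreal \<bar>f x\<bar>)
      else (let I = (\<integral>\<^sup>+ x. ennreal (\<bar>f x\<bar> powr real_of_ereal p) \<partial>I11)
            in if I = \<infinity> then \<infinity> else ennreal (enn2real I powr (1 / real_of_ereal p))))"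

definition Bset :: "ereal \<Rightarrow> real \<Rightarrow> real \<Rightarrow> (real \<Rightarrow> real) set" where
  "Bset p \<alpha> \<beta> = {f. Lp_norm p (\<lambda>x. jw \<alpha> \<beta> x * f x) = 1}"

definition divdiff :: "real list \<Rightarrow> (real \<Rightarrow> real) \<Rightarrow> real" where
  "divdiff xs f = (\<Sum>i<length xs. f (xs ! i) /
       (\<Prod>j\<in>{..<length xs} - {i}. (xs ! i - xs ! j)))"

definition Mset :: "nat \<Rightarrow> (real \<Rightarrow> real) set" where
  "Mset k = {f. \<forall>xs. length xs = k + 1 \<and> distinct xs \<and> set xs \<subseteq> {-1<..<1}
                   \<longrightarrow> divdiff xs f \<ge> 0}"

definition En :: "nat \<Rightarrow> (real \<Rightarrow> real) \<Rightarrow> (real \<Rightarrow> real) \<Rightarrow> ereal \<Rightarrow> ennreal" where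
  "En n f w q = (INF P \<in> {P :: real poly. degree P \<le> n}. Lp_norm q (\<lambda>x. w x * (f x - poly P x)))"

definition Edev :: "(real \<Rightarrow> real) set \<Rightarrow> nat \<Rightarrow> (real \<Rightarrow> real) \<Rightarrow> ereal \<Rightarrow> ennreal" where
  "Edev X n w q = (SUP f \<in> X. En n f w q)"

definition einv :: "ereal \<Rightarrow> real" where
  "einv p = (if p = \<infinity> then 0 else 1 / real_of_ereal p)"

end

theory Submission
  imports Defs
begin

text \<open>Put \<open>x = cos \<theta>\<close>, \<open>\<tau>\<^sub>i = cos (i \<pi> / N)\<close> with \<open>N\<close> proportional to \<open>n\<close>. A function with nonnegative
  \<open>k\<close>-th divided differences is, between consecutive nodes, within its oscillation of a local
  interpolant of degree less than \<open>k\<close>; patching the interpolants together by polynomial steps which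
  decay fast away from the nodes costs a sum of local oscillations. These telescope, since divided
  differences of order \<open>k - 1\<close> are monotone, and the sum over dyadic blocks near the endpoints is
  controlled by Hoelder's inequality; the sign of the exponent of the resulting geometric series
  distinguishes the cases.

  For the lower bounds, \<open>\<kappa>(x) sin (N arccos x)\<close> annihilates the polynomials of degree at most \<open>n\<close>
  when \<open>\<kappa>\<close> is a polynomial of degree at most \<open>N - n - 2\<close>. Localising \<open>\<kappa>\<close> around nodes and testing
  against truncated powers at \<open>\<tau>\<^sub>1\<close>, a jump in the interior, or jumps at all dyadic nodes
  \<open>\<tau>\<^bsub>2^l\<^esub>\<close> gives the rates. The sum of dyadic jumps even shows that the logarithmic factor in the
  critical case \<open>p = 2 q\<close> is attained.\<close>

text \<open>Let \<rho> = ((k - 1) q - 1) / 2 + q / p. The nodes at distance about 2^(-j) from an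
  endpoint contribute N^(-(k - 1) q - 1) 2^(j \<rho>) to the q-th power of the error: the mesh there
  is about 2^(-j/2) / N, Hoelder bounds the differences of order k - 1, and the powers of the weight
  cancel. If \<rho> > 0, the endpoint levels with 2^j near N^2 dominate; if \<rho> < 0, which forces
  k = 1, the interior does. \<rho> = 0 means k = 1, p = 2 q or k = 2, q = 1, p = \<infinity>. In the
  first case the integrals of the p-th power over the levels have a bounded sum, so only the square
  root of the number of levels is lost; in the second, without weight, convexity bounds
  \<open>f\<close> everywhere and the levels telescope. The obstacle is that \<open>f\<close> is
  known only through a weighted norm and may be unbounded at the endpoints. Its divided differences
  are therefore estimated at points found by averaging, and on a fixed number of end cells
  \<open>f\<close> itself counts as error: these cells have measure of order N^(-2), and Hoelder
  shows that their share is within the rate.\<close>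

abbreviation werr :: "real \<Rightarrow> real \<Rightarrow> real \<Rightarrow> (real \<Rightarrow> real) \<Rightarrow> real poly \<Rightarrow> ennreal" where
  "werr \<alpha> \<beta> q f P \<equiv> (\<integral>\<^sup>+x. ennreal (\<bar>jw \<alpha> \<beta> x * (f x - poly P x)\<bar> powr q) \<partial>I11)"

abbreviation wmeas :: "real \<Rightarrow> real \<Rightarrow> (real \<Rightarrow> real) \<Rightarrow> bool" where
  "wmeas \<alpha> \<beta> f \<equiv> (\<lambda>x. jw \<alpha> \<beta> x * f x) \<in> borel_measurable I11"

section \<open>Divided differences over finite sets\<close>

text \<open>The Lagrange form, indexed by a set instead of a list, so that the symmetry in the nodes
  is built in and nodes can be removed and exchanged by set operations.\<close>

definition dd :: "real set \<Rightarrow> (real \<Rightarrow> real) \<Rightarrow> real" where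
  "dd A f = (\<Sum>a\<in>A. f a / (\<Prod>b\<in>A - {a}. a - b))"

lemma divdiff_eq_dd:
  assumes "distinct xs"
  shows "divdiff xs f = dd (set xs) f"
proof -
  have b: "bij_betw ((!) xs) {..<length xs} (set xs)"
    using bij_betw_nth[OF assms] by simp
  have "dd (set xs) f = (\<Sum>i<length xs. f (xs ! i) / (\<Prod>b\<in>set xs - {xs ! i}. xs ! i - b))"
    unfolding dd_def using sum.reindex_bij_betw[OF b, symmetric] by simp
  also have "... = divdiff xs f"
    unfolding divdiff_def
  proof (rule sum.cong[OF refl])
    fix i assume "i \<in> {..<length xs}"
    then have i: "i < length xs" by simp
    have b': "bij_betw ((!) xs) ({..<length xs} - {i}) (set xs - {xs ! i})"
      using bij_betw_DiffI[OF b, of "{i}" "{xs ! i}"] i by (auto simp: bij_betw_def)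
    show "f (xs ! i) / (\<Prod>b\<in>set xs - {xs ! i}. xs ! i - b) =
      f (xs ! i) / (\<Prod>j\<in>{..<length xs} - {i}. xs ! i - xs ! j)"
      using prod.reindex_bij_betw[OF b', of "\<lambda>b. xs ! i - b"] by simp
  qed
  finally show ?thesis by simp
qed

lemma Mset_iff_dd:
  "f \<in> Mset k \<longleftrightarrow> (\<forall>A. finite A \<and> card A = Suc k \<and> A \<subseteq> {-1<..<1} \<longrightarrow> dd A f \<ge> 0)"
proof
  assume f: "f \<in> Mset k"
  show "\<forall>A. finite A \<and> card A = Suc k \<and> A \<subseteq> {-1<..<1} \<longrightarrow> dd A f \<ge> 0"
  proof (intro allI impI)
    fix A :: "real set" assume A: "finite A \<and> card A = Suc k \<and> A \<subseteq> {-1<..<1}"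
    then obtain xs where xs: "set xs = A" "distinct xs"
      using finite_distinct_list by blast
    then have "length xs = k + 1" using A distinct_card by fastforce
    with f xs A have "divdiff xs f \<ge> 0" unfolding Mset_def by blast
    with xs show "dd A f \<ge> 0" by (simp add: divdiff_eq_dd)
  qed
next
  assume "\<forall>A. finite A \<and> card A = Suc k \<and> A \<subseteq> {-1<..<1} \<longrightarrow> dd A f \<ge> 0"
  then show "f \<in> Mset k"
    unfolding Mset_def by (auto simp: divdiff_eq_dd distinct_card)
qed

lemma MsetD:
  assumes "f \<in> Mset k" "finite A" "card A = Suc k" "A \<subseteq> {-1<..<1}"
  shows "dd A f \<ge> 0"
  using assms Mset_iff_dd by blast

text \<open>Removing the node \<open>e\<close> multiplies the term at \<open>c\<close> by
  \<open>c - e\<close>. This factor vanishes at \<open>c = e\<close>, so both differences on the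
  right are sums over all of \<open>A\<close> and the identity can be checked term by term.\<close>

lemma dd_rec:
  assumes A: "finite A" and ab: "a \<in> A" "b \<in> A" "a \<noteq> b"
  shows "(b - a) * dd A f = dd (A - {a}) f - dd (A - {b}) f"
proof -
  let ?g = "\<lambda>c. f c / (\<Prod>d\<in>A - {c}. c - d)"
  have tm: "c \<in> A - {e} \<Longrightarrow> e \<in> A \<Longrightarrow> f c / (\<Prod>d\<in>A - {e} - {c}. c - d) = ?g c * (c - e)" for c e
  proof -
    assume c: "c \<in> A - {e}" and e: "e \<in> A"
    have "A - {c} = insert e (A - {e} - {c})" using c e by auto
    then have "(\<Prod>d\<in>A - {c}. c - d) = (c - e) * (\<Prod>d\<in>A - {e} - {c}. c - d)"
      using A by (simp add: prod.insert_remove)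
    then show ?thesis using c by simp
  qed
  have dde: "dd (A - {e}) f = (\<Sum>c\<in>A. ?g c * (c - e))" if "e \<in> A" for e
  proof -
    have "dd (A - {e}) f = (\<Sum>c\<in>A - {e}. ?g c * (c - e))"
      unfolding dd_def using tm that by (intro sum.cong) auto
    also have "... = (\<Sum>c\<in>A. ?g c * (c - e))"
      using A that by (simp add: sum.remove[of A e])
    finally show ?thesis .
  qed
  have ring: "(b - a) * g = g * (c - a) - g * (c - b)" for c g :: real
    by (simp add: algebra_simps)
  show ?thesis
    unfolding dde[OF ab(1)] dde[OF ab(2)]
    unfolding dd_def sum_distrib_left sum_subtractf[symmetric]
    by (rule sum.cong[OF refl ring])
qed

lemma dd_cong: "(\<And>x. x \<in> A \<Longrightarrow> f x = g x) \<Longrightarrow> dd A f = dd A g"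
  unfolding dd_def by (intro sum.cong) auto

lemma dd_add: "dd A (\<lambda>x. f x + g x) = dd A f + dd A g"
  unfolding dd_def by (simp add: add_divide_distrib sum.distrib)

lemma dd_cmult: "dd A (\<lambda>x. c * f x) = c * dd A f"
  unfolding dd_def by (simp add: sum_distrib_left)

text \<open>The Leibniz rule for a linear factor. For \<open>t = a\<close> the factor cancels
  \<open>c - a\<close> in every denominator, which removes the node \<open>a\<close>; another
  \<open>t\<close> only adds a multiple of \<open>f\<close>.\<close>

lemma dd_times_linear:
  assumes A: "finite A" "a \<in> A"
  shows "dd A (\<lambda>x. (x - t) * f x) = (a - t) * dd A f + dd (A - {a}) f"
proof -
  have "dd A (\<lambda>x. (x - a) * f x) = dd (A - {a}) f"
  proof -
    have "dd A (\<lambda>x. (x - a) * f x) = (\<Sum>c\<in>A - {a}. (c - a) * f c / (\<Prod>d\<in>A - {c}. c - d))"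
      unfolding dd_def using A by (simp add: sum.remove[of A a])
    also have "... = dd (A - {a}) f" unfolding dd_def
    proof (rule sum.cong[OF refl])
      fix c assume c: "c \<in> A - {a}"
      have "A - {c} = insert a (A - {a} - {c})" using c A by auto
      then have "(\<Prod>d\<in>A - {c}. c - d) = (c - a) * (\<Prod>d\<in>A - {a} - {c}. c - d)"
        using A by (simp add: prod.insert_remove)
      then show "(c - a) * f c / (\<Prod>d\<in>A - {c}. c - d) = f c / (\<Prod>d\<in>A - {a} - {c}. c - d)"
        using c by simp
    qed
    finally show ?thesis .
  qed
  moreover have "dd A (\<lambda>x. (x - t) * f x) = dd A (\<lambda>x. (x - a) * f x + (a - t) * f x)"
    by (intro dd_cong) (simp add: algebra_simps)
  ultimately show ?thesis by (simp add: dd_add dd_cmult)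
qed

lemma dd_const:
  assumes "finite A" "2 \<le> card A"
  shows "dd A (\<lambda>x. c) = 0"
  using assms
proof (induction "card A" arbitrary: A rule: less_induct)
  case less
  obtain a where a: "a \<in> A" using less.prems by fastforce
  have "card (A - {a}) \<ge> 1" using less.prems a by simp
  then obtain b where b: "b \<in> A - {a}" by (metis card.empty equals0I not_one_le_zero)
  have "(b - a) * dd A (\<lambda>x. c) = 0"
  proof (cases "card A = 2")
    case True
    have "card (A - {a} - {b}) = 0" using True less.prems a b by simp
    then have "A - {a} - {b} = {}" using less.prems(1) by simp
    then have "A - {a} = {b}" "A - {b} = {a}" using a b by auto
    then show ?thesis
      by (subst dd_rec[OF less.prems(1) a]) (use b in \<open>auto simp: dd_def\<close>)
  next
    case False
    then have "card (A - {a}) \<ge> 2" "card (A - {b}) \<ge> 2" using less.prems a b by auto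
    then have "dd (A - {a}) (\<lambda>x. c) = 0" "dd (A - {b}) (\<lambda>x. c) = 0"
      using less a b by (auto intro!: less.hyps simp: card_gt_0_iff)
    then show ?thesis using dd_rec[OF less.prems(1) a, of b "\<lambda>x. c"] b by simp
  qed
  then show ?case using b by simp
qed

text \<open>Induction along the Horner scheme: \<open>pCons c p\<close> is a constant plus
  \<open>x\<close> times \<open>p\<close>, and \<open>dd_times_linear\<close> trades the factor
  \<open>x\<close> for one node.\<close>

lemma dd_poly_eq_0:
  fixes p :: "real poly"
  assumes "finite A" "degree p + 1 < card A"
  shows "dd A (poly p) = 0"
  using assms
proof (induction p arbitrary: A)
  case 0
  have "poly (0 :: real poly) = (\<lambda>x. 0)" by (rule ext) simp
  then show ?case by (simp add: dd_def)
next
  case (pCons c p)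
  have eq: "poly (pCons c p) = (\<lambda>x. c + (x - 0) * poly p x)" by (rule ext) simp
  obtain a where a: "a \<in> A" using pCons.prems by fastforce
  have "dd A (\<lambda>x. (x - 0) * poly p x) = 0"
  proof (cases "p = 0")
    case False
    then have "degree (pCons c p) = Suc (degree p)" by simp
    then have "degree p + 1 < card (A - {a})" using pCons.prems a by simp
    then have "dd (A - {a}) (poly p) = 0" "dd A (poly p) = 0"
      using pCons.IH[of "A - {a}"] pCons.IH[of A] pCons.prems a by auto
    then show ?thesis by (subst dd_times_linear[OF pCons.prems(1) a]) simp
  qed (simp add: dd_def)
  then show ?case unfolding eq dd_add using dd_const[of A c] pCons.prems by simp
qed

text \<open>The nodes of \<open>A\<close> are exchanged for those of \<open>B\<close> one at a time.
  By \<open>dd_rec\<close>, replacing \<open>a\<close> by \<open>b > a\<close> changes the value by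
  \<open>b - a\<close> times a difference of order \<open>k\<close>, which is nonnegative. In the
  inner induction \<open>C\<close> holds the nodes already exchanged.\<close>

lemma dd_mono:
  assumes f: "f \<in> Mset k"
    and "finite A" "finite B" "card A = k" "card B = k"
    and sub: "A \<subseteq> {-1<..<1}" "B \<subseteq> {-1<..<1}"
    and less: "\<And>a b. a \<in> A \<Longrightarrow> b \<in> B \<Longrightarrow> a < b"
  shows "dd A f \<le> dd B f"
proof -
  have "dd (A \<union> C) f \<le> dd (B \<union> C) f"
    if "finite A" "finite B" "finite C" "card A = m" "card B = m" "A \<inter> C = {}" "B \<inter> C = {}"
      "m + card C = k" "A \<union> B \<union> C \<subseteq> {-1<..<1}" "\<forall>a\<in>A. \<forall>b\<in>B. a < b" for A B C m
    using that
  proof (induction m arbitrary: A B C)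
    case 0
    then show ?case by simp
  next
    case (Suc m)
    obtain a A' where a: "A = insert a A'" "a \<notin> A'" "card A' = m"
      using Suc.prems(4) by (metis card_Suc_eq)
    obtain b B' where b: "B = insert b B'" "b \<notin> B'" "card B' = m"
      using Suc.prems(5) by (metis card_Suc_eq)
    have ab: "a < b" and bA: "b \<notin> A" and aB: "a \<notin> B" using Suc.prems(10) a b by force+
    let ?S = "insert a (insert b (A' \<union> C))"
    have cS: "card ?S = Suc k"
      using Suc.prems a b ab bA by (auto simp: card_Un_disjoint)
    have "dd ?S f \<ge> 0"
      using Suc.prems a b by (intro MsetD[OF f] cS) auto
    moreover have "(b - a) * dd ?S f = dd (?S - {a}) f - dd (?S - {b}) f"
      using Suc.prems a ab by (intro dd_rec) auto
    moreover have "?S - {a} = A' \<union> insert b C" "?S - {b} = A \<union> C"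
      using Suc.prems a b ab bA by auto
    ultimately have 1: "dd (A \<union> C) f \<le> dd (A' \<union> insert b C) f"
      using ab by (smt (verit) mult_nonneg_nonneg)
    have "dd (A' \<union> insert b C) f \<le> dd (B' \<union> insert b C) f"
      using Suc.prems a b bA by (intro Suc.IH) auto
    moreover have "B' \<union> insert b C = B \<union> C" using b by auto
    ultimately show ?case using 1 by simp
  qed
  from this[of A B "{}" k] show ?thesis using assms by auto
qed

section \<open>Lagrange interpolation, its error, and growth of polynomials away from the
  nodes\<close>

definition interp :: "real set \<Rightarrow> (real \<Rightarrow> real) \<Rightarrow> real poly" where
  "interp Y f = (\<Sum>y\<in>Y. smult (f y / (\<Prod>z\<in>Y - {y}. y - z)) (\<Prod>z\<in>Y - {y}. [:- z, 1:]))"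

lemma poly_interp:
  "poly (interp Y f) x = (\<Sum>y\<in>Y. f y / (\<Prod>z\<in>Y - {y}. y - z) * (\<Prod>z\<in>Y - {y}. x - z))"
  unfolding interp_def by (simp add: poly_sum poly_prod)

lemma degree_interp:
  assumes "finite Y"
  shows "degree (interp Y f) \<le> card Y - 1"
  unfolding interp_def
proof (rule degree_sum_le[OF assms])
  fix y assume y: "y \<in> Y"
  have "degree (\<Prod>z\<in>Y - {y}. [:- z, 1:]) \<le> (\<Sum>z\<in>Y - {y}. degree [:- z, 1:])"
    using degree_prod_sum_le[of "Y - {y}" "\<lambda>z. [:- z, 1:]"] assms by (simp add: o_def)
  also have "... = card Y - 1" using assms y by simp
  finally show "degree (smult (f y / (\<Prod>z\<in>Y - {y}. y - z)) (\<Prod>z\<in>Y - {y}. [:- z, 1:])) \<le> card Y - 1"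
    using degree_smult_le order.trans by blast
qed

lemma poly_interp_node:
  assumes "finite Y" "y \<in> Y"
  shows "poly (interp Y f) y = f y"
proof -
  have "poly (interp Y f) y = (\<Sum>z\<in>Y. if z = y then f y else 0)"
    unfolding poly_interp
  proof (rule sum.cong[OF refl])
    fix z assume z: "z \<in> Y"
    show "f z / (\<Prod>u\<in>Y - {z}. z - u) * (\<Prod>u\<in>Y - {z}. y - u) = (if z = y then f y else 0)"
    proof (cases "z = y")
      case True
      have "(\<Prod>u\<in>Y - {y}. y - u) \<noteq> 0" using assms by (subst prod_zero_iff) auto
      with True show ?thesis by simp
    next
      case False
      have "(\<Prod>u\<in>Y - {z}. y - u) = 0"
        by (rule prod_zero) (use assms False in auto)
      with False show ?thesis by simp
    qed
  qed
  also have "... = f y" using assms by simp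
  finally show ?thesis .
qed

text \<open>After multiplication by the product of all \<open>x - y\<close>, the term of the divided
  difference at \<open>x\<close> becomes \<open>f x\<close>, and the term at \<open>y\<close>
  becomes minus the Lagrange basis polynomial of \<open>y\<close> times \<open>f y\<close>.\<close>

lemma interp_error:
  assumes "finite Y" "x \<notin> Y"
  shows "f x - poly (interp Y f) x = dd (insert x Y) f * (\<Prod>y\<in>Y. x - y)"
proof -
  have nz: "(\<Prod>y\<in>Y. x - y) \<noteq> 0" using assms by (subst prod_zero_iff) auto
  have "insert x Y - {x} = Y" using assms by auto
  then have "dd (insert x Y) f = f x / (\<Prod>y\<in>Y. x - y) + (\<Sum>y\<in>Y. f y / (\<Prod>b\<in>insert x Y - {y}. y - b))"
    unfolding dd_def using assms by simp
  then have "dd (insert x Y) f * (\<Prod>y\<in>Y. x - y) =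
      f x + (\<Sum>y\<in>Y. f y / (\<Prod>b\<in>insert x Y - {y}. y - b) * (\<Prod>y\<in>Y. x - y))"
    using nz by (simp add: distrib_right sum_distrib_right)
  also have "(\<Sum>y\<in>Y. f y / (\<Prod>b\<in>insert x Y - {y}. y - b) * (\<Prod>y\<in>Y. x - y)) = - poly (interp Y f) x"
    unfolding poly_interp sum_negf[symmetric]
  proof (rule sum.cong[OF refl])
    fix y assume y: "y \<in> Y"
    have 1: "(\<Prod>b\<in>insert x Y - {y}. y - b) = (y - x) * (\<Prod>b\<in>Y - {y}. y - b)"
    proof -
      have "insert x Y - {y} = insert x (Y - {y})" using y assms by auto
      then show ?thesis using assms by simp
    qed
    have 2: "(\<Prod>y\<in>Y. x - y) = (x - y) * (\<Prod>b\<in>Y - {y}. x - b)"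
      using assms y by (simp add: prod.remove)
    have "x \<noteq> y" using y assms by auto
    then show "f y / (\<Prod>b\<in>insert x Y - {y}. y - b) * (\<Prod>y\<in>Y. x - y) =
       - (f y / (\<Prod>z\<in>Y - {y}. y - z) * (\<Prod>z\<in>Y - {y}. x - z))"
      unfolding 1 2 by (simp add: divide_simps) (simp add: algebra_simps)
  qed
  finally show ?thesis by simp
qed

lemma interp_poly_self:
  fixes p :: "real poly"
  assumes "finite Z" "degree p < card Z"
  shows "poly (interp Z (poly p)) x = poly p x"
proof (cases "x \<in> Z")
  case False
  then show ?thesis using interp_error[OF assms(1) False, of "poly p"] dd_poly_eq_0[of "insert x Z" p] assms
    by simp
qed (use assms poly_interp_node in blast)

text \<open>The polynomial is its own interpolant on \<open>Z\<close>, and each factor of a Lagrange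
  basis polynomial is at most \<open>L / s\<close>. This transports a bound from a few separated
  points of one cell to the whole interval.\<close>

lemma poly_growth:
  fixes p :: "real poly"
  assumes Z: "finite Z" "degree p < card Z" and b: "\<And>z. z \<in> Z \<Longrightarrow> \<bar>poly p z\<bar> \<le> B"
    and sep: "\<And>z z'. z \<in> Z \<Longrightarrow> z' \<in> Z \<Longrightarrow> z \<noteq> z' \<Longrightarrow> \<bar>z - z'\<bar> \<ge> s" and "s > 0"
    and dist: "\<And>z. z \<in> Z \<Longrightarrow> \<bar>x - z\<bar> \<le> L"
  shows "\<bar>poly p x\<bar> \<le> real (card Z) * B * (L / s) ^ (card Z - 1)"
proof -
  have "\<bar>poly p x\<bar> = \<bar>\<Sum>y\<in>Z. poly p y / (\<Prod>z\<in>Z - {y}. y - z) * (\<Prod>z\<in>Z - {y}. x - z)\<bar>"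
    using interp_poly_self[OF Z, of x] by (simp add: poly_interp)
  also have "... \<le> (\<Sum>y\<in>Z. \<bar>poly p y / (\<Prod>z\<in>Z - {y}. y - z) * (\<Prod>z\<in>Z - {y}. x - z)\<bar>)"
    by (rule sum_abs)
  also have "... \<le> (\<Sum>y\<in>Z. B * (L / s) ^ (card Z - 1))"
  proof (rule sum_mono)
    fix y assume y: "y \<in> Z"
    have B: "0 \<le> B" using b[OF y] by linarith
    have "\<bar>poly p y / (\<Prod>z\<in>Z - {y}. y - z) * (\<Prod>z\<in>Z - {y}. x - z)\<bar>
      = \<bar>poly p y\<bar> * (\<Prod>z\<in>Z - {y}. \<bar>x - z\<bar> / \<bar>y - z\<bar>)"
      by (simp add: abs_mult abs_prod prod_dividef)
    also have "... \<le> B * (\<Prod>z\<in>Z - {y}. L / s)"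
    proof (intro mult_mono prod_mono conjI prod_nonneg)
      fix z assume z: "z \<in> Z - {y}"
      then show "\<bar>x - z\<bar> / \<bar>y - z\<bar> \<le> L / s"
        using dist[of z] sep[of y z] y \<open>s > 0\<close> by (intro frac_le) auto
    qed (use b y B in auto)
    also have "... = B * (L / s) ^ (card Z - 1)" using Z y by simp
    finally show "\<bar>poly p y / (\<Prod>z\<in>Z - {y}. y - z) * (\<Prod>z\<in>Z - {y}. x - z)\<bar> \<le> B * (L / s) ^ (card Z - 1)" .
  qed
  also have "... = real (card Z) * B * (L / s) ^ (card Z - 1)" by simp
  finally show ?thesis .
qed

lemma dd_abs_le:
  assumes Z: "finite Z" and b: "\<And>z. z \<in> Z \<Longrightarrow> \<bar>f z\<bar> \<le> B"
    and sep: "\<And>z z'. z \<in> Z \<Longrightarrow> z' \<in> Z \<Longrightarrow> z \<noteq> z' \<Longrightarrow> \<bar>z - z'\<bar> \<ge> s" and "s > 0"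
  shows "\<bar>dd Z f\<bar> \<le> real (card Z) * B / s ^ (card Z - 1)"
proof -
  have "\<bar>dd Z f\<bar> \<le> (\<Sum>y\<in>Z. \<bar>f y / (\<Prod>z\<in>Z - {y}. y - z)\<bar>)"
    unfolding dd_def by (rule sum_abs)
  also have "... \<le> (\<Sum>y\<in>Z. B / s ^ (card Z - 1))"
  proof (rule sum_mono)
    fix y assume y: "y \<in> Z"
    have B: "0 \<le> B" using b[OF y] by linarith
    have "(\<Prod>z\<in>Z - {y}. s) \<le> (\<Prod>z\<in>Z - {y}. \<bar>y - z\<bar>)"
      by (intro prod_mono) (use sep y \<open>s > 0\<close> in auto)
    then have "s ^ (card Z - 1) \<le> \<bar>\<Prod>z\<in>Z - {y}. y - z\<bar>" using y Z by (simp add: abs_prod)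
    then show "\<bar>f y / (\<Prod>z\<in>Z - {y}. y - z)\<bar> \<le> B / s ^ (card Z - 1)"
      unfolding abs_divide using b[OF y] \<open>s > 0\<close> B by (intro frac_le) auto
  qed
  also have "... = real (card Z) * B / s ^ (card Z - 1)" by simp
  finally show ?thesis .
qed

lemma dd_uminus_image:
  assumes "finite A"
  shows "dd (uminus ` A) f = (- 1) ^ (card A - 1) * dd A (\<lambda>x. f (- x))"
proof -
  have "dd (uminus ` A) f = (\<Sum>a\<in>A. f (- a) / (\<Prod>b\<in>uminus ` A - {- a}. - a - b))"
    unfolding dd_def by (subst sum.reindex) (auto intro: inj_onI)
  also have "... = (\<Sum>a\<in>A. (- 1) ^ (card A - 1) * (f (- a) / (\<Prod>b\<in>A - {a}. a - b)))"
  proof (rule sum.cong[OF refl])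
    fix a assume a: "a \<in> A"
    have "uminus ` A - {- a} = uminus ` (A - {a})" by auto
    then have "(\<Prod>b\<in>uminus ` A - {- a}. - a - b) = (\<Prod>b\<in>A - {a}. - a - (- b))"
      by (simp add: prod.reindex inj_on_def)
    also have "... = (\<Prod>b\<in>A - {a}. (- 1) * (a - b))" by (intro prod.cong) auto
    also have "... = (- 1) ^ (card A - 1) * (\<Prod>b\<in>A - {a}. a - b)"
      unfolding prod.distrib using a assms by simp
    finally show "f (- a) / (\<Prod>b\<in>uminus ` A - {- a}. - a - b) =
      (- 1) ^ (card A - 1) * (f (- a) / (\<Prod>b\<in>A - {a}. a - b))"
      by (cases "even (card A - 1)") simp_all
  qed
  finally show ?thesis by (simp add: dd_def sum_distrib_left)
qed

text \<open>The sign compensates for the \<open>k\<close> denominators that change sign. Thanks to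
  this symmetry the endpoint estimates need only be made near 1; it interchanges the two exponents
  of the weight.\<close>

lemma Mset_reflect:
  assumes "f \<in> Mset k"
  shows "(\<lambda>x. (- 1) ^ k * f (- x)) \<in> Mset k"
  unfolding Mset_iff_dd
proof (intro allI impI)
  fix A :: "real set" assume A: "finite A \<and> card A = Suc k \<and> A \<subseteq> {-1<..<1}"
  have "card (uminus ` A) = Suc k" using A by (simp add: card_image)
  then have "0 \<le> dd (uminus ` A) f" using A by (intro MsetD[OF assms]) auto
  also have "... = (- 1) ^ k * dd A (\<lambda>x. f (- x))" using dd_uminus_image[of A f] A by simp
  finally show "0 \<le> dd A (\<lambda>x. (- 1) ^ k * f (- x))" by (simp add: dd_cmult)
qed

lemma Mset1I:
  assumes "\<And>x y. -1 < x \<Longrightarrow> x < y \<Longrightarrow> y < 1 \<Longrightarrow> f x \<le> f y"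
  shows "f \<in> Mset 1"
  unfolding Mset_iff_dd
proof (intro allI impI)
  fix A :: "real set" assume A: "finite A \<and> card A = Suc 1 \<and> A \<subseteq> {-1<..<1}"
  then have "card A = 2" by simp
  then obtain x y where xy: "A = {x, y}" "x \<noteq> y" by (auto simp: card_2_iff)
  have e: "{x, y} - {x} = {y}" "{x, y} - {y} = {x}" using xy by auto
  have "dd A f = (f y - f x) / (y - x)"
    unfolding dd_def xy(1) using xy(2) by (simp add: e divide_simps) (simp add: algebra_simps)
  moreover have "x < y \<Longrightarrow> f x \<le> f y" "y < x \<Longrightarrow> f y \<le> f x" using A xy assms by auto
  ultimately show "dd A f \<ge> 0" using xy
    by (cases "x < y") (auto intro: divide_nonneg_pos divide_nonpos_neg)
qed

section \<open>Truncated powers as members of the class\<close>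

text \<open>The case distinction makes \<open>m = 0\<close> the jump at \<open>t\<close>, with value
  0 at \<open>t\<close>; the formula with a positive part would give \<open>0 ^ 0 = 1\<close> to the
  left of \<open>t\<close>.\<close>

definition tpow :: "nat \<Rightarrow> real \<Rightarrow> real \<Rightarrow> real" where
  "tpow m t x = (if x > t then (x - t) ^ m else 0)"

text \<open>The step from \<open>m\<close> to \<open>m + 1\<close> is the Cox--de Boor recursion for B-splines.\<close>

lemma dd_tpow_nonneg:
  assumes "finite A" "card A = m + 2"
  shows "dd A (tpow m t) \<ge> 0"
  using assms
proof (induction m arbitrary: A)
  case 0
  then have "card A = 2" by simp
  then obtain x y where xy: "A = {x, y}" "x \<noteq> y" by (auto simp: card_2_iff)
  have e: "{x, y} - {x} = {y}" "{x, y} - {y} = {x}" using xy by auto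
  have "dd A (tpow 0 t) = (tpow 0 t y - tpow 0 t x) / (y - x)"
    unfolding dd_def xy(1) using xy(2) by (simp add: e divide_simps) (simp add: algebra_simps)
  moreover have "tpow 0 t u \<le> tpow 0 t v" if "u \<le> v" for u v using that by (simp add: tpow_def)
  ultimately show ?case
    by (cases "x \<le> y") (simp_all add: divide_nonpos_nonpos)
next
  case (Suc m)
  have ne: "A \<noteq> {}" using Suc.prems by auto
  define lo where "lo = Min A" define hi where "hi = Max A"
  have in_A: "lo \<in> A" "hi \<in> A" unfolding lo_def hi_def using Suc.prems ne by auto
  have bd: "lo \<le> x" "x \<le> hi" if "x \<in> A" for x unfolding lo_def hi_def using Suc.prems that by auto
  have "lo \<noteq> hi"
  proof
    assume "lo = hi"
    then have "A = {lo}" using bd in_A by force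
    then show False using Suc.prems by simp
  qed
  with bd in_A have lh: "lo < hi" by force
  consider "t \<le> lo" | "hi \<le> t" | "lo < t" "t < hi" by linarith
  then show ?case
  proof cases
    case 1
    have "dd A (tpow (Suc m) t) = dd A (poly ([:- t, 1:] ^ Suc m))"
    proof (rule dd_cong)
      fix x assume x: "x \<in> A"
      show "tpow (Suc m) t x = poly ([:- t, 1:] ^ Suc m) x"
        using bd[OF x] 1 by (cases "x = t") (auto simp: tpow_def simp del: power_Suc)
    qed
    also have "... = 0" using Suc.prems
      by (intro dd_poly_eq_0) (auto simp: degree_power_eq simp del: power_Suc)
    finally show ?thesis by simp
  next
    case 2
    have "dd A (tpow (Suc m) t) = dd A (\<lambda>x. 0)"
      by (rule dd_cong) (use bd 2 in \<open>force simp: tpow_def\<close>)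
    then show ?thesis by (simp add: dd_def)
  next
    case 3
    let ?g = "tpow m t"
    have "dd A (tpow (Suc m) t) = dd A (\<lambda>x. (x - t) * ?g x)"
      by (rule dd_cong) (simp add: tpow_def)
    also have "... = (lo - t) * dd A ?g + dd (A - {lo}) ?g"
      by (rule dd_times_linear) (use Suc.prems in_A in auto)
    finally have 4: "dd A (tpow (Suc m) t) = (lo - t) * dd A ?g + dd (A - {lo}) ?g" .
    have 5: "(hi - lo) * dd A ?g = dd (A - {lo}) ?g - dd (A - {hi}) ?g"
      by (rule dd_rec) (use Suc.prems in_A lh in auto)
    have "dd (A - {lo}) ?g \<ge> 0" "dd (A - {hi}) ?g \<ge> 0"
      by (rule Suc.IH; use Suc.prems in_A in auto)+
    \<comment> \<open>For \<open>t\<close> between the extreme nodes the difference, times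
      \<open>hi - lo\<close>, is a combination of two differences of the lower power with the
      nonnegative coefficients \<open>hi - t\<close> and \<open>t - lo\<close>.\<close>
    then have "0 \<le> (hi - t) * dd (A - {lo}) ?g + (t - lo) * dd (A - {hi}) ?g" using 3 by simp
    also have "... = (hi - lo) * dd A (tpow (Suc m) t)"
    proof -
      have "(hi - lo) * dd A (tpow (Suc m) t) = (lo - t) * ((hi - lo) * dd A ?g) + (hi - lo) * dd (A - {lo}) ?g"
        unfolding 4 by (simp add: algebra_simps)
      then show ?thesis unfolding 5 by (simp add: algebra_simps)
    qed
    finally show ?thesis using lh by (simp add: zero_le_mult_iff)
  qed
qed

lemma tpow_in_Mset: "tpow m t \<in> Mset (Suc m)"
  unfolding Mset_iff_dd using dd_tpow_nonneg by simp

section \<open>Chebyshev polynomials and Fejer kernels\<close>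

fun cheb :: "nat \<Rightarrow> real poly" where
  "cheb 0 = 1"
| "cheb (Suc 0) = [:0, 1:]"
| "cheb (Suc (Suc n)) = [:0, 2:] * cheb (Suc n) - cheb n"

lemma poly_cheb: "poly (cheb n) (cos t) = cos (real n * t)"
proof (induction n rule: cheb.induct)
  case (3 n)
  have "cos (real (Suc (Suc n)) * t) + cos (real n * t) = 2 * cos t * cos (real (Suc n) * t)"
  proof -
    have "cos (real (Suc (Suc n)) * t) = cos (real (Suc n) * t + t)"
      "cos (real n * t) = cos (real (Suc n) * t - t)"
      by (simp_all add: algebra_simps)
    then show ?thesis by (simp add: cos_add cos_diff)
  qed
  with 3 show ?case by simp
qed simp_all

lemma degree_cheb: "degree (cheb n) \<le> n"
proof (induction n rule: cheb.induct)
  case (3 n)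
  have "degree ([:0, 2:] * cheb (Suc n)) \<le> Suc (Suc n)"
    using degree_mult_le[of "[:0, 2:]" "cheb (Suc n)"] 3 by simp
  with 3 show ?case by (auto intro!: degree_diff_le)
qed simp_all

lemma coeff_cheb_neq_0: "coeff (cheb n) n \<noteq> 0"
proof (induction n rule: cheb.induct)
  case (3 n)
  have "coeff (cheb n) (Suc (Suc n)) = 0"
    using degree_cheb[of n] by (intro coeff_eq_0) simp
  with 3 show ?case by simp
qed simp_all

text \<open>In the variable \<open>cos t\<close> every polynomial is a cosine sum. This is how
  translates and integrals of kernels are recognised as polynomials again, and how orthogonality is
  reduced to the Chebyshev polynomials.\<close>

lemma cheb_expand:
  fixes R :: "real poly"
  assumes "degree R \<le> n"
  shows "\<exists>a. R = (\<Sum>j\<le>n. smult (a j) (cheb j))"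
  using assms
proof (induction n arbitrary: R)
  case 0
  then obtain c where "R = [:c:]" by (auto elim: degree_eq_zeroE)
  then show ?case by (intro exI[of _ "\<lambda>_. c"]) simp
next
  case (Suc n)
  define c where "c = coeff R (Suc n) / coeff (cheb (Suc n)) (Suc n)"
  let ?R = "R - smult c (cheb (Suc n))"
  have "degree ?R \<le> n"
  proof (rule degree_le, intro allI impI)
    fix i assume i: "n < i"
    show "coeff ?R i = 0"
    proof (cases "i = Suc n")
      case True
      then show ?thesis using coeff_cheb_neq_0[of "Suc n"] by (simp add: c_def)
    next
      case False
      then have "coeff R i = 0" "coeff (cheb (Suc n)) i = 0"
        using i Suc.prems degree_cheb[of "Suc n"] by (auto intro!: coeff_eq_0)
      then show ?thesis by simp
    qed
  qed
  from Suc.IH[OF this] obtain a where a: "?R = (\<Sum>j\<le>n. smult (a j) (cheb j))" by blast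
  have "(\<Sum>j\<le>Suc n. smult ((a(Suc n := c)) j) (cheb j)) = ?R + smult c (cheb (Suc n))"
    unfolding a by simp
  then show ?case by (intro exI[of _ "a(Suc n := c)"]) simp
qed

text \<open>\<open>M\<close> times the usual Fejer kernel, written as a polynomial in the cosine:
  the sum of the first \<open>M\<close> Dirichlet kernels.\<close>

definition fejer :: "nat \<Rightarrow> real poly" where
  "fejer M = (\<Sum>m<M. 1 + smult 2 (\<Sum>j=1..m. cheb j))"

lemma degree_fejer: "degree (fejer M) \<le> M"
  unfolding fejer_def
proof (rule degree_sum_le)
  fix m assume "m \<in> {..<M}"
  then have "degree (\<Sum>j=1..m. cheb j) \<le> M"
    by (intro degree_sum_le) (auto intro: order.trans[OF degree_cheb])
  then show "degree (1 + smult 2 (\<Sum>j=1..m. cheb j)) \<le> M"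
    by (intro degree_add_le) (auto intro: order.trans[OF degree_smult_le])
qed simp

lemma poly_fejer: "poly (fejer M) (cos u) = (\<Sum>m<M. 1 + 2 * (\<Sum>j=1..m. cos (real j * u)))"
  by (simp add: fejer_def poly_sum poly_cheb)

lemma dirichlet_kernel:
  "(1 - cos u) * (1 + 2 * (\<Sum>j=1..m. cos (real j * u))) = cos (real m * u) - cos (real (Suc m) * u)"
proof (induction m)
  case (Suc m)
  have "cos (real (Suc (Suc m)) * u) = cos (real (Suc m) * u + u)"
    "cos (real m * u) = cos (real (Suc m) * u - u)"
    by (simp_all add: algebra_simps)
  then have 1: "cos (real (Suc (Suc m)) * u) + cos (real m * u) = 2 * cos u * cos (real (Suc m) * u)"
    by (simp add: cos_add cos_diff)
  have "(1 - cos u) * (1 + 2 * (\<Sum>j=1..Suc m. cos (real j * u))) =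
    (1 - cos u) * (1 + 2 * (\<Sum>j=1..m. cos (real j * u))) + (1 - cos u) * (2 * cos (real (Suc m) * u))"
    by (simp add: algebra_simps)
  then show ?case unfolding Suc.IH using 1 by (simp add: algebra_simps del: of_nat_Suc)
qed simp

text \<open>The closed form (sin(M u / 2) / sin(u / 2))^2, cleared of its denominator so that it
  also covers the points with \<open>cos u = 1\<close>. It results from telescoping the Dirichlet
  kernels.\<close>

lemma fejer_mult: "(1 - cos u) * poly (fejer M) (cos u) = 1 - cos (real M * u)"
proof -
  have "(1 - cos u) * poly (fejer M) (cos u) = (\<Sum>m<M. cos (real m * u) - cos (real (Suc m) * u))"
    unfolding poly_fejer sum_distrib_left[of "1 - cos u"] by (simp only: dirichlet_kernel)
  also have "... = 1 - cos (real M * u)"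
    using sum_lessThan_telescope'[of "\<lambda>m. cos (real m * u)" M] by simp
  finally show ?thesis .
qed

lemma one_minus_cos: "1 - cos u = 2 * (sin (u / 2))\<^sup>2" for u :: real
  using cos_double_sin[of "u / 2"] by simp

lemma fejer_le_sq: "poly (fejer M) (cos u) \<le> (real M)\<^sup>2"
proof -
  have "poly (fejer M) (cos u) \<le> (\<Sum>m<M. 1 + 2 * real m)"
    unfolding poly_fejer
  proof (rule sum_mono)
    fix m
    have "(\<Sum>j=1..m. cos (real j * u)) \<le> (\<Sum>j=1..m. 1)" by (intro sum_mono) simp
    then show "1 + 2 * (\<Sum>j=1..m. cos (real j * u)) \<le> 1 + 2 * real m" by simp
  qed
  also have "... = (real M)\<^sup>2" by (induction M) (auto simp: power2_eq_square algebra_simps)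
  finally show ?thesis .
qed

lemma fejer_cos_eq_1: "cos u = 1 \<Longrightarrow> poly (fejer M) (cos u) = (real M)\<^sup>2"
proof -
  assume "cos u = 1"
  then have "poly (fejer M) (cos u) = poly (fejer M) (cos 0)" by simp
  also have "... = (\<Sum>m<M. 1 + 2 * real m)" unfolding poly_fejer by simp
  also have "... = (real M)\<^sup>2" by (induction M) (auto simp: power2_eq_square algebra_simps)
  finally show ?thesis .
qed

lemma fejer_nonneg: "poly (fejer M) (cos u) \<ge> 0"
proof (cases "cos u = 1")
  case False
  then have "1 - cos u > 0" using cos_le_one[of u] by linarith
  moreover have "(1 - cos u) * poly (fejer M) (cos u) \<ge> 0" unfolding fejer_mult by simp
  ultimately show ?thesis by (simp add: zero_le_mult_iff)
next
  case True
  show ?thesis unfolding fejer_cos_eq_1[OF True] by simp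
qed

lemma fejer_le_sin: "poly (fejer M) (cos u) * (sin (u / 2))\<^sup>2 \<le> 1"
proof -
  have "2 * (poly (fejer M) (cos u) * (sin (u / 2))\<^sup>2) = 1 - cos (real M * u)"
    using fejer_mult[of u M] one_minus_cos[of u] by (simp add: algebra_simps)
  then show ?thesis using cos_ge_minus_one[of "real M * u"] by linarith
qed

lemma sin_concave:
  assumes "0 \<le> t" "t \<le> 1" "0 \<le> x" "x \<le> pi"
  shows "t * sin x \<le> sin (t * x)"
proof -
  have "convex_on {0..pi} (\<lambda>x. - sin x)"
  proof (rule f''_ge0_imp_convex[where f' = "\<lambda>x. - cos x" and f'' = sin])
    show "convex {0..pi}" by simp
  qed (auto intro!: derivative_eq_intros sin_ge_zero)
  from convex_onD[OF this assms(1,2), of 0 x] show ?thesis using assms by simp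
qed

lemma sin_ge_line: "0 \<le> x \<Longrightarrow> x \<le> pi / 2 \<Longrightarrow> sin x \<ge> 2 / pi * x"
  using sin_concave[of "2 / pi * x" "pi / 2"] by (simp add: field_simps)

text \<open>Up to half the distance to its first zero 2 pi / M, the kernel is comparable with its
  maximum M^2: Jordan's inequality bounds 1 - cos(M u) from below, and 1 - cos u is at most u^2 /
  2.\<close>

lemma fejer_ge:
  assumes "\<bar>real M * u\<bar> \<le> pi"
  shows "poly (fejer M) (cos u) \<ge> 4 / pi\<^sup>2 * (real M)\<^sup>2"
proof (cases "cos u = 1")
  case True
  have "4 \<le> pi\<^sup>2" using pi_ge_two power_mono[of 2 pi 2] by simp
  then have "4 / pi\<^sup>2 * (real M)\<^sup>2 \<le> 1 * (real M)\<^sup>2" by (intro mult_right_mono) auto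
  then show ?thesis using fejer_cos_eq_1[OF True] by simp
next
  case False
  then have pos: "1 - cos u > 0" using cos_le_one[of u] by linarith
  have 1: "1 - cos u \<le> u\<^sup>2 / 2"
  proof -
    have "(sin (u / 2))\<^sup>2 \<le> (u / 2)\<^sup>2" using abs_sin_x_le_abs_x[of "u / 2"] by (metis power2_abs power_mono abs_ge_zero)
    then show ?thesis unfolding one_minus_cos by (simp add: power_divide)
  qed
  have "2 / pi * \<bar>real M * u / 2\<bar> \<le> sin \<bar>real M * u / 2\<bar>"
    using assms by (intro sin_ge_line) auto
  then have "(2 / pi * \<bar>real M * u / 2\<bar>)\<^sup>2 \<le> (sin \<bar>real M * u / 2\<bar>)\<^sup>2" by (intro power_mono) auto
  also have "... = (sin (real M * u / 2))\<^sup>2" by (cases "real M * u / 2 \<ge> 0") (auto simp: abs_real_def)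
  finally have "4 / pi\<^sup>2 * (real M)\<^sup>2 * (u\<^sup>2 / 2) \<le> 1 - cos (real M * u)"
    unfolding one_minus_cos[of "real M * u"] by (simp add: power_mult_distrib power_divide mult.commute)
  moreover have "4 / pi\<^sup>2 * (real M)\<^sup>2 * (1 - cos u) \<le> 4 / pi\<^sup>2 * (real M)\<^sup>2 * (u\<^sup>2 / 2)"
    using 1 by (intro mult_left_mono) auto
  ultimately have "(1 - cos u) * (4 / pi\<^sup>2 * (real M)\<^sup>2) \<le> (1 - cos u) * poly (fejer M) (cos u)"
    unfolding fejer_mult by (simp add: mult.commute)
  then show ?thesis by (rule mult_left_le_imp_le[OF _ pos])
qed

text \<open>The even part of a translate of a cosine polynomial is again a cosine polynomial.\<close>

lemma cheb_sum_translate: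
  assumes "R = (\<Sum>j\<le>n. smult (a j) (cheb j))"
  shows "poly R (cos (t - s)) + poly R (cos (t + s)) =
    (\<Sum>j\<le>n. 2 * a j * cos (real j * s) * cos (real j * t))"
proof -
  have "poly R (cos (t - s)) + poly R (cos (t + s)) =
    (\<Sum>j\<le>n. a j * (cos (real j * (t - s)) + cos (real j * (t + s))))"
    unfolding assms by (simp add: poly_sum poly_cheb sum.distrib distrib_left)
  also have "... = (\<Sum>j\<le>n. 2 * a j * cos (real j * s) * cos (real j * t))"
    by (intro sum.cong) (simp_all add: cos_add cos_diff distrib_left right_diff_distrib mult_ac)
  finally show ?thesis .
qed

lemma translate_poly:
  fixes R :: "real poly"
  shows "\<exists>V. degree V \<le> degree R \<and>
    (\<forall>t. poly V (cos t) = poly R (cos (t - s)) + poly R (cos (t + s)))"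
proof -
  obtain a where a: "R = (\<Sum>j\<le>degree R. smult (a j) (cheb j))"
    using cheb_expand[of R "degree R"] by blast
  let ?V = "\<Sum>j\<le>degree R. smult (2 * a j * cos (real j * s)) (cheb j)"
  have "degree ?V \<le> degree R"
    by (rule degree_sum_le) (auto intro: order.trans[OF degree_smult_le] order.trans[OF degree_cheb])
  moreover have "poly ?V (cos t) = poly R (cos (t - s)) + poly R (cos (t + s))" for t
    by (subst cheb_sum_translate[OF a]) (simp add: poly_sum poly_cheb)
  ultimately show ?thesis by blast
qed

lemma integral_cos_mult:
  assumes "0 \<le> a"
  shows "integral {0..a} (\<lambda>s. cos (real (Suc j) * s)) = sin (real (Suc j) * a) / real (Suc j)"
proof -
  have "((\<lambda>s. cos (real (Suc j) * s)) has_integral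
    (sin (real (Suc j) * a) / real (Suc j) - sin (real (Suc j) * 0) / real (Suc j))) {0..a}"
    using assms
    by (intro fundamental_theorem_of_calculus)
       (auto intro!: derivative_eq_intros simp flip: has_real_derivative_iff_has_vector_derivative
         simp del: of_nat_Suc)
  then show ?thesis by (simp add: integral_unique)
qed

text \<open>The symmetrised translate contains only cosines of multiples of \<open>t\<close>, so
  integrating over the shift changes the coefficients alone. This makes the convolution of a kernel
  with a step a polynomial in \<open>cos t\<close>.\<close>

lemma translate_poly_integral:
  fixes R :: "real poly"
  assumes "0 \<le> b"
  shows "\<exists>V. degree V \<le> degree R \<and>
    (\<forall>t. poly V (cos t) = integral {0..b} (\<lambda>s. poly R (cos (t - s)) + poly R (cos (t + s))))"
proof -
  obtain a where a: "R = (\<Sum>j\<le>degree R. smult (a j) (cheb j))"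
    using cheb_expand[of R "degree R"] by blast
  let ?V = "\<Sum>j\<le>degree R. smult (2 * a j * integral {0..b} (\<lambda>s. cos (real j * s))) (cheb j)"
  have "degree ?V \<le> degree R"
    by (rule degree_sum_le) (auto intro: order.trans[OF degree_smult_le] order.trans[OF degree_cheb])
  moreover have "poly ?V (cos t) = integral {0..b} (\<lambda>s. poly R (cos (t - s)) + poly R (cos (t + s)))" for t
  proof -
    have "integral {0..b} (\<lambda>s. poly R (cos (t - s)) + poly R (cos (t + s))) =
      integral {0..b} (\<lambda>s. \<Sum>j\<le>degree R. (2 * a j * cos (real j * t)) * cos (real j * s))"
      by (subst cheb_sum_translate[OF a]) (simp add: mult_ac)
    also have "... = (\<Sum>j\<le>degree R. integral {0..b} (\<lambda>s. (2 * a j * cos (real j * t)) * cos (real j * s)))"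
      by (intro integral_sum) (auto intro!: integrable_continuous_interval continuous_intros)
    also have "... = poly ?V (cos t)"
      by (simp add: poly_sum poly_cheb mult_ac)
    finally show ?thesis by simp
  qed
  ultimately show ?thesis by blast
qed

text \<open>Over the full range of shifts only the constant coefficient survives, hence the total
  mass of the kernel does not depend on the point \<open>t\<close> from which it is seen.\<close>

lemma integral_translate_const:
  fixes R :: "real poly"
  shows "integral {0..pi} (\<lambda>s. poly R (cos (t - s)) + poly R (cos (t + s))) =
    2 * integral {0..pi} (\<lambda>s. poly R (cos s))"
proof -
  obtain a where a: "R = (\<Sum>j\<le>degree R. smult (a j) (cheb j))"
    using cheb_expand[of R "degree R"] by blast
  have main: "integral {0..pi} (\<lambda>s. poly R (cos (t - s)) + poly R (cos (t + s))) = 2 * a 0 * pi" for t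
  proof -
    have "integral {0..pi} (\<lambda>s. poly R (cos (t - s)) + poly R (cos (t + s))) =
      integral {0..pi} (\<lambda>s. \<Sum>j\<le>degree R. (2 * a j * cos (real j * t)) * cos (real j * s))"
      by (subst cheb_sum_translate[OF a]) (simp add: mult_ac)
    also have "... = (\<Sum>j\<le>degree R. integral {0..pi} (\<lambda>s. (2 * a j * cos (real j * t)) * cos (real j * s)))"
      by (intro integral_sum) (auto intro!: integrable_continuous_interval continuous_intros)
    also have "... = (\<Sum>j\<le>degree R. if j = 0 then 2 * a 0 * pi else 0)"
    proof (rule sum.cong[OF refl])
      fix j
      have "sin (real (Suc i) * pi) = 0" for i by (rule sin_npi)
      then have "integral {0..pi} (\<lambda>s. cos (real (Suc i) * s)) = 0" for i
        by (subst integral_cos_mult) simp_all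
      then show "integral {0..pi} (\<lambda>s. (2 * a j * cos (real j * t)) * cos (real j * s)) =
        (if j = 0 then 2 * a 0 * pi else 0)"
        by (cases j) (simp_all del: of_nat_Suc)
    qed
    also have "... = 2 * a 0 * pi" by simp
    finally show ?thesis .
  qed
  have "2 * a 0 * pi = integral {0..pi} (\<lambda>s. 2 * poly R (cos s))"
    using main[of 0] by simp
  then show ?thesis using main[of t] by simp
qed

lemma integral_fejer: "integral {0..pi} (\<lambda>s. poly (fejer M) (cos s)) = real M * pi"
proof -
  have z: "integral {0..pi} (\<lambda>s. cos (real j * s)) = 0" if j1: "1 \<le> j" for j
  proof -
    obtain i where j: "j = Suc i" using j1 by (cases j) auto
    have "sin (real (Suc i) * pi) = 0" by (rule sin_npi)
    then show ?thesis unfolding j by (subst integral_cos_mult) simp_all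
  qed
  have "integral {0..pi} (\<lambda>s. poly (fejer M) (cos s)) =
     (\<Sum>m<M. integral {0..pi} (\<lambda>s. 1 + 2 * (\<Sum>j=1..m. cos (real j * s))))"
    unfolding poly_fejer
    by (intro integral_sum) (auto intro!: integrable_continuous_interval continuous_intros)
  also have "... = (\<Sum>m<M. pi)"
  proof (rule sum.cong[OF refl])
    fix m
    have "integral {0..pi} (\<lambda>s. 1 + 2 * (\<Sum>j=1..m. cos (real j * s))) =
      integral {0..pi} (\<lambda>s. 1) + integral {0..pi} (\<lambda>s. 2 * (\<Sum>j=1..m. cos (real j * s)))"
      by (intro integral_add integrable_continuous_interval continuous_intros)
    also have "integral {0..pi} (\<lambda>s. 2 * (\<Sum>j=1..m. cos (real j * s))) =
      2 * (\<Sum>j=1..m. integral {0..pi} (\<lambda>s. cos (real j * s)))"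
      by (simp add: integral_sum integrable_continuous_interval continuous_intros)
    finally show "integral {0..pi} (\<lambda>s. 1 + 2 * (\<Sum>j=1..m. cos (real j * s))) = pi"
      using z by simp
  qed
  finally show ?thesis by simp
qed

section \<open>Nodes and localised polynomials\<close>

text \<open>One plus the distance from \<open>x\<close> to the \<open>i\<close>-th node in the
  angular variable, in units of the node spacing pi / N; the 1 makes negative powers harmless at the
  node itself.\<close>

definition dst :: "nat \<Rightarrow> nat \<Rightarrow> real \<Rightarrow> real" where
  "dst N i x = 1 + \<bar>real N * arccos x / pi - real i\<bar>"

definition tau :: "nat \<Rightarrow> nat \<Rightarrow> real" where
  "tau N i = cos (real i * pi / real N)"

text \<open>Up to constants the length of the cell next to the \<open>i\<close>-th node in the
  variable \<open>x\<close>, since dx = sin \<theta> d\<theta> and the angular spacing is pi /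
  N.\<close>

definition hh :: "nat \<Rightarrow> nat \<Rightarrow> real" where
  "hh N i = sin (real i * pi / real N) / real N"

lemma dst_ge_1: "dst N i x \<ge> 1"
  by (simp add: dst_def)

lemma dst_pos: "dst N i x > 0"
  using dst_ge_1[of N i x] by linarith

lemma dst_eq:
  assumes "N \<ge> 1"
  shows "dst N i x = 1 + real N / pi * \<bar>arccos x - real i * pi / real N\<bar>"
proof -
  have "real N * arccos x / pi - real i = real N / pi * (arccos x - real i * pi / real N)"
    using assms by (simp add: field_simps)
  then show ?thesis unfolding dst_def by (simp add: abs_mult)
qed

lemma arccos_diff_eq:
  assumes "N \<ge> 1"
  shows "\<bar>arccos x - real i * pi / real N\<bar> = pi / real N * (dst N i x - 1)"
  using assms by (simp add: dst_eq field_simps)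

lemma node_angle: "i \<le> N \<Longrightarrow> 0 \<le> real i * pi / real N \<and> real i * pi / real N \<le> pi"
  by (cases "N = 0") (auto simp: field_simps)

lemma arccos_tau: "i \<le> N \<Longrightarrow> arccos (tau N i) = real i * pi / real N"
  unfolding tau_def using node_angle[of i N] by (intro arccos_cos) auto

lemma sin_ge_mid:
  assumes "0 \<le> d" "d \<le> y" "y \<le> pi - d"
  shows "sin d \<le> sin y"
proof (cases "y \<le> pi / 2")
  case True
  then show ?thesis using assms by (intro sin_monotone_2pi_le) auto
next
  case False
  have "sin d \<le> sin (pi - y)" using assms False by (intro sin_monotone_2pi_le) auto
  then show ?thesis by simp
qed

lemma fejer_mult_sin_le:
  assumes "0 \<le> s" "s \<le> \<bar>sin (u / 2)\<bar>"
  shows "poly (fejer M) (cos u) * s\<^sup>2 \<le> 1"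
proof -
  have "s\<^sup>2 \<le> (sin (u / 2))\<^sup>2" using assms by (metis power2_abs power_mono)
  then have "poly (fejer M) (cos u) * s\<^sup>2 \<le> poly (fejer M) (cos u) * (sin (u / 2))\<^sup>2"
    by (intro mult_left_mono fejer_nonneg)
  then show ?thesis using fejer_le_sin[of M u] by linarith
qed

text \<open>One Fejer factor is retained for the sake of its integral, which is of order
  \<open>M\<close>; each of the other \<open>r\<close> factors yields two powers of decay.\<close>

lemma fejer_power_le:
  assumes "0 \<le> s" "s \<le> \<bar>sin (u / 2)\<bar>"
  shows "poly (fejer M ^ Suc r) (cos u) * s ^ (2 * r) \<le> poly (fejer M) (cos u)"
proof -
  have "(poly (fejer M) (cos u) * s\<^sup>2) ^ r \<le> 1"
    by (intro power_le_one fejer_mult_sin_le assms mult_nonneg_nonneg fejer_nonneg) simp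
  then have "poly (fejer M) (cos u) * (poly (fejer M) (cos u) * s\<^sup>2) ^ r \<le> poly (fejer M) (cos u) * 1"
    by (intro mult_left_mono fejer_nonneg)
  then show ?thesis by (simp add: poly_power power_mult_distrib power_mult mult.assoc)
qed

text \<open>Convolving the step with a normalised Jackson kernel.\<close>

lemma step_poly:
  fixes r :: nat
  shows "\<exists>C>0. \<forall>N\<ge>1. \<forall>i\<le>N. \<exists>Q. degree Q \<le> Suc r * N \<and>
    (\<forall>x\<in>{-1..1}. \<bar>of_bool (x \<ge> tau N i) - poly Q x\<bar> \<le> C / dst N i x ^ (2 * r))"
proof -
  define c0 where "c0 = (4 / pi\<^sup>2) ^ Suc r"
  have c0: "c0 > 0" unfolding c0_def by simp
  define C where "C = 2 ^ (2 * r) * (1 + 1 / c0)"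
  have C: "C > 0" unfolding C_def using c0 by (simp add: add_pos_pos)
  have "\<exists>Q. degree Q \<le> Suc r * N \<and>
    (\<forall>x\<in>{-1..1}. \<bar>of_bool (x \<ge> tau N i) - poly Q x\<bar> \<le> C / dst N i x ^ (2 * r))"
    if N: "N \<ge> 1" and i: "i \<le> N" for N i
  proof -
    define K where "K = fejer N ^ Suc r"
    define a where "a = real i * pi / real N"
    have a: "0 \<le> a" "a \<le> pi" unfolding a_def using node_angle[OF i] by auto
    define G where "G t s = poly K (cos (t - s)) + poly K (cos (t + s))" for t s
    define g where "g t s = poly (fejer N) (cos (t - s)) + poly (fejer N) (cos (t + s))" for t s
    \<comment> \<open>The total mass, the same for every \<open>t\<close>. After division by
      \<open>Z\<close> the value of \<open>Q\<close> at \<open>cos t\<close> is the fraction of the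
      kernel mass with shifts in \<open>{0..a}\<close>.\<close>
    define Z where "Z = 2 * integral {0..pi} (\<lambda>s. poly K (cos s))"
    have K_nonneg: "poly K (cos u) \<ge> 0" for u unfolding K_def by (simp add: fejer_nonneg)
    have G_nonneg: "G t s \<ge> 0" for t s unfolding G_def using K_nonneg by (simp add: add_nonneg_nonneg)
    have g_nonneg: "g t s \<ge> 0" for t s unfolding g_def using fejer_nonneg by (simp add: add_nonneg_nonneg)
    have G_int: "G t integrable_on {u..v}" and g_int: "g t integrable_on {u..v}" for t u v
      unfolding G_def g_def by (intro integrable_continuous_interval continuous_intros)+
    have ZG: "integral {0..pi} (G t) = Z" for t
      unfolding G_def Z_def by (rule integral_translate_const)
    have gN: "integral {0..pi} (g t) = 2 * real N * pi" for t
      unfolding g_def by (subst integral_translate_const) (simp add: integral_fejer)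
    \<comment> \<open>Only shifts up to pi / N are kept for the lower bound of the mass; there the
      kernel has height about N^(2 r + 2) by \<open>fejer_ge\<close>.\<close>
    have Zge: "Z \<ge> 2 * pi * c0 * real N ^ (2 * r + 1)"
    proof -
      have piN: "pi / real N \<le> pi" using N by (simp add: field_simps)
      have "integral {0..pi / real N} (\<lambda>s. c0 * real N ^ (2 * r + 2)) \<le>
        integral {0..pi / real N} (\<lambda>s. poly K (cos s))"
      proof (rule integral_le)
        fix s assume s: "s \<in> {0..pi / real N}"
        then have "\<bar>real N * s\<bar> \<le> pi" using N by (simp add: field_simps)
        from fejer_ge[OF this] have "(4 / pi\<^sup>2 * (real N)\<^sup>2) ^ Suc r \<le> poly (fejer N) (cos s) ^ Suc r"
          by (intro power_mono) auto
        moreover have "(4 / pi\<^sup>2 * (real N)\<^sup>2) ^ Suc r = c0 * real N ^ (2 * r + 2)"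
          unfolding c0_def power_mult_distrib by (simp flip: power_mult power_add)
        ultimately show "c0 * real N ^ (2 * r + 2) \<le> poly K (cos s)"
          unfolding K_def poly_power by simp
      qed (auto intro!: integrable_continuous_interval continuous_intros)
      also have "... \<le> integral {0..pi} (\<lambda>s. poly K (cos s))"
        by (rule integral_subset_le)
          (use piN K_nonneg in \<open>auto intro!: integrable_continuous_interval continuous_intros\<close>)
      finally have "pi / real N * (c0 * real N ^ (2 * r + 2)) \<le> Z / 2"
        unfolding Z_def using N by (simp add: mult_ac)
      moreover have "pi / real N * (c0 * real N ^ (2 * r + 2)) = pi * c0 * real N ^ (2 * r + 1)"
        using N by simp
      ultimately show ?thesis by simp
    qed
    have "2 * pi * c0 * real N ^ (2 * r + 1) > 0" using c0 N by simp
    with Zge have Z: "Z > 0" by linarith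
    obtain V where V: "degree V \<le> degree K" "\<And>t. poly V (cos t) = integral {0..a} (G t)"
      using translate_poly_integral[OF a(1), of K] unfolding G_def by blast
    define Q where "Q = smult (1 / Z) V"
    have "degree Q \<le> Suc r * N"
    proof -
      have "degree K \<le> Suc r * degree (fejer N)"
        unfolding K_def by (metis degree_power_le mult.commute)
      also have "... \<le> Suc r * N" using degree_fejer by (intro mult_left_mono) auto
      finally show ?thesis unfolding Q_def using V(1) by (meson degree_smult_le order.trans)
    qed
    moreover have "\<bar>of_bool (x \<ge> tau N i) - poly Q x\<bar> \<le> C / dst N i x ^ (2 * r)" if x: "x \<in> {-1..1}" for x
    proof -
      define t where "t = arccos x"
      have t: "0 \<le> t" "t \<le> pi" "cos t = x" unfolding t_def using x by (auto simp: arccos_lbound arccos_ubound)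
      define d where "d = \<bar>t - a\<bar>"
      have d: "0 \<le> d" "d \<le> pi" unfolding d_def using t a by auto
      have ge_iff: "x \<ge> tau N i \<longleftrightarrow> t \<le> a"
        unfolding tau_def a_def[symmetric] t(3)[symmetric] using t a by (intro cos_mono_le_eq) auto
      have Qx: "poly Q x = integral {0..a} (G t) / Z"
        unfolding t(3)[symmetric] Q_def by (simp add: V)
      \<comment> \<open>The error is the fraction of the mass on the other side of \<open>a\<close>.
        For such shifts both (t - s) / 2 and (t + s) / 2 stay at least d / 2 away from the zeros 0
        and pi of the sine, so both translates decay.\<close>
      have tail: "\<exists>u v. \<bar>of_bool (x \<ge> tau N i) - poly Q x\<bar> = integral {u..v} (G t) / Z \<and> 0 \<le> u \<and> u \<le> v \<and> v \<le> pi \<and>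
        (\<forall>s\<in>{u..v}. sin (d / 2) \<le> \<bar>sin ((t - s) / 2)\<bar> \<and> sin (d / 2) \<le> \<bar>sin ((t + s) / 2)\<bar>)"
      proof (cases "t \<le> a")
        case True
        have "integral {0..a} (G t) + integral {a..pi} (G t) = Z"
          using a G_int by (subst Henstock_Kurzweil_Integration.integral_combine) (auto simp: ZG)
        then have eq: "of_bool (x \<ge> tau N i) - poly Q x = integral {a..pi} (G t) / Z"
          using True Z by (simp add: ge_iff Qx field_simps)
        have "integral {a..pi} (G t) \<ge> 0" by (intro integral_nonneg G_int G_nonneg)
        then have "\<bar>of_bool (x \<ge> tau N i) - poly Q x\<bar> = integral {a..pi} (G t) / Z" unfolding eq using Z by simp
        moreover have "sin (d / 2) \<le> \<bar>sin ((t - s) / 2)\<bar> \<and> sin (d / 2) \<le> \<bar>sin ((t + s) / 2)\<bar>" if s: "s \<in> {a..pi}" for s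
        proof -
          have "(s - t) / 2 \<le> pi - d / 2" "d / 2 \<le> (s - t) / 2"
            using s True t(1) a(2) unfolding d_def by (auto simp: field_simps)
          then have "sin (d / 2) \<le> sin ((s - t) / 2)" using d by (intro sin_ge_mid) auto
          moreover have "sin ((t - s) / 2) = - sin ((s - t) / 2)"
            by (metis minus_diff_eq minus_divide_left sin_minus)
          moreover have "(t + s) / 2 \<le> pi - d / 2" "d / 2 \<le> (t + s) / 2"
            using s True t(1) a(2) unfolding d_def by (auto simp: field_simps)
          then have "sin (d / 2) \<le> sin ((t + s) / 2)" using d by (intro sin_ge_mid) auto
          ultimately show ?thesis by linarith
        qed
        ultimately show ?thesis using a by blast
      next
        case False
        have eq: "of_bool (x \<ge> tau N i) - poly Q x = - (integral {0..a} (G t) / Z)"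
          using False by (simp add: ge_iff Qx)
        have "integral {0..a} (G t) \<ge> 0" by (intro integral_nonneg G_int G_nonneg)
        then have "\<bar>of_bool (x \<ge> tau N i) - poly Q x\<bar> = integral {0..a} (G t) / Z" unfolding eq using Z by simp
        moreover have "sin (d / 2) \<le> \<bar>sin ((t - s) / 2)\<bar> \<and> sin (d / 2) \<le> \<bar>sin ((t + s) / 2)\<bar>" if s: "s \<in> {0..a}" for s
        proof -
          have "(t - s) / 2 \<le> pi - d / 2" "d / 2 \<le> (t - s) / 2" "(t + s) / 2 \<le> pi - d / 2" "d / 2 \<le> (t + s) / 2"
            using s False t(2) a unfolding d_def by (auto simp: field_simps)
          then have "sin (d / 2) \<le> sin ((t - s) / 2)" "sin (d / 2) \<le> sin ((t + s) / 2)"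
            using d by (auto intro!: sin_ge_mid)
          then show ?thesis by linarith
        qed
        ultimately show ?thesis using a by (intro exI[of _ 0] exI[of _ a]) auto
      qed
      obtain u v where uv: "\<bar>of_bool (x \<ge> tau N i) - poly Q x\<bar> = integral {u..v} (G t) / Z" "0 \<le> u" "u \<le> v" "v \<le> pi"
        "\<And>s. s \<in> {u..v} \<Longrightarrow> sin (d / 2) \<le> \<bar>sin ((t - s) / 2)\<bar> \<and> sin (d / 2) \<le> \<bar>sin ((t + s) / 2)\<bar>"
        using tail by blast
      have sd: "0 \<le> sin (d / 2)" using d by (intro sin_ge_zero) auto
      have "integral {u..v} (\<lambda>s. G t s * sin (d / 2) ^ (2 * r)) \<le> integral {u..v} (g t)"
      proof (rule integral_le)
        fix s assume s: "s \<in> {u..v}"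
        have "poly K (cos (t - s)) * sin (d / 2) ^ (2 * r) \<le> poly (fejer N) (cos (t - s))"
          "poly K (cos (t + s)) * sin (d / 2) ^ (2 * r) \<le> poly (fejer N) (cos (t + s))"
          unfolding K_def using uv(5)[OF s] sd by (blast intro: fejer_power_le)+
        then show "G t s * sin (d / 2) ^ (2 * r) \<le> g t s" unfolding G_def g_def by (simp add: distrib_right)
      qed (auto intro!: integrable_on_mult_left G_int g_int)
      also have "... \<le> integral {0..pi} (g t)"
        by (rule integral_subset_le) (use uv g_int g_nonneg in auto)
      finally have I: "integral {u..v} (G t) * sin (d / 2) ^ (2 * r) \<le> 2 * real N * pi"
        by (simp add: gN)
      have I1: "integral {u..v} (G t) \<le> Z"
        unfolding ZG[of t, symmetric] by (rule integral_subset_le) (use uv G_int G_nonneg in auto)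
      let ?E = "\<bar>of_bool (x \<ge> tau N i) - poly Q x\<bar>"
      have E1: "?E \<le> 1" using uv(1) I1 Z by simp
      define e where "e = real N * d / pi"
      have dst: "dst N i x = 1 + e" unfolding dst_eq[OF N] e_def d_def t_def a_def by simp
      have e: "0 \<le> e" unfolding e_def using d by simp
      have eN: "e \<le> real N * sin (d / 2)"
      proof -
        have "2 / pi * (d / 2) \<le> sin (d / 2)" using d by (intro sin_ge_line) auto
        then have "real N * (2 / pi * (d / 2)) \<le> real N * sin (d / 2)" by (intro mult_left_mono) auto
        then show ?thesis unfolding e_def by simp
      qed
      have "?E * e ^ (2 * r) \<le> 1 / c0"
      proof -
        have IG: "0 \<le> integral {u..v} (G t)" by (intro integral_nonneg G_int G_nonneg)
        have "integral {u..v} (G t) * e ^ (2 * r) \<le> integral {u..v} (G t) * (real N * sin (d / 2)) ^ (2 * r)"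
          using eN e by (intro mult_left_mono power_mono IG) auto
        also have "... = real N ^ (2 * r) * (integral {u..v} (G t) * sin (d / 2) ^ (2 * r))"
          by (simp add: power_mult_distrib)
        also have "... \<le> real N ^ (2 * r) * (2 * real N * pi)" by (intro mult_left_mono I) auto
        also have "... = (2 * pi * c0 * real N ^ (2 * r + 1)) / c0" using c0 by simp
        also have "... \<le> Z / c0" using Zge c0 by (intro divide_right_mono) auto
        finally have "integral {u..v} (G t) * e ^ (2 * r) / Z \<le> 1 / c0" using Z c0 by (simp add: field_simps)
        then show ?thesis unfolding uv(1) by simp
      qed
      moreover have "?E * dst N i x ^ (2 * r) \<le> C"
      proof (cases "e \<le> 1")
        case True
        have "?E * dst N i x ^ (2 * r) \<le> 1 * 2 ^ (2 * r)"
          using E1 True e unfolding dst by (intro mult_mono power_mono) auto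
        also have "... \<le> C" unfolding C_def using c0 by simp
        finally show ?thesis .
      next
        case False
        have "?E * dst N i x ^ (2 * r) \<le> ?E * (2 * e) ^ (2 * r)"
          using False unfolding dst by (intro mult_left_mono power_mono) auto
        also have "... = 2 ^ (2 * r) * (?E * e ^ (2 * r))" by (simp add: power_mult_distrib)
        also have "... \<le> 2 ^ (2 * r) * (1 / c0)" using \<open>?E * e ^ (2 * r) \<le> 1 / c0\<close> by (intro mult_left_mono) auto
        also have "... \<le> C" unfolding C_def by (intro mult_left_mono) auto
        finally show ?thesis .
      qed
      ultimately show ?thesis using dst_pos[of N i x] by (simp add: field_simps)
    qed
    ultimately show ?thesis by blast
  qed
  with C show ?thesis by blast
qed

text \<open>A power of the Fejer kernel of order \<open>M\<close>, moved to the angle of the node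
  and normalised to height about 1. Its width is N / M node spacings, hence the factor (2 N / M)^(2
  r). In the application N / M is a fixed constant, and the degree \<open>r * M\<close> leaves room
  below \<open>N\<close>.\<close>

lemma node_poly:
  fixes r :: nat
  assumes M: "1 \<le> M" "M \<le> N" and i: "i \<le> N"
  shows "\<exists>V. degree V \<le> r * M \<and> (\<forall>x\<in>{-1..1}. 0 \<le> poly V x \<and>
      poly V x \<le> 2 * (2 * real N / real M) ^ (2 * r) / dst N i x ^ (2 * r) \<and>
      (dst N i x \<le> 2 \<longrightarrow> poly V x \<ge> (4 / pi\<^sup>2) ^ r))"
proof -
  define a where "a = real i * pi / real N"
  have N: "N \<ge> 1" using M by simp
  have a: "0 \<le> a" "a \<le> pi" unfolding a_def using node_angle[OF i] by auto
  define K where "K = fejer M ^ r"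
  obtain V where V: "degree V \<le> degree K"
    "\<And>t. poly V (cos t) = poly K (cos (t - a)) + poly K (cos (t + a))"
    using translate_poly[of K a] by blast
  define W where "W = smult (1 / real M ^ (2 * r)) V"
  have "degree W \<le> r * M"
  proof -
    have "degree K \<le> r * degree (fejer M)"
      unfolding K_def by (metis degree_power_le mult.commute)
    also have "... \<le> r * M" using degree_fejer by (intro mult_left_mono) auto
    finally show ?thesis unfolding W_def using V(1) by (meson degree_smult_le order.trans)
  qed
  moreover have "0 \<le> poly W x \<and>
      poly W x \<le> 2 * (2 * real N / real M) ^ (2 * r) / dst N i x ^ (2 * r) \<and>
      (dst N i x \<le> 2 \<longrightarrow> poly W x \<ge> (4 / pi\<^sup>2) ^ r)" if x: "x \<in> {-1..1}" for x
  proof -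
    define t where "t = arccos x"
    have t: "0 \<le> t" "t \<le> pi" "cos t = x" unfolding t_def using x by (auto simp: arccos_lbound arccos_ubound)
    define d where "d = \<bar>t - a\<bar>"
    have d: "0 \<le> d" "d \<le> pi" unfolding d_def using t a by auto
    define e where "e = real N * d / pi"
    have dst: "dst N i x = 1 + e" unfolding dst_eq[OF N] e_def d_def t_def a_def by simp
    have e: "0 \<le> e" unfolding e_def using d by simp
    define F where "F u = poly (fejer M) (cos u) / (real M)\<^sup>2" for u
    have F0: "F u \<ge> 0" for u unfolding F_def by (simp add: fejer_nonneg)
    have Wx: "poly W x = F (t - a) ^ r + F (t + a) ^ r"
      unfolding W_def F_def t(3)[symmetric] by (simp add: V K_def power_divide add_divide_distrib power_mult)
    have F_le: "F u \<le> (2 * real N / (real M * dst N i x))\<^sup>2" if s: "sin (d / 2) \<le> \<bar>sin (u / 2)\<bar>" for u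
    proof (cases "e \<le> 1")
      case True
      have "F u \<le> 1" unfolding F_def using fejer_le_sq[of M u] M by simp
      also have "1 \<le> 2 * real N / (real M * dst N i x)"
      proof -
        have "real M * dst N i x \<le> real N * 2" using M True e unfolding dst by (intro mult_mono) auto
        then show ?thesis using M dst_pos[of N i x] by (simp add: field_simps)
      qed
      then have "1 \<le> (2 * real N / (real M * dst N i x))\<^sup>2" by (simp add: one_le_power)
      finally show ?thesis .
    next
      case False
      have "2 / pi * (d / 2) \<le> sin (d / 2)" using d by (intro sin_ge_line) auto
      then have "poly (fejer M) (cos u) * (2 / pi * (d / 2))\<^sup>2 \<le> 1"
        using d s by (intro fejer_mult_sin_le) auto
      moreover have "2 / pi * (d / 2) = e / real N" unfolding e_def using N by simp
      ultimately have "poly (fejer M) (cos u) * (e / real N)\<^sup>2 \<le> 1" by simp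
      then have "F u \<le> (real N / (real M * e))\<^sup>2"
        unfolding F_def using False N M by (simp add: field_simps power_divide power_mult_distrib)
      also have "... \<le> (2 * real N / (real M * dst N i x))\<^sup>2"
      proof (intro power_mono)
        have "real M * (1 + e) \<le> real M * (2 * e)" using False by (intro mult_left_mono) auto
        then have "2 * real N / (real M * (2 * e)) \<le> 2 * real N / (real M * (1 + e))"
          using False M by (intro divide_left_mono) auto
        then show "real N / (real M * e) \<le> 2 * real N / (real M * dst N i x)" unfolding dst by simp
      qed (use False in auto)
      finally show ?thesis .
    qed
    have s1: "sin (d / 2) \<le> \<bar>sin ((t - a) / 2)\<bar>"
    proof (cases "t \<ge> a")
      case False
      have "sin ((t - a) / 2) = - sin (d / 2)" using False unfolding d_def
        by (simp flip: sin_minus add: minus_divide_left)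
      then show ?thesis by linarith
    qed (simp add: d_def)
    have "sin (d / 2) \<le> sin ((t + a) / 2)" using t a unfolding d_def by (intro sin_ge_mid) auto
    then have s2: "sin (d / 2) \<le> \<bar>sin ((t + a) / 2)\<bar>" by linarith
    have "poly W x \<le> ((2 * real N / (real M * dst N i x))\<^sup>2) ^ r + ((2 * real N / (real M * dst N i x))\<^sup>2) ^ r"
      unfolding Wx using F_le[OF s1] F_le[OF s2] F0 by (intro add_mono power_mono)
    also have "... = 2 * (2 * real N / real M) ^ (2 * r) / dst N i x ^ (2 * r)"
      by (simp add: power_mult power_divide power_mult_distrib)
    finally have up: "poly W x \<le> 2 * (2 * real N / real M) ^ (2 * r) / dst N i x ^ (2 * r)" .
    have low: "poly W x \<ge> (4 / pi\<^sup>2) ^ r" if "dst N i x \<le> 2"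
    proof -
      have "real N * d \<le> pi" using that unfolding dst e_def by (simp add: field_simps)
      moreover have "real M * d \<le> real N * d" using M d by (intro mult_right_mono) auto
      ultimately have "\<bar>real M * (t - a)\<bar> \<le> pi" unfolding d_def by (simp add: abs_mult)
      from fejer_ge[OF this] have "4 / pi\<^sup>2 \<le> F (t - a)" unfolding F_def using M by (simp add: field_simps)
      then have "(4 / pi\<^sup>2) ^ r \<le> F (t - a) ^ r" by (intro power_mono) auto
      then show ?thesis unfolding Wx using F0[of "t + a"] by (simp add: add_increasing2)
    qed
    show ?thesis using up low F0 by (auto simp: Wx add_nonneg_nonneg)
  qed
  ultimately show ?thesis by blast
qed

section \<open>Geometry of the nodes and comparison of the weight between points\<close>

declare dst_pos [simp]

lemma dst_nonneg [simp]: "0 \<le> dst N i x"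
  using dst_pos[of N i x] by linarith

lemma dst_neq_0 [simp]: "dst N i x \<noteq> 0"
  using dst_pos[of N i x] by linarith

lemma abs_sin_diff_le: "\<bar>sin a - sin b\<bar> \<le> \<bar>a - b\<bar>" for a b :: real
proof -
  have "sin a - sin b = 2 * sin ((a - b) / 2) * cos ((a + b) / 2)" by (rule sin_diff_sin)
  then have "\<bar>sin a - sin b\<bar> = 2 * (\<bar>sin ((a - b) / 2)\<bar> * \<bar>cos ((a + b) / 2)\<bar>)" by (simp add: abs_mult)
  also have "... \<le> 2 * (\<bar>(a - b) / 2\<bar> * 1)"
    by (intro mult_left_mono mult_mono abs_sin_x_le_abs_x) auto
  finally show ?thesis by simp
qed

lemma sin_node_ge:
  assumes "1 \<le> i" "i < N"
  shows "sin (real i * pi / real N) \<ge> 2 / real N"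
proof (cases "2 * i \<le> N")
  case True
  have "2 / pi * (real i * pi / real N) \<le> sin (real i * pi / real N)"
    using assms True by (intro sin_ge_line) (auto simp: field_simps)
  moreover have "2 / real N \<le> 2 / pi * (real i * pi / real N)" using assms by (simp add: field_simps)
  ultimately show ?thesis by linarith
next
  case False
  have e: "real (N - i) * pi / real N = pi - real i * pi / real N"
    using assms by (simp add: of_nat_diff field_simps)
  have "2 / pi * (real (N - i) * pi / real N) \<le> sin (real (N - i) * pi / real N)"
    using assms False by (intro sin_ge_line) (auto simp: field_simps of_nat_diff)
  moreover have "2 * 1 / real N \<le> 2 * real (N - i) / real N" using assms by (intro divide_right_mono) auto
  then have "2 / real N \<le> 2 / pi * (real (N - i) * pi / real N)" by simp
  moreover have "sin (real (N - i) * pi / real N) = sin (real i * pi / real N)" unfolding e by simp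
  ultimately show ?thesis by linarith
qed

lemma hh_ge: "1 \<le> i \<Longrightarrow> i < N \<Longrightarrow> hh N i \<ge> 2 / (real N)\<^sup>2"
  using sin_node_ge[of i N] unfolding hh_def by (simp add: power2_eq_square divide_right_mono flip: divide_divide_eq_left)

lemma hh_pos: "1 \<le> i \<Longrightarrow> i < N \<Longrightarrow> hh N i > 0"
  using hh_ge[of i N] by (smt (verit) divide_pos_pos of_nat_0_less_iff zero_less_power order.strict_trans1 zero_order(1) gr0I less_nat_zero_code)

text \<open>The difference of cosines is a product of two sines. The one at the mean angle exceeds
  the sine at the node by at most the factor \<open>dst\<close>, since at interior nodes one spacing
  changes the sine by a multiple of itself; the other sine is linear in \<open>dst\<close>. Hence
  the square.\<close>

lemma dist_tau_le:
  assumes i: "1 \<le> i" "i < N" and x: "x \<in> {-1..1}"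
  shows "\<bar>x - tau N i\<bar> \<le> pi * hh N i * (dst N i x)\<^sup>2"
proof -
  define a where "a = real i * pi / real N"
  define t where "t = arccos x"
  have t: "cos t = x" unfolding t_def using x by auto
  define d where "d = dst N i x"
  have d1: "d \<ge> 1" unfolding d_def by (rule dst_ge_1)
  have ta: "\<bar>t - a\<bar> = pi / real N * (d - 1)"
    unfolding t_def a_def d_def using i by (intro arccos_diff_eq) auto
  have sa: "sin a \<ge> 2 / real N" unfolding a_def using sin_node_ge[OF i] .
  have "\<bar>sin ((t + a) / 2)\<bar> \<le> \<bar>sin a\<bar> + \<bar>(t + a) / 2 - a\<bar>"
    using abs_sin_diff_le[of "(t + a) / 2" a] by linarith
  also have "(t + a) / 2 - a = (t - a) / 2" by (simp add: field_simps)
  also have "\<bar>(t - a) / 2\<bar> = \<bar>t - a\<bar> / 2" by simp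
  also have "... = pi / 4 * (d - 1) * (2 / real N)" unfolding ta by simp
  also have "... \<le> 1 * (d - 1) * sin a"
    using pi_less_4 d1 sa by (intro mult_mono) auto
  also have "\<bar>sin a\<bar> + 1 * (d - 1) * sin a = d * sin a"
    using sa i by (simp add: algebra_simps) (smt (verit) divide_nonneg_nonneg of_nat_0_le_iff)
  finally have 1: "\<bar>sin ((t + a) / 2)\<bar> \<le> d * sin a" by simp
  have "x - tau N i = 2 * sin ((t + a) / 2) * sin ((a - t) / 2)"
    unfolding tau_def a_def[symmetric] t[symmetric] by (rule cos_diff_cos)
  then have "\<bar>x - tau N i\<bar> = 2 * \<bar>sin ((t + a) / 2)\<bar> * \<bar>sin ((a - t) / 2)\<bar>" by (simp add: abs_mult)
  also have "... \<le> 2 * (d * sin a) * \<bar>(a - t) / 2\<bar>"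
    using 1 by (intro mult_mono abs_sin_x_le_abs_x) auto
  also have "... = pi * hh N i * (d * (d - 1))"
    using ta unfolding hh_def a_def[symmetric] by (simp add: abs_minus_commute)
  also have "... \<le> pi * hh N i * d\<^sup>2"
    using hh_pos[OF i] d1 by (intro mult_left_mono) (auto simp: power2_eq_square)
  finally show ?thesis unfolding d_def .
qed

lemma one_minus_tau: "1 - tau N i = 2 * (sin (real i * pi / real N / 2))\<^sup>2"
  unfolding tau_def by (rule one_minus_cos)

lemma tau_reflect: "i \<le> N \<Longrightarrow> 1 \<le> N \<Longrightarrow> tau N (N - i) = - tau N i"
proof -
  assume "i \<le> N" "1 \<le> N"
  then have "real (N - i) * pi / real N = pi - real i * pi / real N" by (simp add: of_nat_diff field_simps)
  then show ?thesis unfolding tau_def by simp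
qed

lemma dst_reflect:
  assumes "i \<le> N" "1 \<le> N" "x \<in> {-1..1}"
  shows "dst N (N - i) (- x) = dst N i x"
proof -
  have "arccos (- x) = pi - arccos x" using assms by (intro arccos_minus) auto
  then have "real N * arccos (- x) / pi - real (N - i) = real N * (pi - arccos x) / pi - (real N - real i)"
    using assms by (simp add: of_nat_diff)
  also have "... = - (real N * arccos x / pi - real i)" by (simp add: field_simps)
  finally have "real N * arccos (- x) / pi - real (N - i) = - (real N * arccos x / pi - real i)" .
  then show ?thesis unfolding dst_def by (simp only: abs_minus_cancel)
qed

text \<open>Here 1 - x = 2 sin^2(\<theta> / 2), and moving by one spacing changes sin(\<theta> / 2)
  by at most twice its value at the node, because \<open>1 \<le> i\<close> keeps the node at least
  one spacing away from the angle 0.\<close>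

lemma one_minus_le_dst:
  assumes i: "1 \<le> i" "i \<le> N" and x: "x \<in> {-1..1}"
  shows "1 - x \<le> 4 * (dst N i x)\<^sup>2 * (1 - tau N i)"
proof -
  define a where "a = real i * pi / real N"
  define t where "t = arccos x"
  have t: "0 \<le> t" "t \<le> pi" "cos t = x" unfolding t_def using x by (auto simp: arccos_lbound arccos_ubound)
  have a: "0 \<le> a" "a \<le> pi" unfolding a_def using node_angle[OF i(2)] by auto
  define d where "d = dst N i x"
  have d1: "d \<ge> 1" unfolding d_def by (rule dst_ge_1)
  have ta: "\<bar>t - a\<bar> = pi / real N * (d - 1)"
    unfolding t_def a_def d_def using i by (intro arccos_diff_eq) auto
  have "2 / pi * (a / 2) \<le> sin (a / 2)" using a by (intro sin_ge_line) auto
  moreover have "1 / real N \<le> 2 / pi * (a / 2)" unfolding a_def using i by (simp add: field_simps)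
  ultimately have sa: "1 / real N \<le> sin (a / 2)" by linarith
  have "sin (t / 2) \<le> sin (a / 2) + \<bar>t - a\<bar> / 2"
  proof -
    have "\<bar>t - a\<bar> / 2 = \<bar>t / 2 - a / 2\<bar>" by (simp add: abs_real_def field_simps)
    then show ?thesis using abs_sin_diff_le[of "t / 2" "a / 2"] by linarith
  qed
  also have "\<bar>t - a\<bar> / 2 = pi / 2 * (d - 1) * (1 / real N)" unfolding ta by simp
  also have "... \<le> 2 * (d - 1) * sin (a / 2)"
    using pi_less_4 d1 sa by (intro mult_mono) auto
  also have "sin (a / 2) + 2 * (d - 1) * sin (a / 2) \<le> 2 * d * sin (a / 2)"
  proof -
    have "0 \<le> sin (a / 2)" using sa by (smt (verit) divide_nonneg_nonneg of_nat_0_le_iff)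
    then show ?thesis by (simp add: algebra_simps)
  qed
  finally have "sin (t / 2) \<le> 2 * d * sin (a / 2)" by simp
  moreover have "0 \<le> sin (t / 2)" using t by (intro sin_ge_zero) auto
  ultimately have "(sin (t / 2))\<^sup>2 \<le> (2 * d * sin (a / 2))\<^sup>2" by (intro power_mono)
  then have "2 * (sin (t / 2))\<^sup>2 \<le> 4 * d\<^sup>2 * (2 * (sin (a / 2))\<^sup>2)" by (simp add: power_mult_distrib)
  then show ?thesis
    unfolding one_minus_tau d_def a_def[symmetric] using one_minus_cos[of t] t by simp
qed

lemma one_plus_le_dst:
  assumes i: "i < N" and x: "x \<in> {-1..1}"
  shows "1 + x \<le> 4 * (dst N i x)\<^sup>2 * (1 + tau N i)"
  using one_minus_le_dst[of "N - i" N "- x"] dst_reflect[of i N x] tau_reflect[of i N] assms by simp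

text \<open>The reverse comparison, for bounded \<open>dst\<close>. It fails as \<open>x\<close>
  tends to 1, so the angle of \<open>x\<close> is kept a quarter spacing away from 0. The constant
  is 20^2, with 20 = 1 + 19 and 6 pi < 19.\<close>

lemma one_minus_tau_le:
  assumes i: "1 \<le> i" "i \<le> N" and x: "x \<in> {-1..1}" and nu: "1 / 4 \<le> real N * arccos x / pi" and d: "dst N i x \<le> 4"
  shows "1 - tau N i \<le> 400 * (1 - x)"
proof -
  define a where "a = real i * pi / real N"
  define t where "t = arccos x"
  have t: "0 \<le> t" "t \<le> pi" "cos t = x" unfolding t_def using x by (auto simp: arccos_lbound arccos_ubound)
  have a: "0 \<le> a" "a \<le> pi" unfolding a_def using node_angle[OF i(2)] by auto
  have ta: "\<bar>t - a\<bar> = pi / real N * (dst N i x - 1)"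
    unfolding t_def a_def using i by (intro arccos_diff_eq) auto
  also have "... \<le> pi / real N * 3" using d by (intro mult_left_mono) auto
  finally have ta: "\<bar>t - a\<bar> \<le> pi / real N * 3" .
  have "2 / pi * (t / 2) \<le> sin (t / 2)" using t by (intro sin_ge_line) auto
  moreover have "1 / (4 * real N) \<le> 2 / pi * (t / 2)" using nu i unfolding t_def[symmetric] by (simp add: field_simps)
  ultimately have st: "1 / (4 * real N) \<le> sin (t / 2)" by linarith
  have "sin (a / 2) \<le> sin (t / 2) + \<bar>t - a\<bar> / 2"
  proof -
    have "\<bar>t - a\<bar> / 2 = \<bar>t / 2 - a / 2\<bar>" by (simp add: abs_real_def field_simps)
    then show ?thesis using abs_sin_diff_le[of "a / 2" "t / 2"] by linarith
  qed
  also have "\<bar>t - a\<bar> / 2 \<le> (6 * pi) * (1 / (4 * real N))" using ta by (simp add: mult.commute)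
  also have "... \<le> 19 * sin (t / 2)"
    using pi_approx st by (intro mult_mono) auto
  finally have "sin (a / 2) \<le> 20 * sin (t / 2)" by simp
  moreover have "0 \<le> sin (a / 2)" using a by (intro sin_ge_zero) auto
  ultimately have "(sin (a / 2))\<^sup>2 \<le> (20 * sin (t / 2))\<^sup>2" by (intro power_mono)
  then have "2 * (sin (a / 2))\<^sup>2 \<le> 400 * (2 * (sin (t / 2))\<^sup>2)" by (simp add: power_mult_distrib)
  then show ?thesis
    unfolding one_minus_tau a_def[symmetric] using one_minus_cos[of t] t by simp
qed

lemma one_plus_tau_le:
  assumes i: "i < N" and x: "x \<in> {-1..1}" and nu: "real N * arccos x / pi \<le> real N - 1 / 4" and d: "dst N i x \<le> 4"
  shows "1 + tau N i \<le> 400 * (1 + x)"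
proof -
  have "arccos (- x) = pi - arccos x" using x by (intro arccos_minus) auto
  then have "real N * arccos (- x) / pi = real N - real N * arccos x / pi"
    by (simp add: right_diff_distrib diff_divide_distrib)
  then have "1 / 4 \<le> real N * arccos (- x) / pi" using nu by linarith
  then show ?thesis
    using one_minus_tau_le[of "N - i" N "- x"] dst_reflect[of i N x] tau_reflect[of i N] assms by simp
qed

lemma jw_nonneg: "jw \<alpha> \<beta> x \<ge> 0"
  by (simp add: jw_def)

lemma jw_pos: "-1 < x \<Longrightarrow> x < 1 \<Longrightarrow> jw \<alpha> \<beta> x > 0"
  by (simp add: jw_def)

lemma tau_bounds: "1 \<le> i \<Longrightarrow> i < N \<Longrightarrow> -1 < tau N i \<and> tau N i < 1"
proof -
  assume i: "1 \<le> i" "i < N"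
  have 0: "0 < real i * pi / real N" "real i * pi / real N < pi" using i by (auto simp: field_simps)
  have "cos (real i * pi / real N) < cos 0" using 0 by (intro cos_monotone_0_pi) auto
  moreover have "cos pi < cos (real i * pi / real N)" using 0 by (intro cos_monotone_0_pi) auto
  ultimately show ?thesis by (simp add: tau_def)
qed

lemma jw_le_scale:
  assumes "0 \<le> \<alpha>" "0 \<le> \<beta>" "0 \<le> 1 - x" "0 \<le> 1 + x" "1 - x \<le> c * (1 - y)" "1 + x \<le> c * (1 + y)" "-1 \<le> y" "y \<le> 1" "0 \<le> c"
  shows "jw \<alpha> \<beta> x \<le> c powr (\<alpha> + \<beta>) * jw \<alpha> \<beta> y"
proof -
  have "jw \<alpha> \<beta> x \<le> (c * (1 + y)) powr \<alpha> * (c * (1 - y)) powr \<beta>"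
    unfolding jw_def using assms by (intro mult_mono powr_mono2) auto
  also have "... = c powr (\<alpha> + \<beta>) * jw \<alpha> \<beta> y"
    unfolding jw_def using assms by (simp add: powr_mult powr_add)
  finally show ?thesis .
qed

text \<open>Both endpoint distances grow at most quadratically in \<open>dst\<close>, so the weight
  costs the power 2 (\<alpha> + \<beta>) of it. A fixed surplus of decay in the kernels will pay for
  this.\<close>

lemma jw_le_dst:
  assumes i: "1 \<le> i" "i < N" and x: "x \<in> {-1..1}" and "0 \<le> \<alpha>" "0 \<le> \<beta>"
  shows "jw \<alpha> \<beta> x \<le> 4 powr (\<alpha> + \<beta>) * dst N i x powr (2 * (\<alpha> + \<beta>)) * jw \<alpha> \<beta> (tau N i)"
proof -
  have "jw \<alpha> \<beta> x \<le> (4 * (dst N i x)\<^sup>2) powr (\<alpha> + \<beta>) * jw \<alpha> \<beta> (tau N i)"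
    using one_minus_le_dst[of i N x] one_plus_le_dst[of i N x] tau_bounds[of i N] assms
    by (intro jw_le_scale) auto
  also have "(4 * (dst N i x)\<^sup>2) powr (\<alpha> + \<beta>) = 4 powr (\<alpha> + \<beta>) * dst N i x powr (2 * (\<alpha> + \<beta>))"
  proof -
    have "(dst N i x)\<^sup>2 = dst N i x powr 2" using powr_realpow[OF dst_pos, of N i x 2] by simp
    then show ?thesis by (simp only: powr_mult powr_powr)
  qed
  finally show ?thesis .
qed

lemma jw_tau_le:
  assumes i: "1 \<le> i" "i < N" and x: "x \<in> {-1..1}" and "0 \<le> \<alpha>" "0 \<le> \<beta>"
    and "1 / 4 \<le> real N * arccos x / pi" "real N * arccos x / pi \<le> real N - 1 / 4" "dst N i x \<le> 4"
  shows "jw \<alpha> \<beta> (tau N i) \<le> 400 powr (\<alpha> + \<beta>) * jw \<alpha> \<beta> x"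
  using one_minus_tau_le[of i N x] one_plus_tau_le[of i N x] tau_bounds[of i N] assms
  by (intro jw_le_scale) auto

section \<open>Sums of localised bounds over the nodes and their integrals\<close>

lemma sum_inverse_squares_le: "(\<Sum>m<n. 1 / (1 + real m)\<^sup>2) \<le> 2"
proof -
  have "(\<Sum>m<Suc n. 1 / (1 + real m)\<^sup>2) \<le> 2 - 1 / (1 + real n)" for n
  proof (induction n)
    case (Suc n)
    have "1 / (1 + real (Suc n))\<^sup>2 \<le> 1 / ((1 + real n) * (2 + real n))"
      by (intro divide_left_mono) (auto simp: power2_eq_square)
    also have "... = 1 / (1 + real n) - 1 / (2 + real n)" by (simp add: field_simps)
    finally show ?case using Suc by simp
  qed simp
  moreover have "1 / (1 + real n) \<ge> 0" for n by simp
  ultimately have "(\<Sum>m<Suc n. 1 / (1 + real m)\<^sup>2) \<le> 2" for n by (smt (verit))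
  then show ?thesis by (cases n) simp_all
qed

text \<open>On either side of \<open>x\<close> the distances to the nodes dominate distinct natural
  numbers, so each side is at most the sum of 1 / (1 + m)^2, which is at most 2.\<close>

lemma sum_dst_le:
  assumes "finite A" and x: "x \<in> {-1..1}"
  shows "(\<Sum>i\<in>A. 1 / (dst N i x)\<^sup>2) \<le> 4"
proof -
  define v where "v = real N * arccos x / pi"
  have v: "v \<ge> 0" unfolding v_def using x arccos_lbound[of x] by simp
  define l where "l = nat \<lfloor>v\<rfloor>"
  have l: "real l \<le> v" "v < real l + 1" unfolding l_def using v by (simp_all add: of_nat_nat)
  have inj: "(\<Sum>i\<in>B. 1 / (dst N i x)\<^sup>2) \<le> 2"
    if B: "finite B" "inj_on g B" "\<And>i. i \<in> B \<Longrightarrow> 1 + real (g i) \<le> dst N i x" for B g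
  proof -
    have "(\<Sum>i\<in>B. 1 / (dst N i x)\<^sup>2) \<le> (\<Sum>i\<in>B. 1 / (1 + real (g i))\<^sup>2)"
      using B(3) by (intro sum_mono divide_left_mono power_mono mult_pos_pos zero_less_power dst_pos) auto
    also have "... = (\<Sum>m\<in>g ` B. 1 / (1 + real m)\<^sup>2)" by (simp add: sum.reindex[OF B(2)])
    also have "... \<le> (\<Sum>m<Suc (Max (g ` B)). 1 / (1 + real m)\<^sup>2)"
      using B(1) by (intro sum_mono2) (auto simp: less_Suc_eq_le)
    also have "... \<le> 2" by (rule sum_inverse_squares_le)
    finally show ?thesis .
  qed
  have "(\<Sum>i\<in>{i\<in>A. i \<le> l}. 1 / (dst N i x)\<^sup>2) \<le> 2"
    by (rule inj[where g = "\<lambda>i. l - i"])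
      (use assms l in \<open>auto simp: inj_on_def dst_def v_def[symmetric] of_nat_diff\<close>)
  moreover have "(\<Sum>i\<in>{i\<in>A. i > l}. 1 / (dst N i x)\<^sup>2) \<le> 2"
    by (rule inj[where g = "\<lambda>i. i - Suc l"])
      (use assms l in \<open>auto simp: inj_on_def dst_def v_def[symmetric] of_nat_diff Suc_le_eq\<close>)
  moreover have "A = {i\<in>A. i \<le> l} \<union> {i\<in>A. i > l}" by auto
  then have "(\<Sum>i\<in>A. 1 / (dst N i x)\<^sup>2) =
    (\<Sum>i\<in>{i\<in>A. i \<le> l}. 1 / (dst N i x)\<^sup>2) + (\<Sum>i\<in>{i\<in>A. i > l}. 1 / (dst N i x)\<^sup>2)"
    using assms(1) by (subst sum.union_disjoint[symmetric]) auto
  ultimately show ?thesis by linarith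
qed

text \<open>A majorant of the fourth inverse power of \<open>dst\<close> in terms of
  \<open>x\<close> itself. By \<open>dist_tau_le\<close> half of the decay is lost in passing from
  angles to \<open>x\<close>; the remaining quadratic decay at the scale \<open>hh\<close> has an
  integral proportional to \<open>hh\<close>.\<close>

definition bell :: "nat \<Rightarrow> nat \<Rightarrow> real \<Rightarrow> real" where
  "bell N i x = 4 / (1 + \<bar>x - tau N i\<bar> / (pi * hh N i))\<^sup>2"

lemma bell_nonneg: "bell N i x \<ge> 0"
  by (simp add: bell_def)

lemma bell_measurable [measurable]: "bell N i \<in> borel_measurable borel"
  unfolding bell_def by measurable

lemma dst_le_bell:
  assumes i: "1 \<le> i" "i < N" and x: "x \<in> {-1..1}"
  shows "1 / dst N i x ^ 4 \<le> bell N i x"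
proof -
  let ?d = "dst N i x"
  have h: "hh N i > 0" using hh_pos[OF i] .
  have d: "?d \<ge> 1" by (rule dst_ge_1)
  then have d2: "1 \<le> ?d\<^sup>2" by (simp add: one_le_power)
  have "\<bar>x - tau N i\<bar> / (pi * hh N i) \<le> ?d\<^sup>2"
    using dist_tau_le[OF i x] h by (simp add: pos_divide_le_eq mult_ac)
  then have "1 + \<bar>x - tau N i\<bar> / (pi * hh N i) \<le> 2 * ?d\<^sup>2" using d2 by linarith
  then have "(1 + \<bar>x - tau N i\<bar> / (pi * hh N i))\<^sup>2 \<le> (2 * ?d\<^sup>2)\<^sup>2"
    using h by (intro power_mono) auto
  also have "... = 4 * ?d ^ 4" by (simp add: power_mult_distrib flip: power_mult)
  finally have 1: "(1 + \<bar>x - tau N i\<bar> / (pi * hh N i))\<^sup>2 \<le> 4 * ?d ^ 4" .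
  have "0 < 1 + \<bar>x - tau N i\<bar> / (pi * hh N i)" using h by (intro add_pos_nonneg) auto
  then have "4 / (4 * ?d ^ 4) \<le> bell N i x"
    unfolding bell_def using 1 d by (intro divide_left_mono) auto
  then show ?thesis by simp
qed

lemma nn_integral_half_line: "(\<integral>\<^sup>+y. ennreal (1 / (1 + y)\<^sup>2) * indicator {0..} y \<partial>lborel) = 1"
proof -
  have "((\<lambda>y::real. inverse (1 + y)) \<longlongrightarrow> 0) at_top"
    by (rule tendsto_inverse_0_at_top, rule filterlim_tendsto_add_at_top[OF tendsto_const filterlim_ident])
  from tendsto_minus[OF this] have lim: "((\<lambda>y::real. - 1 / (1 + y)) \<longlongrightarrow> 0) at_top"
    by (simp add: inverse_eq_divide)
  have "(\<integral>\<^sup>+y. ennreal (1 / (1 + y)\<^sup>2) * indicator {0..} y \<partial>lborel) = ennreal (0 - (- 1 / (1 + 0)))"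
    by (rule nn_integral_FTC_atLeast[OF _ _ _ lim])
      (auto intro!: derivative_eq_intros simp: power2_eq_square)
  then show ?thesis by simp
qed

lemma nn_integral_line: "(\<integral>\<^sup>+y. ennreal (1 / (1 + \<bar>y\<bar>)\<^sup>2) \<partial>lborel) \<le> 2"
proof -
  have "(\<integral>\<^sup>+y. ennreal (1 / (1 + \<bar>y\<bar>)\<^sup>2) \<partial>lborel) \<le>
    (\<integral>\<^sup>+y. ennreal (1 / (1 + y)\<^sup>2) * indicator {0..} y +
      ennreal (1 / (1 + - y)\<^sup>2) * indicator {0..} (- y) \<partial>lborel)"
    by (intro nn_integral_mono) (auto split: split_indicator)
  also have "... = (\<integral>\<^sup>+y. ennreal (1 / (1 + y)\<^sup>2) * indicator {0..} y \<partial>lborel) +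
      (\<integral>\<^sup>+y. ennreal (1 / (1 + - y)\<^sup>2) * indicator {0..} (- y) \<partial>lborel)"
    by (rule nn_integral_add) measurable
  also have "(\<integral>\<^sup>+y. ennreal (1 / (1 + - y)\<^sup>2) * indicator {0..} (- y) \<partial>lborel) =
     (\<integral>\<^sup>+y. ennreal (1 / (1 + y)\<^sup>2) * indicator {0..} y \<partial>lborel)"
    using nn_integral_real_affine[of "\<lambda>y. ennreal (1 / (1 + y)\<^sup>2) * indicator {0..} y" "-1" 0] by simp
  finally show ?thesis unfolding nn_integral_half_line by simp
qed

lemma nn_integral_bell:
  assumes i: "1 \<le> i" "i < N"
  shows "(\<integral>\<^sup>+x. ennreal (bell N i x) \<partial>lborel) \<le> ennreal (8 * pi * hh N i)"
proof -
  let ?c = "pi * hh N i"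
  have c: "?c > 0" using hh_pos[OF i] by simp
  have "(\<integral>\<^sup>+x. ennreal (bell N i x) \<partial>lborel) =
    ennreal ?c * (\<integral>\<^sup>+x. ennreal (bell N i (tau N i + ?c * x)) \<partial>lborel)"
    using nn_integral_real_affine[of "\<lambda>x. ennreal (bell N i x)" ?c "tau N i"] c hh_pos[OF i] by simp
  also have "(\<integral>\<^sup>+x. ennreal (bell N i (tau N i + ?c * x)) \<partial>lborel) =
    (\<integral>\<^sup>+x. ennreal 4 * ennreal (1 / (1 + \<bar>x\<bar>)\<^sup>2) \<partial>lborel)"
  proof (rule nn_integral_cong)
    fix x
    have "\<bar>?c * x\<bar> / ?c = \<bar>x\<bar>" using hh_pos[OF i] by (simp add: abs_mult)
    then show "ennreal (bell N i (tau N i + ?c * x)) = ennreal 4 * ennreal (1 / (1 + \<bar>x\<bar>)\<^sup>2)"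
      unfolding bell_def by (simp flip: ennreal_mult' del: ennreal_numeral)
  qed
  also have "... = ennreal 4 * (\<integral>\<^sup>+x. ennreal (1 / (1 + \<bar>x\<bar>)\<^sup>2) \<partial>lborel)"
    by (rule nn_integral_cmult) measurable
  also have "ennreal ?c * \<dots> \<le> ennreal ?c * (ennreal 4 * ennreal 2)"
    using nn_integral_line by (intro mult_left_mono) auto
  also have "... = ennreal (8 * pi * hh N i)"
    using c by (simp flip: ennreal_mult' del: ennreal_numeral)
  finally show ?thesis .
qed

text \<open>Two of the six powers of decay pay for the summation over the nodes. The other four stay
  with the maximal term, whose \<open>q\<close>-th power is bounded by the sum on the right.\<close>

lemma sum_dst_powr_le:
  assumes A: "finite A" and x: "x \<in> {-1..1}" and v: "\<And>i. i \<in> A \<Longrightarrow> 0 \<le> v i" and q: "1 \<le> q"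
  shows "(\<Sum>i\<in>A. v i / dst N i x ^ 6) powr q \<le> 4 powr q * (\<Sum>i\<in>A. v i powr q / dst N i x ^ 4)"
proof (cases "A = {}")
  case False
  define m where "m = Max ((\<lambda>i. v i / dst N i x ^ 4) ` A)"
  have m_ge: "v i / dst N i x ^ 4 \<le> m" if "i \<in> A" for i
    unfolding m_def using A that by (intro Max_ge) auto
  have "m \<in> (\<lambda>i. v i / dst N i x ^ 4) ` A" unfolding m_def using A False by (intro Max_in) auto
  then obtain j where j: "j \<in> A" "m = v j / dst N j x ^ 4" by blast
  have m: "0 \<le> m" unfolding j(2) using v[OF j(1)] dst_pos[of N j x] by simp
  have "(\<Sum>i\<in>A. v i / dst N i x ^ 6) \<le> (\<Sum>i\<in>A. m * (1 / (dst N i x)\<^sup>2))"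
  proof (rule sum_mono)
    fix i assume i: "i \<in> A"
    have "v i / dst N i x ^ 6 = (v i / dst N i x ^ 4) * (1 / (dst N i x)\<^sup>2)" by (simp flip: power_add)
    also have "... \<le> m * (1 / (dst N i x)\<^sup>2)" using m_ge[OF i] by (intro mult_right_mono) auto
    finally show "v i / dst N i x ^ 6 \<le> m * (1 / (dst N i x)\<^sup>2)" .
  qed
  also have "... \<le> m * 4"
    unfolding sum_distrib_left[symmetric] by (intro mult_left_mono sum_dst_le A x m)
  finally have "(\<Sum>i\<in>A. v i / dst N i x ^ 6) powr q \<le> (m * 4) powr q"
    using q v dst_pos by (intro powr_mono2 sum_nonneg divide_nonneg_pos) auto
  also have "... = 4 powr q * m powr q" using m by (simp add: powr_mult)
  also have "m powr q \<le> v j powr q / dst N j x ^ 4"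
  proof -
    have d: "dst N j x ^ 4 \<ge> 1" using dst_ge_1 by (intro one_le_power)
    then have "(dst N j x ^ 4) powr 1 \<le> (dst N j x ^ 4) powr q" using q by (intro powr_mono)
    then have "dst N j x ^ 4 \<le> (dst N j x ^ 4) powr q" using d by simp
    then show ?thesis unfolding j(2) using v[OF j(1)] d
      by (simp add: powr_divide) (intro divide_left_mono, auto)
  qed
  also have "... \<le> (\<Sum>i\<in>A. v i powr q / dst N i x ^ 4)"
    using A j(1) dst_pos by (intro member_le_sum) (auto intro!: divide_nonneg_pos)
  finally show ?thesis by simp
qed simp

text \<open>Passes from a pointwise bound by decaying contributions of the nodes to a discrete
  weighted l_q norm with masses \<open>hh\<close>. The weight uses 2 (\<alpha> + \<beta>) powers of
  the decay and \<open>sum_dst_powr_le\<close> uses six.\<close>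

lemma nn_integral_lattice:
  assumes q: "1 \<le> q" and ab: "0 \<le> \<alpha>" "0 \<le> \<beta>" and s: "2 * (\<alpha> + \<beta>) + 6 \<le> real s"
    and A: "finite A" "A \<subseteq> {1..<N}" and b: "\<And>i. i \<in> A \<Longrightarrow> 0 \<le> b i"
    and F: "\<And>x. x \<in> {-1<..<1} \<Longrightarrow> \<bar>F x\<bar> \<le> (\<Sum>i\<in>A. b i / dst N i x ^ s)"
  shows "(\<integral>\<^sup>+x. ennreal (\<bar>jw \<alpha> \<beta> x * F x\<bar> powr q) \<partial>I11) \<le>
    ennreal ((4 * 4 powr (\<alpha> + \<beta>)) powr q * 8 * pi * (\<Sum>i\<in>A. (b i * jw \<alpha> \<beta> (tau N i)) powr q * hh N i))"
proof -
  define c where "c = (4 * 4 powr (\<alpha> + \<beta>)) powr q"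
  define v where "v i = b i * jw \<alpha> \<beta> (tau N i)" for i
  have c0: "c \<ge> 0" unfolding c_def by simp
  have v0: "v i \<ge> 0" if "i \<in> A" for i unfolding v_def using b[OF that] jw_nonneg by simp
  have pt: "\<bar>jw \<alpha> \<beta> x * F x\<bar> powr q \<le> (\<Sum>i\<in>A. c * v i powr q * bell N i x)" if x: "x \<in> {-1..1}" for x
  proof (cases "x \<in> {-1<..<1}")
    case False
    then have "x = -1 \<or> x = 1" using x by auto
    \<comment> \<open>As \<open>0 powr 0 = 0\<close>, the weight vanishes at both endpoints even
      when an exponent is 0, so the open interval carries all the information on
      \<open>F\<close>.\<close>
    then have "jw \<alpha> \<beta> x = 0" unfolding jw_def by auto
    moreover have "0 \<le> (\<Sum>i\<in>A. c * v i powr q * bell N i x)" using c0 bell_nonneg by (intro sum_nonneg) auto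
    ultimately show ?thesis using q by simp
  next
    case True
    have "\<bar>jw \<alpha> \<beta> x * F x\<bar> = jw \<alpha> \<beta> x * \<bar>F x\<bar>" by (simp add: abs_mult jw_nonneg)
    also have "... \<le> jw \<alpha> \<beta> x * (\<Sum>i\<in>A. b i / dst N i x ^ s)"
      by (intro mult_left_mono F True jw_nonneg)
    also have "... = (\<Sum>i\<in>A. jw \<alpha> \<beta> x * (b i / dst N i x ^ s))" by (simp add: sum_distrib_left)
    also have "... \<le> (\<Sum>i\<in>A. 4 powr (\<alpha> + \<beta>) * (v i / dst N i x ^ 6))"
    proof (rule sum_mono)
      fix i assume i: "i \<in> A"
      let ?d = "dst N i x"
      have d: "1 \<le> ?d" by (rule dst_ge_1)
      have "?d powr (2 * (\<alpha> + \<beta>)) * ?d ^ 6 = ?d powr (2 * (\<alpha> + \<beta>) + 6)"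
        using powr_realpow[OF dst_pos, of N i x 6] by (simp add: powr_add)
      also have "... \<le> ?d powr real s" using s d by (intro powr_mono) auto
      also have "... = ?d ^ s" using d by (simp add: powr_realpow)
      finally have "?d powr (2 * (\<alpha> + \<beta>)) * ?d ^ 6 / (?d ^ 6 * ?d ^ s) \<le> ?d ^ s / (?d ^ 6 * ?d ^ s)"
        by (intro divide_right_mono) auto
      then have ds: "?d powr (2 * (\<alpha> + \<beta>)) / ?d ^ s \<le> 1 / ?d ^ 6" by simp
      have "jw \<alpha> \<beta> x * (b i / ?d ^ s) \<le>
        (4 powr (\<alpha> + \<beta>) * ?d powr (2 * (\<alpha> + \<beta>)) * jw \<alpha> \<beta> (tau N i)) * (b i / ?d ^ s)"
        using i A b[OF i] x ab d by (intro mult_right_mono jw_le_dst) auto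
      also have "... = 4 powr (\<alpha> + \<beta>) * v i * (?d powr (2 * (\<alpha> + \<beta>)) / ?d ^ s)"
        unfolding v_def by simp
      also have "... \<le> 4 powr (\<alpha> + \<beta>) * v i * (1 / ?d ^ 6)"
        using v0[OF i] by (intro mult_left_mono ds) auto
      finally show "jw \<alpha> \<beta> x * (b i / ?d ^ s) \<le> 4 powr (\<alpha> + \<beta>) * (v i / ?d ^ 6)" by simp
    qed
    also have "... = 4 powr (\<alpha> + \<beta>) * (\<Sum>i\<in>A. v i / dst N i x ^ 6)" by (simp add: sum_distrib_left)
    finally have "\<bar>jw \<alpha> \<beta> x * F x\<bar> powr q \<le> (4 powr (\<alpha> + \<beta>) * (\<Sum>i\<in>A. v i / dst N i x ^ 6)) powr q"
      using q by (intro powr_mono2) auto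
    also have "... = (4 powr (\<alpha> + \<beta>)) powr q * (\<Sum>i\<in>A. v i / dst N i x ^ 6) powr q"
      by (rule powr_mult)
    also have "... \<le> (4 powr (\<alpha> + \<beta>)) powr q * (4 powr q * (\<Sum>i\<in>A. v i powr q / dst N i x ^ 4))"
      using v0 A x q by (intro mult_left_mono sum_dst_powr_le) auto
    also have "... = (\<Sum>i\<in>A. c * v i powr q * (1 / dst N i x ^ 4))"
      unfolding c_def by (simp add: sum_distrib_left powr_mult mult_ac)
    also have "... \<le> (\<Sum>i\<in>A. c * v i powr q * bell N i x)"
      using A x c0 by (intro sum_mono mult_left_mono dst_le_bell) auto
    finally show ?thesis .
  qed
  have "(\<integral>\<^sup>+x. ennreal (\<bar>jw \<alpha> \<beta> x * F x\<bar> powr q) \<partial>I11) =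
    (\<integral>\<^sup>+x. ennreal (\<bar>jw \<alpha> \<beta> x * F x\<bar> powr q) * indicator {-1..1} x \<partial>lborel)"
    unfolding I11_def by (subst nn_integral_restrict_space) auto
  also have "... \<le> (\<integral>\<^sup>+x. (\<Sum>i\<in>A. ennreal (c * v i powr q) * ennreal (bell N i x)) \<partial>lborel)"
  proof (rule nn_integral_mono)
    fix x :: real
    have "(\<Sum>i\<in>A. ennreal (c * v i powr q) * ennreal (bell N i x)) = ennreal (\<Sum>i\<in>A. c * v i powr q * bell N i x)"
      using c0 bell_nonneg by (subst sum_ennreal[symmetric]) (auto simp: ennreal_mult')
    then show "ennreal (\<bar>jw \<alpha> \<beta> x * F x\<bar> powr q) * indicator {-1..1} x \<le>
      (\<Sum>i\<in>A. ennreal (c * v i powr q) * ennreal (bell N i x))"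
      using pt[of x] by (auto split: split_indicator intro: ennreal_leI)
  qed
  also have "... = (\<Sum>i\<in>A. ennreal (c * v i powr q) * (\<integral>\<^sup>+x. ennreal (bell N i x) \<partial>lborel))"
    by (subst nn_integral_sum) (auto simp: nn_integral_cmult)
  also have "... \<le> (\<Sum>i\<in>A. ennreal (c * v i powr q) * ennreal (8 * pi * hh N i))"
    using A by (intro sum_mono mult_left_mono nn_integral_bell) auto
  also have "... = (\<Sum>i\<in>A. ennreal (c * v i powr q * (8 * pi * hh N i)))"
  proof (rule sum.cong[OF refl], rule ennreal_mult[symmetric])
    fix i assume "i \<in> A"
    then have "hh N i > 0" using A by (intro hh_pos) auto
    then show "0 \<le> 8 * pi * hh N i" by simp
  qed (use c0 in auto)
  also have "... = ennreal (\<Sum>i\<in>A. c * v i powr q * (8 * pi * hh N i))"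
  proof (rule sum_ennreal)
    fix i assume "i \<in> A"
    then have "hh N i > 0" using A by (intro hh_pos) auto
    then show "0 \<le> c * v i powr q * (8 * pi * hh N i)" using c0 by simp
  qed
  also have "(\<Sum>i\<in>A. c * v i powr q * (8 * pi * hh N i)) = c * 8 * pi * (\<Sum>i\<in>A. v i powr q * hh N i)"
    by (simp add: sum_distrib_left mult_ac)
  finally show ?thesis unfolding c_def v_def .
qed

lemma nu_tau_bounds:
  assumes "l \<le> m" "m \<le> N" "1 \<le> N" and x: "tau N m \<le> x" "x \<le> tau N l"
  shows "real l \<le> real N * arccos x / pi" "real N * arccos x / pi \<le> real m"
proof -
  have b: "-1 \<le> tau N m" "tau N l \<le> 1" unfolding tau_def by simp_all
  have "arccos (tau N l) \<le> arccos x" "arccos x \<le> arccos (tau N m)"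
    using x b by (auto intro!: arccos_le_arccos)
  then have "real l * pi / real N \<le> arccos x" "arccos x \<le> real m * pi / real N"
    using assms by (simp_all add: arccos_tau)
  then show "real l \<le> real N * arccos x / pi" "real N * arccos x / pi \<le> real m"
    using assms(3) by (simp_all add: field_simps)
qed

lemma tau_strict_antimono:
  assumes "i < j" "j \<le> N"
  shows "tau N j < tau N i"
  unfolding tau_def using assms node_angle[of j N] node_angle[of i N]
  by (intro cos_monotone_0_pi) (auto simp: divide_strict_right_mono)

lemma tau_antimono: "i \<le> j \<Longrightarrow> j \<le> N \<Longrightarrow> tau N j \<le> tau N i"
  using tau_strict_antimono[of i j N] by (cases "i = j") auto

lemma tau_abs_le: "-1 \<le> tau N i" "tau N i \<le> 1"
  unfolding tau_def by simp_all

lemma hh_ratio: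
  assumes "1 \<le> j" "j < N"
  shows "hh N i \<le> 2 * (1 + \<bar>real i - real j\<bar>) * hh N j"
proof -
  define a where "a = real i * pi / real N"
  define b where "b = real j * pi / real N"
  have "a - b = (real i - real j) * (pi / real N)" unfolding a_def b_def by (simp add: field_simps diff_divide_distrib)
  then have "\<bar>a - b\<bar> = \<bar>real i - real j\<bar> * (pi / real N)" by (simp add: abs_mult)
  also have "... = \<bar>real i - real j\<bar> * (pi / 2) * (2 / real N)" by simp
  also have "... \<le> \<bar>real i - real j\<bar> * 2 * sin b"
    unfolding b_def using pi_less_4 sin_node_ge[OF assms] by (intro mult_mono) auto
  finally have "sin a \<le> (1 + 2 * \<bar>real i - real j\<bar>) * sin b"
    using abs_sin_diff_le[of a b] by (simp add: algebra_simps)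
  also have "... \<le> 2 * (1 + \<bar>real i - real j\<bar>) * sin b"
  proof (rule mult_right_mono)
    show "0 \<le> sin b" unfolding b_def using node_angle[of j N] assms by (intro sin_ge_zero) auto
  qed simp
  finally have "sin a / real N \<le> 2 * (1 + \<bar>real i - real j\<bar>) * sin b / real N" by (intro divide_right_mono) auto
  then show ?thesis unfolding hh_def a_def b_def by simp
qed

text \<open>The cell length is a product of two sines; the one at the middle of the cell is at least
  a third of the sine at the node \<open>i\<close>, even for the last cell before -1.\<close>

lemma tau_gap:
  assumes "1 \<le> i" "i < N"
  shows "tau N i - tau N (Suc i) \<ge> hh N i / 2"
proof -
  define a where "a = real i * pi / real N"
  define h where "h = pi / (2 * real N)"
  have N: "real N \<ge> 2" using assms by simp
  have h: "0 < h" unfolding h_def using N by simp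
  have b: "real (Suc i) * pi / real N = a + 2 * h" unfolding a_def h_def using N by (simp add: field_simps)
  have "h \<le> pi / 2" unfolding h_def using N by (simp add: field_simps)
  then have "2 / pi * h \<le> sin h" using h by (intro sin_ge_line) auto
  moreover have "2 / pi * h = 1 / real N" unfolding h_def by simp
  ultimately have sh: "1 / real N \<le> sin h" by simp
  have a2: "a = 2 * real i * h" unfolding a_def h_def by simp
  have "2 * h \<le> a" unfolding a2 using assms h by simp
  have "a + 2 * h \<le> pi" using node_angle[of "Suc i" N] assms b by simp
  then have "sin h \<le> sin (a + h)" using h \<open>2 * h \<le> a\<close> by (intro sin_ge_mid) auto
  then have sm: "1 / real N \<le> sin (a + h)" using sh by linarith
  have "h = pi / 2 * (1 / real N)" unfolding h_def by simp
  also have "... \<le> 2 * sin (a + h)" using pi_less_4 sm by (intro mult_mono) auto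
  finally have sa: "sin a \<le> 3 * sin (a + h)" using abs_sin_diff_le[of a "a + h"] h by linarith
  have "tau N i - tau N (Suc i) = 2 * sin ((a + (a + 2 * h)) / 2) * sin ((a + 2 * h - a) / 2)"
    unfolding tau_def b a_def[symmetric] by (rule cos_diff_cos)
  also have "... = 2 * sin (a + h) * sin h"
  proof -
    have "(a + (a + 2 * h)) / 2 = a + h" "(a + 2 * h - a) / 2 = h" by simp_all
    then show ?thesis by (simp only:)
  qed
  also have "... \<ge> 2 * (sin a / 3) * (1 / real N)"
  proof -
    have "0 \<le> sin a" unfolding a_def using node_angle[of i N] assms by (intro sin_ge_zero) auto
    then show ?thesis using sa sh by (intro mult_mono) auto
  qed
  finally have 1: "2 * (sin a / 3) * (1 / real N) \<le> tau N i - tau N (Suc i)" .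
  have "hh N i > 0" using hh_pos[OF assms] .
  moreover have "2 * (sin a / 3) * (1 / real N) = 2 / 3 * hh N i" unfolding hh_def a_def by simp
  ultimately show ?thesis using 1 by simp
qed

section \<open>Interpolation in the cells and its local error\<close>

text \<open>\<open>k\<close> points strictly inside the cell to the left of the \<open>i\<close>-th
  node. Point sets of different cells are then strictly ordered, as \<open>dd_mono\<close> demands,
  and even the extreme cells stay within the open interval.\<close>

definition YY :: "nat \<Rightarrow> nat \<Rightarrow> nat \<Rightarrow> real set" where
  "YY N k i = (\<lambda>j. tau N (Suc i) + real j / real (Suc k) * (tau N i - tau N (Suc i))) ` {1..k}"

lemma YY_props:
  assumes "i < N"
  shows "finite (YY N k i)" "card (YY N k i) = k"
    "\<And>y. y \<in> YY N k i \<Longrightarrow> tau N (Suc i) < y \<and> y < tau N i"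
    "\<And>y z. y \<in> YY N k i \<Longrightarrow> z \<in> YY N k i \<Longrightarrow> y \<noteq> z \<Longrightarrow> \<bar>y - z\<bar> \<ge> (tau N i - tau N (Suc i)) / real (Suc k)"
proof -
  let ?g = "tau N i - tau N (Suc i)"
  have g: "?g > 0" using tau_strict_antimono[of i "Suc i" N] assms by simp
  show "finite (YY N k i)" unfolding YY_def by simp
  have "inj_on (\<lambda>j. tau N (Suc i) + real j / real (Suc k) * ?g) {1..k}"
    using g by (auto simp: inj_on_def simp del: of_nat_Suc)
  then show "card (YY N k i) = k" unfolding YY_def by (simp add: card_image)
  show "tau N (Suc i) < y \<and> y < tau N i" if y: "y \<in> YY N k i" for y
  proof -
    obtain j where j: "j \<in> {1..k}" "y = tau N (Suc i) + real j / real (Suc k) * ?g"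
      using y unfolding YY_def by blast
    have r: "0 < real j / real (Suc k)" "real j / real (Suc k) < 1" using j(1) by auto
    define e where "e = real j / real (Suc k) * ?g"
    have "e < 1 * ?g" unfolding e_def by (rule mult_strict_right_mono[OF r(2) g])
    moreover have "0 < e" unfolding e_def by (rule mult_pos_pos[OF r(1) g])
    moreover have "y = tau N (Suc i) + e" unfolding j(2) e_def ..
    ultimately show ?thesis by simp
  qed
  show "\<bar>y - z\<bar> \<ge> ?g / real (Suc k)" if yz: "y \<in> YY N k i" "z \<in> YY N k i" "y \<noteq> z" for y z
  proof -
    obtain j where j: "y = tau N (Suc i) + real j / real (Suc k) * ?g"
      using yz unfolding YY_def by blast
    obtain l where l: "z = tau N (Suc i) + real l / real (Suc k) * ?g"
      using yz unfolding YY_def by blast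
    have jl: "j \<noteq> l" using yz(3) j l by auto
    have ring: "(t + a / c * g) - (t + b / c * g) = (a - b) * (g / c)" for t a b c g :: real
      by (simp add: left_diff_distrib diff_divide_distrib)
    have "y - z = (real j - real l) * (?g / real (Suc k))" unfolding j l by (rule ring)
    then have "\<bar>y - z\<bar> = \<bar>real j - real l\<bar> * (?g / real (Suc k))" using g by (simp add: abs_mult)
    also have "... \<ge> 1 * (?g / real (Suc k))"
      using jl g by (intro mult_right_mono) (auto simp del: of_nat_Suc)
    finally show ?thesis by simp
  qed
qed

text \<open>The difference of order \<open>k - 1\<close> belonging to a cell. It is antitone in
  \<open>i\<close>, since the nodes are numbered from right to left.\<close>

definition DQ :: "nat \<Rightarrow> nat \<Rightarrow> nat \<Rightarrow> (real \<Rightarrow> real) \<Rightarrow> real" where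
  "DQ N k i f = dd (YY N k i) f"

lemma YY_inside: "i < N \<Longrightarrow> YY N k i \<subseteq> {-1<..<1}"
  using YY_props(3)[where i = i and N = N and k = k] tau_abs_le(1)[of N "Suc i"] tau_abs_le(2)[of N i] by fastforce

lemma dd_le_DQ:
  assumes f: "f \<in> Mset k" and i: "i < N"
    and B: "finite B" "card B = k" "B \<subseteq> {-1<..<1}" "\<And>b. b \<in> B \<Longrightarrow> b \<le> tau N (Suc i)"
  shows "dd B f \<le> DQ N k i f"
  unfolding DQ_def
  by (rule dd_mono[OF f B(1) YY_props(1)[OF i] B(2) YY_props(2)[OF i] B(3) YY_inside[OF i]])
    (use B(4) YY_props(3)[OF i] in fastforce)

lemma DQ_le_dd:
  assumes f: "f \<in> Mset k" and i: "i < N"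
    and B: "finite B" "card B = k" "B \<subseteq> {-1<..<1}" "\<And>b. b \<in> B \<Longrightarrow> tau N i \<le> b"
  shows "DQ N k i f \<le> dd B f"
  unfolding DQ_def
  by (rule dd_mono[OF f YY_props(1)[OF i] B(1) YY_props(2)[OF i] B(2) YY_inside[OF i] B(3)])
    (use B(4) YY_props(3)[OF i] in fastforce)

lemma DQ_antimono:
  assumes f: "f \<in> Mset k" and ij: "i \<le> j" "j < N"
  shows "DQ N k j f \<le> DQ N k i f"
proof (cases "i = j")
  case False
  then have "i < j" using ij by simp
  show ?thesis unfolding DQ_def[of N k j]
  proof (rule dd_le_DQ[OF f])
    fix b assume "b \<in> YY N k j"
    then have "b < tau N j" using YY_props(3) ij by blast
    also have "... \<le> tau N (Suc i)" using \<open>i < j\<close> ij by (intro tau_antimono) auto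
    finally show "b \<le> tau N (Suc i)" by simp
  qed (use ij \<open>i < j\<close> YY_props YY_inside in auto)
qed simp

lemma dist_le_dst:
  assumes i: "1 \<le> i" "i < N" and x: "x \<in> {-1..1}" and z: "z \<in> {-1..1}" "dst N i z \<le> 3"
  shows "\<bar>x - z\<bar> \<le> 10 * pi * hh N i * (dst N i x)\<^sup>2"
proof -
  have h: "hh N i > 0" using hh_pos[OF i] .
  have "(dst N i z)\<^sup>2 \<le> 3\<^sup>2" using z by (intro power_mono) auto
  then have "pi * hh N i * (dst N i z)\<^sup>2 \<le> pi * hh N i * 9" using h by (intro mult_left_mono) auto
  also have "... \<le> 9 * (pi * hh N i * (dst N i x)\<^sup>2)"
  proof -
    have "1 \<le> (dst N i x)\<^sup>2" using dst_ge_1 by (rule one_le_power)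
    then have "pi * hh N i * 1 \<le> pi * hh N i * (dst N i x)\<^sup>2" using h by (intro mult_left_mono) auto
    then show ?thesis by simp
  qed
  finally have "\<bar>z - tau N i\<bar> \<le> 9 * (pi * hh N i * (dst N i x)\<^sup>2)"
    using dist_tau_le[OF i z(1)] by linarith
  then show ?thesis using dist_tau_le[OF i x] by linarith
qed

text \<open>\<open>poly_growth\<close> gives the power \<open>k - 1\<close> of the distance in
  \<open>x\<close>; this distance is quadratic in \<open>dst\<close>, which doubles the
  exponent.\<close>

lemma node_growth:
  fixes p :: "real poly"
  assumes i: "1 \<le> i" "i < N" and Z: "finite Z" "card Z = k" "1 \<le> k" "degree p \<le> k - 1"
    and c: "c > 0" and sep: "\<And>z z'. z \<in> Z \<Longrightarrow> z' \<in> Z \<Longrightarrow> z \<noteq> z' \<Longrightarrow> \<bar>z - z'\<bar> \<ge> hh N i / c"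
    and dZ: "\<And>z. z \<in> Z \<Longrightarrow> z \<in> {-1..1} \<and> dst N i z \<le> 3" and B: "\<And>z. z \<in> Z \<Longrightarrow> \<bar>poly p z\<bar> \<le> B"
    and x: "x \<in> {-1..1}"
  shows "\<bar>poly p x\<bar> \<le> real k * (10 * pi * c) ^ (k - 1) * B * dst N i x ^ (2 * (k - 1))"
proof -
  have h: "hh N i > 0" using hh_pos[OF i] .
  have "\<bar>poly p x\<bar> \<le> real (card Z) * B * ((10 * pi * hh N i * (dst N i x)\<^sup>2) / (hh N i / c)) ^ (card Z - 1)"
    by (rule poly_growth) (use assms h dist_le_dst in auto)
  also have "(10 * pi * hh N i * (dst N i x)\<^sup>2) / (hh N i / c) = 10 * pi * c * (dst N i x)\<^sup>2"
    using h c by simp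
  finally show ?thesis using Z by (simp add: power_mult_distrib power_mult mult_ac)
qed

text \<open>The error is a difference of order \<open>k\<close> times a product of \<open>k\<close>
  distances. One of them is at most the diameter \<open>hi - lo\<close> of the point set and turns
  the difference of order \<open>k\<close> into one between two of order \<open>k - 1\<close>, which
  monotonicity places between the cells \<open>i + 2\<close> and \<open>i - 1\<close>. The other
  distances are bounded by the mesh. Two cells are allowed for \<open>x\<close> so that neighbouring
  interpolants can be compared on a common cell.\<close>

lemma interp_local_error:
  assumes f: "f \<in> Mset k" and k: "1 \<le> k" and i: "1 \<le> i" "i + 3 \<le> N"
    and x: "tau N (i + 2) \<le> x" "x \<le> tau N i"
  shows "\<bar>f x - poly (interp (YY N k i) f) x\<bar> \<le>
    (90 * pi) ^ (k - 1) * (hh N i ^ (k - 1) * (DQ N k (i - 1) f - DQ N k (i + 2) f))"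
proof -
  let ?Y = "YY N k i"
  have iN: "i < N" using i by simp
  note Y = YY_props[OF iN, where k = k]
  have h: "hh N i > 0" using hh_pos[of i N] i by simp
  have D: "DQ N k (i + 2) f \<le> DQ N k (i - 1) f" using i by (intro DQ_antimono f) auto
  have x1: "-1 < x" "x < 1" using x tau_bounds[of "i + 2" N] tau_bounds[of i N] i by auto
  show ?thesis
  proof (cases "x \<in> ?Y")
    case True
    then show ?thesis using poly_interp_node[OF Y(1), of x f] D h by simp
  next
    case False
    define A where "A = insert x ?Y"
    have A: "finite A" "card A = Suc k" unfolding A_def using Y(1,2) False by auto
    have Ain: "A \<subseteq> {-1<..<1}" unfolding A_def using x1 YY_inside[OF iN] by auto
    have Abd: "tau N (i + 2) \<le> a \<and> a \<le> tau N i" if "a \<in> A" for a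
    proof (cases "a = x")
      case False
      then have "a \<in> ?Y" using that unfolding A_def by auto
      then have "tau N (Suc i) < a" "a < tau N i" using Y(3) by auto
      moreover have "tau N (i + 2) < tau N (Suc i)" using i by (intro tau_strict_antimono) auto
      ultimately show ?thesis by linarith
    qed (use x in simp)
    define lo where "lo = Min A" define hi where "hi = Max A"
    have lohi: "lo \<in> A" "hi \<in> A" unfolding lo_def hi_def using A(1) Min_in[of A] Max_in[of A] A_def by blast+
    have bd: "lo \<le> a" "a \<le> hi" if "a \<in> A" for a unfolding lo_def hi_def using A that by auto
    have "lo \<noteq> hi"
    proof
      assume "lo = hi"
      then have "A = {lo}" using bd lohi by force
      then show False using A k by simp
    qed
    then have lh: "lo < hi" using bd lohi by force
    have dA: "dd A f \<ge> 0" by (rule MsetD[OF f A Ain])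
    have "(hi - lo) * dd A f = dd (A - {lo}) f - dd (A - {hi}) f"
      using A lohi lh by (intro dd_rec) auto
    moreover have "dd (A - {lo}) f \<le> DQ N k (i - 1) f"
      using A lohi Ain Abd i by (intro dd_le_DQ[OF f]) auto
    moreover have "dd (A - {hi}) f \<ge> DQ N k (i + 2) f"
      using A lohi Ain Abd i by (intro DQ_le_dd[OF f]) auto
    ultimately have dA2: "(hi - lo) * dd A f \<le> DQ N k (i - 1) f - DQ N k (i + 2) f" by linarith
    have dist: "\<bar>x - y\<bar> \<le> 90 * pi * hh N i" if y: "y \<in> ?Y" for y
    proof -
      have yb: "tau N (Suc i) < y" "y < tau N i" using Y(3)[OF y] by auto
      have "real i \<le> real N * arccos y / pi" "real N * arccos y / pi \<le> real (Suc i)"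
        using nu_tau_bounds[of i "Suc i" N y] yb iN by auto
      then have "dst N i y \<le> 3" unfolding dst_def by auto
      moreover have "real i \<le> real N * arccos x / pi" "real N * arccos x / pi \<le> real (i + 2)"
        using nu_tau_bounds[of i "i + 2" N x] x i by auto
      then have "dst N i x \<le> 3" unfolding dst_def by auto
      then have "(dst N i x)\<^sup>2 \<le> 3\<^sup>2" by (intro power_mono) auto
      ultimately have "\<bar>x - y\<bar> \<le> 10 * pi * hh N i * (dst N i x)\<^sup>2"
        using x1 yb tau_abs_le(1)[of N "Suc i"] tau_abs_le(2)[of N i] i iN by (intro dist_le_dst) auto
      also have "... \<le> 10 * pi * hh N i * 3\<^sup>2"
        using h \<open>(dst N i x)\<^sup>2 \<le> 3\<^sup>2\<close> by (intro mult_left_mono) auto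
      finally show ?thesis by simp
    qed
    have "card ?Y \<noteq> 0" using Y(2) k by simp
    then obtain y0 where y0: "y0 \<in> ?Y" using Y(1) by fastforce
    have "\<bar>\<Prod>y\<in>?Y. x - y\<bar> = \<bar>x - y0\<bar> * (\<Prod>y\<in>?Y - {y0}. \<bar>x - y\<bar>)"
      using Y(1) y0 by (simp add: abs_prod prod.remove abs_mult)
    also have "... \<le> (hi - lo) * (\<Prod>y\<in>?Y - {y0}. 90 * pi * hh N i)"
    proof (intro mult_mono prod_mono prod_nonneg)
      have "x \<in> A" "y0 \<in> A" unfolding A_def using y0 by auto
      then show "\<bar>x - y0\<bar> \<le> hi - lo" using bd[of x] bd[of y0] by linarith
    qed (use dist lh in auto)
    also have "... = (hi - lo) * (90 * pi * hh N i) ^ (k - 1)" using Y(1,2) y0 by simp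
    finally have pr: "\<bar>\<Prod>y\<in>?Y. x - y\<bar> \<le> (hi - lo) * (90 * pi * hh N i) ^ (k - 1)" .
    have "\<bar>f x - poly (interp ?Y f) x\<bar> = dd A f * \<bar>\<Prod>y\<in>?Y. x - y\<bar>"
      unfolding interp_error[OF Y(1) False] A_def[symmetric] using dA by (simp add: abs_mult)
    also have "... \<le> dd A f * ((hi - lo) * (90 * pi * hh N i) ^ (k - 1))"
      using pr dA by (intro mult_left_mono) auto
    also have "... = ((hi - lo) * dd A f) * (90 * pi * hh N i) ^ (k - 1)" by simp
    also have "... \<le> (DQ N k (i - 1) f - DQ N k (i + 2) f) * (90 * pi * hh N i) ^ (k - 1)"
      using dA2 h by (intro mult_right_mono) auto
    finally show ?thesis by (simp add: power_mult_distrib mult_ac)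
  qed
qed

section \<open>Points found by averaging\<close>

lemma emeasure_I11_interval:
  assumes "-1 \<le> u" "u \<le> v" "v \<le> 1"
  shows "emeasure I11 {u..v} = ennreal (v - u)"
  unfolding I11_def using assms by (subst emeasure_restrict_space) auto

lemma space_I11 [simp]: "space I11 = {-1..1}"
  by (simp add: I11_def space_restrict_space)

lemma borel_I11: "f \<in> borel_measurable borel \<Longrightarrow> f \<in> borel_measurable I11"
  unfolding I11_def by (intro measurable_restrict_space1) simp

lemma sets_I11_interval: "-1 \<le> u \<Longrightarrow> v \<le> 1 \<Longrightarrow> {u..v} \<in> sets I11"
  unfolding I11_def sets_restrict_space by (auto intro!: image_eqI[of _ _ "{u..v}"])

text \<open>Otherwise the excess over the average is positive on the open interval although its
  integral vanishes. The endpoints form a null set, so the point can be taken strictly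
  inside.\<close>

lemma exists_le_average:
  fixes G :: "real \<Rightarrow> real"
  assumes uv: "-1 \<le> u" "u < v" "v \<le> 1" and G: "G \<in> borel_measurable I11"
    and J: "(\<integral>\<^sup>+x. ennreal (G x) * indicator {u..v} x \<partial>I11) \<le> ennreal J" "0 \<le> J"
  shows "\<exists>z. u < z \<and> z < v \<and> G z \<le> J / (v - u)"
proof (rule ccontr)
  assume "\<not> ?thesis"
  then have G_gt: "G z > J / (v - u)" if "u < z" "z < v" for z using that by force
  define c where "c = J / (v - u)"
  have c: "c \<ge> 0" unfolding c_def using J uv by simp
  have [measurable]: "G \<in> borel_measurable I11" "{u..v} \<in> sets I11"
    using G sets_I11_interval uv by auto
  have ae: "AE x in I11. x \<noteq> u \<and> x \<noteq> v"
  proof -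
    have "AE x in lborel. x \<noteq> u \<and> x \<noteq> v"
      using AE_lborel_singleton[of u] AE_lborel_singleton[of v] by auto
    then show ?thesis unfolding I11_def by (subst AE_restrict_space_iff) auto
  qed
  have "(\<integral>\<^sup>+x. ennreal (G x - c) * indicator {u..v} x \<partial>I11) + ennreal J \<le> 0 + ennreal J"
  proof -
    have "ennreal J = ennreal c * ennreal (v - u)" unfolding c_def using J uv by (simp flip: ennreal_mult)
    also have "... = (\<integral>\<^sup>+x. ennreal c * indicator {u..v} x \<partial>I11)"
      using uv by (simp add: nn_integral_cmult_indicator emeasure_I11_interval)
    finally have "(\<integral>\<^sup>+x. ennreal (G x - c) * indicator {u..v} x \<partial>I11) + ennreal J =
      (\<integral>\<^sup>+x. ennreal (G x - c) * indicator {u..v} x + ennreal c * indicator {u..v} x \<partial>I11)"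
      by (simp add: nn_integral_add)
    also have "... = (\<integral>\<^sup>+x. ennreal (G x) * indicator {u..v} x \<partial>I11)"
    proof (rule nn_integral_cong_AE, use ae in eventually_elim)
      fix x assume "x \<noteq> u \<and> x \<noteq> v"
      then have "x \<in> {u..v} \<Longrightarrow> G x \<ge> c" using G_gt[of x] unfolding c_def by fastforce
      then show "ennreal (G x - c) * indicator {u..v} x + ennreal c * indicator {u..v} x = ennreal (G x) * indicator {u..v} x"
        using c by (auto split: split_indicator simp flip: ennreal_plus)
    qed
    finally show ?thesis using J by simp
  qed
  then have "(\<integral>\<^sup>+x. ennreal (G x - c) * indicator {u..v} x \<partial>I11) = 0"
    using ennreal_add_left_cancel_le[of "ennreal J" "\<integral>\<^sup>+x. ennreal (G x - c) * indicator {u..v} x \<partial>I11" 0]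
    by (simp add: add.commute)
  then have "AE x in I11. ennreal (G x - c) * indicator {u..v} x = 0"
    by (subst (asm) nn_integral_0_iff_AE) auto
  then have "AE x in I11. x \<notin> {u..v}" using ae
  proof eventually_elim
    fix x assume x: "ennreal (G x - c) * indicator {u..v} x = 0" "x \<noteq> u \<and> x \<noteq> v"
    show "x \<notin> {u..v}"
    proof
      assume "x \<in> {u..v}"
      then have "G x > c" using x G_gt[of x] unfolding c_def by auto
      then show False using x \<open>x \<in> {u..v}\<close> by (auto simp: ennreal_eq_0_iff)
    qed
  qed
  then have "(\<integral>\<^sup>+x. indicator {u..v} x \<partial>I11) = 0"
    by (subst nn_integral_0_iff_AE) (auto elim!: eventually_mono split: split_indicator)
  then have "emeasure I11 {u..v} = 0" by simp
  then show False using uv by (simp add: emeasure_I11_interval ennreal_eq_0_iff)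
qed

text \<open>The interval is cut into \<open>2 * k\<close> slots and every other one supplies a
  point; the slots left out in between guarantee the separation.\<close>

lemma pick_points:
  fixes G :: "real \<Rightarrow> real"
  assumes uv: "-1 \<le> u" "u < v" "v \<le> 1" and G: "G \<in> borel_measurable I11" and k: "1 \<le> k"
    and J: "(\<integral>\<^sup>+x. ennreal (G x) * indicator {u..v} x \<partial>I11) \<le> ennreal J" "0 \<le> J"
  shows "\<exists>Z. finite Z \<and> card Z = k \<and> Z \<subseteq> {u<..<v} \<and> (\<forall>z\<in>Z. G z \<le> 2 * real k / (v - u) * J) \<and>
    (\<forall>z\<in>Z. \<forall>z'\<in>Z. z \<noteq> z' \<longrightarrow> \<bar>z - z'\<bar> \<ge> (v - u) / (2 * real k))"
proof -
  define w where "w = (v - u) / (2 * real k)"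
  have w: "w > 0" unfolding w_def using uv k by simp
  have kw: "2 * real k * w = v - u" unfolding w_def using k by simp
  have "\<exists>z. u + 2 * real l * w < z \<and> z < u + (2 * real l + 1) * w \<and> G z \<le> J / w" if l: "l < k" for l
  proof -
    let ?u = "u + 2 * real l * w" let ?v = "u + (2 * real l + 1) * w"
    have 0: "0 \<le> 2 * real l * w" using w by simp
    have "(2 * real l + 1) * w \<le> 2 * real k * w" using l w by (intro mult_right_mono) auto
    then have vv: "?v \<le> v" using kw by simp
    have d: "?v - ?u = w" by (simp add: algebra_simps)
    have "(\<integral>\<^sup>+x. ennreal (G x) * indicator {?u..?v} x \<partial>I11) \<le> (\<integral>\<^sup>+x. ennreal (G x) * indicator {u..v} x \<partial>I11)"
    proof (rule nn_integral_mono)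
      fix x
      have "u \<le> ?u" using 0 by linarith
      then have "x \<in> {?u..?v} \<Longrightarrow> x \<in> {u..v}" using vv by (meson atLeastAtMost_iff order_trans)
      then show "ennreal (G x) * indicator {?u..?v} x \<le> ennreal (G x) * indicator {u..v} x"
        by (intro mult_left_mono) (auto simp: indicator_def simp del: atLeastAtMost_iff)
    qed
    then show ?thesis
      using exists_le_average[of ?u ?v G J] uv 0 vv w d J G by auto
  qed
  then obtain z where z: "\<And>l. l < k \<Longrightarrow> u + 2 * real l * w < z l \<and> z l < u + (2 * real l + 1) * w \<and> G (z l) \<le> J / w"
    by metis
  have sep: "\<bar>z l - z m\<bar> \<ge> w" if "l < k" "m < k" "l < m" for l m
  proof -
    have "(2 * real l + 2) * w \<le> 2 * real m * w" using that w by (intro mult_right_mono) auto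
    then show ?thesis using z[of l] z[of m] that by (simp add: algebra_simps)
  qed
  then have sep': "\<bar>z l - z m\<bar> \<ge> w" if "l < k" "m < k" "l \<noteq> m" for l m
    using that sep[of l m] sep[of m l] by (cases "l < m") (auto simp: abs_minus_commute)
  have inj: "inj_on z {..<k}"
    using sep' w by (force simp: inj_on_def)
  show ?thesis
  proof (intro exI[of _ "z ` {..<k}"] conjI ballI impI)
    show "card (z ` {..<k}) = k" using inj by (simp add: card_image)
    show "z ` {..<k} \<subseteq> {u<..<v}"
    proof
      fix y assume "y \<in> z ` {..<k}"
      then obtain l where l: "l < k" "y = z l" by auto
      have "0 \<le> 2 * real l * w" using w by simp
      moreover have "(2 * real l + 1) * w \<le> 2 * real k * w" using l w by (intro mult_right_mono) auto
      ultimately have "u < y" "y < v" using z[OF l(1)] l(2) kw by linarith+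
      then show "y \<in> {u<..<v}" by simp
    qed
    fix y assume "y \<in> z ` {..<k}"
    then obtain l where l: "l < k" "y = z l" by auto
    have "J / w = 2 * real k / (v - u) * J" unfolding w_def using k by simp
    then show "G y \<le> 2 * real k / (v - u) * J" using z[OF l(1)] l by simp
    fix y' assume "y' \<in> z ` {..<k}" "y \<noteq> y'"
    then show "\<bar>y - y'\<bar> \<ge> (v - u) / (2 * real k)" using sep' l unfolding w_def[symmetric] by auto
  qed simp
qed

section \<open>Patching the local interpolants\<close>

lemma powr_add2_le:
  fixes x y q :: real
  assumes "0 \<le> q"
  shows "\<bar>x + y\<bar> powr q \<le> 2 powr q * (\<bar>x\<bar> powr q + \<bar>y\<bar> powr q)"
proof -
  have "\<bar>x + y\<bar> powr q \<le> (2 * max \<bar>x\<bar> \<bar>y\<bar>) powr q" using assms by (intro powr_mono2) auto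
  also have "... = 2 powr q * max \<bar>x\<bar> \<bar>y\<bar> powr q" by (simp add: powr_mult)
  also have "max \<bar>x\<bar> \<bar>y\<bar> powr q \<le> \<bar>x\<bar> powr q + \<bar>y\<bar> powr q" by (simp add: max_def)
  finally show ?thesis by simp
qed

lemma powr_add3_le:
  fixes x y z q :: real
  assumes "0 \<le> q" "0 \<le> x" "0 \<le> y" "0 \<le> z"
  shows "(x + y + z) powr q \<le> 3 powr q * (x powr q + y powr q + z powr q)"
proof -
  have "(x + y + z) powr q \<le> (3 * max (max x y) z) powr q" using assms by (intro powr_mono2) auto
  also have "... = 3 powr q * max (max x y) z powr q" by (simp add: powr_mult)
  also have "max (max x y) z powr q \<le> x powr q + y powr q + z powr q"
    by (auto simp: max_def add_increasing2 add_increasing)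
  finally show ?thesis by simp
qed

lemma sum_telescope_down: "i \<le> b \<Longrightarrow> (\<Sum>j\<in>{Suc i..b}. g (j - 1) - g j) = g i - g b"
  for g :: "nat \<Rightarrow> real"
proof (induction b rule: dec_induct)
  case (step b)
  then show ?case by simp
qed simp

text \<open>The step at \<open>tau N j\<close> is switched on at \<open>x\<close> exactly when
  \<open>j > i\<close>, so the jumps from \<open>b\<close> to \<open>i\<close> telescope. The
  disjunctions let the first and the last piece extend beyond their cells, up to the
  endpoints.\<close>

lemma piecewise_telescope:
  fixes p :: "nat \<Rightarrow> real"
  assumes i: "a \<le> i" "i \<le> b" "b \<le> N" and x: "i = a \<or> x < tau N i" "i = b \<or> x \<ge> tau N (Suc i)"
  shows "p b + (\<Sum>j\<in>{Suc a..b}. (p (j - 1) - p j) * of_bool (x \<ge> tau N j)) = p i"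
proof -
  have "(\<Sum>j\<in>{Suc a..b}. (p (j - 1) - p j) * of_bool (x \<ge> tau N j)) =
    (\<Sum>j\<in>{Suc a..b}. if Suc i \<le> j then p (j - 1) - p j else 0)"
  proof (rule sum.cong[OF refl])
    fix j assume j: "j \<in> {Suc a..b}"
    have "x \<ge> tau N j \<longleftrightarrow> Suc i \<le> j"
    proof
      assume 1: "Suc i \<le> j"
      then have "x \<ge> tau N (Suc i)" using x j by auto
      moreover have "tau N j \<le> tau N (Suc i)" using 1 j i by (intro tau_antimono) auto
      ultimately show "x \<ge> tau N j" by linarith
    next
      assume 1: "x \<ge> tau N j"
      show "Suc i \<le> j"
      proof (rule ccontr)
        assume "\<not> Suc i \<le> j"
        then have "x < tau N i" "tau N i \<le> tau N j" using x j i by (auto intro!: tau_antimono)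
        then show False using 1 by linarith
      qed
    qed
    then show "(p (j - 1) - p j) * of_bool (x \<ge> tau N j) = (if Suc i \<le> j then p (j - 1) - p j else 0)" by simp
  qed
  also have "... = (\<Sum>j\<in>{Suc i..b}. p (j - 1) - p j)"
    using i by (intro sum.mono_neutral_cong_right) auto
  also have "... = p i - p b" using i by (intro sum_telescope_down) auto
  finally show ?thesis by simp
qed

lemma piece_exists:
  assumes ab: "a \<le> b" "Suc b \<le> N"
  obtains i where "a \<le> i" "i \<le> b" "i = a \<or> x < tau N i" "i = b \<or> x \<ge> tau N (Suc i)"
    "x \<ge> tau N a \<Longrightarrow> i = a" "x < tau N (Suc b) \<Longrightarrow> i = b"
    "tau N (Suc b) \<le> x \<Longrightarrow> x < tau N a \<Longrightarrow> tau N (Suc i) \<le> x \<and> x < tau N i"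
proof -
  consider "x \<ge> tau N a" | "x < tau N (Suc b)" | "tau N (Suc b) \<le> x" "x < tau N a" by linarith
  then show ?thesis
  proof cases
    case 1
    moreover have "tau N (Suc a) \<le> tau N a" "tau N (Suc b) \<le> tau N a" using ab by (auto intro!: tau_antimono)
    ultimately show ?thesis by (intro that[of a]) (use ab in auto)
  next
    case 2
    moreover have "tau N (Suc b) \<le> tau N b" "tau N b \<le> tau N a" using ab by (auto intro!: tau_antimono)
    ultimately show ?thesis by (intro that[of b]) (use ab in auto)
  next
    case 3
    define j where "j = (LEAST j. tau N j \<le> x)"
    have j1: "tau N j \<le> x" unfolding j_def using 3(1) by (rule LeastI)
    have j2: "j \<le> Suc b" unfolding j_def using 3(1) by (rule Least_le)
    have j3: "a < j"
    proof (rule ccontr)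
      assume "\<not> a < j"
      then have "tau N a \<le> tau N j" using ab by (intro tau_antimono) auto
      then show False using j1 3 by linarith
    qed
    have "x < tau N (j - 1)" using not_less_Least[of "j - 1" "\<lambda>j. tau N j \<le> x"] j3 unfolding j_def[symmetric] by simp
    then show ?thesis using 3 j1 j2 j3 by (intro that[of "j - 1"]) auto
  qed
qed

lemma jw_measurable [measurable]: "jw \<alpha> \<beta> \<in> borel_measurable borel"
  unfolding jw_def by measurable

lemma poly_measurable [measurable]: "poly (P :: real poly) \<in> borel_measurable borel"
  by (intro borel_measurable_continuous_onI continuous_intros)

text \<open>There are three sources of error: interpolation within a cell; the replacement of each
  step by a polynomial, which multiplies the jump between neighbouring interpolants by a decaying
  factor; and the end zones, where \<open>f\<close> itself is counted and only the extrapolated end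
  pieces must be bounded. The end pieces belong to the cells 20 and N - 21, which lie in the zone of
  the last integral, so that they are controlled by that integral too.\<close>

lemma local_approx:
  fixes k :: nat and q \<alpha> \<beta> :: real
  assumes k: "1 \<le> k" and q: "1 \<le> q" and ab: "0 \<le> \<alpha>" "0 \<le> \<beta>"
  shows "\<exists>C>0. \<exists>R. \<forall>N\<ge>64. \<forall>f\<in>Mset k. (\<lambda>x. jw \<alpha> \<beta> x * f x) \<in> borel_measurable I11 \<longrightarrow>
    (\<integral>\<^sup>+x. ennreal (\<bar>jw \<alpha> \<beta> x * f x\<bar> powr q) \<partial>I11) < \<infinity> \<longrightarrow>
    (\<exists>P. degree P \<le> R * N \<and>
      werr \<alpha> \<beta> q f P \<le>
      ennreal (C * (\<Sum>i\<in>{20..N - 21}. (hh N i ^ (k - 1) * (DQ N k (i - 1) f - DQ N k (i + 2) f) * jw \<alpha> \<beta> (tau N i)) powr q * hh N i)) +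
      ennreal C * (\<integral>\<^sup>+x. ennreal (\<bar>jw \<alpha> \<beta> x * f x\<bar> powr q) * indicator {x. x \<ge> tau N 21 \<or> x \<le> tau N (N - 21)} x \<partial>I11))"
proof -
  \<comment> \<open>The decay 2 s' is what must be left for
    \<open>nn_integral_lattice\<close>.\<close>
  define s' where "s' = nat \<lceil>\<alpha> + \<beta> + 3\<rceil>"
  have s': "2 * (\<alpha> + \<beta>) + 6 \<le> real (2 * s')"
  proof -
    have "\<alpha> + \<beta> + 3 \<le> real s'" unfolding s'_def by linarith
    then show ?thesis by simp
  qed
  \<comment> \<open>The step polynomials decay with the power 2 r: of this 2 (k - 1) compensates for
    the growth of the jumps and 2 s' remains.\<close>
  define r where "r = k - 1 + s'"
  obtain Cs where Cs: "Cs > 0" "\<And>N i. N \<ge> 1 \<Longrightarrow> i \<le> N \<Longrightarrow> \<exists>Q. degree Q \<le> Suc r * N \<and>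
    (\<forall>x\<in>{-1..1}. \<bar>of_bool (x \<ge> tau N i) - poly Q x\<bar> \<le> Cs / dst N i x ^ (2 * r))"
    using step_poly[of r] by blast
  define c where "c = 4 * (real k + 1)"
  have c: "c > 0" unfolding c_def by simp
  define Kg where "Kg = real k * (10 * pi * c) ^ (k - 1)"
  have Kg: "Kg \<ge> 0" unfolding Kg_def using c by simp
  define Ke where "Ke = (90 * pi) ^ (k - 1)"
  have Ke: "Ke > 0" unfolding Ke_def by simp
  define Kb where "Kb = Kg * Cs + 2 ^ (2 * s') + Kg * 22 ^ (2 * r)"
  have Kb: "Kb \<ge> 0" unfolding Kb_def using Kg Cs by (simp add: add_nonneg_nonneg)
  define K4 where "K4 = (4 powr (\<alpha> + \<beta>) * 2 powr (2 * (\<alpha> + \<beta>))) powr q * 4"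
  have K4: "K4 \<ge> 0" unfolding K4_def by simp
  define K5 where "K5 = (400 powr (\<alpha> + \<beta>)) powr q * (4 * real k)"
  have K5: "K5 \<ge> 0" unfolding K5_def by simp
  define K6 where "K6 = (4 * 4 powr (\<alpha> + \<beta>)) powr q * 8 * pi"
  have K6: "K6 \<ge> 0" unfolding K6_def by simp
  define C where "C = 2 powr q * (1 + K6 * Kb powr q * 3 powr q * (Ke powr q * (1 + K4) + 2 * K5))"
  have C: "C > 0" unfolding C_def
    using K6 K4 K5 by (intro mult_pos_pos add_pos_nonneg mult_nonneg_nonneg add_nonneg_nonneg) auto
  have "\<exists>P. degree P \<le> (k + Suc r) * N \<and>
      werr \<alpha> \<beta> q f P \<le>
      ennreal (C * (\<Sum>i\<in>{20..N - 21}. (hh N i ^ (k - 1) * (DQ N k (i - 1) f - DQ N k (i + 2) f) * jw \<alpha> \<beta> (tau N i)) powr q * hh N i)) +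
      ennreal C * (\<integral>\<^sup>+x. ennreal (\<bar>jw \<alpha> \<beta> x * f x\<bar> powr q) * indicator {x. x \<ge> tau N 21 \<or> x \<le> tau N (N - 21)} x \<partial>I11)"
    if N: "N \<ge> 64" and f: "f \<in> Mset k" and mf: "wmeas \<alpha> \<beta> f"
      and fin: "(\<integral>\<^sup>+x. ennreal (\<bar>jw \<alpha> \<beta> x * f x\<bar> powr q) \<partial>I11) < \<infinity>" for N f
  proof -
    define w where "w i = jw \<alpha> \<beta> (tau N i)" for i
    define b where "b = N - 21"
    have b: "20 < b" "Suc b < N" "b + 3 \<le> N" "real N - real b = 21" unfolding b_def using N by (auto simp: of_nat_diff)
    define e where "e i = Ke * (hh N i ^ (k - 1) * (DQ N k (i - 1) f - DQ N k (i + 2) f))" for i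
    define p where "p i = interp (YY N k i) f" for i
    let ?A = "{20..b}"
    have hp: "hh N i > 0" and wp: "w i > 0" if "i \<in> ?A" for i
      using that b tau_bounds[of i N] by (auto simp: w_def intro!: hh_pos jw_pos)
    have e0: "e i \<ge> 0" if "i \<in> ?A" for i
      unfolding e_def using Ke hp[OF that] that b by (auto intro!: mult_nonneg_nonneg DQ_antimono f)
    have e1: "e (i - 1) \<ge> 0" if "20 < i" "i \<le> b" for i using that by (intro e0) auto
    have err: "\<bar>f x - poly (p i) x\<bar> \<le> e i" if "i \<in> ?A" "tau N (i + 2) \<le> x" "x \<le> tau N i" for i x
      unfolding p_def e_def Ke_def using that b by (intro interp_local_error f k) auto
    have degp: "degree (p i) \<le> k - 1" if "i \<in> ?A" for i
      unfolding p_def using degree_interp[of "YY N k i" f] YY_props[of i N, where k = k] that b by auto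
    have gap: "tau N i - tau N (Suc i) \<ge> hh N i / 2" if "i \<in> ?A" for i
      using that b by (intro tau_gap) auto
    have jump: "\<bar>poly (p (i - 1)) x - poly (p i) x\<bar> \<le> Kg * e (i - 1) * dst N i x ^ (2 * (k - 1))"
      if i: "i \<in> {21..b}" and x: "x \<in> {-1..1}" for i x
    proof -
      have iN: "1 \<le> i" "i < N" "i \<in> ?A" "i - 1 \<in> ?A" using i b by auto
      note Y = YY_props[OF iN(2), where k = k]
      have "\<bar>poly (p (i - 1) - p i) x\<bar> \<le> real k * (10 * pi * c) ^ (k - 1) * e (i - 1) * dst N i x ^ (2 * (k - 1))"
      proof (rule node_growth[OF iN(1,2) Y(1,2) k _ c])
        show "degree (p (i - 1) - p i) \<le> k - 1" using degp iN by (intro degree_diff_le) auto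
        fix y z assume yz: "y \<in> YY N k i" "z \<in> YY N k i" "y \<noteq> z"
        have "hh N i / c \<le> hh N i / 2 / real (Suc k)"
          using hp[OF iN(3)] unfolding c_def by (simp add: field_simps)
        also have "... \<le> (tau N i - tau N (Suc i)) / real (Suc k)" using gap[OF iN(3)] by (intro divide_right_mono) auto
        also have "... \<le> \<bar>y - z\<bar>" using Y(4)[OF yz] .
        finally show "hh N i / c \<le> \<bar>y - z\<bar>" .
      next
        fix z assume z: "z \<in> YY N k i"
        have zb: "tau N (Suc i) < z" "z < tau N i" using Y(3)[OF z] by auto
        have "real i \<le> real N * arccos z / pi" "real N * arccos z / pi \<le> real (Suc i)"
          using nu_tau_bounds[of i "Suc i" N z] zb iN by auto
        then have "dst N i z \<le> 3" unfolding dst_def by auto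
        then show "z \<in> {-1..1} \<and> dst N i z \<le> 3" using zb tau_abs_le(1)[of N "Suc i"] tau_abs_le(2)[of N i] by auto
        have "tau N i \<le> tau N (i - 1)" using iN by (intro tau_antimono) auto
        moreover have "i - 1 + 2 = Suc i" using iN by simp
        ultimately have "\<bar>f z - poly (p (i - 1)) z\<bar> \<le> e (i - 1)" using zb iN by (intro err) auto
        moreover have "poly (p i) z = f z" unfolding p_def using z Y(1) by (intro poly_interp_node)
        ultimately show "\<bar>poly (p (i - 1) - p i) z\<bar> \<le> e (i - 1)" by simp
      qed (use x in auto)
      then show ?thesis unfolding Kg_def by simp
    qed
    define G where "G x = \<bar>jw \<alpha> \<beta> x * f x\<bar> powr q" for x
    have mG [measurable]: "G \<in> borel_measurable I11" unfolding G_def using mf by measurable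
    let ?E = "{x. x \<ge> tau N 21 \<or> x \<le> tau N (N - 21)}"
    define T where "T = enn2real (\<integral>\<^sup>+x. ennreal (G x) * indicator ?E x \<partial>I11)"
    have "(\<integral>\<^sup>+x. ennreal (G x) * indicator ?E x \<partial>I11) \<le> (\<integral>\<^sup>+x. ennreal (G x) \<partial>I11)"
      by (intro nn_integral_mono) (auto split: split_indicator)
    then have Tf: "(\<integral>\<^sup>+x. ennreal (G x) * indicator ?E x \<partial>I11) < top" using fin unfolding G_def by (simp add: top_unique less_top) 
    then have T: "(\<integral>\<^sup>+x. ennreal (G x) * indicator ?E x \<partial>I11) = ennreal T" unfolding T_def by simp
    have T0: "T \<ge> 0" unfolding T_def by simp
    \<comment> \<open>A bound for the size of \<open>f\<close> at well chosen points of the cell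
      \<open>m\<close>: the average of the \<open>q\<close>-th power of the weighted function over
      the cell, with the weight moved to the node by \<open>jw_tau_le\<close>.\<close>
    define F where "F m = 400 powr (\<alpha> + \<beta>) / w m * (2 * real k / (tau N m - tau N (Suc m)) * T) powr (1 / q)" for m
    have F0: "F m \<ge> 0" if "m \<in> ?A" for m unfolding F_def using wp[OF that] by simp
    have endp: "\<bar>poly (p m) x\<bar> \<le> Kg * (F m + e m) * dst N m x ^ (2 * (k - 1))"
      if m: "m = 20 \<or> m = b" and x: "x \<in> {-1..1}" for m x
    proof -
      have mA: "m \<in> ?A" "1 \<le> m" "m < N" using m b by auto
      let ?u = "tau N (Suc m)" and ?v = "tau N m"
      have uv: "?u < ?v" using mA by (intro tau_strict_antimono) auto
      have "(\<integral>\<^sup>+x. ennreal (G x) * indicator {?u..?v} x \<partial>I11) \<le> (\<integral>\<^sup>+x. ennreal (G x) * indicator ?E x \<partial>I11)"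
      proof (rule nn_integral_mono)
        fix x
        have "x \<in> {?u..?v} \<Longrightarrow> x \<in> ?E" using m unfolding b_def by auto
        then show "ennreal (G x) * indicator {?u..?v} x \<le> ennreal (G x) * indicator ?E x"
          by (intro mult_left_mono) (auto simp: indicator_def simp del: atLeastAtMost_iff mem_Collect_eq)
      qed
      then obtain Z where Z: "finite Z" "card Z = k" "Z \<subseteq> {?u<..<?v}"
        "\<And>z. z \<in> Z \<Longrightarrow> G z \<le> 2 * real k / (?v - ?u) * T"
        "\<And>z z'. z \<in> Z \<Longrightarrow> z' \<in> Z \<Longrightarrow> z \<noteq> z' \<Longrightarrow> \<bar>z - z'\<bar> \<ge> (?v - ?u) / (2 * real k)"
        using pick_points[OF _ uv _ mG k, of T] tau_abs_le T T0 by auto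
      have "\<bar>poly (p m) x\<bar> \<le> real k * (10 * pi * c) ^ (k - 1) * (F m + e m) * dst N m x ^ (2 * (k - 1))"
      proof (rule node_growth[OF mA(2,3) Z(1,2) k degp[OF mA(1)] c])
        fix y z assume yz: "y \<in> Z" "z \<in> Z" "y \<noteq> z"
        have "hh N m / c \<le> hh N m / 2 / (2 * real k)"
          using hp[OF mA(1)] k unfolding c_def by (simp add: field_simps)
        also have "... \<le> (?v - ?u) / (2 * real k)" using gap[OF mA(1)] by (intro divide_right_mono) auto
        also have "... \<le> \<bar>y - z\<bar>" using Z(5)[OF yz] .
        finally show "hh N m / c \<le> \<bar>y - z\<bar>" .
      next
        fix z assume z: "z \<in> Z"
        have zb: "?u < z" "z < ?v" using Z(3) z by auto
        have nu: "real m \<le> real N * arccos z / pi" "real N * arccos z / pi \<le> real (Suc m)"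
          using nu_tau_bounds[of m "Suc m" N z] zb mA by auto
        then have d3: "dst N m z \<le> 3" unfolding dst_def by auto
        have z1: "-1 < z" "z < 1" using zb tau_abs_le(1)[of N "Suc m"] tau_abs_le(2)[of N m] by auto
        then show "z \<in> {-1..1} \<and> dst N m z \<le> 3" using d3 by auto
        have wz: "w m \<le> 400 powr (\<alpha> + \<beta>) * jw \<alpha> \<beta> z" unfolding w_def
        proof (rule jw_tau_le[OF mA(2,3) _ ab])
          have "real (Suc m) \<le> real N - 1" using mA b m by auto
          then show "real N * arccos z / pi \<le> real N - 1 / 4" using nu by linarith
          show "1 / 4 \<le> real N * arccos z / pi" using nu mA by linarith
        qed (use z1 d3 in auto)
        have jz: "jw \<alpha> \<beta> z > 0" using z1 by (intro jw_pos)
        have "jw \<alpha> \<beta> z * \<bar>f z\<bar> = (G z) powr (1 / q)"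
          unfolding G_def using q jz by (simp add: powr_powr abs_mult)
        also have "... \<le> (2 * real k / (?v - ?u) * T) powr (1 / q)"
          using q by (intro powr_mono2 Z(4) z) (auto simp: G_def)
        finally have g1: "jw \<alpha> \<beta> z * \<bar>f z\<bar> \<le> (2 * real k / (?v - ?u) * T) powr (1 / q)" .
        have "w m * \<bar>f z\<bar> \<le> 400 powr (\<alpha> + \<beta>) * (jw \<alpha> \<beta> z * \<bar>f z\<bar>)"
          using wz mult_right_mono[OF wz, of "\<bar>f z\<bar>"] by (simp add: mult_ac)
        also have "... \<le> 400 powr (\<alpha> + \<beta>) * (2 * real k / (?v - ?u) * T) powr (1 / q)"
          using g1 by (intro mult_left_mono) auto
        finally have "\<bar>f z\<bar> \<le> F m" unfolding F_def using wp[OF mA(1)] by (simp add: field_simps)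
        moreover have "\<bar>f z - poly (p m) z\<bar> \<le> e m"
        proof (rule err[OF mA(1)])
          have "tau N (m + 2) \<le> tau N (Suc m)" using mA b m by (intro tau_antimono) auto
          then show "tau N (m + 2) \<le> z" using zb by simp
        qed (use zb in auto)
        ultimately show "\<bar>poly (p m) z\<bar> \<le> F m + e m" by linarith
      qed (use x in auto)
      then show ?thesis unfolding Kg_def by simp
    qed
    have "\<exists>Q. \<forall>i\<le>N. degree (Q i) \<le> Suc r * N \<and>
      (\<forall>x\<in>{-1..1}. \<bar>of_bool (x \<ge> tau N i) - poly (Q i) x\<bar> \<le> Cs / dst N i x ^ (2 * r))"
      using Cs(2)[of N] N by (intro choice) (auto simp del: mult_Suc)
    then obtain Q where Q: "\<And>i. i \<le> N \<Longrightarrow> degree (Q i) \<le> Suc r * N"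
      "\<And>i x. i \<le> N \<Longrightarrow> x \<in> {-1..1} \<Longrightarrow> \<bar>of_bool (x \<ge> tau N i) - poly (Q i) x\<bar> \<le> Cs / dst N i x ^ (2 * r)"
      by blast
    define P where "P = p b + (\<Sum>i\<in>{21..b}. (p (i - 1) - p i) * Q i)"
    have degP: "degree P \<le> (k + Suc r) * N"
    proof -
      have kN: "k - 1 + Suc r * N \<le> (k + Suc r) * N"
      proof -
        have "k - 1 \<le> k * N" using N by (cases N) auto
        then show ?thesis by (simp add: algebra_simps)
      qed
      have "degree (\<Sum>i\<in>{21..b}. (p (i - 1) - p i) * Q i) \<le> k - 1 + Suc r * N"
      proof (rule degree_sum_le)
        fix i assume i: "i \<in> {21..b}"
        have iA: "i \<in> ?A" "i - 1 \<in> ?A" using i by auto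
        have "degree (p (i - 1) - p i) \<le> k - 1" using degp[OF iA(1)] degp[OF iA(2)] by (rule degree_diff_le[rotated])
        moreover have "degree (Q i) \<le> Suc r * N" using i b by (intro Q(1)) auto
        ultimately show "degree ((p (i - 1) - p i) * Q i) \<le> k - 1 + Suc r * N"
          by (intro order_trans[OF degree_mult_le add_mono])
      qed simp
      moreover have "degree (p b) \<le> k - 1 + Suc r * N" using degp[of b] b by simp
      ultimately have "degree P \<le> k - 1 + Suc r * N" unfolding P_def by (intro degree_add_le)
      with kN show ?thesis by linarith
    qed
    \<comment> \<open>The piecewise interpolant itself: the same sum as \<open>P\<close>, with exact
      steps.\<close>
    define S where "S x = poly (p b) x + (\<Sum>j\<in>{21..b}. (poly (p (j - 1)) x - poly (p j) x) * of_bool (x \<ge> tau N j))" for x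
    define X where "X i x = Kg * Cs * (if 20 < i then e (i - 1) else 0) / dst N i x ^ (2 * s')" for i x
    have SP: "\<bar>S x - poly P x\<bar> \<le> (\<Sum>i\<in>?A. X i x)" if x: "x \<in> {-1..1}" for x
    proof -
      have "S x - poly P x = (\<Sum>j\<in>{21..b}. (poly (p (j - 1)) x - poly (p j) x) * (of_bool (x \<ge> tau N j) - poly (Q j) x))"
        unfolding S_def P_def by (simp add: poly_sum sum_subtractf right_diff_distrib)
      also have "\<bar>\<dots>\<bar> \<le> (\<Sum>j\<in>{21..b}. \<bar>(poly (p (j - 1)) x - poly (p j) x) * (of_bool (x \<ge> tau N j) - poly (Q j) x)\<bar>)"
        by (rule sum_abs)
      also have "... \<le> (\<Sum>j\<in>{21..b}. X j x)"
      proof (rule sum_mono)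
        fix j assume j: "j \<in> {21..b}"
        let ?d = "dst N j x"
        have "\<bar>(poly (p (j - 1)) x - poly (p j) x) * (of_bool (x \<ge> tau N j) - poly (Q j) x)\<bar> \<le>
          (Kg * e (j - 1) * ?d ^ (2 * (k - 1))) * (Cs / ?d ^ (2 * r))"
          unfolding abs_mult using j b jump[OF j x] Q(2)[of j x] x Kg e0[of "j - 1"]
          by (intro mult_mono) (auto intro!: mult_nonneg_nonneg)
        also have "... = Kg * Cs * e (j - 1) * (?d ^ (2 * (k - 1)) / ?d ^ (2 * r))" by simp
        also have "?d ^ (2 * (k - 1)) / ?d ^ (2 * r) = 1 / ?d ^ (2 * s')"
        proof -
          have "?d ^ (2 * r) = ?d ^ (2 * (k - 1)) * ?d ^ (2 * s')" unfolding r_def by (simp add: power_add distrib_left)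
          then show ?thesis by simp
        qed
        finally show "\<bar>(poly (p (j - 1)) x - poly (p j) x) * (of_bool (x \<ge> tau N j) - poly (Q j) x)\<bar> \<le> X j x"
          unfolding X_def using j by simp
      qed
      also have "... \<le> (\<Sum>i\<in>?A. X i x)"
        unfolding X_def using Kg Cs e0 by (intro sum_mono2) (auto intro!: divide_nonneg_nonneg mult_nonneg_nonneg)
      finally show ?thesis .
    qed
    \<comment> \<open>The coefficient of node \<open>i\<close> in the final bound: the oscillation
      of its own cell, that of the right neighbour responsible for the jump at the node, and for the
      two end cells the size of \<open>f\<close>.\<close>
    define bb where "bb i = Kb * (e i + (if 20 < i then e (i - 1) else 0) + (if i = 20 \<or> i = b then F i else 0))" for i
    have bb0: "bb i \<ge> 0" if "i \<in> ?A" for i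
      unfolding bb_def using Kb e0 F0 e1 that by (intro mult_nonneg_nonneg add_nonneg_nonneg) auto
    define E' where "E' x \<longleftrightarrow> x \<ge> tau N 20 \<or> x < tau N (Suc b)" for x
    \<comment> \<open>On the end zones \<open>f\<close> is taken out of the error; it returns at the
      end through its own integral, so that here only the polynomial has to be bounded.\<close>
    define Ft where "Ft x = f x - poly P x - (if E' x then f x else 0)" for x
    define Y where "Y i x = (2 ^ (2 * s') + Kg * 22 ^ (2 * r)) * (e i + (if i = 20 \<or> i = b then F i else 0)) / dst N i x ^ (2 * s')" for i x
    have Y0: "Y i x \<ge> 0" if "i \<in> ?A" for i x
      unfolding Y_def using Kg e0 F0 that by (intro divide_nonneg_nonneg mult_nonneg_nonneg add_nonneg_nonneg) auto
    have Ft_le: "\<bar>Ft x\<bar> \<le> (\<Sum>i\<in>?A. bb i / dst N i x ^ (2 * s'))" if x: "x \<in> {-1<..<1}" for x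
    proof -
      obtain i where i: "20 \<le> i" "i \<le> b" "i = 20 \<or> x < tau N i" "i = b \<or> x \<ge> tau N (Suc i)"
        "x \<ge> tau N 20 \<Longrightarrow> i = 20" "x < tau N (Suc b) \<Longrightarrow> i = b"
        "tau N (Suc b) \<le> x \<Longrightarrow> x < tau N 20 \<Longrightarrow> tau N (Suc i) \<le> x \<and> x < tau N i"
        using piece_exists[of 20 b N x] b by auto
      have iA: "i \<in> ?A" "1 \<le> i" "i < N" using i b by auto
      have Sx: "S x = poly (p i) x"
        unfolding S_def using piecewise_telescope[of 20 i b N x "\<lambda>i. poly (p i) x"] i b by simp
      let ?d = "dst N i x"
      have "\<bar>Ft x - (S x - poly P x)\<bar> \<le> Y i x"
      proof (cases "E' x")
        case True
        then have i2: "i = 20 \<or> i = b" unfolding E'_def using i by auto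
        have nux: "0 \<le> real N * arccos x / pi" "real N * arccos x / pi \<le> real N"
          using x arccos_lbound[of x] arccos_ubound[of x] N by (auto simp: field_simps)
        \<comment> \<open>On an end zone \<open>x\<close> is at most 21 spacings away from the node
          of its end piece, hence extrapolation costs only a constant there.\<close>
        have d22: "?d \<le> 22"
        proof (cases "x \<ge> tau N 20")
          case True
          then have "real N * arccos x / pi \<le> real 20"
            using nu_tau_bounds(2)[of 0 20 N x] x b by (auto simp: tau_def)
          then show ?thesis using nux i(5)[OF True] unfolding dst_def by auto
        next
          case False
          then have xb: "x < tau N (Suc b)" using \<open>E' x\<close> unfolding E'_def by auto
          then have "real (Suc b) \<le> real N * arccos x / pi"
            using nu_tau_bounds(1)[of "Suc b" N N x] x b by (auto simp: tau_def)
          then show ?thesis using nux i(6)[OF xb] b(4) unfolding dst_def by auto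
        qed
        have "\<bar>Ft x - (S x - poly P x)\<bar> = \<bar>poly (p i) x\<bar>" unfolding Ft_def Sx using True by simp
        also have "... \<le> Kg * (F i + e i) * ?d ^ (2 * (k - 1))" using x by (intro endp i2) auto
        also have "?d ^ (2 * (k - 1)) = ?d ^ (2 * r) / ?d ^ (2 * s')"
        proof -
          have "?d ^ (2 * r) = ?d ^ (2 * (k - 1)) * ?d ^ (2 * s')" unfolding r_def by (simp add: power_add distrib_left)
          then show ?thesis by simp
        qed
        also have "Kg * (F i + e i) * \<dots> \<le> Kg * (F i + e i) * (22 ^ (2 * r) / ?d ^ (2 * s'))"
          using Kg F0[OF iA(1)] e0[OF iA(1)] d22
          by (intro mult_left_mono divide_right_mono power_mono) auto
        also have "... = (Kg * 22 ^ (2 * r)) * (e i + F i) / ?d ^ (2 * s')" by simp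
        also have "... \<le> (2 ^ (2 * s') + Kg * 22 ^ (2 * r)) * (e i + F i) / ?d ^ (2 * s')"
          using F0[OF iA(1)] e0[OF iA(1)] by (intro divide_right_mono mult_right_mono) auto
        also have "... = Y i x" unfolding Y_def using i2 by simp
        finally show ?thesis .
      next
        case False
        then have xi: "tau N (Suc i) \<le> x" "x < tau N i" using i(7) unfolding E'_def by auto
        have "real i \<le> real N * arccos x / pi" "real N * arccos x / pi \<le> real (Suc i)"
          using nu_tau_bounds[of i "Suc i" N x] xi iA by auto
        then have d2: "?d \<le> 2" unfolding dst_def by auto
        have "tau N (i + 2) \<le> tau N (Suc i)" using i b by (intro tau_antimono) auto
        then have "\<bar>f x - poly (p i) x\<bar> \<le> e i" using xi by (intro err iA(1)) auto
        moreover have "Ft x - (S x - poly P x) = f x - poly (p i) x" unfolding Ft_def Sx using False by simp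
        ultimately have "\<bar>Ft x - (S x - poly P x)\<bar> \<le> e i" by simp
        also have "e i \<le> e i * (2 ^ (2 * s') / ?d ^ (2 * s'))"
        proof -
          have "?d ^ (2 * s') \<le> 2 ^ (2 * s')" using d2 by (intro power_mono) auto
          then have "1 \<le> 2 ^ (2 * s') / ?d ^ (2 * s')" by simp
          from mult_left_mono[OF this e0[OF iA(1)]] show ?thesis by (simp only: mult_1_right)
        qed
        also have "... = 2 ^ (2 * s') * e i / ?d ^ (2 * s')" by simp
        also have "... \<le> Y i x"
          unfolding Y_def using Kg F0[OF iA(1)] e0[OF iA(1)] by (intro divide_right_mono mult_mono) auto
        finally show ?thesis .
      qed
      then have "\<bar>Ft x\<bar> \<le> (\<Sum>i\<in>?A. X i x) + Y i x" using SP[of x] x by auto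
      also have "Y i x \<le> (\<Sum>i\<in>?A. Y i x)" using iA Y0 by (intro member_le_sum) auto
      also have "(\<Sum>i\<in>?A. X i x) + (\<Sum>i\<in>?A. Y i x) = (\<Sum>i\<in>?A. X i x + Y i x)" by (simp add: sum.distrib)
      also have "... \<le> (\<Sum>i\<in>?A. bb i / dst N i x ^ (2 * s'))"
      proof (rule sum_mono)
        fix i assume i: "i \<in> ?A"
        define u where "u = (if 20 < i then e (i - 1) else 0)"
        define v where "v = (if i = 20 \<or> i = b then F i else 0)"
        have uv: "0 \<le> u" "0 \<le> v" "0 \<le> e i" unfolding u_def v_def using i e0 F0 e1 by auto
        have "X i x + Y i x = (Kg * Cs * u + (2 ^ (2 * s') + Kg * 22 ^ (2 * r)) * (e i + v)) / dst N i x ^ (2 * s')"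
          unfolding X_def Y_def u_def v_def by (simp add: add_divide_distrib)
        also have "... \<le> (Kb * (e i + u + v)) / dst N i x ^ (2 * s')"
        proof (rule divide_right_mono)
          have "0 \<le> Kg * Cs * (e i + v) + (2 ^ (2 * s') + Kg * 22 ^ (2 * r)) * u"
            using uv Kg Cs by (intro add_nonneg_nonneg mult_nonneg_nonneg) auto
          then show "Kg * Cs * u + (2 ^ (2 * s') + Kg * 22 ^ (2 * r)) * (e i + v) \<le> Kb * (e i + u + v)"
            unfolding Kb_def by (simp add: algebra_simps)
        qed simp
        finally show "X i x + Y i x \<le> bb i / dst N i x ^ (2 * s')" unfolding bb_def u_def v_def .
      qed
      finally show ?thesis by simp
    qed
    have I1: "(\<integral>\<^sup>+x. ennreal (\<bar>jw \<alpha> \<beta> x * Ft x\<bar> powr q) \<partial>I11) \<le> ennreal (K6 * (\<Sum>i\<in>?A. (bb i * w i) powr q * hh N i))"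
      unfolding K6_def w_def using b by (intro nn_integral_lattice[OF q ab s'] Ft_le bb0) auto
    define \<Sigma> where "\<Sigma> = (\<Sum>i\<in>?A. (hh N i ^ (k - 1) * (DQ N k (i - 1) f - DQ N k (i + 2) f) * w i) powr q * hh N i)"
    have \<Sigma>0: "\<Sigma> \<ge> 0" unfolding \<Sigma>_def using hp by (intro sum_nonneg mult_nonneg_nonneg) (auto intro: less_imp_le)
    have \<Sigma>e: "(\<Sum>i\<in>?A. (e i * w i) powr q * hh N i) = Ke powr q * \<Sigma>"
      unfolding \<Sigma>_def e_def sum_distrib_left by (simp add: powr_mult mult_ac)
    have I2: "(\<Sum>i\<in>?A. (bb i * w i) powr q * hh N i) \<le> Kb powr q * 3 powr q * (Ke powr q * (1 + K4) * \<Sigma> + 2 * K5 * T)"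
    proof -
      define u where "u i = (if 20 < i then e (i - 1) else 0)" for i
      define v where "v i = (if i = 20 \<or> i = b then F i else 0)" for i
      have uv: "0 \<le> u i" "0 \<le> v i" "0 \<le> e i" if "i \<in> ?A" for i unfolding u_def v_def using that e0 F0 e1 by auto
      have "(\<Sum>i\<in>?A. (bb i * w i) powr q * hh N i) \<le>
        (\<Sum>i\<in>?A. Kb powr q * 3 powr q * ((e i * w i) powr q * hh N i + (u i * w i) powr q * hh N i + (v i * w i) powr q * hh N i))"
      proof (rule sum_mono)
        fix i assume i: "i \<in> ?A"
        have "(bb i * w i) powr q = Kb powr q * (e i * w i + u i * w i + v i * w i) powr q"
          unfolding bb_def u_def v_def powr_mult[symmetric] by (simp add: algebra_simps)
        also have "... \<le> Kb powr q * (3 powr q * ((e i * w i) powr q + (u i * w i) powr q + (v i * w i) powr q))"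
          using uv[OF i] wp[OF i] q by (intro mult_left_mono powr_add3_le mult_nonneg_nonneg) auto
        finally have "(bb i * w i) powr q * hh N i \<le>
          (Kb powr q * (3 powr q * ((e i * w i) powr q + (u i * w i) powr q + (v i * w i) powr q))) * hh N i"
          using hp[OF i] by (intro mult_right_mono) auto
        then show "(bb i * w i) powr q * hh N i \<le> Kb powr q * 3 powr q * ((e i * w i) powr q * hh N i + (u i * w i) powr q * hh N i + (v i * w i) powr q * hh N i)"
          by (simp add: algebra_simps)
      qed
      also have "... = Kb powr q * 3 powr q * ((\<Sum>i\<in>?A. (e i * w i) powr q * hh N i) +
         (\<Sum>i\<in>?A. (u i * w i) powr q * hh N i) + (\<Sum>i\<in>?A. (v i * w i) powr q * hh N i))"
        unfolding sum_distrib_left[symmetric] sum.distrib ..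
      also have "... \<le> Kb powr q * 3 powr q * (Ke powr q * \<Sigma> + K4 * (Ke powr q * \<Sigma>) + 2 * K5 * T)"
      proof (intro mult_left_mono add_mono)
        show "(\<Sum>i\<in>?A. (e i * w i) powr q * hh N i) \<le> Ke powr q * \<Sigma>" using \<Sigma>e by simp
        have "(\<Sum>i\<in>?A. (u i * w i) powr q * hh N i) = (\<Sum>i\<in>{21..b}. (e (i - 1) * w i) powr q * hh N i)"
          using q by (intro sum.mono_neutral_cong_right) (auto simp: u_def)
        also have "... \<le> (\<Sum>i\<in>{21..b}. K4 * ((e (i - 1) * w (i - 1)) powr q * hh N (i - 1)))"
        proof (rule sum_mono)
          fix i assume i: "i \<in> {21..b}"
          have i1: "1 \<le> i - 1" "i - 1 < N" "i - 1 \<in> ?A" using i b by auto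
          have dd2: "dst N (i - 1) (tau N i) = 2"
            unfolding dst_def using i b by (simp add: arccos_tau of_nat_diff)
          have "w i \<le> 4 powr (\<alpha> + \<beta>) * 2 powr (2 * (\<alpha> + \<beta>)) * w (i - 1)"
            unfolding w_def using jw_le_dst[OF i1(1,2), of "tau N i"] ab tau_abs_le dd2 by simp
          then have "e (i - 1) * w i \<le> e (i - 1) * (4 powr (\<alpha> + \<beta>) * 2 powr (2 * (\<alpha> + \<beta>)) * w (i - 1))"
            using e0[OF i1(3)] by (intro mult_left_mono)
          then have "(e (i - 1) * w i) powr q \<le> (e (i - 1) * (4 powr (\<alpha> + \<beta>) * 2 powr (2 * (\<alpha> + \<beta>)) * w (i - 1))) powr q"
            using q e0[OF i1(3)] wp[of i] i by (intro powr_mono2 mult_nonneg_nonneg) auto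
          moreover have "hh N i \<le> 4 * hh N (i - 1)" using hh_ratio[OF i1(1,2), of i] i by simp
          ultimately have "(e (i - 1) * w i) powr q * hh N i \<le>
            (e (i - 1) * (4 powr (\<alpha> + \<beta>) * 2 powr (2 * (\<alpha> + \<beta>)) * w (i - 1))) powr q * (4 * hh N (i - 1))"
            using hp[of i] i by (intro mult_mono) auto
          then show "(e (i - 1) * w i) powr q * hh N i \<le> K4 * ((e (i - 1) * w (i - 1)) powr q * hh N (i - 1))"
            unfolding K4_def by (simp add: powr_mult mult_ac)
        qed
        also have "... = K4 * (\<Sum>i\<in>{21..b}. (e (i - 1) * w (i - 1)) powr q * hh N (i - 1))" by (simp add: sum_distrib_left)
        also have "(\<Sum>i\<in>{21..b}. (e (i - 1) * w (i - 1)) powr q * hh N (i - 1)) = (\<Sum>i\<in>{20..b - 1}. (e i * w i) powr q * hh N i)"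
          using b by (intro sum.reindex_bij_witness[of _ Suc "\<lambda>i. i - 1"]) auto
        also have "... \<le> (\<Sum>i\<in>?A. (e i * w i) powr q * hh N i)"
          by (intro sum_mono2) (auto intro!: mult_nonneg_nonneg less_imp_le[OF hp])
        finally show "(\<Sum>i\<in>?A. (u i * w i) powr q * hh N i) \<le> K4 * (Ke powr q * \<Sigma>)"
          using K4 \<Sigma>e by (simp add: mult_left_mono)
        have "(\<Sum>i\<in>?A. (v i * w i) powr q * hh N i) = (\<Sum>i\<in>{20, b}. (F i * w i) powr q * hh N i)"
          using q b by (intro sum.mono_neutral_cong_right) (auto simp: v_def)
        also have "... \<le> (\<Sum>i\<in>{20, b}. K5 * T)"
        proof (rule sum_mono)
          fix i assume "i \<in> {20, b}"
          then have i: "i \<in> ?A" using b by auto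
          have g: "tau N i - tau N (Suc i) > 0" using gap[OF i] hp[OF i] by linarith
          have "F i * w i = 400 powr (\<alpha> + \<beta>) * (2 * real k / (tau N i - tau N (Suc i)) * T) powr (1 / q)"
            unfolding F_def using wp[OF i] by simp
          then have FQ: "(F i * w i) powr q = (400 powr (\<alpha> + \<beta>)) powr q * (2 * real k / (tau N i - tau N (Suc i)) * T)"
            using q g T0 by (simp add: powr_mult[of _ _ q] powr_powr del: powr_mult)
          have "(F i * w i) powr q * hh N i \<le> (400 powr (\<alpha> + \<beta>)) powr q * (2 * real k / (tau N i - tau N (Suc i)) * T) * (2 * (tau N i - tau N (Suc i)))"
            unfolding FQ using gap[OF i] g T0 by (intro mult_left_mono mult_nonneg_nonneg) auto
          also have "... = K5 * T"
          proof -
            have "A * (2 * K / g * T) * (2 * g) = A * (4 * K) * T" if "g > 0" for A K g :: real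
              using that by simp
            from this[OF g] show ?thesis unfolding K5_def .
          qed
          finally show "(F i * w i) powr q * hh N i \<le> K5 * T" .
        qed
        also have "... \<le> 2 * K5 * T" using K5 T0 b by simp
        finally show "(\<Sum>i\<in>?A. (v i * w i) powr q * hh N i) \<le> 2 * K5 * T" .
      qed auto
      finally show ?thesis by (simp add: algebra_simps)
    qed
    have mFt: "wmeas \<alpha> \<beta> Ft"
    proof -
      have eq: "(\<lambda>x. jw \<alpha> \<beta> x * Ft x) = (\<lambda>x. jw \<alpha> \<beta> x * f x - jw \<alpha> \<beta> x * poly P x - (jw \<alpha> \<beta> x * f x) * indicator {x. E' x} x)"
        unfolding Ft_def by (auto simp: fun_eq_iff algebra_simps split: split_indicator)
      have [measurable]: "(\<lambda>x. jw \<alpha> \<beta> x * poly P x) \<in> borel_measurable I11"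
        "(\<lambda>x. indicator {x. E' x} x :: real) \<in> borel_measurable I11"
        unfolding E'_def by (intro borel_I11; measurable)+
      show ?thesis unfolding eq using mf by measurable
    qed
    have "werr \<alpha> \<beta> q f P \<le>
      (\<integral>\<^sup>+x. ennreal (2 powr q) * (ennreal (G x) * indicator ?E x + ennreal (\<bar>jw \<alpha> \<beta> x * Ft x\<bar> powr q)) \<partial>I11)"
    proof (rule nn_integral_mono)
      fix x
      define y where "y = (if E' x then jw \<alpha> \<beta> x * f x else 0)"
      have "jw \<alpha> \<beta> x * (f x - poly P x) = y + jw \<alpha> \<beta> x * Ft x"
        unfolding y_def Ft_def by (simp add: algebra_simps)
      then have "\<bar>jw \<alpha> \<beta> x * (f x - poly P x)\<bar> powr q \<le> 2 powr q * (\<bar>y\<bar> powr q + \<bar>jw \<alpha> \<beta> x * Ft x\<bar> powr q)"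
        using powr_add2_le[of q y "jw \<alpha> \<beta> x * Ft x"] q by simp
      then have "ennreal (\<bar>jw \<alpha> \<beta> x * (f x - poly P x)\<bar> powr q) \<le> ennreal (2 powr q * (\<bar>y\<bar> powr q + \<bar>jw \<alpha> \<beta> x * Ft x\<bar> powr q))"
        by (rule ennreal_leI)
      also have "... = ennreal (2 powr q) * (ennreal (\<bar>y\<bar> powr q) + ennreal (\<bar>jw \<alpha> \<beta> x * Ft x\<bar> powr q))"
        by (simp add: ennreal_mult ennreal_plus)
      finally have "ennreal (\<bar>jw \<alpha> \<beta> x * (f x - poly P x)\<bar> powr q) \<le> ennreal (2 powr q) * (ennreal (\<bar>y\<bar> powr q) + ennreal (\<bar>jw \<alpha> \<beta> x * Ft x\<bar> powr q))" .
      moreover have "ennreal (\<bar>y\<bar> powr q) \<le> ennreal (G x) * indicator ?E x"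
      proof (cases "E' x")
        case True
        have "tau N 21 \<le> tau N 20" "tau N (Suc b) \<le> tau N b" using b by (auto intro!: tau_antimono)
        then have "x \<in> ?E" using True unfolding E'_def b_def by auto
        then show ?thesis unfolding y_def G_def using True by simp
      qed (use q in \<open>simp add: y_def\<close>)
      ultimately show "ennreal (\<bar>jw \<alpha> \<beta> x * (f x - poly P x)\<bar> powr q) \<le>
        ennreal (2 powr q) * (ennreal (G x) * indicator ?E x + ennreal (\<bar>jw \<alpha> \<beta> x * Ft x\<bar> powr q))"
        by (elim order_trans) (intro mult_left_mono add_right_mono; simp)
    qed
    also have "... = ennreal (2 powr q) * (ennreal T + (\<integral>\<^sup>+x. ennreal (\<bar>jw \<alpha> \<beta> x * Ft x\<bar> powr q) \<partial>I11))"
    proof -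
      have [measurable]: "(indicator ?E :: real \<Rightarrow> ennreal) \<in> borel_measurable I11"
        by (intro borel_I11) measurable
      have [measurable]: "wmeas \<alpha> \<beta> Ft" by (rule mFt)
      show ?thesis by (simp add: nn_integral_cmult nn_integral_add T)
    qed
    also have "... \<le> ennreal (2 powr q) * (ennreal T + ennreal (K6 * (Kb powr q * 3 powr q * (Ke powr q * (1 + K4) * \<Sigma> + 2 * K5 * T))))"
      using I1 I2 K6 by (intro mult_left_mono add_left_mono order_trans[OF I1] ennreal_leI) auto
    also have "... \<le> ennreal (C * \<Sigma> + C * T)"
    proof -
      define M where "M = K6 * Kb powr q * 3 powr q"
      have M: "M \<ge> 0" unfolding M_def using K6 by simp
      have "2 powr q * (T + K6 * (Kb powr q * 3 powr q * (Ke powr q * (1 + K4) * \<Sigma> + 2 * K5 * T))) =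
        2 powr q * (T + M * (Ke powr q * (1 + K4)) * \<Sigma> + M * (2 * K5) * T)"
        unfolding M_def by (simp add: algebra_simps)
      also have "... \<le> 2 powr q * (T + M * (Ke powr q * (1 + K4)) * \<Sigma> + M * (2 * K5) * T +
          (\<Sigma> + M * (2 * K5) * \<Sigma> + M * (Ke powr q * (1 + K4)) * T))"
      proof -
        have "0 \<le> \<Sigma> + M * (2 * K5) * \<Sigma> + M * (Ke powr q * (1 + K4)) * T"
          using M K4 K5 T0 \<Sigma>0 by (intro add_nonneg_nonneg mult_nonneg_nonneg) auto
        then show ?thesis by (intro mult_left_mono) auto
      qed
      also have "... = C * \<Sigma> + C * T" unfolding C_def M_def[symmetric] by (simp add: algebra_simps)
      finally have "ennreal (2 powr q * (T + K6 * (Kb powr q * 3 powr q * (Ke powr q * (1 + K4) * \<Sigma> + 2 * K5 * T)))) \<le> ennreal (C * \<Sigma> + C * T)"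
        by (rule ennreal_leI)
      moreover have "0 \<le> K6 * (Kb powr q * 3 powr q * (Ke powr q * (1 + K4) * \<Sigma> + 2 * K5 * T))"
        using K6 K4 K5 T0 \<Sigma>0 by (intro mult_nonneg_nonneg add_nonneg_nonneg) auto
      ultimately show ?thesis using T0 by (simp add: ennreal_mult ennreal_plus[symmetric] del: ennreal_plus)
    qed
    also have "... = ennreal (C * \<Sigma>) + ennreal C * ennreal T"
      using C \<Sigma>0 T0 by (simp add: ennreal_plus ennreal_mult')
    finally have "werr \<alpha> \<beta> q f P \<le> ennreal (C * \<Sigma>) + ennreal C * ennreal T" .
    with degP show ?thesis unfolding \<Sigma>_def w_def b_def T[symmetric] G_def by blast
  qed
  with C show ?thesis by blast
qed

lemma sum_powr_le_powr_sum:
  fixes x :: "'a \<Rightarrow> real"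
  assumes A: "finite A" "\<And>i. i \<in> A \<Longrightarrow> 0 \<le> x i" and q: "1 \<le> q"
  shows "(\<Sum>i\<in>A. x i powr q) \<le> (\<Sum>i\<in>A. x i) powr q"
proof -
  define S where "S = (\<Sum>i\<in>A. x i)"
  have S: "0 \<le> S" unfolding S_def using A by (intro sum_nonneg) auto
  have "(\<Sum>i\<in>A. x i powr q) \<le> (\<Sum>i\<in>A. x i * S powr (q - 1))"
  proof (rule sum_mono)
    fix i assume i: "i \<in> A"
    have "x i \<le> S" unfolding S_def using A i by (intro member_le_sum) auto
    then have "x i powr (q - 1) \<le> S powr (q - 1)" using A i q by (intro powr_mono2) auto
    moreover have "x i powr q = x i * x i powr (q - 1)" using A(2)[OF i] q by (cases "x i = 0") (auto simp: powr_diff)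
    ultimately show "x i powr q \<le> x i * S powr (q - 1)" using A(2)[OF i] by (simp add: mult_left_mono)
  qed
  also have "... = S * S powr (q - 1)" unfolding S_def by (simp add: sum_distrib_right)
  also have "... = S powr q" using S q by (cases "S = 0") (auto simp: powr_diff)
  finally show ?thesis unfolding S_def .
qed

text \<open>Clamping \<open>D\<close> between \<open>L\<close> and \<open>U\<close> changes no term
  with index in \<open>A\<close> and keeps the sequence antitone. The sum may then be enlarged to
  all of \<open>{1..M}\<close>, where it telescopes with lag three.\<close>

lemma sum_diff3_le:
  fixes D :: "nat \<Rightarrow> real"
  assumes mono: "\<And>i j. i \<le> j \<Longrightarrow> j \<le> M + 2 \<Longrightarrow> D j \<le> D i"
    and A: "A \<subseteq> {1..M}" and L: "\<And>i. i \<in> A \<Longrightarrow> L \<le> D (i + 2)" and U: "\<And>i. i \<in> A \<Longrightarrow> D (i - 1) \<le> U"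
    and LU: "L \<le> U"
  shows "(\<Sum>i\<in>A. D (i - 1) - D (i + 2)) \<le> 3 * (U - L)"
proof -
  define E where "E i = max L (min U (D i))" for i
  have E_mono: "E j \<le> E i" if "i \<le> j" "j \<le> M + 2" for i j
    using mono[OF that] unfolding E_def by (auto simp: max_def min_def)
  have E_bd: "L \<le> E i" "E i \<le> U" for i using LU unfolding E_def by auto
  have "(\<Sum>i\<in>A. D (i - 1) - D (i + 2)) = (\<Sum>i\<in>A. E (i - 1) - E (i + 2))"
  proof (rule sum.cong[OF refl])
    fix i assume i: "i \<in> A"
    then have "D (i + 2) \<le> D (i - 1)" using A by (intro mono) auto
    then show "D (i - 1) - D (i + 2) = E (i - 1) - E (i + 2)" using L[OF i] U[OF i] unfolding E_def by auto
  qed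
  also have "... \<le> (\<Sum>i\<in>{1..M}. E (i - 1) - E (i + 2))"
    using A by (intro sum_mono2) (auto intro!: E_mono)
  also have "... = E 0 + E 1 + E 2 - (E M + E (M + 1) + E (M + 2))"
    by (induction M) (simp_all add: numeral_2_eq_2)
  also have "... \<le> 3 * (U - L)"
    using E_bd(2)[of 0] E_bd(2)[of 1] E_bd(2)[of 2] E_bd(1)[of M] E_bd(1)[of "M + 1"] E_bd(1)[of "M + 2"] by simp
  finally show ?thesis .
qed

section \<open>Dyadic blocks of nodes near the endpoint 1\<close>

lemma one_minus_tau_scale:
  assumes i: "1 \<le> i" "i \<le> m" "m \<le> N"
  shows "1 - tau N m \<le> (real m / real i)\<^sup>2 * (1 - tau N i)"
proof -
  define a where "a = real m * pi / real N / 2"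
  have a: "0 \<le> a" "a \<le> pi"
  proof -
    define X where "X = real m * pi / real N"
    have "0 \<le> X \<and> X \<le> pi" unfolding X_def by (rule node_angle[OF i(3)])
    then show "0 \<le> a" "a \<le> pi" unfolding a_def X_def[symmetric] by auto
  qed
  have "real i / real m * sin a \<le> sin (real i / real m * a)"
    using i a by (intro sin_concave) auto
  also have "real i / real m * a = real i * pi / real N / 2" unfolding a_def using i by simp
  finally have "sin a \<le> real m / real i * sin (real i * pi / real N / 2)" using i by (simp add: field_simps)
  moreover have "0 \<le> sin a" using a by (intro sin_ge_zero)
  ultimately have "(sin a)\<^sup>2 \<le> (real m / real i * sin (real i * pi / real N / 2))\<^sup>2" by (intro power_mono)
  then have "2 * (sin a)\<^sup>2 \<le> (real m / real i)\<^sup>2 * (2 * (sin (real i * pi / real N / 2))\<^sup>2)"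
    unfolding power_mult_distrib by linarith
  then show ?thesis unfolding one_minus_tau a_def .
qed

lemma one_minus_tau_ge:
  assumes "i \<le> N" "1 \<le> N"
  shows "1 - tau N i \<ge> 2 * (real i / real N)\<^sup>2"
proof -
  define a where "a = real i * pi / real N / 2"
  have a: "0 \<le> a" "a \<le> pi / 2" unfolding a_def using node_angle[OF assms(1)] by auto
  have "2 / pi * a \<le> sin a" using a by (rule sin_ge_line)
  moreover have "2 / pi * a = real i / real N" unfolding a_def by simp
  ultimately have "(real i / real N)\<^sup>2 \<le> (sin a)\<^sup>2" by (intro power_mono) auto
  then show ?thesis unfolding one_minus_tau a_def by simp
qed

lemma hh_sq_le: "(hh N i)\<^sup>2 \<le> 2 * (1 - tau N i) / (real N)\<^sup>2"
proof -
  have "(sin (real i * pi / real N))\<^sup>2 = (1 - tau N i) * (1 + tau N i)"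
    unfolding tau_def sin_squared_eq by (simp add: power2_eq_square algebra_simps)
  also have "... \<le> (1 - tau N i) * 2" using tau_abs_le[of N i] by (intro mult_left_mono) auto
  finally have "(sin (real i * pi / real N))\<^sup>2 / (real N)\<^sup>2 \<le> 2 * (1 - tau N i) / (real N)\<^sup>2"
    by (intro divide_right_mono) auto
  then show ?thesis unfolding hh_def by (simp add: power_divide)
qed

text \<open>The start at 16 ensures that shifting an index by -1 or +3 changes the distance to 1
  only by a factor below 2 or 3/2, so that windows fixed in advance separate the block from the
  comparison points used below.\<close>

definition blk :: "nat \<Rightarrow> nat \<Rightarrow> nat set" where
  "blk N j = {i \<in> {16..N div 2}. 1 / 2 ^ Suc j < 1 - tau N i \<and> 1 - tau N i \<le> 1 / 2 ^ j}"

lemma tau_half_nonneg: "i \<le> N div 2 \<Longrightarrow> 0 \<le> tau N i"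
proof -
  assume i: "i \<le> N div 2"
  show ?thesis
  proof (cases "N = 0")
    case False
    have "real i \<le> real N / 2" using i by linarith
    then have "real i * pi \<le> real N / 2 * pi" by (intro mult_right_mono) auto
    then have "real i * pi / real N \<le> pi / 2" using False by (simp add: field_simps)
    then show ?thesis unfolding tau_def by (intro cos_ge_zero) (auto simp: order_trans[of _ 0])
  qed (simp add: tau_def)
qed

text \<open>Levels with 2^j up to N^2 suffice because 1 - \<open>tau N i\<close> is at least 2 (i /
  N)^2 and hence exceeds N^(-2).\<close>

lemma blk_cover:
  assumes N: "N \<ge> 1"
  shows "{16..N div 2} \<subseteq> (\<Union>j\<in>{j. 2 ^ j \<le> N\<^sup>2}. blk N j)"
proof
  fix i assume i: "i \<in> {16..N div 2}"
  define d where "d = 1 - tau N i"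
  have d1: "d \<le> 1" unfolding d_def using tau_half_nonneg[of i N] i by auto
  have iN: "i \<le> N" using i by auto
  have "2 * (real i / real N)\<^sup>2 \<le> d" unfolding d_def using iN N by (intro one_minus_tau_ge)
  moreover have "(1 / real N)\<^sup>2 \<le> (real i / real N)\<^sup>2" using i by (intro power_mono divide_right_mono) auto
  moreover have "0 < (1 / real N)\<^sup>2" using N by simp
  ultimately have dN: "(1 / real N)\<^sup>2 < d" by linarith
  then have d0: "0 < d" using \<open>0 < (1 / real N)\<^sup>2\<close> by linarith
  define j where "j = (LEAST j. 1 / 2 ^ Suc j < d)"
  obtain n where n: "(1 / 2) ^ n < d" using real_arch_pow_inv[of d "1 / 2"] d0 by auto
  have "(1 / 2 :: real) ^ Suc n \<le> (1 / 2) ^ n" by simp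
  then have "1 / 2 ^ Suc n < d" using n by (simp add: power_one_over)
  then have j1: "1 / 2 ^ Suc j < d" unfolding j_def by (rule LeastI)
  have j2: "d \<le> 1 / 2 ^ j"
  proof (cases j)
    case (Suc m)
    then have "\<not> 1 / 2 ^ Suc m < d" unfolding j_def using not_less_Least by (metis lessI)
    then show ?thesis using Suc by simp
  qed (use d1 in simp)
  have "1 / (real N)\<^sup>2 < 1 / 2 ^ j" using dN j2 by (simp add: power_one_over)
  then have "2 ^ j < (real N)\<^sup>2" using N by (simp add: field_simps)
  then have "2 ^ j < N\<^sup>2" by (metis of_nat_less_iff of_nat_numeral of_nat_power)
  then have "j \<in> {j. 2 ^ j \<le> N\<^sup>2}" by simp
  moreover have "i \<in> blk N j" using i j1 j2 unfolding blk_def d_def by simp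
  ultimately show "i \<in> (\<Union>j\<in>{j. 2 ^ j \<le> N\<^sup>2}. blk N j)" by blast
qed

text \<open>Monotonicity places all differences of the block between those at a point set
  \<open>L\<close> to its left and \<open>U\<close> to its right, and \<open>sum_diff3_le\<close>
  applies. The windows leave room for the cells \<open>i - 1\<close> and \<open>i + 2\<close>; the
  bound 7/4 keeps \<open>L\<close> above -1 when \<open>j = 0\<close>.\<close>

lemma blk_dd_sum:
  fixes k :: nat and \<alpha> \<beta> :: real
  assumes k: "1 \<le> k" and N: "N \<ge> 64" and f: "f \<in> Mset k"
    and U: "finite U" "card U = k" "\<And>z. z \<in> U \<Longrightarrow> 1 / 8 * (1 / 2 ^ j) \<le> 1 - z \<and> 1 - z \<le> 1 / 4 * (1 / 2 ^ j)"
    and L: "finite L" "card L = k" "\<And>z. z \<in> L \<Longrightarrow> 3 / 2 * (1 / 2 ^ j) \<le> 1 - z \<and> 1 - z \<le> 7 / 4 * (1 / 2 ^ j)"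
  shows "(\<Sum>i\<in>blk N j. DQ N k (i - 1) f - DQ N k (i + 2) f) \<le> 3 * (dd U f - dd L f)"
proof -
  define e where "e = (1 / 2 ^ j :: real)"
  have e: "0 < e" "e \<le> 1" unfolding e_def by (auto simp: one_le_power)
  note U3 = U(3)[folded e_def] and L3 = L(3)[folded e_def]
  have Ui: "U \<subseteq> {-1<..<1}" and Li: "L \<subseteq> {-1<..<1}" using U3 L3 e by fastforce+
  show ?thesis
  proof (rule sum_diff3_le[where M = "N div 2"])
    fix i l assume "i \<le> l" "l \<le> N div 2 + 2"
    then show "DQ N k l f \<le> DQ N k i f" using N by (intro DQ_antimono f) auto
  next
    show "dd L f \<le> dd U f"
      by (rule dd_mono[OF f L(1) U(1) L(2) U(2) Li Ui]) (use U3 L3 e in fastforce)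
  next
    fix i assume i: "i \<in> blk N j"
    then have i16: "16 \<le> i" "i \<le> N div 2" and ie: "e / 2 < 1 - tau N i" "1 - tau N i \<le> e"
      unfolding blk_def e_def by auto
    have iN: "i + 3 < N" using i16 N by auto
    show "dd L f \<le> DQ N k (i + 2) f"
    proof (rule dd_le_DQ[OF f _ L(1,2) Li])
      fix z assume z: "z \<in> L"
      have "1 - tau N (i + 3) \<le> (real (i + 3) / real i)\<^sup>2 * (1 - tau N i)"
        using i16 iN by (intro one_minus_tau_scale) auto
      also have "(real (i + 3) / real i)\<^sup>2 \<le> (19 / 16)\<^sup>2" using i16 by (intro power_mono) (auto simp: field_simps)
      also have "(19 / 16)\<^sup>2 * (1 - tau N i) \<le> (19 / 16)\<^sup>2 * e" using ie by (intro mult_left_mono) auto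
      also have "... \<le> 3 / 2 * e" using e by (simp add: power2_eq_square)
      finally have "1 - tau N (i + 3) \<le> 3 / 2 * e" using tau_abs_le(2)[of N i] by (simp add: mult_right_mono)
      then show "z \<le> tau N (Suc (i + 2))" using L3[OF z] by (simp add: eval_nat_numeral)
    qed (use iN in simp)
    show "DQ N k (i - 1) f \<le> dd U f"
    proof (rule DQ_le_dd[OF f _ U(1,2) Ui])
      fix z assume z: "z \<in> U"
      have "1 - tau N i \<le> (real i / real (i - 1))\<^sup>2 * (1 - tau N (i - 1))"
        using i16 iN by (intro one_minus_tau_scale) auto
      also have "(real i / real (i - 1))\<^sup>2 \<le> (4 / 3)\<^sup>2" using i16 by (intro power_mono) (auto simp: field_simps of_nat_diff)
      finally have "1 - tau N i \<le> (4 / 3)\<^sup>2 * (1 - tau N (i - 1))" using tau_abs_le(2)[of N "i - 1"] by (simp add: mult_right_mono)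
      moreover define T where "T = tau N (i - 1)"
      ultimately have "1 - T \<ge> (1 - tau N i) / 2" using tau_abs_le(2)[of N "i - 1"] by (simp add: power2_eq_square)
      moreover have "1 - z \<le> e / 4" using U3[OF z] by simp
      moreover have "e / 4 < (1 - tau N i) / 2" using ie by simp
      ultimately have "1 - z < 1 - T" by (meson le_less_trans less_le_trans)
      then have "T \<le> z" by simp
      then show "tau N (i - 1) \<le> z" unfolding T_def .
    qed (use iN in simp)
  qed (auto simp: blk_def)
qed

text \<open>The zone that contains the windows of the sets \<open>U\<close> and \<open>L\<close> of
  level \<open>j\<close>, taken at both endpoints so that it is invariant under reflection.\<close>

definition Xset :: "nat \<Rightarrow> real set" where
  "Xset j = {x. 1 - x \<in> {1 / 2 ^ j / 8..7 / 4 * (1 / 2 ^ j)} \<or> 1 + x \<in> {1 / 2 ^ j / 8..7 / 4 * (1 / 2 ^ j)}}"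

abbreviation Xmass :: "real \<Rightarrow> real \<Rightarrow> (real \<Rightarrow> real) \<Rightarrow> nat \<Rightarrow> ennreal" where
  "Xmass \<alpha> \<beta> f j \<equiv> (\<integral>\<^sup>+x. ennreal \<bar>jw \<alpha> \<beta> x * f x\<bar> * indicator (Xset j) x \<partial>I11)"

text \<open>The average of the weighted function over a window is of order 2^j times
  \<open>a\<close>; the weight there is at least a multiple of 2^(-j \<beta>); and each of the
  \<open>k - 1\<close> factors in a denominator of the divided difference costs another 2^j. The
  factor of the other endpoint is harmless as 1 + z is at least 1/4.\<close>

lemma blk_pick:
  fixes k :: nat and \<alpha> \<beta> a u v :: real
  assumes k: "1 \<le> k" and ab: "0 \<le> \<alpha>" "0 \<le> \<beta>"
    and mf: "wmeas \<alpha> \<beta> f"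
    and a: "0 \<le> a" "Xmass \<alpha> \<beta> f j \<le> ennreal a"
    and uv: "1 / 8 \<le> u" "u + 1 / 8 \<le> v" "v \<le> 7 / 4"
  shows "\<exists>U. finite U \<and> card U = k \<and> (\<forall>z\<in>U. u * (1 / 2 ^ j) < 1 - z \<and> 1 - z < v * (1 / 2 ^ j)) \<and>
    \<bar>dd U f\<bar> \<le> real k * (16 * real k * 4 powr \<alpha> * 8 powr \<beta>) * (16 * real k) ^ (k - 1) *
      (2 ^ j) ^ (k - 1) * (2 ^ j) powr \<beta> * (2 ^ j * a)"
proof -
  define e where "e = (1 / 2 ^ j :: real)"
  have e: "0 < e" "e \<le> 1" unfolding e_def by (auto simp: one_le_power)
  have ve: "v * e \<le> 7 / 4" using mult_mono[of v "7 / 4" e 1] e uv by simp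
  have ue: "e / 8 \<le> u * e" "v * e \<le> 7 / 4 * e" using e uv by auto
  have uve: "u * e + e / 8 \<le> v * e" using mult_right_mono[OF uv(2), of e] e by (simp add: algebra_simps)
  let ?u = "1 - v * e" and ?v = "1 - u * e"
  have "(\<integral>\<^sup>+x. ennreal \<bar>jw \<alpha> \<beta> x * f x\<bar> * indicator {?u..?v} x \<partial>I11) \<le>
    (Xmass \<alpha> \<beta> f j)"
  proof (rule nn_integral_mono)
    fix x
    have "x \<in> {?u..?v} \<Longrightarrow> x \<in> Xset j" unfolding Xset_def e_def[symmetric] using ue by auto
    then show "ennreal \<bar>jw \<alpha> \<beta> x * f x\<bar> * indicator {?u..?v} x \<le> ennreal \<bar>jw \<alpha> \<beta> x * f x\<bar> * indicator (Xset j) x"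
      by (intro mult_left_mono) (auto simp: indicator_def simp del: atLeastAtMost_iff)
  qed
  then have I: "(\<integral>\<^sup>+x. ennreal \<bar>jw \<alpha> \<beta> x * f x\<bar> * indicator {?u..?v} x \<partial>I11) \<le> ennreal a" using a(2) by order
  have "?u < ?v" "-1 \<le> ?u" "?v \<le> 1" using uve ve e uv by auto
  from pick_points[OF this(2,1,3) _ k I a(1)] mf obtain U where U: "finite U" "card U = k" "U \<subseteq> {?u<..<?v}"
    "\<And>z. z \<in> U \<Longrightarrow> \<bar>jw \<alpha> \<beta> z * f z\<bar> \<le> 2 * real k / (?v - ?u) * a"
    "\<And>z z'. z \<in> U \<Longrightarrow> z' \<in> U \<Longrightarrow> z \<noteq> z' \<Longrightarrow> \<bar>z - z'\<bar> \<ge> (?v - ?u) / (2 * real k)"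
    by (auto simp: borel_measurable_abs)
  define s where "s = e / (16 * real k)"
  have s: "s > 0" unfolding s_def using e k by simp
  define B where "B = 16 * real k * 4 powr \<alpha> * 8 powr \<beta> * (2 ^ j) powr \<beta> * (2 ^ j * a)"
  have "\<bar>dd U f\<bar> \<le> real (card U) * B / s ^ (card U - 1)"
  proof (rule dd_abs_le[OF U(1) _ _ s])
    fix z assume z: "z \<in> U"
    have z1: "u * e < 1 - z" "1 - z < v * e" using U(3) z by auto
    have zr: "e / 8 \<le> 1 - z" "1 / 4 \<le> 1 + z" using z1 ue ve by auto
    have "(1 / 4) powr \<alpha> * (e / 8) powr \<beta> \<le> jw \<alpha> \<beta> z"
      unfolding jw_def using zr ab e by (intro mult_mono powr_mono2) auto
    moreover have pos: "0 < (1 / 4) powr \<alpha> * (e / 8) powr \<beta>" using e by simp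
    ultimately have "(1 / 4) powr \<alpha> * (e / 8) powr \<beta> * \<bar>f z\<bar> \<le> jw \<alpha> \<beta> z * \<bar>f z\<bar>"
      by (intro mult_right_mono) auto
    also have "... = \<bar>jw \<alpha> \<beta> z * f z\<bar>" using jw_nonneg by (simp add: abs_mult)
    also have "... \<le> 2 * real k / (?v - ?u) * a" by (rule U(4)[OF z])
    also have "... \<le> 2 * real k / (e / 8) * a"
    proof -
      have "e / 8 \<le> ?v - ?u" using uve by simp
      then show ?thesis using e a uv by (intro mult_right_mono divide_left_mono mult_pos_pos) auto
    qed
    also have "... = 16 * real k * (2 ^ j * a)" unfolding e_def by simp
    finally have 1: "(1 / 4) powr \<alpha> * (e / 8) powr \<beta> * \<bar>f z\<bar> \<le> 16 * real k * (2 ^ j * a)" .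
    have 2: "4 powr \<alpha> * 8 powr \<beta> * (2 ^ j) powr \<beta> * ((1 / 4) powr \<alpha> * (e / 8) powr \<beta>) = 1"
    proof -
      have "4 powr \<alpha> * (1 / 4) powr \<alpha> = 1" by (simp add: powr_divide)
      moreover have "8 powr \<beta> * (2 ^ j) powr \<beta> * (e / 8) powr \<beta> = (8 * 2 ^ j * (e / 8)) powr \<beta>"
        by (simp only: powr_mult)
      then have "8 powr \<beta> * (2 ^ j) powr \<beta> * (e / 8) powr \<beta> = 1" unfolding e_def by simp
      moreover have "A * B * T * (A' * E) = 1" if "A * A' = 1" "B * T * E = 1" for A B T A' E :: real
      proof -
        have "A * B * T * (A' * E) = (A * A') * (B * T * E)" by (simp only: mult_ac)
        then show ?thesis using that by simp
      qed
      ultimately show ?thesis by blast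
    qed
    have "\<bar>f z\<bar> = 4 powr \<alpha> * 8 powr \<beta> * (2 ^ j) powr \<beta> * ((1 / 4) powr \<alpha> * (e / 8) powr \<beta> * \<bar>f z\<bar>)"
      using 2 by (simp add: mult.assoc[symmetric])
    also have "... \<le> 4 powr \<alpha> * 8 powr \<beta> * (2 ^ j) powr \<beta> * (16 * real k * (2 ^ j * a))"
      using 1 by (intro mult_left_mono) auto
    finally show "\<bar>f z\<bar> \<le> B" unfolding B_def by (simp add: mult_ac)
  next
    fix z z' assume "z \<in> U" "z' \<in> U" "z \<noteq> z'"
    then have "(?v - ?u) / (2 * real k) \<le> \<bar>z - z'\<bar>" by (rule U(5))
    moreover have "e / 8 / (2 * real k) \<le> (?v - ?u) / (2 * real k)" using uve by (intro divide_right_mono) auto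
    ultimately show "s \<le> \<bar>z - z'\<bar>" unfolding s_def by simp
  qed
  also have "... = real k * (16 * real k * 4 powr \<alpha> * 8 powr \<beta>) * (16 * real k) ^ (k - 1) *
      (2 ^ j) ^ (k - 1) * (2 ^ j) powr \<beta> * (2 ^ j * a)"
    unfolding U(2) B_def s_def e_def by (simp add: power_divide power_mult_distrib)
  finally have "\<bar>dd U f\<bar> \<le> real k * (16 * real k * 4 powr \<alpha> * 8 powr \<beta>) * (16 * real k) ^ (k - 1) *
      (2 ^ j) ^ (k - 1) * (2 ^ j) powr \<beta> * (2 ^ j * a)" .
  moreover have "\<forall>z\<in>U. u * (1 / 2 ^ j) < 1 - z \<and> 1 - z < v * (1 / 2 ^ j)"
    using U(3) unfolding e_def[symmetric] by fastforce
  ultimately show ?thesis using U(1,2) by blast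
qed

section \<open>Summation of local oscillations\<close>

text \<open>The \<open>q\<close>-th power of the weighted local interpolation error times the mesh
  length, so that the sum over the nodes is the \<open>q\<close>-th power of a discrete weighted
  norm.\<close>

definition loc_term :: "nat \<Rightarrow> nat \<Rightarrow> real \<Rightarrow> real \<Rightarrow> real \<Rightarrow> (real \<Rightarrow> real) \<Rightarrow> nat \<Rightarrow> real" where
  "loc_term N k q \<alpha> \<beta> f i =
    (hh N i ^ (k - 1) * (DQ N k (i - 1) f - DQ N k (i + 2) f) * jw \<alpha> \<beta> (tau N i)) powr q * hh N i"

abbreviation loc_sum :: "nat \<Rightarrow> nat \<Rightarrow> real \<Rightarrow> real \<Rightarrow> real \<Rightarrow> (real \<Rightarrow> real) \<Rightarrow> real" where
  "loc_sum N k q \<alpha> \<beta> f \<equiv> (\<Sum>i\<in>{20..N - 21}. loc_term N k q \<alpha> \<beta> f i)"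

text \<open>Within a block, mesh and weight are bounded by constants of the level. The l_q norm of
  the oscillations is at most their l_1 norm, which telescopes by \<open>blk_dd_sum\<close> and is
  bounded at the points of \<open>blk_pick\<close>. The factor 2^(j \<beta>) lost there cancels
  against the weight, so \<beta> does not enter the exponent.\<close>

lemma blk_sum:
  fixes k :: nat and q \<alpha> \<beta> :: real
  assumes k: "1 \<le> k" and q: "1 \<le> q" and ab: "0 \<le> \<alpha>" "0 \<le> \<beta>"
  shows "\<exists>C>0. \<forall>N\<ge>64. \<forall>f\<in>Mset k. \<forall>j a. (\<lambda>x. jw \<alpha> \<beta> x * f x) \<in> borel_measurable I11 \<longrightarrow> 0 \<le> a \<longrightarrow>
    (Xmass \<alpha> \<beta> f j) \<le> ennreal a \<longrightarrow>
    (\<Sum>i\<in>blk N j. loc_term N k q \<alpha> \<beta> f i) \<le>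
    C * real N powr (- (real (k - 1) * q) - 1) * (2 ^ j) powr ((real (k - 1) * q - 1) / 2) * (2 ^ j * a) powr q"
proof -
  define C0 where "C0 = real k * (16 * real k * 4 powr \<alpha> * 8 powr \<beta>) * (16 * real k) ^ (k - 1)"
  define C1 where "C1 = 6 * C0"
  have C1: "C1 > 0" unfolding C1_def C0_def using k by simp
  define C where "C = 2 * (2 ^ (k - 1) * 2 powr \<alpha> * C1) powr q"
  have C: "C > 0" unfolding C_def using C1 by simp
  have "(\<Sum>i\<in>blk N j. loc_term N k q \<alpha> \<beta> f i) \<le>
    C * real N powr (- (real (k - 1) * q) - 1) * (2 ^ j) powr ((real (k - 1) * q - 1) / 2) * (2 ^ j * a) powr q"
    if N: "N \<ge> 64" and f: "f \<in> Mset k" and mf: "wmeas \<alpha> \<beta> f" and a: "0 \<le> a"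
      "Xmass \<alpha> \<beta> f j \<le> ennreal a" for N f j a
  proof -
    define t where "t = (2 ^ j :: real)"
    have t: "t > 0" unfolding t_def by simp
    have N0: "real N > 0" using N by simp
    define \<Delta> where "\<Delta> i = DQ N k (i - 1) f - DQ N k (i + 2) f" for i
    have \<Delta>0: "\<Delta> i \<ge> 0" if "i \<in> blk N j" for i
      unfolding \<Delta>_def using that N by (auto intro!: DQ_antimono f simp: blk_def)
    have "\<exists>U. finite U \<and> card U = k \<and> (\<forall>z\<in>U. 1 / 8 * (1 / t) < 1 - z \<and> 1 - z < 1 / 4 * (1 / t)) \<and>
      \<bar>dd U f\<bar> \<le> C0 * t ^ (k - 1) * t powr \<beta> * (t * a)"
      unfolding C0_def t_def by (rule blk_pick[OF k ab mf a]) auto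
    then obtain U where U: "finite U" "card U = k" "\<And>z. z \<in> U \<Longrightarrow> 1 / 8 * (1 / t) < 1 - z \<and> 1 - z < 1 / 4 * (1 / t)"
      "\<bar>dd U f\<bar> \<le> C0 * t ^ (k - 1) * t powr \<beta> * (t * a)"
      by blast
    have "\<exists>L. finite L \<and> card L = k \<and> (\<forall>z\<in>L. 3 / 2 * (1 / t) < 1 - z \<and> 1 - z < 7 / 4 * (1 / t)) \<and>
      \<bar>dd L f\<bar> \<le> C0 * t ^ (k - 1) * t powr \<beta> * (t * a)"
      unfolding C0_def t_def by (rule blk_pick[OF k ab mf a]) auto
    then obtain L where L: "finite L" "card L = k" "\<And>z. z \<in> L \<Longrightarrow> 3 / 2 * (1 / t) < 1 - z \<and> 1 - z < 7 / 4 * (1 / t)"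
      "\<bar>dd L f\<bar> \<le> C0 * t ^ (k - 1) * t powr \<beta> * (t * a)"
      by blast
    have "(\<Sum>i\<in>blk N j. \<Delta> i) \<le> 3 * (dd U f - dd L f)"
      unfolding \<Delta>_def by (rule blk_dd_sum[OF k N f U(1,2) _ L(1,2)]) (use U(3)[unfolded t_def] L(3)[unfolded t_def] in \<open>blast intro: less_imp_le\<close>)+
    also have "... \<le> 6 * (C0 * t ^ (k - 1) * t powr \<beta> * (t * a))"
    proof -
      have "3 * (u - l) \<le> 6 * X" if "\<bar>u\<bar> \<le> X" "\<bar>l\<bar> \<le> X" for u l X :: real
        using abs_le_D1[OF that(1)] abs_le_D2[OF that(2)] by simp
      from this[OF U(4) L(4)] show ?thesis .
    qed
    also have "... = C1 * t ^ (k - 1) * t powr \<beta> * (t * a)" unfolding C1_def by simp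
    finally have S: "(\<Sum>i\<in>blk N j. \<Delta> i) \<le> C1 * t ^ (k - 1) * t powr \<beta> * (t * a)" .
    \<comment> \<open>The square root of the bound in \<open>hh_sq_le\<close>, with the distance to
      1 replaced by its maximum 1 / t on the block.\<close>
    define h where "h = 2 * t powr (- 1 / 2) / real N"
    have h: "h > 0" unfolding h_def using t N0 by simp
    have hi: "0 \<le> hh N i" "hh N i \<le> h" and wi: "jw \<alpha> \<beta> (tau N i) \<le> 2 powr \<alpha> * t powr (- \<beta>)" if i: "i \<in> blk N j" for i
    proof -
      have i1: "1 \<le> i" "i < N" "1 - tau N i \<le> 1 / t" using i N unfolding blk_def t_def by auto
      show "0 \<le> hh N i" using hh_pos[OF i1(1,2)] by simp
      have "(hh N i)\<^sup>2 \<le> 2 * (1 - tau N i) / (real N)\<^sup>2" by (rule hh_sq_le)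
      also have "... \<le> 4 * (1 / t) / (real N)\<^sup>2" using i1 t tau_abs_le(2)[of N i] by (intro divide_right_mono mult_mono) auto
      also have "... = h\<^sup>2"
      proof -
        have "(t powr (- 1 / 2))\<^sup>2 = t powr (- 1)" using t by (simp add: power2_eq_square flip: powr_add)
        then show ?thesis unfolding h_def using t by (simp add: power_divide power_mult_distrib powr_minus_divide)
      qed
      finally show "hh N i \<le> h" by (rule power2_le_imp_le) (use h in simp)
      have "jw \<alpha> \<beta> (tau N i) \<le> 2 powr \<alpha> * (1 / t) powr \<beta>"
        unfolding jw_def using i1 tau_abs_le[of N i] ab by (intro mult_mono powr_mono2) auto
      also have "(1 / t) powr \<beta> = t powr (- \<beta>)" using t by (simp add: powr_minus_divide powr_divide)
      finally show "jw \<alpha> \<beta> (tau N i) \<le> 2 powr \<alpha> * t powr (- \<beta>)" .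
    qed
    define H where "H = h ^ (k - 1) * (2 powr \<alpha> * t powr (- \<beta>))"
    have H: "H \<ge> 0" unfolding H_def using h by simp
    have "(\<Sum>i\<in>blk N j. loc_term N k q \<alpha> \<beta> f i) \<le> (\<Sum>i\<in>blk N j. (H * \<Delta> i) powr q * h)"
    proof (rule sum_mono)
      fix i assume i: "i \<in> blk N j"
      have "hh N i ^ (k - 1) * \<Delta> i * jw \<alpha> \<beta> (tau N i) \<le> h ^ (k - 1) * \<Delta> i * (2 powr \<alpha> * t powr (- \<beta>))"
        using hi[OF i] wi[OF i] \<Delta>0[OF i] jw_nonneg h by (intro mult_mono power_mono) auto
      also have "... = H * \<Delta> i" unfolding H_def by simp
      finally show "loc_term N k q \<alpha> \<beta> f i \<le> (H * \<Delta> i) powr q * h"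
        unfolding loc_term_def \<Delta>_def[symmetric] using hi[OF i] \<Delta>0[OF i] jw_nonneg q
        by (intro mult_mono[OF powr_mono2]) auto
    qed
    also have "... = (\<Sum>i\<in>blk N j. (H * \<Delta> i) powr q) * h" by (simp add: sum_distrib_right)
    also have "... \<le> (\<Sum>i\<in>blk N j. H * \<Delta> i) powr q * h"
      using h H \<Delta>0 q by (intro mult_right_mono sum_powr_le_powr_sum) (auto simp: blk_def)
    also have "(\<Sum>i\<in>blk N j. H * \<Delta> i) = H * (\<Sum>i\<in>blk N j. \<Delta> i)" by (simp add: sum_distrib_left)
    also have "(H * (\<Sum>i\<in>blk N j. \<Delta> i)) powr q * h \<le> (H * (C1 * t ^ (k - 1) * t powr \<beta> * (t * a))) powr q * h"
      using S H h q \<Delta>0 by (intro mult_right_mono powr_mono2 mult_left_mono mult_nonneg_nonneg sum_nonneg) auto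
    also have "... = C * real N powr (- (real (k - 1) * q) - 1) * t powr ((real (k - 1) * q - 1) / 2) * (t * a) powr q"
    proof -
      define \<kappa> where "\<kappa> = real (k - 1)"
      have tk: "t ^ (k - 1) = t powr \<kappa>" unfolding \<kappa>_def using t by (simp add: powr_realpow)
      have hk: "h ^ (k - 1) = 2 ^ (k - 1) * t powr (- \<kappa> / 2) * real N powr (- \<kappa>)"
      proof -
        have "(t powr (- 1 / 2)) ^ (k - 1) = t powr (- \<kappa> / 2)"
        proof -
          have "(t powr (- 1 / 2)) ^ (k - 1) = (t powr (- 1 / 2)) powr \<kappa>"
            unfolding \<kappa>_def using t by (intro powr_realpow[symmetric]) simp
          then show ?thesis by (simp add: powr_powr)
        qed
        moreover have "real N powr (- \<kappa>) = 1 / real N ^ (k - 1)"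
          unfolding \<kappa>_def using N0 by (simp add: powr_minus_divide powr_realpow)
        ultimately show ?thesis unfolding h_def by (simp add: power_divide power_mult_distrib)
      qed
      have "H * (C1 * t ^ (k - 1) * t powr \<beta> * (t * a)) =
        (2 ^ (k - 1) * 2 powr \<alpha> * C1) * (real N powr (- \<kappa>)) * (t powr (- \<kappa> / 2) * t powr \<kappa> * (t powr (- \<beta>) * t powr \<beta>)) * (t * a)"
        unfolding H_def hk tk by simp
      also have "t powr (- \<kappa> / 2) * t powr \<kappa> * (t powr (- \<beta>) * t powr \<beta>) = t powr (\<kappa> / 2)"
        using t by (simp flip: powr_add)
      finally have "(H * (C1 * t ^ (k - 1) * t powr \<beta> * (t * a))) powr q =
        (2 ^ (k - 1) * 2 powr \<alpha> * C1) powr q * (real N powr (- \<kappa> * q)) * t powr (\<kappa> / 2 * q) * (t * a) powr q"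
        by (simp only: powr_mult powr_powr)
      then have "(H * (C1 * t ^ (k - 1) * t powr \<beta> * (t * a))) powr q * h =
         C * (real N powr (- \<kappa> * q) * (1 / real N)) * (t powr (\<kappa> / 2 * q) * t powr (- 1 / 2)) * (t * a) powr q"
        unfolding h_def C_def by simp
      also have "real N powr (- \<kappa> * q) * (1 / real N) = real N powr (- (\<kappa> * q) - 1)"
        using N0 by (simp add: powr_diff)
      also have "t powr (\<kappa> / 2 * q) * t powr (- 1 / 2) = t powr ((\<kappa> * q - 1) / 2)"
        using t by (simp add: diff_divide_distrib flip: powr_add)
      finally show ?thesis unfolding \<kappa>_def .
    qed
    finally show ?thesis unfolding t_def .
  qed
  with C show ?thesis by blast
qed

section \<open>Reflection to the endpoint -1\<close>

text \<open>The mirror image of cell \<open>i\<close> has the index \<open>N - 1 - i\<close>, not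
  \<open>N - i\<close>, because a cell is named after its right end node; equidistant points are
  mapped onto equidistant points.\<close>

lemma YY_reflect:
  assumes i: "i < N"
  shows "YY N k (N - 1 - i) = uminus ` YY N k i"
proof -
  have e1: "tau N (Suc (N - 1 - i)) = - tau N i" "tau N (N - 1 - i) = - tau N (Suc i)"
    using tau_reflect[of i N] tau_reflect[of "Suc i" N] i by (simp_all add: Suc_diff_Suc)
  have eq: "- tau N i + real (Suc k - j) / real (Suc k) * (- tau N (Suc i) - - tau N i) =
    - (tau N (Suc i) + real j / real (Suc k) * (tau N i - tau N (Suc i)))" if "j \<in> {1..k}" for j
  proof -
    have e: "real (Suc k - j) / real (Suc k) = 1 - real j / real (Suc k)"
      using that by (simp add: of_nat_diff diff_divide_distrib del: of_nat_Suc)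
    show ?thesis unfolding e by (simp add: algebra_simps del: of_nat_Suc)
  qed
  have im: "(\<lambda>j. Suc k - j) ` {1..k} = {1..k}"
  proof
    show "{1..k} \<subseteq> (\<lambda>j. Suc k - j) ` {1..k}"
    proof
      fix x assume "x \<in> {1..k}"
      then show "x \<in> (\<lambda>j. Suc k - j) ` {1..k}" by (intro image_eqI[of _ _ "Suc k - x"]) auto
    qed
  qed auto
  have "YY N k (N - 1 - i) = (\<lambda>j. - tau N i + real j / real (Suc k) * (- tau N (Suc i) - - tau N i)) ` ((\<lambda>j. Suc k - j) ` {1..k})"
    unfolding YY_def e1 im ..
  also have "... = uminus ` YY N k i"
    unfolding YY_def image_image using eq by (intro image_cong refl) auto
  finally show ?thesis .
qed

lemma DQ_reflect:
  assumes i: "i < N" and k: "1 \<le> k"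
  shows "DQ N k (N - 1 - i) f = - DQ N k i (\<lambda>x. (- 1) ^ k * f (- x))"
proof -
  have "DQ N k (N - 1 - i) f = (- 1) ^ (k - 1) * dd (YY N k i) (\<lambda>x. f (- x))"
    unfolding DQ_def YY_reflect[OF i] using YY_props(1,2)[OF i, where k = k] by (simp add: dd_uminus_image)
  also have "(- 1) ^ (k - 1) = - ((- 1 :: real) ^ k)" using k by (cases k) auto
  finally show ?thesis unfolding DQ_def dd_cmult by simp
qed

lemma jw_reflect: "jw \<alpha> \<beta> (- x) = jw \<beta> \<alpha> x"
  unfolding jw_def by (simp add: mult.commute)

text \<open>The index \<open>N - 2 - i\<close> is chosen so that the cells \<open>i - 1\<close> and
  \<open>i + 2\<close> of the difference are interchanged by the reflection. Mesh and weight are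
  then taken at the node \<open>i + 2\<close> instead of \<open>i\<close>, which costs the
  constants: 6 for the mesh, and \<open>dst\<close> equal to 3 for the weight.\<close>

lemma loc_term_reflect:
  fixes q :: real
  assumes k: "1 \<le> k" and q: "1 \<le> q" and ab: "0 \<le> \<alpha>" "0 \<le> \<beta>" and f: "f \<in> Mset k" and i: "1 \<le> i" "i + 3 \<le> N"
  shows "loc_term N k q \<alpha> \<beta> f (N - 2 - i) \<le>
    (6 ^ (k - 1) * (4 powr (\<alpha> + \<beta>) * 3 powr (2 * (\<alpha> + \<beta>)))) powr q * 6 * loc_term N k q \<beta> \<alpha> (\<lambda>x. (- 1) ^ k * f (- x)) i"
proof -
  let ?g = "\<lambda>x. (- 1) ^ k * f (- x)"
  have g: "?g \<in> Mset k" by (rule Mset_reflect[OF f])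
  have "N - 2 - i - 1 = N - 1 - (i + 2)" "N - 2 - i + 2 = N - 1 - (i - 1)" using i by auto
  then have D: "DQ N k (N - 2 - i - 1) f - DQ N k (N - 2 - i + 2) f = DQ N k (i - 1) ?g - DQ N k (i + 2) ?g"
    using DQ_reflect[of "i + 2" N k f] DQ_reflect[of "i - 1" N k f] i k by simp
  have D0: "DQ N k (i - 1) ?g - DQ N k (i + 2) ?g \<ge> 0"
    using DQ_antimono[OF g, of "i - 1" "i + 2" N] i by simp
  have t: "tau N (N - 2 - i) = - tau N (i + 2)"
    using tau_reflect[of "i + 2" N] i by simp
  have h: "hh N (N - 2 - i) = hh N (i + 2)"
  proof -
    have "real (N - 2 - i) * pi / real N = pi - real (i + 2) * pi / real N"
      using i by (simp add: of_nat_diff field_simps)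
    then show ?thesis unfolding hh_def by simp
  qed
  have h6: "hh N (i + 2) \<le> 6 * hh N i" using hh_ratio[of i N "i + 2"] i by simp
  have hp: "hh N i > 0" "hh N (i + 2) > 0" using i by (auto intro!: hh_pos)
  have d3: "dst N i (tau N (i + 2)) = 3" unfolding dst_def using i by (simp add: arccos_tau)
  have w: "jw \<alpha> \<beta> (tau N (N - 2 - i)) \<le> 4 powr (\<alpha> + \<beta>) * 3 powr (2 * (\<alpha> + \<beta>)) * jw \<beta> \<alpha> (tau N i)"
    unfolding t jw_reflect using jw_le_dst[of i N "tau N (i + 2)" \<beta> \<alpha>] i ab tau_abs_le d3 by (simp add: add.commute)
  have "hh N (N - 2 - i) ^ (k - 1) * (DQ N k (N - 2 - i - 1) f - DQ N k (N - 2 - i + 2) f) * jw \<alpha> \<beta> (tau N (N - 2 - i)) \<le>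
    (6 * hh N i) ^ (k - 1) * (DQ N k (i - 1) ?g - DQ N k (i + 2) ?g) * (4 powr (\<alpha> + \<beta>) * 3 powr (2 * (\<alpha> + \<beta>)) * jw \<beta> \<alpha> (tau N i))"
    unfolding D h using h6 hp D0 w jw_nonneg by (intro mult_mono power_mono) auto
  also have "... = (6 ^ (k - 1) * (4 powr (\<alpha> + \<beta>) * 3 powr (2 * (\<alpha> + \<beta>)))) *
    (hh N i ^ (k - 1) * (DQ N k (i - 1) ?g - DQ N k (i + 2) ?g) * jw \<beta> \<alpha> (tau N i))"
    by (simp add: power_mult_distrib)
  finally have "(hh N (N - 2 - i) ^ (k - 1) * (DQ N k (N - 2 - i - 1) f - DQ N k (N - 2 - i + 2) f) * jw \<alpha> \<beta> (tau N (N - 2 - i))) powr q * hh N (N - 2 - i) \<le>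
    ((6 ^ (k - 1) * (4 powr (\<alpha> + \<beta>) * 3 powr (2 * (\<alpha> + \<beta>)))) *
    (hh N i ^ (k - 1) * (DQ N k (i - 1) ?g - DQ N k (i + 2) ?g) * jw \<beta> \<alpha> (tau N i))) powr q * (6 * hh N i)"
    using hp h6 q D0 jw_nonneg unfolding D h by (intro mult_mono[OF powr_mono2]) auto
  then show ?thesis unfolding loc_term_def by (simp add: powr_mult mult_ac)
qed

lemma measurable_I11_ennreal:
  assumes "F \<in> borel_measurable I11"
  shows "(\<lambda>x. F x * indicator {-1..1} x :: ennreal) \<in> borel_measurable borel"
  using assms unfolding I11_def by (subst (asm) borel_measurable_restrict_space_iff_ennreal) (auto simp: mult.commute)

lemma measurable_uminus_I11: "uminus \<in> I11 \<rightarrow>\<^sub>M I11"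
  unfolding I11_def by (intro measurable_restrict_space3) auto

lemma nn_integral_I11_reflect:
  assumes "F \<in> borel_measurable I11"
  shows "(\<integral>\<^sup>+x. F (- x) \<partial>I11) = (\<integral>\<^sup>+x. F x \<partial>I11)"
proof -
  have "(\<integral>\<^sup>+x. F x \<partial>I11) = (\<integral>\<^sup>+x. F x * indicator {-1..1} x \<partial>lborel)"
    unfolding I11_def by (subst nn_integral_restrict_space) auto
  also have "... = (\<integral>\<^sup>+x. F (- x) * indicator {-1..1} (- x) \<partial>lborel)"
    using nn_integral_real_affine[OF measurable_I11_ennreal[OF assms], of "-1" 0] by simp
  also have "... = (\<integral>\<^sup>+x. F (- x) * indicator {-1..1} x \<partial>lborel)"
    by (intro nn_integral_cong) (auto split: split_indicator)
  also have "... = (\<integral>\<^sup>+x. F (- x) \<partial>I11)"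
    unfolding I11_def by (subst nn_integral_restrict_space) auto
  finally show ?thesis by simp
qed

lemma Xset_uminus: "- x \<in> Xset j \<longleftrightarrow> x \<in> Xset j"
  unfolding Xset_def by auto

lemma Xset_borel: "Xset j \<in> sets borel"
  unfolding Xset_def by measurable

lemma loc_term_nonneg:
  assumes "f \<in> Mset k" "1 \<le> i" "i + 2 < N"
  shows "loc_term N k q \<alpha> \<beta> f i \<ge> 0"
  unfolding loc_term_def using hh_pos[of i N] assms by (intro mult_nonneg_nonneg) auto

lemma half_sum:
  assumes g: "\<And>i. i \<in> {16..N div 2} \<Longrightarrow> 0 \<le> g i" and N: "N \<ge> 1"
  shows "(\<Sum>i\<in>{16..N div 2}. g i) \<le> (\<Sum>j\<in>{j. 2 ^ j \<le> N\<^sup>2}. \<Sum>i\<in>blk N j. g i :: real)"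
proof -
  let ?J = "{j. 2 ^ j \<le> N\<^sup>2}"
  have fJ: "finite ?J"
  proof (rule finite_subset)
    show "?J \<subseteq> {..N\<^sup>2}"
    proof
      fix j assume "j \<in> ?J"
      then have "2 ^ j \<le> N\<^sup>2" by simp
      moreover have "j < 2 ^ j" by (rule less_exp)
      ultimately have "j \<le> N\<^sup>2" by linarith
      then show "j \<in> {..N\<^sup>2}" by simp
    qed
  qed simp
  have "(\<Sum>i\<in>{16..N div 2}. g i) \<le> (\<Sum>i\<in>{16..N div 2}. \<Sum>j\<in>?J. if i \<in> blk N j then g i else 0)"
  proof (rule sum_mono)
    fix i assume i: "i \<in> {16..N div 2}"
    then obtain j where j: "j \<in> ?J" "i \<in> blk N j" using blk_cover[OF N] by blast
    have "g i = (if i \<in> blk N j then g i else 0)" using j by simp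
    also have "... \<le> (\<Sum>j\<in>?J. if i \<in> blk N j then g i else 0)"
      using j fJ g[OF i] by (intro member_le_sum) auto
    finally show "g i \<le> (\<Sum>j\<in>?J. if i \<in> blk N j then g i else 0)" .
  qed
  also have "... = (\<Sum>j\<in>?J. \<Sum>i\<in>{16..N div 2}. if i \<in> blk N j then g i else 0)" by (rule sum.swap)
  also have "... = (\<Sum>j\<in>?J. \<Sum>i\<in>blk N j. g i)"
    by (intro sum.cong refl sum.mono_neutral_cong_right) (auto simp: blk_def)
  finally show ?thesis .
qed

lemma reflect_measurable:
  assumes "wmeas \<alpha> \<beta> f"
  shows "(\<lambda>x. jw \<beta> \<alpha> x * ((- 1) ^ k * f (- x))) \<in> borel_measurable I11"
proof -
  have "(\<lambda>x. (- 1) ^ k * (jw \<alpha> \<beta> (- x) * f (- x))) \<in> borel_measurable I11"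
    using measurable_compose[OF measurable_uminus_I11 assms] by measurable
  moreover have "(\<lambda>x. (- 1) ^ k * (jw \<alpha> \<beta> (- x) * f (- x))) = (\<lambda>x. jw \<beta> \<alpha> x * ((- 1) ^ k * f (- x)))"
    by (simp add: jw_reflect mult_ac)
  ultimately show ?thesis by simp
qed

lemma reflect_nn_integral:
  assumes m: "wmeas \<alpha> \<beta> f"
  shows "(\<integral>\<^sup>+x. ennreal \<bar>jw \<beta> \<alpha> x * ((- 1) ^ k * f (- x))\<bar> * indicator (Xset j) x \<partial>I11) =
    (Xmass \<alpha> \<beta> f j)"
proof -
  have X: "(indicator (Xset j) :: real \<Rightarrow> ennreal) \<in> borel_measurable I11"
    by (intro borel_I11 borel_measurable_indicator Xset_borel)
  have "(\<lambda>x. ennreal \<bar>jw \<alpha> \<beta> x * f x\<bar> * indicator (Xset j) x) \<in> borel_measurable I11"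
    using m X by measurable
  from nn_integral_I11_reflect[OF this] have "(Xmass \<alpha> \<beta> f j) =
    (\<integral>\<^sup>+x. ennreal \<bar>jw \<alpha> \<beta> (- x) * f (- x)\<bar> * indicator (Xset j) (- x) \<partial>I11)" by simp
  also have "... = (\<integral>\<^sup>+x. ennreal \<bar>jw \<beta> \<alpha> x * ((- 1) ^ k * f (- x))\<bar> * indicator (Xset j) x \<partial>I11)"
    by (intro nn_integral_cong) (simp add: jw_reflect abs_mult power_abs indicator_def Xset_uminus)
  finally show ?thesis by simp
qed

text \<open>Nodes in the left half are treated as nodes near 1 of the reflected function, with the
  two exponents of the weight interchanged.\<close>

lemma total_sum_halves:
  fixes q :: real
  assumes k: "1 \<le> k" and q: "1 \<le> q" and ab: "0 \<le> \<alpha>" "0 \<le> \<beta>" and N: "N \<ge> 64" and f: "f \<in> Mset k"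
  shows "loc_sum N k q \<alpha> \<beta> f \<le> (\<Sum>i\<in>{16..N div 2}. loc_term N k q \<alpha> \<beta> f i) +
    (6 ^ (k - 1) * (4 powr (\<alpha> + \<beta>) * 3 powr (2 * (\<alpha> + \<beta>)))) powr q * 6 *
      (\<Sum>i\<in>{16..N div 2}. loc_term N k q \<beta> \<alpha> (\<lambda>x. (- 1) ^ k * f (- x)) i)"
proof -
  let ?g = "\<lambda>x. (- 1) ^ k * f (- x)"
  let ?K = "(6 ^ (k - 1) * (4 powr (\<alpha> + \<beta>) * 3 powr (2 * (\<alpha> + \<beta>)))) powr q * 6"
  have g: "?g \<in> Mset k" by (rule Mset_reflect[OF f])
  have "loc_sum N k q \<alpha> \<beta> f =
    (\<Sum>i\<in>{20..N div 2}. loc_term N k q \<alpha> \<beta> f i) + (\<Sum>i\<in>{Suc (N div 2)..N - 21}. loc_term N k q \<alpha> \<beta> f i)"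
    using N by (subst sum.union_disjoint[symmetric]) (auto intro!: sum.cong)
  also have "(\<Sum>i\<in>{20..N div 2}. loc_term N k q \<alpha> \<beta> f i) \<le> (\<Sum>i\<in>{16..N div 2}. loc_term N k q \<alpha> \<beta> f i)"
    using N by (intro sum_mono2) (auto intro!: loc_term_nonneg f)
  also have "(\<Sum>i\<in>{Suc (N div 2)..N - 21}. loc_term N k q \<alpha> \<beta> f i) =
    (\<Sum>i\<in>{19..N - 2 - Suc (N div 2)}. loc_term N k q \<alpha> \<beta> f (N - 2 - i))"
    using N by (intro sum.reindex_bij_witness[of _ "\<lambda>i. N - 2 - i" "\<lambda>i. N - 2 - i"])
      (auto intro!: arg_cong[where f = "loc_term N k q \<alpha> \<beta> f"])
  also have "... \<le> (\<Sum>i\<in>{19..N - 2 - Suc (N div 2)}. ?K * loc_term N k q \<beta> \<alpha> ?g i)"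
    using N by (intro sum_mono loc_term_reflect k q ab f) auto
  also have "... \<le> (\<Sum>i\<in>{16..N div 2}. ?K * loc_term N k q \<beta> \<alpha> ?g i)"
    using N by (intro sum_mono2) (auto intro!: mult_nonneg_nonneg loc_term_nonneg g)
  also have "... = ?K * (\<Sum>i\<in>{16..N div 2}. loc_term N k q \<beta> \<alpha> ?g i)" by (simp add: sum_distrib_left)
  finally show ?thesis by simp
qed

lemma total_sum:
  fixes k :: nat and q \<alpha> \<beta> :: real
  assumes k: "1 \<le> k" and q: "1 \<le> q" and ab: "0 \<le> \<alpha>" "0 \<le> \<beta>"
  shows "\<exists>C>0. \<forall>N\<ge>64. \<forall>f\<in>Mset k. \<forall>a. (\<lambda>x. jw \<alpha> \<beta> x * f x) \<in> borel_measurable I11 \<longrightarrow> (\<forall>j. 0 \<le> a j) \<longrightarrow>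
    (\<forall>j. (Xmass \<alpha> \<beta> f j) \<le> ennreal (a j)) \<longrightarrow>
    loc_sum N k q \<alpha> \<beta> f \<le>
    C * real N powr (- (real (k - 1) * q) - 1) *
      (\<Sum>j\<in>{j. 2 ^ j \<le> N\<^sup>2}. (2 ^ j) powr ((real (k - 1) * q - 1) / 2) * (2 ^ j * a j) powr q)"
proof -
  obtain C1 where C1: "C1 > 0" "\<And>N f j a. N \<ge> 64 \<Longrightarrow> f \<in> Mset k \<Longrightarrow> (\<lambda>x. jw \<alpha> \<beta> x * f x) \<in> borel_measurable I11 \<Longrightarrow> 0 \<le> a \<Longrightarrow>
    (Xmass \<alpha> \<beta> f j) \<le> ennreal a \<Longrightarrow>
    (\<Sum>i\<in>blk N j. loc_term N k q \<alpha> \<beta> f i) \<le>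
    C1 * real N powr (- (real (k - 1) * q) - 1) * (2 ^ j) powr ((real (k - 1) * q - 1) / 2) * (2 ^ j * a) powr q"
    using blk_sum[OF k q ab] by blast
  obtain C2 where C2: "C2 > 0" "\<And>N f j a. N \<ge> 64 \<Longrightarrow> f \<in> Mset k \<Longrightarrow> (\<lambda>x. jw \<beta> \<alpha> x * f x) \<in> borel_measurable I11 \<Longrightarrow> 0 \<le> a \<Longrightarrow>
    (\<integral>\<^sup>+x. ennreal \<bar>jw \<beta> \<alpha> x * f x\<bar> * indicator (Xset j) x \<partial>I11) \<le> ennreal a \<Longrightarrow>
    (\<Sum>i\<in>blk N j. loc_term N k q \<beta> \<alpha> f i) \<le>
    C2 * real N powr (- (real (k - 1) * q) - 1) * (2 ^ j) powr ((real (k - 1) * q - 1) / 2) * (2 ^ j * a) powr q"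
    using blk_sum[OF k q ab(2,1)] by blast
  define K where "K = (6 ^ (k - 1) * (4 powr (\<alpha> + \<beta>) * 3 powr (2 * (\<alpha> + \<beta>)))) powr q * 6"
  have K: "K \<ge> 0" unfolding K_def by simp
  have "loc_sum N k q \<alpha> \<beta> f \<le>
    (C1 + K * C2) * real N powr (- (real (k - 1) * q) - 1) *
      (\<Sum>j\<in>{j. 2 ^ j \<le> N\<^sup>2}. (2 ^ j) powr ((real (k - 1) * q - 1) / 2) * (2 ^ j * a j) powr q)"
    if N: "N \<ge> 64" and f: "f \<in> Mset k" and m: "wmeas \<alpha> \<beta> f" and a0: "\<And>j. 0 \<le> a j"
     and a: "\<And>j. (Xmass \<alpha> \<beta> f j) \<le> ennreal (a j)" for N f a
  proof -
    let ?g = "\<lambda>x. (- 1) ^ k * f (- x)"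
    let ?J = "{j. 2 ^ j \<le> N\<^sup>2}"
    have g: "?g \<in> Mset k" by (rule Mset_reflect[OF f])
    define S where "S = (\<Sum>j\<in>?J. (2 ^ j) powr ((real (k - 1) * q - 1) / 2) * (2 ^ j * a j) powr q)"
    define NN where "NN = real N powr (- (real (k - 1) * q) - 1)"
    have "(\<Sum>i\<in>{16..N div 2}. loc_term N k q \<alpha> \<beta> f i) \<le> (\<Sum>j\<in>?J. \<Sum>i\<in>blk N j. loc_term N k q \<alpha> \<beta> f i)"
      using N by (intro half_sum loc_term_nonneg f) auto
    also have "... \<le> (\<Sum>j\<in>?J. C1 * NN * (2 ^ j) powr ((real (k - 1) * q - 1) / 2) * (2 ^ j * a j) powr q)"
      unfolding NN_def by (intro sum_mono C1(2) N f m a0 a)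
    also have "... = C1 * NN * S" unfolding S_def sum_distrib_left by (simp add: mult_ac)
    finally have 1: "(\<Sum>i\<in>{16..N div 2}. loc_term N k q \<alpha> \<beta> f i) \<le> C1 * NN * S" .
    have "(\<Sum>i\<in>{16..N div 2}. loc_term N k q \<beta> \<alpha> ?g i) \<le> (\<Sum>j\<in>?J. \<Sum>i\<in>blk N j. loc_term N k q \<beta> \<alpha> ?g i)"
      using N by (intro half_sum loc_term_nonneg g) auto
    also have "... \<le> (\<Sum>j\<in>?J. C2 * NN * (2 ^ j) powr ((real (k - 1) * q - 1) / 2) * (2 ^ j * a j) powr q)"
      unfolding NN_def
      by (intro sum_mono C2(2) N g reflect_measurable m a0) (use a reflect_nn_integral[OF m] in simp)
    also have "... = C2 * NN * S" unfolding S_def sum_distrib_left by (simp add: mult_ac)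
    finally have 2: "(\<Sum>i\<in>{16..N div 2}. loc_term N k q \<beta> \<alpha> ?g i) \<le> C2 * NN * S" .
    have "loc_sum N k q \<alpha> \<beta> f \<le> C1 * NN * S + K * (C2 * NN * S)"
      using total_sum_halves[OF k q ab N f, folded K_def] 1 mult_left_mono[OF 2 K] by linarith
    also have "... = (C1 + K * C2) * NN * S" by (simp add: algebra_simps)
    finally show ?thesis unfolding NN_def S_def .
  qed
  moreover have "C1 + K * C2 > 0" using C1(1) C2(1) K by (intro add_pos_nonneg) auto
  ultimately show ?thesis by blast
qed

section \<open>Hoelder's inequality by splitting at a level\<close>

text \<open>This takes the place of Hoelder's and Young's inequalities: up to a constant they follow
  by choosing the level \<open>l\<close> that balances the two terms. No conjugate exponent appears,
  so \<open>P = 1\<close> and \<open>s = P\<close> need no separate treatment.\<close>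

lemma powr_split_le:
  fixes y s P l :: real
  assumes "0 \<le> y" "0 \<le> s" "s \<le> P" "0 < l"
  shows "y powr s \<le> l powr s + l powr (s - P) * y powr P"
proof (cases "y \<le> l")
  case True
  then have "y powr s \<le> l powr s" using assms by (intro powr_mono2) auto
  then show ?thesis by (simp add: add_increasing2)
next
  case False
  then have y: "y > 0" using assms by simp
  have "y powr s = y powr (s - P) * y powr P" using y by (simp flip: powr_add)
  also have "y powr (s - P) \<le> l powr (s - P)" using False assms by (intro powr_mono2') auto
  finally have "y powr s \<le> l powr (s - P) * y powr P" by (simp add: mult_right_mono)
  then show ?thesis by (simp add: add_increasing)
qed

lemma nn_integral_split_le:
  fixes s P l L G :: real
  assumes g: "g \<in> borel_measurable I11" and s: "0 \<le> s" "s \<le> P" and l: "0 < l" and X: "X \<in> sets I11"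
    and L: "emeasure I11 X \<le> ennreal L" "0 \<le> L"
    and G: "(\<integral>\<^sup>+x. ennreal (\<bar>g x\<bar> powr P) * indicator X x \<partial>I11) \<le> ennreal G" "0 \<le> G"
  shows "(\<integral>\<^sup>+x. ennreal (\<bar>g x\<bar> powr s) * indicator X x \<partial>I11) \<le> ennreal (l powr s * L + l powr (s - P) * G)"
proof -
  note [measurable] = g X
  have "(\<integral>\<^sup>+x. ennreal (\<bar>g x\<bar> powr s) * indicator X x \<partial>I11) \<le>
    (\<integral>\<^sup>+x. ennreal (l powr s) * indicator X x + ennreal (l powr (s - P)) * (ennreal (\<bar>g x\<bar> powr P) * indicator X x) \<partial>I11)"
  proof (rule nn_integral_mono)
    fix x
    have "ennreal (\<bar>g x\<bar> powr s) \<le> ennreal (l powr s + l powr (s - P) * \<bar>g x\<bar> powr P)"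
      using powr_split_le[of "\<bar>g x\<bar>" s P l] s l by (intro ennreal_leI) auto
    also have "... = ennreal (l powr s) + ennreal (l powr (s - P)) * ennreal (\<bar>g x\<bar> powr P)"
      by (simp add: ennreal_mult)
    finally show "ennreal (\<bar>g x\<bar> powr s) * indicator X x \<le>
      ennreal (l powr s) * indicator X x + ennreal (l powr (s - P)) * (ennreal (\<bar>g x\<bar> powr P) * indicator X x)"
      by (auto split: split_indicator)
  qed
  also have "... = ennreal (l powr s) * emeasure I11 X +
      ennreal (l powr (s - P)) * (\<integral>\<^sup>+x. ennreal (\<bar>g x\<bar> powr P) * indicator X x \<partial>I11)"
    by (simp add: nn_integral_add nn_integral_cmult)
  also have "... \<le> ennreal (l powr s) * ennreal L + ennreal (l powr (s - P)) * ennreal G"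
    using L G by (intro add_mono mult_left_mono) auto
  also have "... = ennreal (l powr s * L + l powr (s - P) * G)"
    using L G by (simp add: ennreal_mult ennreal_plus)
  finally show ?thesis .
qed

lemma Lp_norm_finite: "Lp_norm p g < \<infinity> \<Longrightarrow> g \<in> borel_measurable I11"
  unfolding Lp_norm_def by (auto split: if_splits)

lemma Lp_norm_eq_1_finite:
  assumes "Lp_norm (ereal P) g = 1" "P > 0"
  shows "(\<integral>\<^sup>+x. ennreal (\<bar>g x\<bar> powr P) \<partial>I11) = 1"
proof -
  define I where "I = (\<integral>\<^sup>+x. ennreal (\<bar>g x\<bar> powr P) \<partial>I11)"
  have I: "I \<noteq> \<infinity>" "ennreal (enn2real I powr (1 / P)) = 1"
    using assms unfolding Lp_norm_def I_def by (auto simp: Let_def split: if_splits)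
  then have "enn2real I powr (1 / P) = 1" by (simp add: ennreal_eq_1)
  then have "(enn2real I powr (1 / P)) powr P = 1 powr P" by simp
  then have "enn2real I = 1" using assms(2) by (simp add: powr_powr)
  then have "I = 1" using I(1) by (metis ennreal_1 ennreal_enn2real_if infinity_ennreal_def)
  then show ?thesis unfolding I_def .
qed

text \<open>For finite \<open>p\<close> the level L^(-1/p) balances the two parts of the split,
  which makes them equal and explains the factor 2; for infinite \<open>p\<close> the function is at
  most 1 almost everywhere.\<close>

lemma holder_set:
  fixes s L :: real and p :: ereal
  assumes g: "Lp_norm p g = 1" and s: "1 \<le> s" "ereal s < p" and X: "X \<in> sets I11" and L: "emeasure I11 X \<le> ennreal L" "0 < L"
  shows "(\<integral>\<^sup>+x. ennreal (\<bar>g x\<bar> powr s) * indicator X x \<partial>I11) \<le> ennreal (2 * L powr (1 - s * einv p))"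
proof -
  have m: "g \<in> borel_measurable I11" using g by (intro Lp_norm_finite[of p]) simp
  note [measurable] = m X
  consider "p = \<infinity>" | P where "p = ereal P" using s by (cases p) auto
  then show ?thesis
  proof cases
    case 1
    have "AE x in I11. ennreal \<bar>g x\<bar> \<le> esssup I11 (\<lambda>x. ennreal \<bar>g x\<bar>)" by (rule esssup_AE)
    moreover have "esssup I11 (\<lambda>x. ennreal \<bar>g x\<bar>) = 1" using g 1 m unfolding Lp_norm_def by auto
    ultimately have ae: "AE x in I11. \<bar>g x\<bar> \<le> 1" by simp
    have "(\<integral>\<^sup>+x. ennreal (\<bar>g x\<bar> powr s) * indicator X x \<partial>I11) \<le> (\<integral>\<^sup>+x. indicator X x \<partial>I11)"
    proof (rule nn_integral_mono_AE, use ae in eventually_elim)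
      fix x assume "\<bar>g x\<bar> \<le> 1"
      then have "\<bar>g x\<bar> powr s \<le> 1" using s powr_mono2[of s "\<bar>g x\<bar>" 1] by simp
      then show "ennreal (\<bar>g x\<bar> powr s) * indicator X x \<le> indicator X x"
        by (auto split: split_indicator simp: ennreal_le_1)
    qed
    also have "... \<le> ennreal L" using L by simp
    also have "... \<le> ennreal (2 * L powr (1 - s * einv p))" using L by (intro ennreal_leI) (simp add: 1 einv_def)
    finally show ?thesis .
  next
    case 2
    have P: "s < P" "P > 0" using s 2 by auto
    define l where "l = L powr (- 1 / P)"
    have l: "l > 0" unfolding l_def using L by simp
    have "(\<integral>\<^sup>+x. ennreal (\<bar>g x\<bar> powr P) * indicator X x \<partial>I11) \<le> (\<integral>\<^sup>+x. ennreal (\<bar>g x\<bar> powr P) \<partial>I11)"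
      by (intro nn_integral_mono) (auto split: split_indicator)
    also have "... \<le> ennreal 1" using Lp_norm_eq_1_finite[of P g] g 2 P by simp
    finally have "(\<integral>\<^sup>+x. ennreal (\<bar>g x\<bar> powr s) * indicator X x \<partial>I11) \<le> ennreal (l powr s * L + l powr (s - P) * 1)"
      using s P l L by (intro nn_integral_split_le m X) auto
    also have "l powr s * L + l powr (s - P) * 1 = 2 * L powr (1 - s * einv p)"
    proof -
      have "l powr s * L = L powr (- s / P) * L powr 1" unfolding l_def using L by (simp add: powr_powr)
      also have "... = L powr (1 - s * einv p)" by (subst powr_add[symmetric]) (simp add: 2 einv_def)
      finally have 1: "l powr s * L = L powr (1 - s * einv p)" .
      have "l powr (s - P) = L powr (- 1 / P * (s - P))" unfolding l_def by (simp only: powr_powr)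
      also have "- 1 / P * (s - P) = 1 - s * einv p" using P by (simp add: 2 einv_def field_simps)
      finally show ?thesis using 1 by simp
    qed
    finally show ?thesis .
  qed
qed

lemma Lp_norm_le:
  assumes F: "F \<in> borel_measurable I11" and q: "q > 0" and B: "0 \<le> B"
    and I: "(\<integral>\<^sup>+x. ennreal (\<bar>F x\<bar> powr q) \<partial>I11) \<le> ennreal B"
  shows "Lp_norm (ereal q) F \<le> ennreal (B powr (1 / q))"
proof -
  define I' where "I' = (\<integral>\<^sup>+x. ennreal (\<bar>F x\<bar> powr q) \<partial>I11)"
  have fin: "I' \<noteq> \<infinity>" using I unfolding I'_def by (auto simp: top_unique)
  have "enn2real I' \<le> B" using I B unfolding I'_def by (metis enn2real_ennreal enn2real_mono ennreal_less_top)
  then have "enn2real I' powr (1 / q) \<le> B powr (1 / q)" using q by (intro powr_mono2) auto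
  moreover have "Lp_norm (ereal q) F = ennreal (enn2real I' powr (1 / q))"
    using F fin unfolding Lp_norm_def I'_def by (auto simp: Let_def)
  ultimately show ?thesis by (simp add: ennreal_leI)
qed

lemma einv_bounds:
  assumes "1 \<le> q" "ereal q < p"
  shows "0 \<le> einv p" "q * einv p < 1" "einv p < 1"
proof -
  consider "p = \<infinity>" | P where "p = ereal P" using assms by (cases p) auto
  then show "0 \<le> einv p" "q * einv p < 1" "einv p < 1"
    using assms by (cases; auto simp: einv_def)+
qed

lemma one_minus_tau_upper: "1 - tau N i \<le> 5 * (real i / real N)\<^sup>2"
proof -
  define a where "a = real i * pi / real N / 2"
  have "(sin a)\<^sup>2 \<le> a\<^sup>2" using abs_sin_x_le_abs_x[of a] by (metis power2_abs power_mono abs_ge_zero)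
  also have "a\<^sup>2 = pi\<^sup>2 / 4 * (real i / real N)\<^sup>2" unfolding a_def by (simp add: power_divide power_mult_distrib mult.commute)
  also have "... \<le> 10 / 4 * (real i / real N)\<^sup>2"
  proof (rule mult_right_mono)
    have "pi\<^sup>2 \<le> (3.15)\<^sup>2" using pi_approx by (intro power_mono) auto
    then show "pi\<^sup>2 / 4 \<le> 10 / 4" by (simp add: power2_eq_square)
  qed simp
  finally show ?thesis unfolding one_minus_tau a_def by simp
qed

lemma emeasure_I11_eq:
  assumes "A \<in> sets borel"
  shows "A \<inter> {-1..1} \<in> sets I11" "emeasure I11 (A \<inter> {-1..1}) = emeasure lborel (A \<inter> {-1..1})"
proof -
  show 1: "A \<inter> {-1..1} \<in> sets I11"
    unfolding I11_def sets_restrict_space using assms by (auto intro!: image_eqI[of _ _ A])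
  show "emeasure I11 (A \<inter> {-1..1}) = emeasure lborel (A \<inter> {-1..1})"
    unfolding I11_def using assms by (subst emeasure_restrict_space) auto
qed

lemma emeasure_two_intervals_le:
  assumes "A \<in> sets borel" "A \<inter> {-1..1} \<subseteq> {a..b} \<union> {c..d}" "a \<le> b" "c \<le> d" "(b - a) + (d - c) \<le> L"
  shows "emeasure I11 (A \<inter> {-1..1}) \<le> ennreal L"
proof -
  have "emeasure I11 (A \<inter> {-1..1}) = emeasure lborel (A \<inter> {-1..1})" by (rule emeasure_I11_eq(2)[OF assms(1)])
  also have "... \<le> emeasure lborel ({a..b} \<union> {c..d})" using assms by (intro emeasure_mono) auto
  also have "... \<le> emeasure lborel {a..b} + emeasure lborel {c..d}" by (rule emeasure_subadditive) auto
  also have "... = ennreal ((b - a) + (d - c))" using assms by (simp add: ennreal_plus)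
  also have "... \<le> ennreal L" using assms by (intro ennreal_leI)
  finally show ?thesis .
qed

lemma nn_integral_I11_indicator:
  "(\<integral>\<^sup>+x. G x * indicator A x \<partial>I11) = (\<integral>\<^sup>+x. G x * indicator (A \<inter> {-1..1}) x \<partial>I11)"
  by (intro nn_integral_cong) (auto split: split_indicator)

lemma emeasure_Xset: "emeasure I11 (Xset j \<inter> {-1..1}) \<le> ennreal (4 / 2 ^ j)"
proof (rule emeasure_two_intervals_le[OF Xset_borel])
  let ?lo = "1 / 2 ^ j / 8 :: real" and ?hi = "7 / 4 * (1 / 2 ^ j) :: real"
  show "Xset j \<inter> {-1..1} \<subseteq> {1 - ?hi..1 - ?lo} \<union> {-1 + ?lo..-1 + ?hi}"
    unfolding Xset_def by auto
  show "1 - ?hi \<le> 1 - ?lo" "-1 + ?lo \<le> -1 + ?hi" by (simp_all add: field_simps)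
  show "(1 - ?lo - (1 - ?hi)) + (-1 + ?hi - (-1 + ?lo)) \<le> 4 / 2 ^ j" by (simp add: field_simps)
qed

lemma BsetD:
  assumes "f \<in> Bset p \<alpha> \<beta>"
  shows "Lp_norm p (\<lambda>x. jw \<alpha> \<beta> x * f x) = 1" "wmeas \<alpha> \<beta> f"
proof -
  show 1: "Lp_norm p (\<lambda>x. jw \<alpha> \<beta> x * f x) = 1" using assms unfolding Bset_def by simp
  show "wmeas \<alpha> \<beta> f" using 1 by (intro Lp_norm_finite[of p]) simp
qed

lemma error_measurable:
  assumes "wmeas \<alpha> \<beta> f"
  shows "(\<lambda>x. jw \<alpha> \<beta> x * (f x - poly P x)) \<in> borel_measurable I11"
proof -
  have "(\<lambda>x. jw \<alpha> \<beta> x * poly P x) \<in> borel_measurable I11" by (intro borel_I11) measurable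
  then have "(\<lambda>x. jw \<alpha> \<beta> x * f x - jw \<alpha> \<beta> x * poly P x) \<in> borel_measurable I11" using assms by measurable
  then show ?thesis by (simp add: right_diff_distrib)
qed

section \<open>Upper bounds\<close>

text \<open>Reduces the upper bounds to estimates of \<open>loc_sum\<close>. The other part of
  \<open>local_approx\<close>, the end zones, has measure of order N^(-2), and Hoelder gives it the
  exponent -(2 - 2 q / p): hence the restriction on \<open>e\<close>.\<close>

lemma Edev_upper:
  fixes q \<alpha> \<beta> e s :: real and p :: ereal and k :: nat
  assumes k: "1 \<le> k" and q: "1 \<le> q" and qp: "ereal q < p" and ab: "0 \<le> \<alpha>" "0 \<le> \<beta>"
    and e: "0 \<le> e" "e \<le> 2 - 2 * q * einv p" and s: "0 \<le> s"
    and H: "\<exists>C>0. \<forall>N\<ge>64. \<forall>f\<in>Mset k \<inter> Bset p \<alpha> \<beta>. loc_sum N k q \<alpha> \<beta> f \<le>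
      C * real N powr (- e) * ln (real N + 1) powr s"
  shows "\<exists>c>0. \<forall>n\<ge>1. Edev (Mset k \<inter> Bset p \<alpha> \<beta>) n (jw \<alpha> \<beta>) (ereal q) \<le>
      ennreal (c * real n powr (- e / q) * ln (real n + 1) powr (s / q))"
proof -
  note ei = einv_bounds[OF q qp]
  obtain C1 where C1: "C1 > 0" "\<And>N f. N \<ge> 64 \<Longrightarrow> f \<in> Mset k \<inter> Bset p \<alpha> \<beta> \<Longrightarrow>
    loc_sum N k q \<alpha> \<beta> f \<le> C1 * real N powr (- e) * ln (real N + 1) powr s"
    using H by blast
  obtain C0 R0 where C0: "C0 > 0" "\<And>N f. N \<ge> 64 \<Longrightarrow> f \<in> Mset k \<Longrightarrow> (\<lambda>x. jw \<alpha> \<beta> x * f x) \<in> borel_measurable I11 \<Longrightarrow>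
    (\<integral>\<^sup>+x. ennreal (\<bar>jw \<alpha> \<beta> x * f x\<bar> powr q) \<partial>I11) < \<infinity> \<Longrightarrow>
    (\<exists>P. degree P \<le> R0 * N \<and>
      werr \<alpha> \<beta> q f P \<le>
      ennreal (C0 * loc_sum N k q \<alpha> \<beta> f) +
      ennreal C0 * (\<integral>\<^sup>+x. ennreal (\<bar>jw \<alpha> \<beta> x * f x\<bar> powr q) * indicator {x. x \<ge> tau N 21 \<or> x \<le> tau N (N - 21)} x \<partial>I11))"
    using local_approx[OF k q ab, folded loc_term_def] by blast
  define R where "R = Suc R0"
  define \<theta> where "\<theta> = 1 - q * einv p"
  have \<theta>: "\<theta> > 0" "e \<le> 2 * \<theta>" unfolding \<theta>_def using ei e by auto
  define D where "D = C0 * C1 + C0 * (2 * 4410 powr \<theta>)"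
  have D: "D > 0" unfolding D_def using C0 C1 by (simp add: add_pos_nonneg)
  define B0 where "B0 = 2 * 2 powr \<theta>"
  define c1 where "c1 = D powr (1 / q) * (2 * real R) powr (e / q)"
  \<comment> \<open>The constant for the finitely many small \<open>n\<close>, where the polynomial
    0 is used; ln 2 is the least value of the logarithm.\<close>
  define c2 where "c2 = B0 powr (1 / q) * (64 * real R) powr (e / q) * ln 2 powr (- s / q)"
  have c12: "c1 > 0" "c2 > 0" unfolding c1_def c2_def B0_def R_def using D by auto
  have fin: "(\<integral>\<^sup>+x. ennreal (\<bar>jw \<alpha> \<beta> x * f x\<bar> powr q) \<partial>I11) \<le> ennreal B0" if f: "f \<in> Bset p \<alpha> \<beta>" for f
  proof -
    have "(\<integral>\<^sup>+x. ennreal (\<bar>jw \<alpha> \<beta> x * f x\<bar> powr q) \<partial>I11) =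
      (\<integral>\<^sup>+x. ennreal (\<bar>jw \<alpha> \<beta> x * f x\<bar> powr q) * indicator {-1..1} x \<partial>I11)"
      by (intro nn_integral_cong) auto
    also have "... \<le> ennreal (2 * 2 powr (1 - q * einv p))"
      using sets_I11_interval[of "-1" 1] emeasure_I11_interval[of "-1" 1]
      by (intro holder_set[OF BsetD(1)[OF f] q qp]) auto
    finally show ?thesis unfolding B0_def \<theta>_def .
  qed
  have En_le: "En n f (jw \<alpha> \<beta>) (ereal q) \<le> ennreal ((c1 + c2) * real n powr (- e / q) * ln (real n + 1) powr (s / q))"
    if n: "n \<ge> 1" and f: "f \<in> Mset k \<inter> Bset p \<alpha> \<beta>" for n f
  proof (cases "n \<ge> 64 * R")
    case True
    define N where "N = n div R"
    have R: "R \<ge> 1" unfolding R_def by simp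
    have N64: "N \<ge> 64" unfolding N_def using True R by (metis div_le_mono nonzero_mult_div_cancel_right not_one_le_zero)
    have RN: "R * N \<le> n" unfolding N_def by (metis div_times_less_eq_dividend mult.commute)
    have nN: "real n \<le> 2 * real R * real N"
    proof -
      have "n < R * N + R" unfolding N_def using R by (metis dividend_less_div_times less_eq_Suc_le mult.commute add.commute One_nat_def)
      moreover have "R \<le> R * N" using N64 by simp
      ultimately have "n \<le> 2 * R * N" by linarith
      then show ?thesis by (metis of_nat_le_iff of_nat_mult of_nat_numeral)
    qed
    note m = BsetD(2)[of f p \<alpha> \<beta>]
    have fM: "f \<in> Mset k" "f \<in> Bset p \<alpha> \<beta>" using f by auto
    have fin': "(\<integral>\<^sup>+x. ennreal (\<bar>jw \<alpha> \<beta> x * f x\<bar> powr q) \<partial>I11) < \<infinity>"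
      using fin[OF fM(2)] by (auto simp: less_top[symmetric] top_unique)
    obtain P where P: "degree P \<le> R0 * N"
      "werr \<alpha> \<beta> q f P \<le>
      ennreal (C0 * loc_sum N k q \<alpha> \<beta> f) +
      ennreal C0 * (\<integral>\<^sup>+x. ennreal (\<bar>jw \<alpha> \<beta> x * f x\<bar> powr q) * indicator {x. x \<ge> tau N 21 \<or> x \<le> tau N (N - 21)} x \<partial>I11)"
      using C0(2)[OF N64 fM(1) m[OF fM(2)] fin'] by blast
    have "degree P \<le> n" using P(1) RN unfolding R_def by simp
    define Nt where "Nt = real N powr (- e) * ln (real N + 1) powr s"
    have lnN: "ln (real N + 1) \<ge> 1"
    proof -
      have "exp 1 \<le> real N + 1" using exp_le N64 by simp
      then show ?thesis by (metis exp_gt_zero ln_exp ln_le_cancel_iff order_less_le_trans)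
    qed
    let ?E = "{x. x \<ge> tau N 21 \<or> x \<le> tau N (N - 21)}"
    have IE: "(\<integral>\<^sup>+x. ennreal (\<bar>jw \<alpha> \<beta> x * f x\<bar> powr q) * indicator ?E x \<partial>I11) \<le> ennreal (2 * 4410 powr \<theta> * Nt)"
    proof -
      have Eb: "?E \<in> sets borel" by measurable
      have t: "tau N (N - 21) = - tau N 21" using tau_reflect[of 21 N] N64 by simp
      \<comment> \<open>5 * 21^2 = 2205, and both ends together give 4410.\<close>
      have "1 - tau N 21 \<le> 2205 * (1 / real N)\<^sup>2" using one_minus_tau_upper[of N 21] by (simp add: power_divide)
      then have "emeasure I11 (?E \<inter> {-1..1}) \<le> ennreal (4410 * (1 / real N)\<^sup>2)"
        using t tau_abs_le[of N 21]
        by (intro emeasure_two_intervals_le[OF Eb, of "tau N 21" 1 "-1" "- tau N 21"]) auto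
      then have "(\<integral>\<^sup>+x. ennreal (\<bar>jw \<alpha> \<beta> x * f x\<bar> powr q) * indicator (?E \<inter> {-1..1}) x \<partial>I11) \<le>
        ennreal (2 * (4410 * (1 / real N)\<^sup>2) powr (1 - q * einv p))"
        using emeasure_I11_eq(1)[OF Eb] N64 by (intro holder_set[OF BsetD(1)[OF fM(2)] q qp]) auto
      also have "... \<le> ennreal (2 * 4410 powr \<theta> * Nt)"
      proof (rule ennreal_leI)
        have "((1 / real N)\<^sup>2) powr \<theta> = real N powr (- (2 * \<theta>))"
        proof -
          have "(1 / real N)\<^sup>2 = real N powr (- 2)" using N64 by (simp add: powr_minus_divide power_one_over)
          then show ?thesis by (simp only: powr_powr) simp
        qed
        also have "... \<le> real N powr (- e)" using \<theta> N64 by (intro powr_mono) auto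
        also have "... \<le> Nt"
          unfolding Nt_def using lnN s by (simp add: ge_one_powr_ge_zero mult_le_cancel_left1)
        finally have "((1 / real N)\<^sup>2) powr \<theta> \<le> Nt" .
        then show "2 * (4410 * (1 / real N)\<^sup>2) powr (1 - q * einv p) \<le> 2 * 4410 powr \<theta> * Nt"
          unfolding \<theta>_def[symmetric] powr_mult by simp
      qed
      finally show ?thesis by (subst nn_integral_I11_indicator)
    qed
    have Nt0: "Nt \<ge> 0" unfolding Nt_def by simp
    have "werr \<alpha> \<beta> q f P \<le>
      ennreal (C0 * (C1 * Nt)) + ennreal C0 * ennreal (2 * 4410 powr \<theta> * Nt)"
    proof (rule order_trans[OF P(2)], intro add_mono mult_left_mono IE ennreal_leI)
      show "loc_sum N k q \<alpha> \<beta> f \<le> C1 * Nt"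
        unfolding Nt_def using C1(2)[OF N64 f] by (simp add: mult_ac)
    qed (use C0 in auto)
    also have "... = ennreal (D * Nt)"
    proof -
      have "ennreal C0 * ennreal (2 * 4410 powr \<theta> * Nt) = ennreal (C0 * (2 * 4410 powr \<theta> * Nt))"
        using C0(1) Nt0 by (intro ennreal_mult[symmetric]) auto
      moreover have "ennreal (C0 * (C1 * Nt)) + ennreal (C0 * (2 * 4410 powr \<theta> * Nt)) =
        ennreal (C0 * (C1 * Nt) + C0 * (2 * 4410 powr \<theta> * Nt))"
        using C0(1) C1(1) Nt0 by (intro ennreal_plus[symmetric]) auto
      moreover have "C0 * (C1 * Nt) + C0 * (2 * 4410 powr \<theta> * Nt) = D * Nt"
        unfolding D_def by (simp add: algebra_simps)
      ultimately show ?thesis by simp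
    qed
    finally have I: "werr \<alpha> \<beta> q f P \<le> ennreal (D * Nt)" .
    have "En n f (jw \<alpha> \<beta>) (ereal q) \<le> Lp_norm (ereal q) (\<lambda>x. jw \<alpha> \<beta> x * (f x - poly P x))"
      unfolding En_def using \<open>degree P \<le> n\<close> by (intro INF_lower) auto
    also have "... \<le> ennreal ((D * Nt) powr (1 / q))"
      using q D Nt0 by (intro Lp_norm_le error_measurable m fM I) auto
    also have "... \<le> ennreal ((c1 + c2) * real n powr (- e / q) * ln (real n + 1) powr (s / q))"
    proof (rule ennreal_leI)
      have "Nt powr (1 / q) = real N powr (- e / q) * ln (real N + 1) powr (s / q)"
        unfolding Nt_def by (simp add: powr_mult powr_powr)
      also have "... \<le> ((2 * real R) powr (e / q) * real n powr (- e / q)) * ln (real n + 1) powr (s / q)"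
      proof (intro mult_mono powr_mono2)
        have "real n powr (e / q) \<le> (2 * real R * real N) powr (e / q)" using nN e q by (intro powr_mono2) auto
        then have "real n powr (e / q) \<le> (2 * real R) powr (e / q) * real N powr (e / q)" by (simp only: powr_mult)
        then show "real N powr (- e / q) \<le> (2 * real R) powr (e / q) * real n powr (- e / q)"
          using n N64 by (simp add: powr_minus field_simps)
        have "N \<le> n" using RN R by (metis (no_types, lifting) dual_order.trans le_square mult_le_cancel2 mult.commute mult_le_mono1 nat_mult_1)
        then show "ln (real N + 1) \<le> ln (real n + 1)" by simp
      qed (use lnN s q in auto)
      finally have "(D * Nt) powr (1 / q) \<le> c1 * real n powr (- e / q) * ln (real n + 1) powr (s / q)"
        unfolding c1_def powr_mult using D by (simp add: mult_ac mult_left_mono)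
      also have "... \<le> (c1 + c2) * real n powr (- e / q) * ln (real n + 1) powr (s / q)"
        using c12 by (intro mult_right_mono) auto
      finally show "(D * Nt) powr (1 / q) \<le> (c1 + c2) * real n powr (- e / q) * ln (real n + 1) powr (s / q)" .
    qed
    finally show ?thesis .
  next
    case False
    have fM: "f \<in> Mset k" "f \<in> Bset p \<alpha> \<beta>" using f by auto
    have "En n f (jw \<alpha> \<beta>) (ereal q) \<le> Lp_norm (ereal q) (\<lambda>x. jw \<alpha> \<beta> x * (f x - poly 0 x))"
      unfolding En_def by (intro INF_lower) auto
    also have "... \<le> ennreal (B0 powr (1 / q))"
      using q fin[OF fM(2)] by (intro Lp_norm_le error_measurable BsetD(2)[OF fM(2)]) (auto simp: B0_def)
    also have "... \<le> ennreal ((c1 + c2) * real n powr (- e / q) * ln (real n + 1) powr (s / q))"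
    proof (rule ennreal_leI)
      have "real n \<le> 64 * real R" using False by simp
      then have "(64 * real R) powr (- (e / q)) \<le> real n powr (- (e / q))"
        using n e q by (intro powr_mono2') auto
      then have 1: "1 \<le> (64 * real R) powr (e / q) * real n powr (- e / q)"
        using R_def by (simp add: powr_minus field_simps)
      have "ln 2 powr (s / q) \<le> ln (real n + 1) powr (s / q)" using n s q by (intro powr_mono2) auto
      then have 2: "1 \<le> ln 2 powr (- s / q) * ln (real n + 1) powr (s / q)"
        by (simp add: powr_minus field_simps)
      have "B0 powr (1 / q) * 1 * 1 \<le> B0 powr (1 / q) * ((64 * real R) powr (e / q) * real n powr (- e / q)) * (ln 2 powr (- s / q) * ln (real n + 1) powr (s / q))"
        by (intro mult_mono 1 2 mult_left_mono) auto
      also have "... = c2 * real n powr (- e / q) * ln (real n + 1) powr (s / q)" unfolding c2_def by simp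
      also have "... \<le> (c1 + c2) * real n powr (- e / q) * ln (real n + 1) powr (s / q)"
        using c12 by (intro mult_right_mono) auto
      finally show "B0 powr (1 / q) \<le> (c1 + c2) * real n powr (- e / q) * ln (real n + 1) powr (s / q)" by simp
    qed
    finally show ?thesis .
  qed
  show ?thesis
  proof (intro exI[of _ "c1 + c2"] conjI allI impI)
    fix n :: nat assume "n \<ge> 1"
    then show "Edev (Mset k \<inter> Bset p \<alpha> \<beta>) n (jw \<alpha> \<beta>) (ereal q) \<le>
      ennreal ((c1 + c2) * real n powr (- e / q) * ln (real n + 1) powr (s / q))"
      unfolding Edev_def by (intro SUP_least En_le)
  qed (use c12 in auto)
qed

section \<open>The series over the dyadic levels\<close>

lemma dyadic_levels:
  fixes N :: nat
  assumes "N \<ge> 1"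
  obtains m where "{j. 2 ^ j \<le> N\<^sup>2} = {..m}" "2 ^ m \<le> N\<^sup>2"
proof -
  let ?J = "{j. 2 ^ j \<le> N\<^sup>2}"
  have sub: "?J \<subseteq> {..N\<^sup>2}"
  proof
    fix j assume "j \<in> ?J"
    then have "2 ^ j \<le> N\<^sup>2" by simp
    moreover have "j < 2 ^ j" by (rule less_exp)
    ultimately have "j \<le> N\<^sup>2" by linarith
    then show "j \<in> {..N\<^sup>2}" by simp
  qed
  then have fin: "finite ?J" by (rule finite_subset) simp
  have "0 \<in> ?J" using assms by simp
  then have ne: "?J \<noteq> {}" by blast
  have mJ: "Max ?J \<in> ?J" using fin ne by (rule Max_in)
  have "?J = {..Max ?J}"
  proof
    show "?J \<subseteq> {..Max ?J}" using fin by auto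
    show "{..Max ?J} \<subseteq> ?J"
    proof
      fix j assume "j \<in> {..Max ?J}"
      then have "(2::nat) ^ j \<le> 2 ^ Max ?J" by (intro power_increasing) auto
      moreover have "2 ^ Max ?J \<le> N\<^sup>2" using mJ by simp
      ultimately have "2 ^ j \<le> N\<^sup>2" by (rule le_trans)
      then show "j \<in> ?J" by simp
    qed
  qed
  with mJ that show thesis by blast
qed

lemma dyadic_sum_pos:
  fixes N :: nat and \<rho> :: real
  assumes "\<rho> > 0" "N \<ge> 1"
  shows "(\<Sum>j\<in>{j. 2 ^ j \<le> N\<^sup>2}. (2 ^ j) powr \<rho>) \<le> 2 powr \<rho> / (2 powr \<rho> - 1) * real N powr (2 * \<rho>)"
proof -
  obtain m where m: "{j. 2 ^ j \<le> N\<^sup>2} = {..m}" "2 ^ m \<le> N\<^sup>2" using dyadic_levels[OF assms(2)] .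
  define r where "r = 2 powr \<rho>"
  have r: "r > 1" unfolding r_def using assms by simp
  have pw: "(2 ^ j) powr \<rho> = r ^ j" for j unfolding r_def by (simp add: powr_powr mult.commute flip: powr_realpow)
  have "(\<Sum>j\<in>{..m}. r ^ j) = (\<Sum>j<Suc m. r ^ j)" by (simp only: lessThan_Suc_atMost)
  also have "... = (r ^ Suc m - 1) / (r - 1)" by (rule geometric_sum) (use r in simp)
  also have "... \<le> r ^ Suc m / (r - 1)" using r by (intro divide_right_mono) auto
  also have "... = r / (r - 1) * (2 ^ m) powr \<rho>" unfolding pw by simp
  also have "... \<le> r / (r - 1) * real N powr (2 * \<rho>)"
  proof (rule mult_left_mono)
    have "real (2 ^ m) \<le> real (N\<^sup>2)" using m(2) of_nat_le_iff by blast
    then have "(2 ^ m) powr \<rho> \<le> ((real N)\<^sup>2) powr \<rho>" using assms by (intro powr_mono2) auto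
    also have "(real N)\<^sup>2 = real N powr 2" using assms by simp
    also have "(real N powr 2) powr \<rho> = real N powr (2 * \<rho>)" by (rule powr_powr)
    finally show "(2 ^ m) powr \<rho> \<le> real N powr (2 * \<rho>)" .
  qed (use r in auto)
  finally show ?thesis unfolding m(1) pw r_def .
qed

lemma dyadic_sum_neg:
  fixes N :: nat and \<rho> :: real
  assumes "\<rho> < 0" "N \<ge> 1"
  shows "(\<Sum>j\<in>{j. 2 ^ j \<le> N\<^sup>2}. (2 ^ j) powr \<rho>) \<le> 1 / (1 - 2 powr \<rho>)"
proof -
  obtain m where m: "{j. 2 ^ j \<le> N\<^sup>2} = {..m}" "2 ^ m \<le> N\<^sup>2" using dyadic_levels[OF assms(2)] .
  define r where "r = 2 powr \<rho>"
  have r: "r < 1" "r > 0" unfolding r_def using assms powr_less_mono[of \<rho> 0 2] by auto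
  have pw: "(2 ^ j) powr \<rho> = r ^ j" for j unfolding r_def by (simp add: powr_powr mult.commute flip: powr_realpow)
  have "(\<Sum>j\<in>{..m}. r ^ j) = (\<Sum>j<Suc m. r ^ j)" by (simp only: lessThan_Suc_atMost)
  also have "... = (1 - r ^ Suc m) / (1 - r)" using r by (subst geometric_sum) (auto simp: field_simps)
  also have "... \<le> 1 / (1 - r)" using r by (intro divide_right_mono) auto
  finally show ?thesis unfolding m(1) pw r_def .
qed

lemma dyadic_card:
  fixes N :: nat
  assumes "N \<ge> 1"
  shows "real (card {j. 2 ^ j \<le> N\<^sup>2}) \<le> 3 / ln 2 * ln (real N + 1)"
proof -
  obtain m where m: "{j. 2 ^ j \<le> N\<^sup>2} = {..m}" "2 ^ m \<le> N\<^sup>2" using dyadic_levels[OF assms] .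
  have "real (2 ^ m) \<le> real (N\<^sup>2)" using m(2) of_nat_le_iff by blast
  then have "ln (2 ^ m) \<le> ln ((real N)\<^sup>2)" using assms by (subst ln_le_cancel_iff) auto
  then have "real m * ln 2 \<le> 2 * ln (real N)" using assms by (simp add: ln_realpow)
  also have "... \<le> 2 * ln (real N + 1)" using assms by simp
  finally have "real m * ln 2 \<le> 2 * ln (real N + 1)" .
  moreover have "ln 2 \<le> ln (real N + 1)" using assms by simp
  moreover have "(real m + 1) * ln 2 = real m * ln 2 + ln 2" by (simp add: distrib_right)
  ultimately have "(real m + 1) * ln 2 \<le> 3 * ln (real N + 1)" by linarith
  then show ?thesis unfolding m(1) by (simp add: field_simps)
qed

lemma Xset_hoelder:
  fixes p :: ereal
  assumes f: "f \<in> Bset p \<alpha> \<beta>" and p: "ereal 1 < p"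
  shows "Xmass \<alpha> \<beta> f j \<le> ennreal (2 * (4 / 2 ^ j) powr (1 - einv p))"
proof -
  have "(\<integral>\<^sup>+x. ennreal (\<bar>jw \<alpha> \<beta> x * f x\<bar> powr 1) * indicator (Xset j \<inter> {-1..1}) x \<partial>I11) \<le> ennreal (2 * (4 / 2 ^ j) powr (1 - 1 * einv p))"
    using emeasure_I11_eq(1)[OF Xset_borel] emeasure_Xset p by (intro holder_set[OF BsetD(1)[OF f]]) auto
  then show ?thesis by (subst nn_integral_I11_indicator) simp
qed

text \<open>Hoelder on the zone of level \<open>j\<close>, whose measure is about 2^(-j), bounds the
  mass by 2^(-j (1 - 1/p)). After the factor 2^j and the power \<open>q\<close> this leaves 2^(j q /
  p), the last summand of \<rho>.\<close>

lemma loc_sum_le: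
  fixes q \<alpha> \<beta> :: real and p :: ereal and k :: nat
  assumes k: "1 \<le> k" and q: "1 \<le> q" and qp: "ereal q < p" and ab: "0 \<le> \<alpha>" "0 \<le> \<beta>"
  defines "\<rho> \<equiv> (real (k - 1) * q - 1) / 2 + q * einv p"
  shows "\<exists>C>0. \<forall>N\<ge>64. \<forall>f\<in>Mset k \<inter> Bset p \<alpha> \<beta>. loc_sum N k q \<alpha> \<beta> f \<le>
      C * real N powr (- (real (k - 1) * q) - 1) * (\<Sum>j\<in>{j. 2 ^ j \<le> N\<^sup>2}. (2 ^ j) powr \<rho>)"
proof -
  obtain C where C: "C > 0" "\<And>N f a. N \<ge> 64 \<Longrightarrow> f \<in> Mset k \<Longrightarrow> (\<lambda>x. jw \<alpha> \<beta> x * f x) \<in> borel_measurable I11 \<Longrightarrow> (\<And>j. 0 \<le> a j) \<Longrightarrow>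
    (\<And>j. (Xmass \<alpha> \<beta> f j) \<le> ennreal (a j)) \<Longrightarrow>
    loc_sum N k q \<alpha> \<beta> f \<le>
    C * real N powr (- (real (k - 1) * q) - 1) *
      (\<Sum>j\<in>{j. 2 ^ j \<le> N\<^sup>2}. (2 ^ j) powr ((real (k - 1) * q - 1) / 2) * (2 ^ j * a j) powr q)"
    using total_sum[OF k q ab] by blast
  define \<theta> where "\<theta> = einv p"
  define K where "K = (2 * 4 powr (1 - \<theta>)) powr q"
  have K: "K > 0" unfolding K_def by simp
  have "loc_sum N k q \<alpha> \<beta> f \<le>
      C * K * real N powr (- (real (k - 1) * q) - 1) * (\<Sum>j\<in>{j. 2 ^ j \<le> N\<^sup>2}. (2 ^ j) powr \<rho>)"
    if N: "N \<ge> 64" and f: "f \<in> Mset k \<inter> Bset p \<alpha> \<beta>" for N f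
  proof -
    define a where "a j = 2 * (4 / 2 ^ j) powr (1 - \<theta>)" for j :: nat
    have p1: "ereal 1 < p" using q qp by (meson ereal_less_eq(3) le_less_trans)
    have "loc_sum N k q \<alpha> \<beta> f \<le>
      C * real N powr (- (real (k - 1) * q) - 1) *
      (\<Sum>j\<in>{j. 2 ^ j \<le> N\<^sup>2}. (2 ^ j) powr ((real (k - 1) * q - 1) / 2) * (2 ^ j * a j) powr q)"
      using f Xset_hoelder[OF _ p1] by (intro C(2) N BsetD(2)[of f p]) (auto simp: a_def \<theta>_def)
    also have "(\<Sum>j\<in>{j. 2 ^ j \<le> N\<^sup>2}. (2 ^ j) powr ((real (k - 1) * q - 1) / 2) * (2 ^ j * a j) powr q) =
      (\<Sum>j\<in>{j. 2 ^ j \<le> N\<^sup>2}. K * (2 ^ j) powr \<rho>)"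
    proof (rule sum.cong[OF refl])
      fix j
      define t where "t = (2 ^ j :: real)"
      have t: "t > 0" unfolding t_def by simp
      have "t * a j = 2 * 4 powr (1 - \<theta>) * t powr \<theta>"
        unfolding a_def t_def[symmetric] using t by (simp add: powr_divide powr_diff)
      then have "(t * a j) powr q = K * t powr (\<theta> * q)" unfolding K_def by (simp add: powr_mult powr_powr)
      then show "(2 ^ j) powr ((real (k - 1) * q - 1) / 2) * (2 ^ j * a j) powr q = K * (2 ^ j) powr \<rho>"
        unfolding t_def[symmetric] \<rho>_def \<theta>_def[symmetric] by (simp add: powr_add mult.commute)
    qed
    finally show ?thesis by (simp add: sum_distrib_left mult_ac)
  qed
  moreover have "C * K > 0" using C(1) K by simp
  ultimately show ?thesis by blast
qed

lemma ln_Suc_pos: "n \<ge> 1 \<Longrightarrow> ln (real n + 1) > 0"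
  by simp

text \<open>An increasing geometric series is of the order of its last term, where 2^j is about N^2;
  the exponents of \<open>N\<close> then add up to -(2 - 2 q / p), independently of
  \<open>k\<close>.\<close>

lemma Edev_upper_pos:
  fixes q \<alpha> \<beta> :: real and p :: ereal and k :: nat
  assumes k: "1 \<le> k" and q: "1 \<le> q" and qp: "ereal q < p" and ab: "0 \<le> \<alpha>" "0 \<le> \<beta>"
    and \<rho>: "(real (k - 1) * q - 1) / 2 + q * einv p > 0"
  shows "\<exists>c>0. \<forall>n\<ge>1. Edev (Mset k \<inter> Bset p \<alpha> \<beta>) n (jw \<alpha> \<beta>) (ereal q) \<le>
      ennreal (c * real n powr (- 2 / q + 2 * einv p))"
proof -
  note ei = einv_bounds[OF q qp]
  define \<rho>' where "\<rho>' = (real (k - 1) * q - 1) / 2 + q * einv p"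
  define e where "e = 2 - 2 * q * einv p"
  obtain C where C: "C > 0" "\<And>N f. N \<ge> 64 \<Longrightarrow> f \<in> Mset k \<inter> Bset p \<alpha> \<beta> \<Longrightarrow> loc_sum N k q \<alpha> \<beta> f \<le>
      C * real N powr (- (real (k - 1) * q) - 1) * (\<Sum>j\<in>{j. 2 ^ j \<le> N\<^sup>2}. (2 ^ j) powr \<rho>')"
    using loc_sum_le[OF k q qp ab] unfolding \<rho>'_def by blast
  define K where "K = 2 powr \<rho>' / (2 powr \<rho>' - 1)"
  have K: "K > 0" unfolding K_def using \<rho> powr_less_mono[of 0 \<rho>' 2] by (simp add: \<rho>'_def)
  have "\<exists>c>0. \<forall>n\<ge>1. Edev (Mset k \<inter> Bset p \<alpha> \<beta>) n (jw \<alpha> \<beta>) (ereal q) \<le>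
      ennreal (c * real n powr (- e / q) * ln (real n + 1) powr (0 / q))"
  proof (rule Edev_upper[OF k q qp ab])
    show "0 \<le> e" "e \<le> 2 - 2 * q * einv p" unfolding e_def using ei by auto
    show "\<exists>C>0. \<forall>N\<ge>64. \<forall>f\<in>Mset k \<inter> Bset p \<alpha> \<beta>. loc_sum N k q \<alpha> \<beta> f \<le>
      C * real N powr (- e) * ln (real N + 1) powr 0"
    proof (intro exI[of _ "C * K"] conjI allI impI ballI)
      fix N :: nat and f assume N: "64 \<le> N" and f: "f \<in> Mset k \<inter> Bset p \<alpha> \<beta>"
      have "loc_sum N k q \<alpha> \<beta> f \<le>
        C * real N powr (- (real (k - 1) * q) - 1) * (K * real N powr (2 * \<rho>'))"
        using C(2)[OF N f] dyadic_sum_pos[of \<rho>' N] \<rho> N C(1) unfolding K_def \<rho>'_def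
        by (elim order_trans) (intro mult_left_mono, auto)
      also have "... = C * K * (real N powr (- (real (k - 1) * q) - 1) * real N powr (2 * \<rho>'))" by simp
      also have "real N powr (- (real (k - 1) * q) - 1) * real N powr (2 * \<rho>') = real N powr (- e)"
      proof -
        have "- (real (k - 1) * q) - 1 + 2 * \<rho>' = - e" unfolding e_def \<rho>'_def by (simp add: field_simps)
        then show ?thesis by (simp only: powr_add[symmetric])
      qed
      finally show "loc_sum N k q \<alpha> \<beta> f \<le> C * K * real N powr (- e) * ln (real N + 1) powr 0"
        using N by simp
    qed (use C K in simp)
  qed simp
  moreover have "- e / q = - 2 / q + 2 * einv p" unfolding e_def using q by (simp add: field_simps)
  moreover have "ln (real n + 1) powr (0 / q) = 1" if "n \<ge> 1" for n using ln_Suc_pos[OF that] by simp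
  ultimately show ?thesis by auto
qed

text \<open>A convergent geometric series: the levels far from the endpoints dominate, and only the
  factor 1 / N of the mesh remains.\<close>

lemma Edev_upper_neg:
  fixes q \<alpha> \<beta> :: real and p :: ereal
  assumes q: "1 \<le> q" and qp: "ereal q < p" and ab: "0 \<le> \<alpha>" "0 \<le> \<beta>"
    and \<rho>: "2 * q * einv p < 1"
  shows "\<exists>c>0. \<forall>n\<ge>1. Edev (Mset 1 \<inter> Bset p \<alpha> \<beta>) n (jw \<alpha> \<beta>) (ereal q) \<le>
      ennreal (c * real n powr (- 1 / q))"
proof -
  note ei = einv_bounds[OF q qp]
  define \<rho>' where "\<rho>' = (real (1 - 1 :: nat) * q - 1) / 2 + q * einv p"
  have \<rho>': "\<rho>' < 0" unfolding \<rho>'_def using \<rho> by simp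
  obtain C where C: "C > 0" "\<And>N f. N \<ge> 64 \<Longrightarrow> f \<in> Mset 1 \<inter> Bset p \<alpha> \<beta> \<Longrightarrow> loc_sum N 1 q \<alpha> \<beta> f \<le>
      C * real N powr (- (real (1 - 1 :: nat) * q) - 1) * (\<Sum>j\<in>{j. 2 ^ j \<le> N\<^sup>2}. (2 ^ j) powr \<rho>')"
    using loc_sum_le[OF order_refl q qp ab] unfolding \<rho>'_def by blast
  define K where "K = 1 / (1 - 2 powr \<rho>')"
  have K: "K > 0" unfolding K_def using \<rho>' powr_less_mono[of \<rho>' 0 2] by simp
  have "\<exists>c>0. \<forall>n\<ge>1. Edev (Mset 1 \<inter> Bset p \<alpha> \<beta>) n (jw \<alpha> \<beta>) (ereal q) \<le>
      ennreal (c * real n powr (- 1 / q) * ln (real n + 1) powr (0 / q))"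
  proof (rule Edev_upper[OF order_refl q qp ab])
    show "1 \<le> 2 - 2 * q * einv p" using \<rho> by simp
    show "\<exists>C>0. \<forall>N\<ge>64. \<forall>f\<in>Mset 1 \<inter> Bset p \<alpha> \<beta>. loc_sum N 1 q \<alpha> \<beta> f \<le>
      C * real N powr (- 1) * ln (real N + 1) powr 0"
    proof (intro exI[of _ "C * K"] conjI allI impI ballI)
      fix N :: nat and f assume N: "64 \<le> N" and f: "f \<in> Mset 1 \<inter> Bset p \<alpha> \<beta>"
      have "loc_sum N 1 q \<alpha> \<beta> f \<le>
        C * real N powr (- (real (1 - 1 :: nat) * q) - 1) * K"
        using C(2)[OF N f] dyadic_sum_neg[of \<rho>' N] \<rho>' N C(1) unfolding K_def
        by (elim order_trans) (intro mult_left_mono, auto)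
      then show "loc_sum N 1 q \<alpha> \<beta> f \<le> C * K * real N powr (- 1) * ln (real N + 1) powr 0"
        using N by (simp add: mult_ac)
    qed (use C K in simp)
  qed simp_all
  moreover have "ln (real n + 1) powr (0 / q) = 1" if "n \<ge> 1" for n using ln_Suc_pos[OF that] by simp
  ultimately show ?thesis by auto
qed

text \<open>Here \<rho> = 0, so all levels have the same bound and their number gives the
  logarithm.\<close>

lemma Edev_upper_zero:
  fixes \<alpha> \<beta> :: real
  assumes ab: "0 \<le> \<alpha>" "0 \<le> \<beta>"
  shows "\<exists>c>0. \<forall>n\<ge>1. Edev (Mset 2 \<inter> Bset \<infinity> \<alpha> \<beta>) n (jw \<alpha> \<beta>) (ereal 1) \<le>
      ennreal (c * real n powr (- 2) * ln (real n + 1))"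
proof -
  have qp: "ereal 1 < \<infinity>" by simp
  have z: "(real (2 - 1 :: nat) * 1 - 1) / 2 + 1 * einv \<infinity> = (0 :: real)" by (simp add: einv_def)
  obtain C where C: "C > 0" "\<And>N f. N \<ge> 64 \<Longrightarrow> f \<in> Mset 2 \<inter> Bset \<infinity> \<alpha> \<beta> \<Longrightarrow> loc_sum N 2 1 \<alpha> \<beta> f \<le>
      C * real N powr (- (real (2 - 1 :: nat) * 1) - 1) * (\<Sum>j\<in>{j. 2 ^ j \<le> N\<^sup>2}. (2 ^ j) powr 0)"
    using loc_sum_le[of 2 1 \<infinity> \<alpha> \<beta>, unfolded z] ab by auto
  define K where "K = 3 / ln (2::real)"
  have K: "K > 0" unfolding K_def by simp
  have "\<exists>c>0. \<forall>n\<ge>1. Edev (Mset 2 \<inter> Bset \<infinity> \<alpha> \<beta>) n (jw \<alpha> \<beta>) (ereal 1) \<le>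
      ennreal (c * real n powr (- 2 / 1) * ln (real n + 1) powr (1 / 1))"
  proof (rule Edev_upper[OF _ _ qp ab])
    show "2 \<le> 2 - 2 * 1 * einv \<infinity>" by (simp add: einv_def)
    show "\<exists>C>0. \<forall>N\<ge>64. \<forall>f\<in>Mset 2 \<inter> Bset \<infinity> \<alpha> \<beta>. loc_sum N 2 1 \<alpha> \<beta> f \<le>
      C * real N powr (- 2) * ln (real N + 1) powr 1"
    proof (intro exI[of _ "C * K"] conjI allI impI ballI)
      fix N :: nat and f assume N: "64 \<le> N" and f: "f \<in> Mset 2 \<inter> Bset \<infinity> \<alpha> \<beta>"
      have "(\<Sum>j\<in>{j. 2 ^ j \<le> N\<^sup>2}. (2 ^ j) powr 0) = real (card {j. 2 ^ j \<le> N\<^sup>2})" by simp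
      then have "loc_sum N 2 1 \<alpha> \<beta> f \<le>
        C * real N powr (- (real (2 - 1 :: nat) * 1) - 1) * (K * ln (real N + 1))"
        using C(2)[OF N f] dyadic_card[of N] N C(1) unfolding K_def
        by (elim order_trans) (intro mult_left_mono, auto)
      then show "loc_sum N 2 1 \<alpha> \<beta> f \<le> C * K * real N powr (- 2) * ln (real N + 1) powr 1"
        using ln_Suc_pos[of N] N by (simp add: mult_ac)
    qed (use C K in simp)
  qed simp_all
  then obtain c where c: "c > 0" "\<And>n. n \<ge> 1 \<Longrightarrow> Edev (Mset 2 \<inter> Bset \<infinity> \<alpha> \<beta>) n (jw \<alpha> \<beta>) (ereal 1) \<le>
      ennreal (c * real n powr (- 2 / 1) * ln (real n + 1) powr (1 / 1))"
    by blast
  show ?thesis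
  proof (intro exI[of _ c] conjI allI impI c(1))
    fix n :: nat assume n: "1 \<le> n"
    have "ln (real n + 1) powr (1 / 1) = ln (real n + 1)" using ln_Suc_pos[OF n] by simp
    moreover have "- 2 / 1 = (- 2 :: real)" by simp
    ultimately show "Edev (Mset 2 \<inter> Bset \<infinity> \<alpha> \<beta>) n (jw \<alpha> \<beta>) (ereal 1) \<le>
      ennreal (c * real n powr (- 2) * ln (real n + 1))" using c(2)[OF n] by (simp only:)
  qed
qed

text \<open>The ends of a window have the ratio 14, which is below 2^4, so only four consecutive
  levels can share a point.\<close>

lemma dyadic_window_card:
  fixes d :: real
  assumes "finite J"
  shows "card {j\<in>J. d \<in> {1 / 2 ^ j / 8..7 / 4 * (1 / 2 ^ j)}} \<le> 4"
proof -
  let ?S = "{j\<in>J. d \<in> {1 / 2 ^ j / 8..7 / 4 * (1 / 2 ^ j)}}"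
  show ?thesis
  proof (cases "?S = {}")
    case False
    define m where "m = Min ?S"
    have fin: "finite ?S" using assms by simp
    have mS: "m \<in> ?S" unfolding m_def using fin False by (rule Min_in)
    have "?S \<subseteq> {m..m + 3}"
    proof
      fix j assume j: "j \<in> ?S"
      have "m \<le> j" unfolding m_def using fin j by (rule Min_le)
      moreover have "j \<le> m + 3"
      proof (rule ccontr)
        assume "\<not> j \<le> m + 3"
        then have "(2::real) ^ (m + 4) \<le> 2 ^ j" by (intro power_increasing) auto
        then have "7 / 4 * (1 / 2 ^ j) \<le> 7 / 4 * (1 / (2::real) ^ (m + 4))" by (intro mult_left_mono divide_left_mono) auto
        also have "... < 1 / 2 ^ m / 8" by (simp add: power_add field_simps)
        finally show False using j mS by auto
      qed
      ultimately show "j \<in> {m..m + 3}" by simp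
    qed
    then have "card ?S \<le> card {m..m + 3}" by (intro card_mono) auto
    then show ?thesis by simp
  next
    case True
    show ?thesis unfolding True by simp
  qed
qed

lemma Xset_overlap:
  assumes "finite J"
  shows "(\<Sum>j\<in>J. indicator (Xset j) x) \<le> (8 :: real)"
proof -
  have "card {j\<in>J. x \<in> Xset j} \<le> card ({j\<in>J. 1 - x \<in> {1 / 2 ^ j / 8..7 / 4 * (1 / 2 ^ j)}} \<union> {j\<in>J. 1 + x \<in> {1 / 2 ^ j / 8..7 / 4 * (1 / 2 ^ j)}})"
    using assms unfolding Xset_def by (intro card_mono) auto
  also have "... \<le> 4 + 4"
    by (rule order_trans[OF card_Un_le add_mono[OF dyadic_window_card[OF assms] dyadic_window_card[OF assms]]])
  finally have "card {j\<in>J. x \<in> Xset j} \<le> 8" by simp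
  moreover have "(\<Sum>j\<in>J. indicator (Xset j) x) = real (card {j\<in>J. x \<in> Xset j})"
    using assms by (simp add: sum.If_cases indicator_def Int_def)
  ultimately show ?thesis by simp
qed

text \<open>Again \<rho> = 0, but the integrals \<open>G j\<close> of the p-th power over the zones
  sum to at most 8 because the zones overlap boundedly. Level \<open>j\<close> contributes the
  square root of \<open>G j\<close>, and the Cauchy-Schwarz inequality over about ln N levels loses
  only the square root of ln N.\<close>

lemma Edev_upper_crit:
  fixes q \<alpha> \<beta> :: real
  assumes q: "1 \<le> q" and ab: "0 \<le> \<alpha>" "0 \<le> \<beta>"
  shows "\<exists>c>0. \<forall>n\<ge>1. Edev (Mset 1 \<inter> Bset (ereal (2 * q)) \<alpha> \<beta>) n (jw \<alpha> \<beta>) (ereal q) \<le>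
      ennreal (c * real n powr (- 1 / q) * ln (real n + 1) powr (1 / (2 * q)))"
proof -
  define P where "P = 2 * q"
  have P: "P \<ge> 2" unfolding P_def using q by simp
  have qp: "ereal q < ereal P" unfolding P_def using q by simp
  obtain C where C: "C > 0" "\<And>N f a. N \<ge> 64 \<Longrightarrow> f \<in> Mset 1 \<Longrightarrow> (\<lambda>x. jw \<alpha> \<beta> x * f x) \<in> borel_measurable I11 \<Longrightarrow> (\<And>j. 0 \<le> a j) \<Longrightarrow>
    (\<And>j. (Xmass \<alpha> \<beta> f j) \<le> ennreal (a j)) \<Longrightarrow>
    loc_sum N 1 q \<alpha> \<beta> f \<le>
    C * real N powr (- (real (1 - 1 :: nat) * q) - 1) *
      (\<Sum>j\<in>{j. 2 ^ j \<le> N\<^sup>2}. (2 ^ j) powr ((real (1 - 1 :: nat) * q - 1) / 2) * (2 ^ j * a j) powr q)"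
    using total_sum[OF order_refl q ab] by blast
  define K where "K = (2 * 4 powr (1 - 1 / P)) powr q"
  have K: "K > 0" unfolding K_def by simp
  define K2 where "K2 = 11 * (3 / ln (2::real)) powr (1 / 2)"
  have K2: "K2 > 0" unfolding K2_def by simp
  have main: "loc_sum N 1 q \<alpha> \<beta> f \<le> C * K * K2 * real N powr (- 1) * ln (real N + 1) powr (1 / 2)"
    if N: "N \<ge> 64" and f: "f \<in> Mset 1" "f \<in> Bset (ereal P) \<alpha> \<beta>" for N f
  proof -
    define g where "g x = jw \<alpha> \<beta> x * f x" for x
    have mg [measurable]: "g \<in> borel_measurable I11" unfolding g_def using BsetD(2)[OF f(2)] .
    let ?J = "{j. 2 ^ j \<le> N\<^sup>2}"
    obtain m where m: "?J = {..m}" "2 ^ m \<le> N\<^sup>2" using dyadic_levels[of N] N by auto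
    have fJ: "finite ?J" unfolding m(1) by simp
    let ?X = "\<lambda>j. Xset j \<inter> {-1..1}"
    have mX [measurable]: "?X j \<in> sets I11" for j by (rule emeasure_I11_eq(1)[OF Xset_borel])
    have I1: "(\<integral>\<^sup>+x. ennreal (\<bar>g x\<bar> powr P) \<partial>I11) = 1"
      using Lp_norm_eq_1_finite[of P g] BsetD(1)[OF f(2)] P unfolding g_def by simp
    define G where "G j = enn2real (\<integral>\<^sup>+x. ennreal (\<bar>g x\<bar> powr P) * indicator (?X j) x \<partial>I11)" for j
    have G0: "G j \<ge> 0" for j unfolding G_def by simp
    have G: "(\<integral>\<^sup>+x. ennreal (\<bar>g x\<bar> powr P) * indicator (?X j) x \<partial>I11) = ennreal (G j)" for j
    proof -
      have "(\<integral>\<^sup>+x. ennreal (\<bar>g x\<bar> powr P) * indicator (?X j) x \<partial>I11) \<le> (\<integral>\<^sup>+x. ennreal (\<bar>g x\<bar> powr P) \<partial>I11)"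
        by (intro nn_integral_mono) (auto split: split_indicator)
      also have "... < top" unfolding I1 by simp
      finally show ?thesis unfolding G_def by simp
    qed
    have sumG: "(\<Sum>j\<in>?J. G j) \<le> 8"
    proof -
      have "ennreal (\<Sum>j\<in>?J. G j) = (\<Sum>j\<in>?J. \<integral>\<^sup>+x. ennreal (\<bar>g x\<bar> powr P) * indicator (?X j) x \<partial>I11)"
        unfolding G using G0 by simp
      also have "... = (\<integral>\<^sup>+x. (\<Sum>j\<in>?J. ennreal (\<bar>g x\<bar> powr P) * indicator (?X j) x) \<partial>I11)"
        by (rule nn_integral_sum[symmetric]) measurable
      also have "... \<le> (\<integral>\<^sup>+x. ennreal 8 * ennreal (\<bar>g x\<bar> powr P) \<partial>I11)"
      proof (rule nn_integral_mono)
        fix x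
        have "(\<Sum>j\<in>?J. ennreal (\<bar>g x\<bar> powr P) * indicator (?X j) x) \<le> (\<Sum>j\<in>?J. ennreal (\<bar>g x\<bar> powr P) * ennreal (indicator (Xset j) x))"
          by (intro sum_mono) (auto split: split_indicator)
        also have "... = ennreal (\<bar>g x\<bar> powr P) * ennreal (\<Sum>j\<in>?J. indicator (Xset j) x)"
        proof -
          have "ennreal (\<Sum>j\<in>?J. indicator (Xset j) x) = (\<Sum>j\<in>?J. ennreal (indicator (Xset j) x))"
            by (rule sum_ennreal[symmetric]) simp
          then show ?thesis by (simp only: sum_distrib_left)
        qed
        also have "... \<le> ennreal (\<bar>g x\<bar> powr P) * ennreal 8"
          by (intro mult_left_mono ennreal_leI Xset_overlap fJ) simp
        finally show "(\<Sum>j\<in>?J. ennreal (\<bar>g x\<bar> powr P) * indicator (?X j) x) \<le> ennreal 8 * ennreal (\<bar>g x\<bar> powr P)"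
          by (simp add: mult.commute)
      qed
      also have "... = ennreal 8 * 1" using I1 by (simp add: nn_integral_cmult)
      finally show ?thesis by (simp add: ennreal_le_iff flip: ennreal_numeral)
    qed
    \<comment> \<open>The summable addition makes every mass positive, so that a level
      \<open>l\<close> can be defined from it, and raises the total by at most 2.\<close>
    define G' where "G' j = G j + (1 / 2) ^ j" for j
    have G'0: "G' j > 0" for j unfolding G'_def using G0[of j] by (simp add: add_nonneg_pos)
    have "(\<Sum>j\<in>?J. (1 / 2 :: real) ^ j) \<le> 2"
    proof -
      have "(\<Sum>j\<in>?J. (1 / 2 :: real) ^ j) = (\<Sum>j<Suc m. (1 / 2) ^ j)" unfolding m(1) by (simp only: lessThan_Suc_atMost)
      also have "... = ((1 / 2) ^ Suc m - 1) / (1 / 2 - 1)" by (rule geometric_sum) simp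
      also have "... \<le> 2" by simp
      finally show ?thesis .
    qed
    then have sumG': "(\<Sum>j\<in>?J. G' j) \<le> 10" unfolding G'_def sum.distrib using sumG by simp
    define a where "a j = 2 * (4 / 2 ^ j) powr (1 - 1 / P) * G' j powr (1 / P)" for j :: nat
    have a: "Xmass \<alpha> \<beta> f j \<le> ennreal (a j)" for j
    proof -
      define L where "L = (4 / 2 ^ j :: real)"
      have L: "L > 0" unfolding L_def by simp
      \<comment> \<open>The balancing level for Hoelder on the zone with its own share of the mass,
        in contrast to \<open>holder_set\<close>, where the mass is estimated by 1.\<close>
      define l where "l = (G' j / L) powr (1 / P)"
      have l: "l > 0" unfolding l_def using G'0[of j] L by simp
      have "(\<integral>\<^sup>+x. ennreal (\<bar>g x\<bar> powr 1) * indicator (?X j) x \<partial>I11) \<le> ennreal (l powr 1 * L + l powr (1 - P) * G' j)"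
      proof (rule nn_integral_split_le[OF mg])
        show "emeasure I11 (?X j) \<le> ennreal L" unfolding L_def by (rule emeasure_Xset)
        show "(\<integral>\<^sup>+x. ennreal (\<bar>g x\<bar> powr P) * indicator (?X j) x \<partial>I11) \<le> ennreal (G' j)"
          unfolding G G'_def by (intro ennreal_leI) simp
      qed (use P l L G'0[of j] mX in auto)
      also have "l powr 1 * L + l powr (1 - P) * G' j = a j"
      proof -
        have "l powr 1 * L = G' j powr (1 / P) * (L powr 1 / L powr (1 / P))"
          unfolding l_def using L G'0[of j] by (simp add: powr_divide powr_powr)
        also have "L powr 1 / L powr (1 / P) = L powr (1 - 1 / P)" by (rule powr_diff[symmetric])
        finally have 1: "l powr 1 * L = G' j powr (1 / P) * L powr (1 - 1 / P)" .
        have "l powr (1 - P) = (G' j / L) powr (1 / P - 1)"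
          unfolding l_def using P by (simp add: powr_powr field_simps)
        also have "... = G' j powr (1 / P - 1) * L powr (1 - 1 / P)"
          using L G'0[of j] by (simp add: powr_divide powr_diff)
        finally have "l powr (1 - P) * G' j = (G' j powr (1 / P - 1) * G' j powr 1) * L powr (1 - 1 / P)"
          using G'0[of j] by simp
        also have "G' j powr (1 / P - 1) * G' j powr 1 = G' j powr (1 / P)" by (subst powr_add[symmetric]) simp
        finally show ?thesis using 1 unfolding a_def L_def[symmetric] by simp
      qed
      finally show ?thesis unfolding g_def by (subst nn_integral_I11_indicator) simp
    qed
    have a0: "a j \<ge> 0" for j unfolding a_def by simp
    have tm: "(2 ^ j) powr ((real (1 - 1 :: nat) * q - 1) / 2) * (2 ^ j * a j) powr q = K * G' j powr (1 / 2)" for j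
    proof -
      define t where "t = (2 ^ j :: real)"
      have t: "t > 0" unfolding t_def by simp
      have "t * a j = 2 * 4 powr (1 - 1 / P) * t powr (1 / P) * G' j powr (1 / P)"
        unfolding a_def t_def[symmetric] using t by (simp add: powr_divide powr_diff)
      then have "(t * a j) powr q = K * t powr (1 / P * q) * G' j powr (1 / P * q)"
        unfolding K_def by (simp only: powr_mult powr_powr)
      moreover have "1 / P * q = 1 / 2" unfolding P_def using q by simp
      ultimately have "(t * a j) powr q = K * t powr (1 / 2) * G' j powr (1 / 2)" by simp
      moreover have "t powr (- 1 / 2) * t powr (1 / 2) = 1" using t by (subst powr_add[symmetric]) simp
      ultimately show ?thesis unfolding t_def[symmetric] by simp
    qed
    define c where "c = real (card ?J)"
    have c1: "c \<ge> 1" unfolding c_def m(1) by simp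
    \<comment> \<open>Cauchy-Schwarz in split form, at the level 1 / c where \<open>c\<close> is the
      number of terms; the result is 1 + 10 times the square root of \<open>c\<close>.\<close>
    have "(\<Sum>j\<in>?J. G' j powr (1 / 2)) \<le> (\<Sum>j\<in>?J. (1 / c) powr (1 / 2) + (1 / c) powr (1 / 2 - 1) * G' j)"
    proof (rule sum_mono)
      fix j
      show "G' j powr (1 / 2) \<le> (1 / c) powr (1 / 2) + (1 / c) powr (1 / 2 - 1) * G' j"
        using powr_split_le[of "G' j" "1 / 2" 1 "1 / c"] G'0[of j] c1 by simp
    qed
    also have "... = c * (1 / c) powr (1 / 2) + (1 / c) powr (1 / 2 - 1) * (\<Sum>j\<in>?J. G' j)"
      by (simp add: sum.distrib sum_distrib_left c_def)
    also have "... \<le> c * (1 / c) powr (1 / 2) + (1 / c) powr (1 / 2 - 1) * 10"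
      using sumG' by (intro add_left_mono mult_left_mono) auto
    also have "... = 11 * c powr (1 / 2)"
    proof -
      have e1: "(1 / c) powr (1 / 2 - 1) = c powr (1 / 2)" using c1 by (simp add: powr_divide powr_minus_divide)
      have "c * (1 / c) powr (1 / 2) = c powr 1 / c powr (1 / 2)" using c1 by (simp add: powr_divide)
      also have "... = c powr (1 - 1 / 2)" by (rule powr_diff[symmetric])
      finally show ?thesis unfolding e1 by simp
    qed
    also have "... \<le> 11 * (3 / ln 2 * ln (real N + 1)) powr (1 / 2)"
      using dyadic_card[of N] N c1 unfolding c_def by (intro mult_left_mono powr_mono2) auto
    also have "... = K2 * ln (real N + 1) powr (1 / 2)" unfolding K2_def powr_mult by simp
    finally have S: "(\<Sum>j\<in>?J. G' j powr (1 / 2)) \<le> K2 * ln (real N + 1) powr (1 / 2)" .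
    have "loc_sum N 1 q \<alpha> \<beta> f \<le> C * real N powr (- (real (1 - 1 :: nat) * q) - 1) *
      (\<Sum>j\<in>?J. K * G' j powr (1 / 2))"
      using C(2)[OF N f(1) BsetD(2)[OF f(2)] a0 a] unfolding tm .
    also have "... = C * K * real N powr (- 1) * (\<Sum>j\<in>?J. G' j powr (1 / 2))"
      by (simp add: sum_distrib_left mult_ac)
    also have "... \<le> C * K * real N powr (- 1) * (K2 * ln (real N + 1) powr (1 / 2))"
      using S C(1) K by (intro mult_left_mono) auto
    finally show ?thesis by (simp add: mult_ac)
  qed
  have "\<exists>c>0. \<forall>n\<ge>1. Edev (Mset 1 \<inter> Bset (ereal P) \<alpha> \<beta>) n (jw \<alpha> \<beta>) (ereal q) \<le>
      ennreal (c * real n powr (- 1 / q) * ln (real n + 1) powr (1 / 2 / q))"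
  proof (rule Edev_upper[OF order_refl q qp ab])
    show "1 \<le> 2 - 2 * q * einv (ereal P)" unfolding P_def einv_def using q by simp
    show "\<exists>C>0. \<forall>N\<ge>64. \<forall>f\<in>Mset 1 \<inter> Bset (ereal P) \<alpha> \<beta>. loc_sum N 1 q \<alpha> \<beta> f \<le>
      C * real N powr (- 1) * ln (real N + 1) powr (1 / 2)"
      using main C(1) K K2 by (intro exI[of _ "C * K * K2"]) auto
  qed simp_all
  then show ?thesis unfolding P_def by simp
qed

section \<open>Convex functions without weight\<close>

lemma dd_pair: "a < b \<Longrightarrow> dd {a, b} f = (f b - f a) / (b - a)"
proof -
  assume ab: "a < b"
  have e: "{a, b} - {a} = {b}" "{a, b} - {b} = {a}" using ab by auto
  show ?thesis unfolding dd_def using ab by (simp add: e divide_simps) (simp add: algebra_simps)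
qed

lemma Mset2_three_points:
  assumes f: "f \<in> Mset 2" and "-1 < a" "a < b" "b < c" "c < 1"
  shows "f b * (c - a) \<le> f a * (c - b) + f c * (b - a)"
proof -
  have "dd {a, b} f \<le> dd {b, c} f"
  proof -
    have "0 \<le> dd {a, b, c} f" by (rule MsetD[OF f]) (use assms in auto)
    moreover have "(c - a) * dd {a, b, c} f = dd ({a, b, c} - {a}) f - dd ({a, b, c} - {c}) f"
      by (rule dd_rec) (use assms in auto)
    moreover have "{a, b, c} - {a} = {b, c}" "{a, b, c} - {c} = {a, b}" using assms by auto
    ultimately show ?thesis using assms by (simp add: zero_le_mult_iff) (metis diff_ge_0_iff_ge mult_nonneg_nonneg diff_gt_0_iff_gt less_trans order_less_imp_le)
  qed
  then have "(f b - f a) / (b - a) \<le> (f c - f b) / (c - b)" using assms by (simp add: dd_pair)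
  then have "(f b - f a) * (c - b) \<le> (f c - f b) * (b - a)" using assms by (simp add: divide_simps)
  then show ?thesis by (simp add: algebra_simps)
qed

text \<open>The norm bounds \<open>f\<close> only almost everywhere; averaging over the interval
  supplies an actual point.\<close>

lemma exists_good_point:
  assumes f: "f \<in> Bset \<infinity> 0 0" and uv: "-1 \<le> u" "u < v" "v \<le> 1"
  shows "\<exists>y. u < y \<and> y < v \<and> \<bar>f y\<bar> \<le> 1"
proof -
  have "(\<integral>\<^sup>+x. ennreal (\<bar>jw 0 0 x * f x\<bar> powr 1) * indicator {u..v} x \<partial>I11) \<le> ennreal (v - u)"
  proof -
    have m: "(\<lambda>x. jw 0 0 x * f x) \<in> borel_measurable I11" by (rule BsetD(2)[OF f])
    have "AE x in I11. ennreal \<bar>jw 0 0 x * f x\<bar> \<le> esssup I11 (\<lambda>x. ennreal \<bar>jw 0 0 x * f x\<bar>)" by (rule esssup_AE)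
    moreover have "esssup I11 (\<lambda>x. ennreal \<bar>jw 0 0 x * f x\<bar>) = 1"
      using BsetD(1)[OF f] m unfolding Lp_norm_def by auto
    ultimately have ae: "AE x in I11. \<bar>jw 0 0 x * f x\<bar> \<le> 1" by simp
    have "(\<integral>\<^sup>+x. ennreal (\<bar>jw 0 0 x * f x\<bar> powr 1) * indicator {u..v} x \<partial>I11) \<le> (\<integral>\<^sup>+x. indicator {u..v} x \<partial>I11)"
    proof (rule nn_integral_mono_AE, use ae in eventually_elim)
      fix x assume "\<bar>jw 0 0 x * f x\<bar> \<le> 1"
      then show "ennreal (\<bar>jw 0 0 x * f x\<bar> powr 1) * indicator {u..v} x \<le> indicator {u..v} x"
        by (auto split: split_indicator simp: ennreal_le_1)
    qed
    then show ?thesis using uv sets_I11_interval[of u v] emeasure_I11_interval[of u v] by simp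
  qed
  then obtain y where y: "u < y" "y < v" "\<bar>jw 0 0 y * f y\<bar> \<le> (v - u) / (v - u)"
    using exists_le_average[of u v "\<lambda>x. \<bar>jw 0 0 x * f x\<bar>" "v - u"] uv BsetD(2)[OF f] by (auto simp: borel_measurable_abs)
  moreover have "jw 0 0 y = 1" unfolding jw_def using y uv by simp
  ultimately show ?thesis using uv by (intro exI[of _ y]) auto
qed

text \<open>Above, \<open>f\<close> lies under a chord between two good points. Below, a very small
  value at \<open>x\<close> would force the line from \<open>x\<close> through a good point
  \<open>z1\<close> above the bound at a second good point \<open>z2\<close> further to the
  right.\<close>

lemma convex_bounded:
  assumes f: "f \<in> Mset 2" "f \<in> Bset \<infinity> 0 0" and x: "-1 < x" "x < 1"
  shows "\<bar>f x\<bar> \<le> 3"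
proof -
  obtain y1 where y1: "-1 < y1" "y1 < x" "\<bar>f y1\<bar> \<le> 1" using exists_good_point[OF f(2), of "-1" x] x by auto
  obtain y2 where y2: "x < y2" "y2 < 1" "\<bar>f y2\<bar> \<le> 1" using exists_good_point[OF f(2), of x 1] x by auto
  have "f x * (y2 - y1) \<le> f y1 * (y2 - x) + f y2 * (x - y1)"
    using y1 y2 by (intro Mset2_three_points f) auto
  also have "... \<le> 1 * (y2 - x) + 1 * (x - y1)" using y1 y2 by (intro add_mono mult_right_mono) auto
  also have "... = 1 * (y2 - y1)" by simp
  finally have "f x \<le> 1" using y1 y2 by (simp only: mult_le_cancel_right)
  \<comment> \<open>\<open>z1\<close> is taken in the first third of the interval to the right of
    \<open>x\<close> and \<open>z2\<close> in the last, so that z1 - x is at most z2 - z1; this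
    ratio yields the constant 3.\<close>
  define \<eta> where "\<eta> = (1 - x) / 3"
  have \<eta>: "\<eta> > 0" "x + 3 * \<eta> \<le> 1" unfolding \<eta>_def using x by (auto simp: field_simps)
  obtain z1 where z1: "x < z1" "z1 < x + \<eta>" "\<bar>f z1\<bar> \<le> 1" using exists_good_point[OF f(2), of x "x + \<eta>"] x \<eta> by auto
  obtain z2 where z2: "x + 2 * \<eta> < z2" "z2 < x + 3 * \<eta>" "\<bar>f z2\<bar> \<le> 1"
    using exists_good_point[OF f(2), of "x + 2 * \<eta>" "x + 3 * \<eta>"] x \<eta> by auto
  have zz: "z1 - x \<le> z2 - z1" "z1 < z2" using z1 z2 \<eta> by linarith+
  have "f z1 * (z2 - x) \<le> f x * (z2 - z1) + f z2 * (z1 - x)"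
    using z1 z2 zz x \<eta> by (intro Mset2_three_points f) auto
  moreover have "- 1 * (z2 - x) \<le> f z1 * (z2 - x)" using z1 z2 \<eta> by (intro mult_right_mono) auto
  moreover have "f z2 * (z1 - x) \<le> 1 * (z1 - x)" using z1 z2 by (intro mult_right_mono) auto
  ultimately have "- 1 * (z2 - x) - 1 * (z1 - x) \<le> f x * (z2 - z1)" by linarith
  moreover have "- 3 * (z2 - z1) \<le> - 1 * (z2 - x) - 1 * (z1 - x)" using zz by (simp add: algebra_simps)
  ultimately have "- 3 * (z2 - z1) \<le> f x * (z2 - z1)" by linarith
  then have "- 3 \<le> f x" using zz by (simp only: mult_le_cancel_right)
  with \<open>f x \<le> 1\<close> show ?thesis by simp
qed

text \<open>On a dyadic block the variation of the slopes, multiplied by the distance to the endpoint, is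
  bounded by increments of \<open>f\<close> over disjoint intervals; these sums telescope, which is what removes the
  logarithm.\<close>

lemma convex_half_sum:
  assumes N: "N \<ge> 64" and f: "f \<in> Mset 2" and b: "\<And>x. -1 < x \<Longrightarrow> x < 1 \<Longrightarrow> \<bar>f x\<bar> \<le> 3"
  shows "(\<Sum>i\<in>{16..N div 2}. loc_term N 2 1 0 0 f i) \<le> 900 / (real N)\<^sup>2"
proof -
  have N0: "real N > 0" using N by simp
  define z where "z j = 1 - 1 / (2::real) ^ j" for j :: nat
  define F where "F j = f (z j)" for j
  have z01: "-1 < z j" "z j < 1" for j unfolding z_def by (auto simp: less_le_trans[of _ 0])
  have F3: "\<bar>F j\<bar> \<le> 3" for j unfolding F_def by (intro b z01)
  define \<Delta> where "\<Delta> i = DQ N 2 (i - 1) f - DQ N 2 (i + 2) f" for i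
  have \<Delta>0: "\<Delta> i \<ge> 0" if "i \<in> {16..N div 2}" for i
    unfolding \<Delta>_def using that N by (auto intro!: DQ_antimono f)
  have lt: "loc_term N 2 1 0 0 f i = (hh N i)\<^sup>2 * \<Delta> i" if "i \<in> {16..N div 2}" for i
  proof -
    have i: "1 \<le> i" "i < N" using that N by auto
    have "jw 0 0 (tau N i) = 1" unfolding jw_def using tau_bounds[OF i] by simp
    moreover have "0 \<le> hh N i * \<Delta> i" using hh_pos[OF i] \<Delta>0[OF that] by simp
    ultimately show ?thesis unfolding loc_term_def \<Delta>_def[symmetric] by (simp add: power2_eq_square mult_ac)
  qed
  \<comment> \<open>Times \<open>e\<close>, the slope over \<open>U\<close> is 8 times an increment
    of \<open>F\<close>, as the two points of \<open>U\<close> are e / 8 apart. The slope over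
    \<open>L\<close> is at least the slope between the points of levels \<open>j - 2\<close> and
    \<open>j - 1\<close>, which are 2 e apart: hence 1/2. For \<open>j < 2\<close> there are no such
    points and the bound on \<open>f\<close> gives 4 (3 + 3) = 24.\<close>
  define B where "B j = 8 * (F (j + 3) - F (j + 2)) - 1 / 2 * (F (j - 1) - F (j - 2)) + (if j < 2 then 24 else 0)" for j :: nat
  have blkB: "(\<Sum>i\<in>blk N j. loc_term N 2 1 0 0 f i) \<le> 6 / (real N)\<^sup>2 * B j" for j
  proof -
    define e where "e = (1 / 2 ^ j :: real)"
    have e: "0 < e" "e \<le> 1" unfolding e_def by (auto simp: one_le_power)
    define U where "U = {z (j + 2), z (j + 3)}"
    define L where "L = {1 - 7 / 4 * e, 1 - 3 / 2 * e}"
    have zU: "z (j + 2) = 1 - e / 4" "z (j + 3) = 1 - e / 8" unfolding z_def e_def by (simp_all add: power_add)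
    have U: "finite U" "card U = 2" and L: "finite L" "card L = 2" unfolding U_def L_def zU using e by auto
    have dU: "dd U f = (F (j + 3) - F (j + 2)) / (e / 8)"
    proof -
      have "z (j + 2) < z (j + 3)" unfolding zU using e by simp
      then have "dd U f = (F (j + 3) - F (j + 2)) / (z (j + 3) - z (j + 2))" unfolding U_def F_def by (rule dd_pair)
      then show ?thesis unfolding zU by simp
    qed
    \<comment> \<open>Convexity puts the slope over \<open>L\<close> above that of a chord further
      left; the chord is chosen among the dyadic points so that the increments of consecutive levels
      telescope.\<close>
    have dL: "- (e * dd L f) \<le> - (1 / 2 * (F (j - 1) - F (j - 2))) + (if j < 2 then 24 else 0)"
    proof (cases "j < 2")
      case True
      have "dd L f = (f (1 - 3 / 2 * e) - f (1 - 7 / 4 * e)) / (1 - 3 / 2 * e - (1 - 7 / 4 * e))"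
        unfolding L_def using e by (intro dd_pair) simp
      also have "1 - 3 / 2 * e - (1 - 7 / 4 * e) = e / 4" by simp
      finally have "e * dd L f = 4 * (f (1 - 3 / 2 * e) - f (1 - 7 / 4 * e))" using e by simp
      moreover have "\<bar>f (1 - 3 / 2 * e)\<bar> \<le> 3" "\<bar>f (1 - 7 / 4 * e)\<bar> \<le> 3" using e by (auto intro!: b)
      moreover have "F (j - 1) - F (j - 2) = 0" using True by (cases j) auto
      ultimately show ?thesis using True by simp
    next
      case False
      then obtain i where j: "j = i + 2" by (metis add.commute le_Suc_ex not_less)
      have zi: "z i = 1 - 4 * e" "z (i + 1) = 1 - 2 * e" unfolding z_def e_def j by (simp_all add: power_add)
      have "dd {z i, z (i + 1)} f \<le> dd L f"
        by (rule dd_mono[OF f]) (use L z01[of i] z01[of "i + 1"] e zi in \<open>auto simp: L_def\<close>)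
      moreover have "dd {z i, z (i + 1)} f = (F (i + 1) - F i) / (z (i + 1) - z i)"
        unfolding F_def using e zi by (intro dd_pair) auto
      moreover have "z (i + 1) - z i = 2 * e" unfolding zi by simp
      ultimately have "(F (i + 1) - F i) / (2 * e) \<le> dd L f" by simp
      then have "e * ((F (i + 1) - F i) / (2 * e)) \<le> e * dd L f" using e by (intro mult_left_mono) auto
      then have "1 / 2 * (F (i + 1) - F i) \<le> e * dd L f" using e by simp
      then show ?thesis using False unfolding j by simp
    qed
    have "(\<Sum>i\<in>blk N j. loc_term N 2 1 0 0 f i) \<le> (\<Sum>i\<in>blk N j. (2 * e / (real N)\<^sup>2) * \<Delta> i)"
    proof (rule sum_mono)
      fix i assume i: "i \<in> blk N j"
      then have i': "i \<in> {16..N div 2}" "1 - tau N i \<le> e" unfolding blk_def e_def by auto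
      have "(hh N i)\<^sup>2 \<le> 2 * (1 - tau N i) / (real N)\<^sup>2" by (rule hh_sq_le)
      also have "... \<le> 2 * e / (real N)\<^sup>2" using i' by (intro divide_right_mono) auto
      finally show "loc_term N 2 1 0 0 f i \<le> (2 * e / (real N)\<^sup>2) * \<Delta> i"
        unfolding lt[OF i'(1)] using \<Delta>0[OF i'(1)] by (intro mult_right_mono)
    qed
    also have "... = (2 * e / (real N)\<^sup>2) * (\<Sum>i\<in>blk N j. \<Delta> i)" by (simp add: sum_distrib_left)
    also have "... \<le> (2 * e / (real N)\<^sup>2) * (3 * (dd U f - dd L f))"
    proof (rule mult_left_mono)
      show "(\<Sum>i\<in>blk N j. \<Delta> i) \<le> 3 * (dd U f - dd L f)"
        unfolding \<Delta>_def
      proof (rule blk_dd_sum[OF _ N f U _ L])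
        fix y assume "y \<in> U"
        then show "1 / 8 * (1 / 2 ^ j) \<le> 1 - y \<and> 1 - y \<le> 1 / 4 * (1 / 2 ^ j)"
          unfolding U_def zU e_def[symmetric] using e by auto
      next
        fix y assume "y \<in> L"
        then show "3 / 2 * (1 / 2 ^ j) \<le> 1 - y \<and> 1 - y \<le> 7 / 4 * (1 / 2 ^ j)"
          unfolding L_def e_def[symmetric] using e by auto
      qed simp
    qed (use e in simp)
    also have "... = 6 / (real N)\<^sup>2 * (e * dd U f - e * dd L f)"
      by (simp add: algebra_simps diff_divide_distrib)
    also have "... \<le> 6 / (real N)\<^sup>2 * B j"
    proof (rule mult_left_mono)
      have "e * dd U f = 8 * (F (j + 3) - F (j + 2))" unfolding dU using e by simp
      then show "e * dd U f - e * dd L f \<le> B j" unfolding B_def using dL by linarith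
    qed simp
    finally show ?thesis .
  qed
  obtain m where m: "{j. 2 ^ j \<le> N\<^sup>2} = {..m}" using dyadic_levels[of N] N by auto
  have "(\<Sum>i\<in>{16..N div 2}. loc_term N 2 1 0 0 f i) \<le> (\<Sum>j\<in>{..m}. \<Sum>i\<in>blk N j. loc_term N 2 1 0 0 f i)"
    unfolding m[symmetric] using N by (intro half_sum loc_term_nonneg f) auto
  also have "... \<le> (\<Sum>j\<in>{..m}. 6 / (real N)\<^sup>2 * B j)" by (intro sum_mono blkB)
  also have "... = 6 / (real N)\<^sup>2 * (\<Sum>j\<in>{..m}. B j)" by (simp add: sum_distrib_left)
  also have "... \<le> 6 / (real N)\<^sup>2 * 150"
  proof (rule mult_left_mono)
    have s1: "(\<Sum>j\<in>{..m}. F (j + 3) - F (j + 2)) = F (m + 3) - F 2"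
      by (induction m) (simp_all add: eval_nat_numeral)
    have s2: "(\<Sum>j\<in>{..m}. F (j - 1) - F (j - 2)) = F (m - 1) - F 0"
    proof (induction m)
      case (Suc m)
      then show ?case by (cases m) (simp_all add: eval_nat_numeral)
    qed simp
    have s3: "(\<Sum>j\<in>{..m}. (if j < 2 then 24 else 0 :: real)) \<le> 48"
    proof -
      have "(\<Sum>j\<in>{..m}. (if j < 2 then 24 else 0 :: real)) = (\<Sum>j\<in>{..m} \<inter> {j. j < 2}. 24)"
        by (simp add: sum.If_cases)
      also have "... \<le> (\<Sum>j\<in>{..<2::nat}. 24)" by (intro sum_mono2) auto
      finally show ?thesis by simp
    qed
    have "(\<Sum>j\<in>{..m}. B j) = 8 * (\<Sum>j\<in>{..m}. F (j + 3) - F (j + 2)) - 1 / 2 * (\<Sum>j\<in>{..m}. F (j - 1) - F (j - 2)) +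
      (\<Sum>j\<in>{..m}. (if j < 2 then 24 else 0))"
      unfolding B_def sum.distrib sum_subtractf sum_distrib_left[symmetric] ..
    also have "... \<le> 8 * (F (m + 3) - F 2) - 1 / 2 * (F (m - 1) - F 0) + 48" unfolding s1 s2 using s3 by simp
    also have "... \<le> 150"
    proof -
      have "8 * (a - b) - 1 / 2 * (c - d) + 48 \<le> 150" if "\<bar>a\<bar> \<le> 3" "\<bar>b\<bar> \<le> 3" "\<bar>c\<bar> \<le> 3" "\<bar>d\<bar> \<le> 3" for a b c d :: real
        using that by (auto simp: abs_le_iff field_simps)
      from this[OF F3 F3 F3 F3] show ?thesis .
    qed
    finally show "(\<Sum>j\<in>{..m}. B j) \<le> 150" .
  qed simp
  finally show ?thesis by simp
qed

lemma Edev_upper_convex: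
  shows "\<exists>c>0. \<forall>n\<ge>1. Edev (Mset 2 \<inter> Bset \<infinity> 0 0) n (jw 0 0) (ereal 1) \<le> ennreal (c * real n powr (- 2))"
proof -
  define K :: real where "K = (6 ^ (2 - 1) * (4 powr (0 + 0) * 3 powr (2 * (0 + 0)))) powr 1 * 6"
  have K: "K \<ge> 0" unfolding K_def by simp
  have "\<exists>c>0. \<forall>n\<ge>1. Edev (Mset 2 \<inter> Bset \<infinity> 0 0) n (jw 0 0) (ereal 1) \<le>
      ennreal (c * real n powr (- 2 / 1) * ln (real n + 1) powr (0 / 1))"
  proof (rule Edev_upper)
    show "2 \<le> 2 - 2 * 1 * einv \<infinity>" by (simp add: einv_def)
    show "\<exists>C>0. \<forall>N\<ge>64. \<forall>f\<in>Mset 2 \<inter> Bset \<infinity> 0 0. (\<Sum>i\<in>{20..N - 21}. loc_term N 2 1 0 0 f i) \<le>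
      C * real N powr (- 2) * ln (real N + 1) powr 0"
    proof (intro exI[of _ "900 + K * 900"] conjI allI impI ballI)
      fix N :: nat and f assume N: "64 \<le> N" and f: "f \<in> Mset 2 \<inter> Bset \<infinity> 0 0"
      have b: "\<bar>f x\<bar> \<le> 3" if "-1 < x" "x < 1" for x using f that by (intro convex_bounded) auto
      have 1: "(\<Sum>i\<in>{16..N div 2}. loc_term N 2 1 0 0 f i) \<le> 900 / (real N)\<^sup>2"
        using f by (intro convex_half_sum N b) auto
      have 2: "(\<Sum>i\<in>{16..N div 2}. loc_term N 2 1 0 0 (\<lambda>x. (- 1) ^ 2 * f (- x)) i) \<le> 900 / (real N)\<^sup>2"
        using f b by (intro convex_half_sum N Mset_reflect) auto
      have "(\<Sum>i\<in>{20..N - 21}. loc_term N 2 1 0 0 f i) \<le> 900 / (real N)\<^sup>2 + K * (900 / (real N)\<^sup>2)"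
        using total_sum_halves[of 2 1 0 0 N f, folded K_def] 1 mult_left_mono[OF 2 K] N f by auto
      also have "... = (900 + K * 900) * real N powr (- 2) * ln (real N + 1) powr 0"
        using N by (simp add: powr_minus_divide add_divide_distrib)
      finally show "(\<Sum>i\<in>{20..N - 21}. loc_term N 2 1 0 0 f i) \<le> (900 + K * 900) * real N powr (- 2) * ln (real N + 1) powr 0" .
    qed (use K in simp)
  qed simp_all
  then obtain c where c: "c > 0" "\<And>n. n \<ge> 1 \<Longrightarrow> Edev (Mset 2 \<inter> Bset \<infinity> 0 0) n (jw 0 0) (ereal 1) \<le>
      ennreal (c * real n powr (- 2 / 1) * ln (real n + 1) powr (0 / 1))"
    by blast
  show ?thesis
  proof (intro exI[of _ c] conjI allI impI c(1))
    fix n :: nat assume n: "1 \<le> n"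
    have "ln (real n + 1) powr (0 / 1) = 1" using ln_Suc_pos[OF n] by simp
    moreover have "- 2 / 1 = (- 2 :: real)" by simp
    ultimately show "Edev (Mset 2 \<inter> Bset \<infinity> 0 0) n (jw 0 0) (ereal 1) \<le> ennreal (c * real n powr (- 2))"
      using c(2)[OF n] by (simp only: mult_1_right)
  qed
qed

section \<open>Duality\<close>

text \<open>With x = cos t the integrand is cos(j t) sin(N t) sin t, a combination of four cosines
  of frequencies N - 1 - j, N - 1 + j, N + 1 - j, N + 1 + j. These are positive as
  \<open>j + 2 \<le> N\<close>, and the sines of the antiderivative vanish at 0 and pi.\<close>

lemma cheb_orthogonal:
  assumes "j + 2 \<le> N"
  shows "((\<lambda>x. poly (cheb j) x * sin (real N * arccos x)) has_integral 0) {-1..1}"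
proof -
  define a where "a = real (N - 1 - j)"
  define b where "b = real (N - 1 + j)"
  define c where "c = real (N + 1 - j)"
  define d where "d = real (N + 1 + j)"
  have pos: "a > 0" "b > 0" "c > 0" "d > 0" unfolding a_def b_def c_def d_def using assms by auto
  define G where "G t = - (sin (a * t) / a + sin (b * t) / b - sin (c * t) / c - sin (d * t) / d) / 4" for t
  have G': "(G has_real_derivative - (cos (a * t) + cos (b * t) - cos (c * t) - cos (d * t)) / 4) (at t)" for t
    unfolding G_def using pos by (auto intro!: derivative_eq_intros)
  have id: "(cos (a * t) + cos (b * t) - cos (c * t) - cos (d * t)) / 4 = cos (real j * t) * sin (real N * t) * sin t" for t
  proof -
    have e: "a * t = (real N * t - t) - real j * t" "b * t = (real N * t - t) + real j * t"
      "c * t = (real N * t + t) - real j * t" "d * t = (real N * t + t) + real j * t"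
      unfolding a_def b_def c_def d_def using assms by (auto simp: of_nat_diff algebra_simps)
    have "cos (a * t) + cos (b * t) = 2 * cos (real N * t - t) * cos (real j * t)"
      unfolding e by (simp only: cos_add[of _ "real j * t"] cos_diff[of _ "real j * t"])
    moreover have "cos (c * t) + cos (d * t) = 2 * cos (real N * t + t) * cos (real j * t)"
      unfolding e by (simp only: cos_add[of _ "real j * t"] cos_diff[of _ "real j * t"])
    moreover have "cos (real N * t - t) - cos (real N * t + t) = 2 * sin (real N * t) * sin t"
      by (simp add: cos_add cos_diff)
    ultimately show ?thesis by (simp add: algebra_simps)
  qed
  have "((\<lambda>x. poly (cheb j) x * sin (real N * arccos x)) has_integral (G (arccos 1) - G (arccos (-1)))) {-1..1}"
  proof (rule fundamental_theorem_of_calculus_interior)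
    show "continuous_on {-1..1} (\<lambda>x. G (arccos x))"
      unfolding G_def using pos by (intro continuous_intros) auto
    fix x :: real assume x: "x \<in> {-1<..<1}"
    have s: "sqrt (1 - x\<^sup>2) > 0" using x by (simp add: abs_square_less_1 abs_less_iff)
    have "((\<lambda>x. G (arccos x)) has_real_derivative
      - (cos (a * arccos x) + cos (b * arccos x) - cos (c * arccos x) - cos (d * arccos x)) / 4 * inverse (- sqrt (1 - x\<^sup>2))) (at x)"
      using x by (intro DERIV_chain2[OF G'] DERIV_arccos) auto
    moreover have "- (cos (a * arccos x) + cos (b * arccos x) - cos (c * arccos x) - cos (d * arccos x)) / 4 * inverse (- sqrt (1 - x\<^sup>2)) =
      poly (cheb j) x * sin (real N * arccos x)"
    proof -
      have neg: "- A / 4 * inverse (- s) = A / 4 / s" for A s :: real by (cases "s = 0") (auto simp: field_simps)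
      have "sin (arccos x) = sqrt (1 - x\<^sup>2)" using x by (intro sin_arccos) auto
      moreover have "cos (real j * arccos x) = poly (cheb j) x"
        using poly_cheb[of j "arccos x"] x by simp
      ultimately show ?thesis unfolding neg id using s by simp
    qed
    ultimately have "((\<lambda>x. G (arccos x)) has_real_derivative poly (cheb j) x * sin (real N * arccos x)) (at x)"
      by (simp only:)
    then show "((\<lambda>x. G (arccos x)) has_vector_derivative poly (cheb j) x * sin (real N * arccos x)) (at x)"
      unfolding has_real_derivative_iff_has_vector_derivative .
  qed simp
  moreover have "G (arccos 1) = 0" unfolding G_def by simp
  moreover have "G (arccos (-1)) = 0"
  proof -
    have "sin (a * pi) = 0" "sin (b * pi) = 0" "sin (c * pi) = 0" "sin (d * pi) = 0"
      unfolding a_def b_def c_def d_def by (rule sin_npi)+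
    then show ?thesis unfolding G_def by simp
  qed
  ultimately show ?thesis by simp
qed

lemma poly_orthogonal:
  fixes P :: "real poly"
  assumes "degree P + 2 \<le> N"
  shows "((\<lambda>x. poly P x * sin (real N * arccos x)) has_integral 0) {-1..1}"
proof -
  obtain a where a: "P = (\<Sum>j\<le>degree P. smult (a j) (cheb j))"
    using cheb_expand[of P "degree P"] by blast
  have "((\<lambda>x. \<Sum>j\<le>degree P. a j * (poly (cheb j) x * sin (real N * arccos x))) has_integral (\<Sum>j\<le>degree P. a j * 0)) {-1..1}"
    using assms by (intro has_integral_sum has_integral_mult_right cheb_orthogonal) auto
  moreover have "(\<Sum>j\<le>degree P. a j * (poly (cheb j) x * sin (real N * arccos x))) = poly P x * sin (real N * arccos x)" for x
    by (subst (2) a) (simp add: poly_sum sum_distrib_left mult_ac)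
  ultimately show ?thesis by simp
qed

lemma continuous_I11:
  assumes "continuous_on {-1..1} (g :: real \<Rightarrow> real)"
  shows "g \<in> borel_measurable I11" "integrable I11 g" "integral\<^sup>L I11 g = integral {-1..1} g"
proof -
  show "g \<in> borel_measurable I11"
    using borel_measurable_continuous_on_restrict[OF assms] unfolding I11_def
    by (simp cong: measurable_cong_sets add: sets_restrict_space)
  have si: "set_integrable lborel {-1..1} g"
    using borel_integrable_atLeastAtMost'[OF assms] .
  then show "integrable I11 g"
    unfolding I11_def set_integrable_def by (subst integrable_restrict_space) auto
  have "integral\<^sup>L I11 g = set_lebesgue_integral lborel {-1..1} g"
    unfolding I11_def set_lebesgue_integral_def by (subst integral_restrict_space) auto
  also have "... = integral {-1..1} g" using si by (rule set_borel_integral_eq_integral)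
  finally show "integral\<^sup>L I11 g = integral {-1..1} g" .
qed

lemma sn_continuous: "continuous_on {-1..1} (\<lambda>x. poly P x * sin (real N * arccos x))"
  by (intro continuous_intros) auto

text \<open>The dual element: multiplied by \<open>sin (N arccos x)\<close>, the polynomial below is orthogonal to
  low degree polynomials, yet it is localised around prescribed nodes.\<close>

definition dual_consts :: "real \<Rightarrow> real \<Rightarrow> nat \<Rightarrow> real \<Rightarrow> real \<Rightarrow> bool" where
  "dual_consts \<alpha> \<beta> c0 c C \<longleftrightarrow> 4 dvd c0 \<and> c0 \<ge> (8::nat) \<and> c > 0 \<and> C > 0 \<and> (\<forall>n\<ge>1. \<forall>\<Lambda> v. finite \<Lambda> \<longrightarrow> \<Lambda> \<subseteq> {1..<c0 * n} \<longrightarrow> (\<forall>i\<in>\<Lambda>. 0 \<le> v i) \<longrightarrow>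
    (\<exists>\<kappa>. degree \<kappa> + n + 2 \<le> c0 * n \<and>
      (\<forall>x\<in>{-1..1}. 0 \<le> poly \<kappa> x \<and> poly \<kappa> x \<le> C * jw \<alpha> \<beta> x * (\<Sum>i\<in>\<Lambda>. v i / dst (c0 * n) i x ^ 4)) \<and>
      (\<forall>i\<in>\<Lambda>. \<forall>x\<in>{-1..1}. dst (c0 * n) i x \<le> 2 \<longrightarrow> 1 / 4 \<le> real (c0 * n) * arccos x / pi \<longrightarrow>
        real (c0 * n) * arccos x / pi \<le> real (c0 * n) - 1 / 4 \<longrightarrow>
        c * v i * jw \<alpha> \<beta> (tau (c0 * n) i) \<le> poly \<kappa> x)))"

text \<open>The weight is not a polynomial, but its product with the complementary weight, of
  exponents a - \<alpha> and a - \<beta>, is (1 - x^2)^a. Dividing each bump by the complementary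
  weight at its node makes the polynomial comparable with the weight times the sum of the bumps; the
  variation of the complementary weight is absorbed by the decay.\<close>

lemma dual_poly:
  fixes \<alpha> \<beta> :: real
  assumes ab: "0 \<le> \<alpha>" "0 \<le> \<beta>"
  shows "\<exists>c0 c C. dual_consts \<alpha> \<beta> c0 c C"
proof -
  \<comment> \<open>The summand 1 makes (1 - x^2)^a vanish at the endpoints, where the weight is 0
    by \<open>0 powr 0 = 0\<close>.\<close>
  define a where "a = nat \<lceil>\<alpha> + \<beta>\<rceil> + 1"
  have a: "\<alpha> \<le> real a" "\<beta> \<le> real a" "a \<ge> 1" unfolding a_def using ab by linarith+
  define \<alpha>' where "\<alpha>' = real a - \<alpha>"
  define \<beta>' where "\<beta>' = real a - \<beta>"
  have ab': "0 \<le> \<alpha>'" "0 \<le> \<beta>'" unfolding \<alpha>'_def \<beta>'_def using a by auto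
  \<comment> \<open>Enough decay to absorb the complementary weight and leave the fourth
    power.\<close>
  define r where "r = nat \<lceil>\<alpha>' + \<beta>'\<rceil> + 2"
  have r: "2 * (\<alpha>' + \<beta>') + 4 \<le> real (2 * r)" unfolding r_def using ab' by simp linarith
  \<comment> \<open>The degree, at most 2 a + r n, together with n + 2 must fit below c0 n. The
    factor 4 provides the divisibility from which \<open>Edev_lower_jump\<close> obtains an even
    index near N / 2.\<close>
  define c0 where "c0 = 4 * (r + 2 * a + 2)"
  define C where "C = 4 powr (\<alpha>' + \<beta>') * (2 * (2 * real c0) ^ (2 * r))"
  have c0: "c0 \<ge> 8" unfolding c0_def by simp
  have C: "C > 0" unfolding C_def using c0 by simp
  define c where "c = (4 / pi\<^sup>2) ^ r * 400 powr (- (\<alpha>' + \<beta>')) * 400 powr (- (\<alpha> + \<beta>))"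
  have c: "c > 0" unfolding c_def by simp
  have "\<exists>\<kappa>. degree \<kappa> + n + 2 \<le> c0 * n \<and>
      (\<forall>x\<in>{-1..1}. 0 \<le> poly \<kappa> x \<and> poly \<kappa> x \<le> C * jw \<alpha> \<beta> x * (\<Sum>i\<in>\<Lambda>. v i / dst (c0 * n) i x ^ 4)) \<and>
      (\<forall>i\<in>\<Lambda>. \<forall>x\<in>{-1..1}. dst (c0 * n) i x \<le> 2 \<longrightarrow> 1 / 4 \<le> real (c0 * n) * arccos x / pi \<longrightarrow>
        real (c0 * n) * arccos x / pi \<le> real (c0 * n) - 1 / 4 \<longrightarrow>
        c * v i * jw \<alpha> \<beta> (tau (c0 * n) i) \<le> poly \<kappa> x)"
    if n: "n \<ge> 1" and \<Lambda>: "finite \<Lambda>" "\<Lambda> \<subseteq> {1..<c0 * n}" and v: "\<And>i. i \<in> \<Lambda> \<Longrightarrow> 0 \<le> v i" for n \<Lambda> v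
  proof -
    define N where "N = c0 * n"
    have nN: "n \<le> N" unfolding N_def using c0 by simp
    have NM: "real N / real n = real c0" unfolding N_def using n by simp
    define W where "W = jw \<alpha>' \<beta>'"
    have "\<forall>i\<in>\<Lambda>. \<exists>V. degree V \<le> r * n \<and> (\<forall>x\<in>{-1..1}. 0 \<le> poly V x \<and>
      poly V x \<le> 2 * (2 * real c0) ^ (2 * r) / dst N i x ^ (2 * r) \<and>
      (dst N i x \<le> 2 \<longrightarrow> poly V x \<ge> (4 / pi\<^sup>2) ^ r))"
    proof
      fix i assume "i \<in> \<Lambda>"
      then have "i \<le> N" using \<Lambda> unfolding N_def by auto
      from node_poly[OF n nN this, of r] NM show "\<exists>V. degree V \<le> r * n \<and> (\<forall>x\<in>{-1..1}. 0 \<le> poly V x \<and>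
      poly V x \<le> 2 * (2 * real c0) ^ (2 * r) / dst N i x ^ (2 * r) \<and>
      (dst N i x \<le> 2 \<longrightarrow> poly V x \<ge> (4 / pi\<^sup>2) ^ r))" by (simp flip: times_divide_eq_right)
    qed
    from bchoice[OF this] obtain V where V0: "\<forall>i\<in>\<Lambda>. degree (V i) \<le> r * n \<and> (\<forall>x\<in>{-1..1}. 0 \<le> poly (V i) x \<and>
      poly (V i) x \<le> 2 * (2 * real c0) ^ (2 * r) / dst N i x ^ (2 * r) \<and>
      (dst N i x \<le> 2 \<longrightarrow> poly (V i) x \<ge> (4 / pi\<^sup>2) ^ r))" by (rule exE)
    have V: "\<And>i. i \<in> \<Lambda> \<Longrightarrow> degree (V i) \<le> r * n"
      "\<And>i x. i \<in> \<Lambda> \<Longrightarrow> x \<in> {-1..1} \<Longrightarrow> 0 \<le> poly (V i) x"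
      "\<And>i x. i \<in> \<Lambda> \<Longrightarrow> x \<in> {-1..1} \<Longrightarrow> poly (V i) x \<le> 2 * (2 * real c0) ^ (2 * r) / dst N i x ^ (2 * r)"
      "\<And>i x. i \<in> \<Lambda> \<Longrightarrow> x \<in> {-1..1} \<Longrightarrow> dst N i x \<le> 2 \<Longrightarrow> poly (V i) x \<ge> (4 / pi\<^sup>2) ^ r"
      using V0 by blast+
    have Wp: "W (tau N i) > 0" if "i \<in> \<Lambda>" for i
      unfolding W_def using that \<Lambda> tau_bounds[of i N] N_def by (intro jw_pos) auto
    define \<kappa> where "\<kappa> = [:1, 0, -1:] ^ a * (\<Sum>i\<in>\<Lambda>. smult (v i / W (tau N i)) (V i))"
    have "degree \<kappa> + n + 2 \<le> c0 * n"
    proof -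
      have "degree ([:1, 0, -1:] ^ a :: real poly) \<le> 2 * a"
        using degree_power_le[of "[:1, 0, -1:] :: real poly" a] by simp
      moreover have "degree (\<Sum>i\<in>\<Lambda>. smult (v i / W (tau N i)) (V i)) \<le> r * n"
        using V(1) \<Lambda>(1) by (intro degree_sum_le) (auto intro: order_trans[OF degree_smult_le])
      ultimately have "degree \<kappa> \<le> 2 * a + r * n"
        unfolding \<kappa>_def by (meson add_mono degree_mult_le order_trans)
      moreover have "2 * a \<le> 2 * a * n" using n by simp
      moreover have "2 * a * n + r * n + n + 2 \<le> c0 * n" unfolding c0_def using n by (simp add: algebra_simps)
      ultimately show ?thesis by linarith
    qed
    moreover have pk: "poly \<kappa> x = (1 - x\<^sup>2) ^ a * (\<Sum>i\<in>\<Lambda>. v i / W (tau N i) * poly (V i) x)" for x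
      unfolding \<kappa>_def by (simp add: poly_sum poly_power power2_eq_square algebra_simps)
    have wW: "(1 - x\<^sup>2) ^ a = jw \<alpha> \<beta> x * W x" if "x \<in> {-1..1}" for x
    proof (cases "x = -1 \<or> x = 1")
      case True
      then show ?thesis unfolding jw_def using a by auto
    next
      case False
      then have x: "1 + x > 0" "1 - x > 0" using that by auto
      have "jw \<alpha> \<beta> x * W x = ((1 + x) powr \<alpha> * (1 + x) powr \<alpha>') * ((1 - x) powr \<beta> * (1 - x) powr \<beta>')"
        unfolding W_def jw_def by simp
      also have "... = (1 + x) powr real a * (1 - x) powr real a"
        unfolding \<alpha>'_def \<beta>'_def by (simp flip: powr_add)
      also have "... = (1 - x\<^sup>2) ^ a" using x by (simp add: powr_realpow power2_eq_square algebra_simps flip: power_mult_distrib)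
      finally show ?thesis by simp
    qed
    moreover have "0 \<le> poly \<kappa> x \<and> poly \<kappa> x \<le> C * jw \<alpha> \<beta> x * (\<Sum>i\<in>\<Lambda>. v i / dst N i x ^ 4)" if x: "x \<in> {-1..1}" for x
    proof
      have t0: "0 \<le> v i / W (tau N i) * poly (V i) x" if "i \<in> \<Lambda>" for i
        using v[OF that] Wp[OF that] V(2)[OF that x] by (intro mult_nonneg_nonneg divide_nonneg_pos) auto
      have W0: "0 \<le> W x" unfolding W_def by (rule jw_nonneg)
      show "0 \<le> poly \<kappa> x" unfolding pk wW[OF x]
        by (intro mult_nonneg_nonneg sum_nonneg t0 jw_nonneg W0)
      have "W x * (\<Sum>i\<in>\<Lambda>. v i / W (tau N i) * poly (V i) x) \<le> (\<Sum>i\<in>\<Lambda>. C * (v i / dst N i x ^ 4))"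
        unfolding sum_distrib_left
      proof (rule sum_mono)
        fix i assume i: "i \<in> \<Lambda>"
        let ?d = "dst N i x"
        have iN: "1 \<le> i" "i < N" using i \<Lambda> unfolding N_def by auto
        have d: "1 \<le> ?d" by (rule dst_ge_1)
        have "?d powr (2 * (\<alpha>' + \<beta>')) * ?d ^ 4 = ?d powr (2 * (\<alpha>' + \<beta>') + 4)"
          using powr_realpow[OF dst_pos, of N i x 4] by (simp add: powr_add)
        also have "... \<le> ?d powr real (2 * r)" using r d by (intro powr_mono) auto
        also have "... = ?d ^ (2 * r)" using d by (intro powr_realpow) auto
        finally have "?d powr (2 * (\<alpha>' + \<beta>')) * ?d ^ 4 / (?d ^ 4 * ?d ^ (2 * r)) \<le> ?d ^ (2 * r) / (?d ^ 4 * ?d ^ (2 * r))"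
          by (intro divide_right_mono) auto
        then have ds: "?d powr (2 * (\<alpha>' + \<beta>')) / ?d ^ (2 * r) \<le> 1 / ?d ^ 4" by simp
        have "W x * (v i / W (tau N i) * poly (V i) x) \<le>
          (4 powr (\<alpha>' + \<beta>') * ?d powr (2 * (\<alpha>' + \<beta>')) * W (tau N i)) * (v i / W (tau N i) * (2 * (2 * real c0) ^ (2 * r) / ?d ^ (2 * r)))"
          unfolding W_def using V(2,3)[OF i x] v[OF i] Wp[OF i, unfolded W_def] t0[OF i, unfolded W_def]
          by (intro mult_mono jw_le_dst iN x ab' mult_left_mono) (auto intro!: mult_nonneg_nonneg less_imp_le)
        also have "... = C * v i * (?d powr (2 * (\<alpha>' + \<beta>')) / ?d ^ (2 * r))"
          unfolding C_def using Wp[OF i] by simp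
        also have "... \<le> C * v i * (1 / ?d ^ 4)" using C v[OF i] by (intro mult_left_mono ds) auto
        finally show "W x * (v i / W (tau N i) * poly (V i) x) \<le> C * (v i / ?d ^ 4)" by simp
      qed
      then have "jw \<alpha> \<beta> x * (W x * (\<Sum>i\<in>\<Lambda>. v i / W (tau N i) * poly (V i) x)) \<le> jw \<alpha> \<beta> x * (\<Sum>i\<in>\<Lambda>. C * (v i / dst N i x ^ 4))"
        by (intro mult_left_mono jw_nonneg)
      then show "poly \<kappa> x \<le> C * jw \<alpha> \<beta> x * (\<Sum>i\<in>\<Lambda>. v i / dst N i x ^ 4)"
        unfolding pk wW[OF x] by (simp add: sum_distrib_left mult_ac)
    qed
    moreover have "c * v i * jw \<alpha> \<beta> (tau N i) \<le> poly \<kappa> x"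
      if i: "i \<in> \<Lambda>" and x: "x \<in> {-1..1}" and d: "dst N i x \<le> 2" and nu: "1 / 4 \<le> real N * arccos x / pi" "real N * arccos x / pi \<le> real N - 1 / 4" for i x
    proof -
      have iN: "1 \<le> i" "i < N" using i \<Lambda> unfolding N_def by auto
      have w1: "jw \<alpha> \<beta> (tau N i) \<le> 400 powr (\<alpha> + \<beta>) * jw \<alpha> \<beta> x" using iN x ab nu d by (intro jw_tau_le) auto
      have w2: "W (tau N i) \<le> 400 powr (\<alpha>' + \<beta>') * W x" unfolding W_def using iN x ab' nu d by (intro jw_tau_le) auto
      have W0: "0 \<le> W x" unfolding W_def by (rule jw_nonneg)
      have w2': "400 powr (- (\<alpha>' + \<beta>')) \<le> W x / W (tau N i)"
        unfolding powr_minus_divide using w2 Wp[OF i] by (simp add: field_simps)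
      have w1': "400 powr (- (\<alpha> + \<beta>)) * jw \<alpha> \<beta> (tau N i) \<le> jw \<alpha> \<beta> x"
        unfolding powr_minus_divide using w1 by (simp add: field_simps)
      have "c * v i * jw \<alpha> \<beta> (tau N i) = (400 powr (- (\<alpha> + \<beta>)) * jw \<alpha> \<beta> (tau N i)) * (400 powr (- (\<alpha>' + \<beta>')) * (v i * (4 / pi\<^sup>2) ^ r))"
        unfolding c_def by simp
      also have "... \<le> jw \<alpha> \<beta> x * (W x / W (tau N i) * (v i * poly (V i) x))"
        using w1' w2' V(4)[OF i x d] v[OF i] jw_nonneg W0 Wp[OF i] by (intro mult_mono mult_nonneg_nonneg mult_left_mono) auto
      also have "... = jw \<alpha> \<beta> x * W x * (v i / W (tau N i) * poly (V i) x)" by simp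
      also have "... \<le> jw \<alpha> \<beta> x * W x * (\<Sum>i\<in>\<Lambda>. v i / W (tau N i) * poly (V i) x)"
        using \<Lambda>(1) i v Wp V(2) x jw_nonneg W0
        by (intro mult_left_mono member_le_sum mult_nonneg_nonneg) (auto intro!: mult_nonneg_nonneg divide_nonneg_pos)
      also have "... = poly \<kappa> x" unfolding pk wW[OF x] ..
      finally show ?thesis .
    qed
    ultimately show ?thesis unfolding N_def by blast
  qed
  note main = this
  have "4 dvd c0" unfolding c0_def by simp
  show ?thesis unfolding dual_consts_def
    by (intro exI[of _ c0] exI[of _ c] exI[of _ C] conjI allI impI) (fact | rule main; simp)+
qed

text \<open>By orthogonality the approximant may be subtracted from \<open>u\<close> in the pairing.
  The remaining integrand is at most the weighted error times a sum of bumps, and on each bump the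
  error is split at a level of its own: one part integrates to the mass of the bump, the other is
  bounded by the \<open>q\<close>-th power of the error, the bumps having total at most 4. Separate
  levels are what allows nodes of very different scales in one pairing.\<close>

lemma dual_pairing:
  fixes \<alpha> \<beta> q :: real and \<kappa> :: "real poly"
  assumes q: "1 \<le> q" and N: "degree \<kappa> + n + 2 \<le> N" and C: "C > 0"
    and \<Lambda>: "finite \<Lambda>" "\<Lambda> \<subseteq> {1..<N}" and v: "\<And>i. i \<in> \<Lambda> \<Longrightarrow> 0 \<le> v i" and l: "\<And>i. i \<in> \<Lambda> \<Longrightarrow> 0 < l i"
    and \<kappa>: "\<And>x. x \<in> {-1..1} \<Longrightarrow> 0 \<le> poly \<kappa> x \<and> poly \<kappa> x \<le> C * jw \<alpha> \<beta> x * (\<Sum>i\<in>\<Lambda>. v i / dst N i x ^ 4)"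
    and u: "u \<in> borel_measurable I11" "\<And>x. x \<in> {-1..1} \<Longrightarrow> \<bar>u x\<bar> \<le> U"
    and ug: "\<And>x. x \<in> {-1..1} \<Longrightarrow> 0 \<le> u x * (poly \<kappa> x * sin (real N * arccos x))"
    and S: "0 \<le> S" "ennreal S \<le> (\<integral>\<^sup>+x. ennreal (u x * (poly \<kappa> x * sin (real N * arccos x))) \<partial>I11)"
    and P: "degree P \<le> n" "werr \<alpha> \<beta> q u P \<le> ennreal E" "0 \<le> E"
    and K: "\<And>i. i \<in> \<Lambda> \<Longrightarrow> v i * l i powr (1 - q) \<le> K" "0 \<le> K"
  shows "S \<le> C * (8 * pi * (\<Sum>i\<in>\<Lambda>. v i * l i * hh N i) + 4 * K * E)"
proof -
  define g where "g x = poly \<kappa> x * sin (real N * arccos x)" for x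
  have C0: "0 \<le> C" and l0: "\<And>i. i \<in> \<Lambda> \<Longrightarrow> 0 \<le> l i" using C l by (auto intro: less_imp_le)
  have gc: "continuous_on {-1..1} g" unfolding g_def by (rule sn_continuous)
  note [measurable] = continuous_I11(1)[OF gc] u(1)
  have gi: "integrable I11 g" by (rule continuous_I11(2)[OF gc])
  have [measurable]: "poly P \<in> borel_measurable I11" "jw \<alpha> \<beta> \<in> borel_measurable I11" by (intro borel_I11; measurable)+
  have ugi: "integrable I11 (\<lambda>x. u x * g x)"
  proof (rule Bochner_Integration.integrable_bound)
    show "integrable I11 (\<lambda>x. U * \<bar>g x\<bar>)" using gi by simp
    show "AE x in I11. norm (u x * g x) \<le> norm (U * \<bar>g x\<bar>)"
    proof (rule AE_I2)
      fix x assume "x \<in> space I11"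
      then have "\<bar>u x\<bar> \<le> U" using u(2) by simp
      then show "norm (u x * g x) \<le> norm (U * \<bar>g x\<bar>)" by (simp add: abs_mult mult_right_mono)
    qed
  qed measurable
  have Pgc: "continuous_on {-1..1} (\<lambda>x. poly P x * g x)"
    unfolding g_def by (intro continuous_intros) auto
  have Pg0: "integral\<^sup>L I11 (\<lambda>x. poly P x * g x) = 0"
  proof -
    have "degree (P * \<kappa>) + 2 \<le> N" using degree_mult_le[of P \<kappa>] P(1) N by linarith
    from poly_orthogonal[OF this] have "((\<lambda>x. poly P x * g x) has_integral 0) {-1..1}"
      unfolding g_def by (simp add: mult.assoc)
    then show ?thesis unfolding continuous_I11(3)[OF Pgc] by (rule integral_unique)
  qed
  have "ennreal S \<le> ennreal (integral\<^sup>L I11 (\<lambda>x. u x * g x))"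
    using S(2) ugi ug unfolding g_def by (subst nn_integral_eq_integral[symmetric]) auto
  then have "S \<le> integral\<^sup>L I11 (\<lambda>x. u x * g x)"
    using ug unfolding g_def by (subst (asm) ennreal_le_iff) (auto intro!: integral_nonneg_AE)
  also have "... = integral\<^sup>L I11 (\<lambda>x. (u x - poly P x) * g x)"
    using ugi continuous_I11(2)[OF Pgc] Pg0 by (simp add: left_diff_distrib)
  also have "... \<le> integral\<^sup>L I11 (\<lambda>x. \<bar>(u x - poly P x) * g x\<bar>)"
    using ugi continuous_I11(2)[OF Pgc] by (intro integral_mono) (auto simp: left_diff_distrib)
  finally have S1: "S \<le> integral\<^sup>L I11 (\<lambda>x. \<bar>(u x - poly P x) * g x\<bar>)" .
  have "ennreal S \<le> (\<integral>\<^sup>+x. ennreal \<bar>(u x - poly P x) * g x\<bar> \<partial>I11)"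
    using S1 ugi continuous_I11(2)[OF Pgc]
    by (subst nn_integral_eq_integral) (auto simp: left_diff_distrib ennreal_leI)
  also have "... \<le> (\<integral>\<^sup>+x. ennreal (\<Sum>i\<in>\<Lambda>. C * v i * l i * bell N i x) + ennreal (C * 4 * K) * ennreal (\<bar>jw \<alpha> \<beta> x * (u x - poly P x)\<bar> powr q) \<partial>I11)"
  proof (rule nn_integral_mono)
    fix x assume "x \<in> space I11"
    then have x: "x \<in> {-1..1}" by simp
    define y where "y = \<bar>jw \<alpha> \<beta> x * (u x - poly P x)\<bar>"
    have y0: "0 \<le> y" unfolding y_def by simp
    have "\<bar>(u x - poly P x) * g x\<bar> \<le> \<bar>u x - poly P x\<bar> * poly \<kappa> x"
      unfolding g_def abs_mult using \<kappa>[OF x] by (intro mult_left_mono) (auto simp: mult_left_le)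
    also have "... \<le> \<bar>u x - poly P x\<bar> * (C * jw \<alpha> \<beta> x * (\<Sum>i\<in>\<Lambda>. v i / dst N i x ^ 4))"
      using \<kappa>[OF x] by (intro mult_left_mono) auto
    also have "... = (\<Sum>i\<in>\<Lambda>. C * v i * y / dst N i x ^ 4)"
      unfolding y_def by (simp add: sum_distrib_left abs_mult jw_nonneg mult_ac)
    also have "... \<le> (\<Sum>i\<in>\<Lambda>. C * v i * l i * bell N i x + C * K * y powr q * (1 / (dst N i x)\<^sup>2))"
    proof (rule sum_mono)
      fix i assume i: "i \<in> \<Lambda>"
      have iN: "1 \<le> i" "i < N" using i \<Lambda> by auto
      \<comment> \<open>The split that replaces Hoelder; for \<open>q = 1\<close> it is harmless, as
        the second term alone dominates.\<close>
      have "y \<le> l i + l i powr (1 - q) * y powr q"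
        using powr_split_le[of y 1 q "l i"] y0 q l[OF i] by simp
      then have "C * v i * y / dst N i x ^ 4 \<le> C * v i * (l i + l i powr (1 - q) * y powr q) / dst N i x ^ 4"
        using C v[OF i] by (intro divide_right_mono mult_left_mono) auto
      also have "... = C * v i * l i * (1 / dst N i x ^ 4) + C * (v i * l i powr (1 - q)) * y powr q * (1 / dst N i x ^ 4)"
        by (simp add: distrib_left add_divide_distrib)
      also have "... \<le> C * v i * l i * bell N i x + C * K * y powr q * (1 / (dst N i x)\<^sup>2)"
      proof (intro add_mono mult_mono mult_left_mono)
        show "1 / dst N i x ^ 4 \<le> bell N i x" by (rule dst_le_bell[OF iN x])
        have "(dst N i x)\<^sup>2 \<le> dst N i x ^ 4" using dst_ge_1 by (intro power_increasing) auto
        then show "1 / dst N i x ^ 4 \<le> 1 / (dst N i x)\<^sup>2" by (intro divide_left_mono) auto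
      qed (use C v[OF i] l[OF i] K(1)[OF i] K(2) in auto)
      finally show "C * v i * y / dst N i x ^ 4 \<le> C * v i * l i * bell N i x + C * K * y powr q * (1 / (dst N i x)\<^sup>2)" .
    qed
    also have "... = (\<Sum>i\<in>\<Lambda>. C * v i * l i * bell N i x) + C * K * y powr q * (\<Sum>i\<in>\<Lambda>. 1 / (dst N i x)\<^sup>2)"
      by (simp add: sum.distrib sum_distrib_left)
    also have "... \<le> (\<Sum>i\<in>\<Lambda>. C * v i * l i * bell N i x) + C * K * y powr q * 4"
      using C K(2) by (intro add_left_mono mult_left_mono sum_dst_le \<Lambda> x) auto
    finally have "\<bar>(u x - poly P x) * g x\<bar> \<le> (\<Sum>i\<in>\<Lambda>. C * v i * l i * bell N i x) + C * 4 * K * y powr q"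
      by (simp add: mult_ac)
    then have "ennreal \<bar>(u x - poly P x) * g x\<bar> \<le> ennreal ((\<Sum>i\<in>\<Lambda>. C * v i * l i * bell N i x) + C * 4 * K * y powr q)"
      by (rule ennreal_leI)
    also have "... = ennreal (\<Sum>i\<in>\<Lambda>. C * v i * l i * bell N i x) + ennreal (C * 4 * K * y powr q)"
      using C0 v K(2) bell_nonneg l0 by (intro ennreal_plus sum_nonneg mult_nonneg_nonneg) auto
    also have "ennreal (C * 4 * K * y powr q) = ennreal (C * 4 * K) * ennreal (y powr q)"
      using C K(2) by (intro ennreal_mult) auto
    finally show "ennreal \<bar>(u x - poly P x) * g x\<bar> \<le> ennreal (\<Sum>i\<in>\<Lambda>. C * v i * l i * bell N i x) +
      ennreal (C * 4 * K) * ennreal (\<bar>jw \<alpha> \<beta> x * (u x - poly P x)\<bar> powr q)" unfolding y_def .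
  qed
  also have "... = (\<integral>\<^sup>+x. ennreal (\<Sum>i\<in>\<Lambda>. C * v i * l i * bell N i x) \<partial>I11) +
      ennreal (C * 4 * K) * (werr \<alpha> \<beta> q u P)"
  proof -
    have [measurable]: "(\<lambda>x. \<Sum>i\<in>\<Lambda>. C * v i * l i * bell N i x) \<in> borel_measurable I11"
      by (intro borel_I11) measurable
    show ?thesis by (simp add: nn_integral_add nn_integral_cmult)
  qed
  also have "... \<le> ennreal (\<Sum>i\<in>\<Lambda>. C * v i * l i * (8 * pi * hh N i)) + ennreal (C * 4 * K) * ennreal E"
  proof (intro add_mono mult_left_mono P(2))
    have "(\<integral>\<^sup>+x. ennreal (\<Sum>i\<in>\<Lambda>. C * v i * l i * bell N i x) \<partial>I11) =
      (\<integral>\<^sup>+x. ennreal (\<Sum>i\<in>\<Lambda>. C * v i * l i * bell N i x) * indicator {-1..1} x \<partial>lborel)"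
      unfolding I11_def by (subst nn_integral_restrict_space) auto
    also have "... \<le> (\<integral>\<^sup>+x. (\<Sum>i\<in>\<Lambda>. ennreal (C * v i * l i) * ennreal (bell N i x)) \<partial>lborel)"
    proof (rule nn_integral_mono)
      fix x :: real
      have "(\<Sum>i\<in>\<Lambda>. ennreal (C * v i * l i) * ennreal (bell N i x)) = (\<Sum>i\<in>\<Lambda>. ennreal (C * v i * l i * bell N i x))"
        using C0 v l0 bell_nonneg by (intro sum.cong refl ennreal_mult[symmetric]) (auto intro!: mult_nonneg_nonneg)
      also have "... = ennreal (\<Sum>i\<in>\<Lambda>. C * v i * l i * bell N i x)"
        using C0 v l0 bell_nonneg by (intro sum_ennreal) (auto intro!: mult_nonneg_nonneg)
      finally show "ennreal (\<Sum>i\<in>\<Lambda>. C * v i * l i * bell N i x) * indicator {-1..1} x \<le> (\<Sum>i\<in>\<Lambda>. ennreal (C * v i * l i) * ennreal (bell N i x))"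
        by (auto split: split_indicator)
    qed
    also have "... = (\<Sum>i\<in>\<Lambda>. ennreal (C * v i * l i) * (\<integral>\<^sup>+x. ennreal (bell N i x) \<partial>lborel))"
      by (subst nn_integral_sum) (auto simp: nn_integral_cmult)
    also have "... \<le> (\<Sum>i\<in>\<Lambda>. ennreal (C * v i * l i) * ennreal (8 * pi * hh N i))"
      using \<Lambda> by (intro sum_mono mult_left_mono nn_integral_bell) auto
    also have "... = (\<Sum>i\<in>\<Lambda>. ennreal (C * v i * l i * (8 * pi * hh N i)))"
    proof (rule sum.cong[OF refl], rule ennreal_mult[symmetric])
      fix i assume i: "i \<in> \<Lambda>"
      show "0 \<le> C * v i * l i" using C v[OF i] l[OF i] by simp
      have "hh N i > 0" using i \<Lambda> by (intro hh_pos) auto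
      then show "0 \<le> 8 * pi * hh N i" by simp
    qed
    also have "... = ennreal (\<Sum>i\<in>\<Lambda>. C * v i * l i * (8 * pi * hh N i))"
    proof (rule sum_ennreal)
      fix i assume i: "i \<in> \<Lambda>"
      have "hh N i > 0" using i \<Lambda> by (intro hh_pos) auto
      then show "0 \<le> C * v i * l i * (8 * pi * hh N i)" using C v[OF i] l[OF i] by simp
    qed
    finally show "(\<integral>\<^sup>+x. ennreal (\<Sum>i\<in>\<Lambda>. C * v i * l i * bell N i x) \<partial>I11) \<le> ennreal (\<Sum>i\<in>\<Lambda>. C * v i * l i * (8 * pi * hh N i))" .
  qed simp
  also have "... = ennreal (C * (8 * pi * (\<Sum>i\<in>\<Lambda>. v i * l i * hh N i) + 4 * K * E))"
  proof -
    have h0: "0 \<le> hh N i" if "i \<in> \<Lambda>" for i using hh_pos[of i N] that \<Lambda> by fastforce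
    have "ennreal (C * 4 * K) * ennreal E = ennreal (C * 4 * K * E)" using C K(2) P(3) by (intro ennreal_mult[symmetric]) auto
    moreover have "ennreal (\<Sum>i\<in>\<Lambda>. C * v i * l i * (8 * pi * hh N i)) + ennreal (C * 4 * K * E) =
      ennreal ((\<Sum>i\<in>\<Lambda>. C * v i * l i * (8 * pi * hh N i)) + C * 4 * K * E)"
      using C0 v l0 h0 K(2) P(3) by (intro ennreal_plus[symmetric] sum_nonneg mult_nonneg_nonneg) auto
    moreover have "(\<Sum>i\<in>\<Lambda>. C * v i * l i * (8 * pi * hh N i)) + C * 4 * K * E = C * (8 * pi * (\<Sum>i\<in>\<Lambda>. v i * l i * hh N i) + 4 * K * E)"
      by (simp add: sum_distrib_left algebra_simps)
    ultimately show ?thesis by simp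
  qed
  finally have fin: "ennreal S \<le> ennreal (C * (8 * pi * (\<Sum>i\<in>\<Lambda>. v i * l i * hh N i) + 4 * K * E))" .
  have "0 \<le> C * (8 * pi * (\<Sum>i\<in>\<Lambda>. v i * l i * hh N i) + 4 * K * E)"
  proof -
    have h0: "0 \<le> hh N i" if "i \<in> \<Lambda>" for i using hh_pos[of i N] that \<Lambda> by fastforce
    show ?thesis using C0 v l0 h0 K(2) P(3) by (intro mult_nonneg_nonneg add_nonneg_nonneg sum_nonneg) auto
  qed
  with fin show ?thesis by (simp add: ennreal_le_iff)
qed

section \<open>Norms of test functions and passage to the normalised class\<close>

lemma esssup_ennreal_cmult_le:
  fixes F :: "real \<Rightarrow> real"
  assumes "F \<in> borel_measurable M" "0 \<le> c"
  shows "esssup M (\<lambda>x. ennreal \<bar>c * F x\<bar>) \<le> ennreal c * esssup M (\<lambda>x. ennreal \<bar>F x\<bar>)"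
proof (rule esssup_I)
  show "(\<lambda>x. ennreal \<bar>c * F x\<bar>) \<in> borel_measurable M" using assms by measurable
  show "AE x in M. ennreal \<bar>c * F x\<bar> \<le> ennreal c * esssup M (\<lambda>x. ennreal \<bar>F x\<bar>)"
    using esssup_AE[of "\<lambda>x. ennreal \<bar>F x\<bar>" M]
    by eventually_elim (use assms in \<open>simp add: abs_mult ennreal_mult mult_left_mono\<close>)
qed

lemma Lp_norm_inf: "F \<in> borel_measurable I11 \<Longrightarrow> Lp_norm \<infinity> F = esssup I11 (\<lambda>x. ennreal \<bar>F x\<bar>)"
  unfolding Lp_norm_def by simp

lemma Lp_norm_scale_le:
  assumes F: "F \<in> borel_measurable I11" and c: "0 < c" and p: "p = \<infinity> \<or> (\<exists>P>0. p = ereal P)"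
  shows "Lp_norm p (\<lambda>x. c * F x) \<le> ennreal c * Lp_norm p F"
  using p
proof
  assume p: "p = \<infinity>"
  have "(\<lambda>x. c * F x) \<in> borel_measurable I11" using F by measurable
  then show ?thesis unfolding p using esssup_ennreal_cmult_le[OF F] F c by (simp add: Lp_norm_inf)
next
  assume "\<exists>P>0. p = ereal P"
  then obtain P where P: "P > 0" "p = ereal P" by blast
  define I where "I = (\<integral>\<^sup>+x. ennreal (\<bar>F x\<bar> powr P) \<partial>I11)"
  show ?thesis
  proof (cases "I = \<infinity>")
    case True
    then have "Lp_norm p F = \<infinity>" using F P unfolding Lp_norm_def I_def by (simp add: Let_def)
    then show ?thesis using c by (simp add: ennreal_mult_top)
  next
    case False
    have cF: "(\<lambda>x. c * F x) \<in> borel_measurable I11" using F by measurable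
    have "(\<integral>\<^sup>+x. ennreal (\<bar>c * F x\<bar> powr P) \<partial>I11) = (\<integral>\<^sup>+x. ennreal (c powr P) * ennreal (\<bar>F x\<bar> powr P) \<partial>I11)"
      using c by (intro nn_integral_cong) (simp add: abs_mult powr_mult ennreal_mult)
    also have "... = ennreal (c powr P) * I" unfolding I_def using F by (intro nn_integral_cmult) measurable
    also have "... = ennreal (c powr P) * ennreal (enn2real I)" using False by (simp add: less_top)
    also have "... = ennreal (c powr P * enn2real I)" by (intro ennreal_mult[symmetric]) auto
    finally have "Lp_norm p (\<lambda>x. c * F x) \<le> ennreal ((c powr P * enn2real I) powr (1 / P))"
      unfolding P(2) using cF P(1) by (intro Lp_norm_le) auto
    also have "(c powr P * enn2real I) powr (1 / P) = c * enn2real I powr (1 / P)"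
      using c P(1) by (simp add: powr_mult powr_powr)
    also have "ennreal (c * enn2real I powr (1 / P)) = ennreal c * ennreal (enn2real I powr (1 / P))"
      using c by (intro ennreal_mult) auto
    also have "ennreal (enn2real I powr (1 / P)) = Lp_norm p F"
      using F False unfolding Lp_norm_def P(2) I_def by (auto simp: Let_def)
    finally show ?thesis .
  qed
qed

lemma Lp_norm_normalize:
  assumes F: "F \<in> borel_measurable I11" and b: "0 < b" "Lp_norm p F = ennreal b" and p: "p = \<infinity> \<or> (\<exists>P>0. p = ereal P)"
  shows "Lp_norm p (\<lambda>x. 1 / b * F x) = 1"
proof (rule antisym)
  show "Lp_norm p (\<lambda>x. 1 / b * F x) \<le> 1"
    using Lp_norm_scale_le[OF F, of "1 / b" p] p b by (simp flip: ennreal_mult)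
  have "Lp_norm p (\<lambda>x. b * (1 / b * F x)) \<le> ennreal b * Lp_norm p (\<lambda>x. 1 / b * F x)"
    using F b p by (intro Lp_norm_scale_le) measurable
  then have le: "ennreal b \<le> ennreal b * Lp_norm p (\<lambda>x. 1 / b * F x)" using b by simp
  have "ennreal (1 / b) * ennreal b \<le> ennreal (1 / b) * (ennreal b * Lp_norm p (\<lambda>x. 1 / b * F x))"
    using le by (rule mult_left_mono) simp
  moreover have "ennreal (1 / b) * ennreal b = 1" using b by (simp flip: ennreal_mult)
  ultimately show "1 \<le> Lp_norm p (\<lambda>x. 1 / b * F x)" by (simp add: mult.assoc[symmetric])
qed

lemma Lp_norm_eq_0_AE:
  assumes F: "F \<in> borel_measurable I11" and 0: "Lp_norm p F = 0" and p: "p = \<infinity> \<or> (\<exists>P>0. p = ereal P)"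
  shows "AE x in I11. F x = 0"
  using p
proof
  assume "p = \<infinity>"
  then have "esssup I11 (\<lambda>x. ennreal \<bar>F x\<bar>) = 0" using 0 F by (simp add: Lp_norm_inf)
  with esssup_AE[of "\<lambda>x. ennreal \<bar>F x\<bar>" I11] show ?thesis by simp
next
  assume "\<exists>P>0. p = ereal P"
  then obtain P where P: "P > 0" "p = ereal P" by blast
  define I where "I = (\<integral>\<^sup>+x. ennreal (\<bar>F x\<bar> powr P) \<partial>I11)"
  have "I \<noteq> \<infinity>" "enn2real I powr (1 / P) = 0"
    using 0 F unfolding Lp_norm_def P(2) I_def by (auto simp: Let_def ennreal_eq_0_iff split: if_splits)
  then have "I = 0" by (simp add: enn2real_eq_0_iff)
  then have "AE x in I11. ennreal (\<bar>F x\<bar> powr P) = 0"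
    unfolding I_def using F by (subst (asm) nn_integral_0_iff_AE) auto
  then show ?thesis by eventually_elim (simp add: ennreal_eq_0_iff)
qed

lemma Lp_norm_nonzero:
  assumes F: "F \<in> borel_measurable I11" and p: "p = \<infinity> \<or> (\<exists>P>0. p = ereal P)"
    and uv: "-1 \<le> u" "u < v" "v \<le> 1" "\<And>x. u \<le> x \<Longrightarrow> x \<le> v \<Longrightarrow> F x \<noteq> 0"
  shows "Lp_norm p F \<noteq> 0"
proof
  assume "Lp_norm p F = 0"
  from Lp_norm_eq_0_AE[OF F this p] have "AE x in I11. x \<notin> {u..v}"
    by eventually_elim (use uv(4) in auto)
  moreover have "{u..v} \<in> sets I11" using uv by (intro sets_I11_interval) auto
  ultimately have "emeasure I11 {u..v} = 0"
    by (subst (asm) AE_iff_measurable[of "{u..v}"]) (use uv in auto)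
  moreover have "emeasure I11 {u..v} = ennreal (v - u)" using uv by (intro emeasure_I11_interval) auto
  ultimately show False using uv by simp
qed

lemma Lp_norm_supported_le:
  assumes F: "F \<in> borel_measurable I11" and p: "p = \<infinity> \<or> (\<exists>P>0. p = ereal P)"
    and h: "0 < h" "h \<le> 2" and M: "0 \<le> M" "\<And>x. x \<in> {-1..1} \<Longrightarrow> \<bar>F x\<bar> \<le> M"
    and supp: "\<And>x. x \<in> {-1..1} \<Longrightarrow> x < 1 - h \<Longrightarrow> F x = 0"
  shows "Lp_norm p F \<le> ennreal (M * h powr einv p)"
  using p
proof
  assume p: "p = \<infinity>"
  have "esssup I11 (\<lambda>x. ennreal \<bar>F x\<bar>) \<le> ennreal M"
  proof (rule esssup_I)
    show "AE x in I11. ennreal \<bar>F x\<bar> \<le> ennreal M" by (rule AE_I2) (auto intro!: ennreal_leI M)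
  qed (use F in measurable)
  then show ?thesis unfolding p using F h by (simp add: Lp_norm_inf einv_def)
next
  assume "\<exists>P>0. p = ereal P"
  then obtain P where P: "P > 0" "p = ereal P" by blast
  have "(\<integral>\<^sup>+x. ennreal (\<bar>F x\<bar> powr P) \<partial>I11) \<le> (\<integral>\<^sup>+x. ennreal (M powr P) * indicator {1 - h..1} x \<partial>I11)"
  proof (rule nn_integral_mono)
    fix x assume "x \<in> space I11"
    then have x: "x \<in> {-1..1}" by simp
    show "ennreal (\<bar>F x\<bar> powr P) \<le> ennreal (M powr P) * indicator {1 - h..1} x"
    proof (cases "x < 1 - h")
      case False
      then show ?thesis using x P M(2)[OF x] by (auto intro!: ennreal_leI powr_mono2)
    qed (use supp[OF x] in simp)
  qed
  also have "... = ennreal (M powr P) * emeasure I11 {1 - h..1}"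
    using h by (intro nn_integral_cmult_indicator sets_I11_interval) auto
  also have "... = ennreal (M powr P * h)"
    using h by (subst emeasure_I11_interval) (auto simp: ennreal_mult)
  finally have "Lp_norm p F \<le> ennreal ((M powr P * h) powr (1 / P))"
    unfolding P(2) using F P h by (intro Lp_norm_le) auto
  also have "(M powr P * h) powr (1 / P) = M * h powr einv p"
    using P M(1) by (simp add: powr_mult powr_powr einv_def)
  finally show ?thesis .
qed

lemma Mset_scale: "f \<in> Mset k \<Longrightarrow> 0 \<le> c \<Longrightarrow> (\<lambda>x. c * f x) \<in> Mset k"
proof -
  assume f: "f \<in> Mset k" and c: "0 \<le> c"
  have "dd A (\<lambda>x. c * f x) = c * dd A f" for A unfolding dd_def by (simp add: sum_distrib_left)
  then show ?thesis using f c unfolding Mset_iff_dd by simp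
qed

text \<open>Test functions are not normalised. Division by the norm \<open>b\<close>, positive
  because \<open>f\<close> does not vanish on some interval, leads into the class, and multiplying
  an approximant by \<open>b\<close> leads back; only the upper bound \<open>B\<close> of the norm
  enters the result.\<close>

lemma Edev_less_approx:
  fixes q \<eta> B :: real and p :: ereal
  assumes q: "1 \<le> q" and qp: "ereal q < p" and f: "f \<in> Mset k" and m: "wmeas \<alpha> \<beta> f"
    and B: "Lp_norm p (\<lambda>x. jw \<alpha> \<beta> x * f x) \<le> ennreal B" "0 \<le> B"
    and uv: "-1 < u" "u < v" "v < 1" "\<And>x. u \<le> x \<Longrightarrow> x \<le> v \<Longrightarrow> f x \<noteq> 0"
    and E: "Edev (Mset k \<inter> Bset p \<alpha> \<beta>) n (jw \<alpha> \<beta>) (ereal q) < ennreal \<eta>" "0 \<le> \<eta>"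
  shows "\<exists>P. degree P \<le> n \<and> werr \<alpha> \<beta> q f P \<le> ennreal ((B * \<eta>) powr q)"
proof -
  have p: "p = \<infinity> \<or> (\<exists>P>0. p = ereal P)" using q qp by (cases p) auto
  let ?F = "\<lambda>x. jw \<alpha> \<beta> x * f x"
  have nz: "Lp_norm p ?F \<noteq> 0"
    using uv jw_pos by (intro Lp_norm_nonzero[OF m p, of u v]) (auto simp: less_imp_neq[symmetric])
  define b where "b = enn2real (Lp_norm p ?F)"
  have fin: "Lp_norm p ?F \<noteq> \<top>" using B(1) by (auto simp: top_unique)
  then have b: "Lp_norm p ?F = ennreal b" unfolding b_def by (simp add: less_top)
  have bpos: "b > 0" using nz unfolding b by (simp add: ennreal_eq_0_iff)
  have bB: "b \<le> B" using B unfolding b by (simp add: ennreal_le_iff)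
  let ?g = "\<lambda>x. 1 / b * f x"
  have "Lp_norm p (\<lambda>x. jw \<alpha> \<beta> x * ?g x) = 1"
    using Lp_norm_normalize[OF m bpos b p] by (simp add: mult_ac)
  then have "?g \<in> Mset k \<inter> Bset p \<alpha> \<beta>" using Mset_scale[OF f, of "1 / b"] bpos unfolding Bset_def by simp
  then have "En n ?g (jw \<alpha> \<beta>) (ereal q) \<le> Edev (Mset k \<inter> Bset p \<alpha> \<beta>) n (jw \<alpha> \<beta>) (ereal q)"
    unfolding Edev_def by (rule SUP_upper)
  also note E(1)
  finally have "En n ?g (jw \<alpha> \<beta>) (ereal q) < ennreal \<eta>" .
  then obtain P0 where P0: "degree P0 \<le> n" "Lp_norm (ereal q) (\<lambda>x. jw \<alpha> \<beta> x * (?g x - poly P0 x)) < ennreal \<eta>"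
    unfolding En_def INF_less_iff by auto
  define H where "H x = jw \<alpha> \<beta> x * (?g x - poly P0 x)" for x
  define I where "I = (\<integral>\<^sup>+x. ennreal (\<bar>H x\<bar> powr q) \<partial>I11)"
  have Hm: "H \<in> borel_measurable I11" and I: "I \<noteq> \<infinity>" and Iq: "ennreal (enn2real I powr (1 / q)) < ennreal \<eta>"
    using P0(2) unfolding H_def[symmetric] Lp_norm_def I_def by (auto simp: Let_def split: if_splits)
  have "enn2real I powr (1 / q) \<le> \<eta>" using Iq by (simp add: ennreal_less_iff)
  then have "(enn2real I powr (1 / q)) powr q \<le> \<eta> powr q" using q by (intro powr_mono2) auto
  then have I2: "enn2real I \<le> \<eta> powr q" using q by (simp add: powr_powr)
  have "(\<integral>\<^sup>+x. ennreal (\<bar>jw \<alpha> \<beta> x * (f x - poly (smult b P0) x)\<bar> powr q) \<partial>I11) = (\<integral>\<^sup>+x. ennreal (b powr q) * ennreal (\<bar>H x\<bar> powr q) \<partial>I11)"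
  proof (rule nn_integral_cong)
    fix x
    have "jw \<alpha> \<beta> x * (f x - poly (smult b P0) x) = b * H x" unfolding H_def using bpos by (simp add: field_simps)
    then show "ennreal (\<bar>jw \<alpha> \<beta> x * (f x - poly (smult b P0) x)\<bar> powr q) = ennreal (b powr q) * ennreal (\<bar>H x\<bar> powr q)"
      using bpos by (simp add: abs_mult powr_mult ennreal_mult)
  qed
  also have "... = ennreal (b powr q) * I" unfolding I_def using Hm by (intro nn_integral_cmult) measurable
  also have "... = ennreal (b powr q) * ennreal (enn2real I)" using I by (simp add: less_top)
  also have "... = ennreal (b powr q * enn2real I)" by (intro ennreal_mult[symmetric]) auto
  also have "... \<le> ennreal ((B * \<eta>) powr q)"
    unfolding powr_mult using bpos bB q I2 by (intro ennreal_leI mult_mono powr_mono2) auto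
  finally show ?thesis using P0(1) degree_smult_le[of b P0] by (intro exI[of _ "smult b P0"]) auto
qed

lemma diff_error_le:
  assumes q: "0 \<le> q" and m: "wmeas \<alpha> \<beta> f" "wmeas \<alpha> \<beta> g"
    and P: "werr \<alpha> \<beta> q f P \<le> ennreal e"
    and Q: "werr \<alpha> \<beta> q g Q \<le> ennreal e" and e: "0 \<le> e"
  shows "(\<integral>\<^sup>+x. ennreal (\<bar>jw \<alpha> \<beta> x * ((f x - g x) - poly (P - Q) x)\<bar> powr q) \<partial>I11) \<le> ennreal (2 * 2 powr q * e)"
proof -
  define X where "X x = jw \<alpha> \<beta> x * (f x - poly P x)" for x
  define Y where "Y x = jw \<alpha> \<beta> x * (g x - poly Q x)" for x
  have [measurable]: "X \<in> borel_measurable I11" "Y \<in> borel_measurable I11"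
    unfolding X_def Y_def using m by (auto intro: error_measurable)
  have "(\<integral>\<^sup>+x. ennreal (\<bar>jw \<alpha> \<beta> x * ((f x - g x) - poly (P - Q) x)\<bar> powr q) \<partial>I11) \<le>
    (\<integral>\<^sup>+x. ennreal (2 powr q) * (ennreal (\<bar>X x\<bar> powr q) + ennreal (\<bar>Y x\<bar> powr q)) \<partial>I11)"
  proof (rule nn_integral_mono)
    fix x
    have "jw \<alpha> \<beta> x * ((f x - g x) - poly (P - Q) x) = X x + (- Y x)"
      unfolding X_def Y_def by (simp add: algebra_simps)
    then have "\<bar>jw \<alpha> \<beta> x * ((f x - g x) - poly (P - Q) x)\<bar> powr q \<le> 2 powr q * (\<bar>X x\<bar> powr q + \<bar>Y x\<bar> powr q)"
      using powr_add2_le[OF q, of "X x" "- Y x"] by simp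
    then have "ennreal (\<bar>jw \<alpha> \<beta> x * ((f x - g x) - poly (P - Q) x)\<bar> powr q) \<le> ennreal (2 powr q * (\<bar>X x\<bar> powr q + \<bar>Y x\<bar> powr q))"
      by (rule ennreal_leI)
    then show "ennreal (\<bar>jw \<alpha> \<beta> x * ((f x - g x) - poly (P - Q) x)\<bar> powr q) \<le> ennreal (2 powr q) * (ennreal (\<bar>X x\<bar> powr q) + ennreal (\<bar>Y x\<bar> powr q))"
      by (simp add: ennreal_mult)
  qed
  also have "... = ennreal (2 powr q) * ((\<integral>\<^sup>+x. ennreal (\<bar>X x\<bar> powr q) \<partial>I11) + (\<integral>\<^sup>+x. ennreal (\<bar>Y x\<bar> powr q) \<partial>I11))"
    by (simp add: nn_integral_cmult nn_integral_add)
  also have "... \<le> ennreal (2 powr q) * (ennreal e + ennreal e)"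
    using P Q unfolding X_def Y_def by (intro mult_left_mono add_mono) auto
  also have "... = ennreal (2 * 2 powr q * e)"
    using e by (simp flip: ennreal_plus ennreal_mult)
  finally show ?thesis .
qed

text \<open>The infimum over polynomials need not be attained. A real number strictly above the
  deviation provides actual approximants, and the lower bounds are derived from those.\<close>

lemma ennreal_le_of_less:
  assumes "\<And>\<eta>. 0 \<le> \<eta> \<Longrightarrow> X < ennreal \<eta> \<Longrightarrow> b \<le> \<eta>"
  shows "ennreal b \<le> X"
proof (rule ccontr)
  assume "\<not> ennreal b \<le> X"
  then have "X < ennreal b" by simp
  from dense[OF this] obtain z where z: "X < z" "z < ennreal b" by (elim exE conjE)
  obtain \<eta> where \<eta>: "z = ennreal \<eta>" "0 \<le> \<eta>" using z(2) by (cases z) auto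
  then have "b \<le> \<eta>" using assms[of \<eta>] z(1) by simp
  then show False using z(2) \<eta> ennreal_leI[of b \<eta>] by (simp add: leD)
qed

lemma tpow_measurable [measurable]: "tpow m t \<in> borel_measurable borel"
proof -
  have "tpow m t = (\<lambda>x. (x - t) ^ m * indicator {t<..} x)" by (auto simp: tpow_def split: split_indicator)
  moreover have "(\<lambda>x. (x - t) ^ m * indicator {t<..} x) \<in> borel_measurable borel" by measurable
  ultimately show ?thesis by metis
qed

section \<open>Lower bounds for the pairing on parts of cells\<close>

text \<open>The points of cell \<open>m\<close> whose angle, in node spacings, lies between m + 1/4
  and m + 1/2. For even \<open>m\<close> the oscillating factor is at least 1/2 there, and even in
  the cell 0 the endpoint 1 is kept at the distance that the weight comparison demands.\<close>

definition mid_ivl :: "nat \<Rightarrow> nat \<Rightarrow> real set" where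
  "mid_ivl N m = {cos ((real m + 1 / 2) * pi / real N)..cos ((real m + 1 / 4) * pi / real N)}"

lemma mid_ivl_nu:
  assumes N: "2 * m + 1 \<le> N" and x: "x \<in> mid_ivl N m"
  shows "x \<in> {-1..1}" "real m + 1 / 4 \<le> real N * arccos x / pi" "real N * arccos x / pi \<le> real m + 1 / 2"
proof -
  have x1: "cos ((real m + 1 / 2) * pi / real N) \<le> x" "x \<le> cos ((real m + 1 / 4) * pi / real N)"
    using x unfolding mid_ivl_def by auto
  show x: "x \<in> {-1..1}"
    using x1 cos_ge_minus_one[of "(real m + 1 / 2) * pi / real N"] cos_le_one[of "(real m + 1 / 4) * pi / real N"]
    unfolding atLeastAtMost_iff by linarith
  have Np: "real N > 0" and mN: "2 * real m + 1 \<le> real N" using N by auto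
  have b: "0 \<le> (real m + s) * pi / real N" "(real m + s) * pi / real N \<le> pi" if "0 \<le> s" "s \<le> 1 / 2" for s
  proof -
    have "(real m + s) * pi \<le> real N * pi" using that mN by (intro mult_right_mono) auto
    then show "(real m + s) * pi / real N \<le> pi" using Np by (simp add: field_simps)
  qed (use that in simp)
  have "arccos x \<le> arccos (cos ((real m + 1 / 2) * pi / real N))" using x1 x by (intro arccos_le_arccos) auto
  also have "... = (real m + 1 / 2) * pi / real N" using b[of "1 / 2"] by (intro arccos_cos) auto
  finally have u: "arccos x \<le> (real m + 1 / 2) * pi / real N" .
  have "(real m + 1 / 4) * pi / real N = arccos (cos ((real m + 1 / 4) * pi / real N))" using b[of "1 / 4"] by (intro arccos_cos[symmetric]) auto
  also have "... \<le> arccos x" using x1 x by (intro arccos_le_arccos) auto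
  finally have l: "(real m + 1 / 4) * pi / real N \<le> arccos x" .
  have "real N * ((real m + 1 / 4) * pi / real N) / pi \<le> real N * arccos x / pi"
    using l by (intro divide_right_mono mult_left_mono) auto
  then show "real m + 1 / 4 \<le> real N * arccos x / pi" using Np by simp
  have "real N * arccos x / pi \<le> real N * ((real m + 1 / 2) * pi / real N) / pi"
    using u by (intro divide_right_mono mult_left_mono) auto
  then show "real N * arccos x / pi \<le> real m + 1 / 2" using Np by simp
qed

lemma cos_diff_ge:
  assumes "0 \<le> a" "a \<le> b" "a + b \<le> pi"
  shows "2 * (b\<^sup>2 - a\<^sup>2) / pi\<^sup>2 \<le> cos a - cos b"
proof -
  have "cos a - cos b = 2 * (sin ((a + b) / 2) * sin ((b - a) / 2))" by (simp add: cos_diff_cos)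
  moreover have "2 / pi * ((a + b) / 2) \<le> sin ((a + b) / 2)" "2 / pi * ((b - a) / 2) \<le> sin ((b - a) / 2)"
    by (rule sin_ge_line; use assms in simp)+
  then have "2 / pi * ((a + b) / 2) * (2 / pi * ((b - a) / 2)) \<le> sin ((a + b) / 2) * sin ((b - a) / 2)"
    using assms by (intro mult_mono) (auto intro!: sin_ge_zero)
  moreover have "2 * (b\<^sup>2 - a\<^sup>2) / pi\<^sup>2 = 2 * (2 / pi * ((a + b) / 2) * (2 / pi * ((b - a) / 2)))"
    by (simp add: field_simps power2_eq_square)
  ultimately show ?thesis by linarith
qed

lemma mid_ivl_length:
  assumes N: "2 * m + 1 \<le> N"
  shows "mid_ivl N m \<in> sets I11" "ennreal (3 * (real m + 1) / 16 * (1 / real N)\<^sup>2) \<le> emeasure I11 (mid_ivl N m)"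
proof -
  define a where "a = (real m + 1 / 4) * pi / real N"
  define b where "b = (real m + 1 / 2) * pi / real N"
  have Np: "real N > 0" and mN: "2 * real m + 1 \<le> real N" using N by auto
  have ab: "0 \<le> a" "a \<le> b" unfolding a_def b_def using Np by (auto intro!: divide_right_mono mult_right_mono)
  have s: "a + b = (2 * real m + 3 / 4) * pi / real N" unfolding a_def b_def by (simp add: add_divide_distrib[symmetric] algebra_simps)
  have "(2 * real m + 3 / 4) * pi \<le> real N * pi" using mN by (intro mult_right_mono) auto
  then have sp: "a + b \<le> pi" unfolding s using Np by (simp add: field_simps)
  have "2 * (b\<^sup>2 - a\<^sup>2) / pi\<^sup>2 = 2 * ((real m + 1 / 2)\<^sup>2 - (real m + 1 / 4)\<^sup>2) * (1 / real N)\<^sup>2"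
    unfolding a_def b_def using Np by (simp add: field_simps power2_eq_square)
  also have "... = (real m + 3 / 8) * (1 / real N)\<^sup>2" by (simp add: algebra_simps power2_eq_square)
  finally have len: "(real m + 3 / 8) * (1 / real N)\<^sup>2 \<le> cos a - cos b" using cos_diff_ge[OF ab sp] by simp
  moreover have "3 * (real m + 1) / 16 * (1 / real N)\<^sup>2 \<le> (real m + 3 / 8) * (1 / real N)\<^sup>2"
    by (intro mult_right_mono) auto
  ultimately have len': "3 * (real m + 1) / 16 * (1 / real N)\<^sup>2 \<le> cos a - cos b" by linarith
  moreover have "0 \<le> 3 * (real m + 1) / 16 * (1 / real N)\<^sup>2" by simp
  ultimately have ba: "cos b \<le> cos a" by linarith
  have I: "mid_ivl N m = {cos b..cos a}" unfolding mid_ivl_def a_def b_def ..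
  show "mid_ivl N m \<in> sets I11" unfolding I by (intro sets_I11_interval) auto
  have "emeasure I11 {cos b..cos a} = ennreal (cos a - cos b)" using ba by (intro emeasure_I11_interval) auto
  then show "ennreal (3 * (real m + 1) / 16 * (1 / real N)\<^sup>2) \<le> emeasure I11 (mid_ivl N m)"
    unfolding I using len' by (simp add: ennreal_leI)
qed

lemma sin_even_shift:
  assumes "even m"
  shows "sin (real N * t) = sin (real N * t - real m * pi)"
proof -
  have "cos (real m * pi) = 1" using assms by simp
  then show ?thesis by (simp add: sin_diff)
qed

lemma mid_ivl_sin:
  assumes N: "2 * m + 1 \<le> N" and m: "even m" and x: "x \<in> mid_ivl N m"
  shows "1 / 2 \<le> sin (real N * arccos x)"
proof -
  note nu = mid_ivl_nu[OF N x]
  have l: "1 / 4 * pi \<le> (real N * arccos x / pi - real m) * pi" by (rule mult_right_mono, use nu in linarith, simp)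
  have u: "(real N * arccos x / pi - real m) * pi \<le> 1 / 2 * pi" by (rule mult_right_mono, use nu in linarith, simp)
  have e: "(real N * arccos x / pi - real m) * pi = real N * arccos x - real m * pi" by (simp add: field_simps)
  have "2 / pi * (1 / 4 * pi) \<le> 2 / pi * (real N * arccos x - real m * pi)" using l unfolding e by (intro mult_left_mono) auto
  also have "... \<le> sin (real N * arccos x - real m * pi)"
  proof (rule sin_ge_line)
    have "0 \<le> 1 / 4 * pi" by simp
    with l show "0 \<le> real N * arccos x - real m * pi" unfolding e by linarith
  qed (use u e in simp)
  finally show ?thesis unfolding sin_even_shift[OF m] by simp
qed

lemma sin_cell_nonneg:
  assumes "Suc m \<le> N" "even m" "tau N (Suc m) \<le> x" "x \<le> tau N m"
  shows "0 \<le> sin (real N * arccos x)"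
proof -
  have nu: "real m \<le> real N * arccos x / pi" "real N * arccos x / pi \<le> real (Suc m)"
    using nu_tau_bounds[of m "Suc m" N x] assms by auto
  have "0 \<le> (real N * arccos x / pi - real m) * pi" using nu by (intro mult_nonneg_nonneg) auto
  moreover have "(real N * arccos x / pi - real m) * pi \<le> 1 * pi" using nu by (intro mult_right_mono) auto
  moreover have e: "(real N * arccos x / pi - real m) * pi = real N * arccos x - real m * pi" by (simp add: field_simps)
  ultimately have "0 \<le> sin (real N * arccos x - real m * pi)" by (intro sin_ge_zero) auto
  then show ?thesis unfolding sin_even_shift[OF assms(2)] .
qed

lemma nu_less_imp:
  assumes "x \<in> {-1..1}" "i \<le> N" "1 \<le> N"
  shows "real N * arccos x / pi < real i \<Longrightarrow> tau N i < x" "real i < real N * arccos x / pi \<Longrightarrow> x < tau N i"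
proof -
  have a: "cos (arccos x) = x" "0 \<le> arccos x" "arccos x \<le> pi" using assms by (auto simp: arccos_lbound arccos_ubound)
  have n: "0 \<le> real i * pi / real N" "real i * pi / real N \<le> pi" using node_angle[OF assms(2)] by auto
  {
    assume "real N * arccos x / pi < real i"
    then have "arccos x < real i * pi / real N" using assms(3) by (simp add: field_simps)
    then have "cos (real i * pi / real N) < cos (arccos x)" using a n by (intro cos_monotone_0_pi) auto
    then show "tau N i < x" using a by (simp add: tau_def)
  next
    assume "real i < real N * arccos x / pi"
    then have "real i * pi / real N < arccos x" using assms(3) by (simp add: field_simps)
    then have "cos (arccos x) < cos (real i * pi / real N)" using a n by (intro cos_monotone_0_pi) auto
    then show "x < tau N i" using a by (simp add: tau_def)
  }
qed

lemma mid_ivl_tau: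
  assumes N: "2 * m + 1 \<le> N" and x: "x \<in> mid_ivl N m"
  shows "tau N (Suc m) < x" "x < tau N m"
  using mid_ivl_nu[OF assms] nu_less_imp[of x "Suc m" N] nu_less_imp[of x m N] N by auto

lemma mid_ivl_dst:
  assumes N: "2 * m + 1 \<le> N" and x: "x \<in> mid_ivl N m" and i: "i = m \<or> i = Suc m"
  shows "dst N i x \<le> 2"
  using mid_ivl_nu[OF N x] i unfolding dst_def by auto

lemma nn_integral_mid_ge:
  fixes s :: "nat \<Rightarrow> real"
  assumes L: "finite \<Lambda>" "\<And>m. m \<in> \<Lambda> \<Longrightarrow> 2 * m + 1 \<le> N" and s: "\<And>m. m \<in> \<Lambda> \<Longrightarrow> 0 \<le> s m"
    and G: "\<And>m x. m \<in> \<Lambda> \<Longrightarrow> x \<in> mid_ivl N m \<Longrightarrow> s m \<le> G x"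
  shows "ennreal (\<Sum>m\<in>\<Lambda>. s m * (3 * (real m + 1) / 16 * (1 / real N)\<^sup>2)) \<le> (\<integral>\<^sup>+x. ennreal (G x) \<partial>I11)"
proof -
  have "ennreal (\<Sum>m\<in>\<Lambda>. s m * (3 * (real m + 1) / 16 * (1 / real N)\<^sup>2)) = (\<Sum>m\<in>\<Lambda>. ennreal (s m * (3 * (real m + 1) / 16 * (1 / real N)\<^sup>2)))"
    using s by (intro sum_ennreal[symmetric] mult_nonneg_nonneg) auto
  also have "... = (\<Sum>m\<in>\<Lambda>. ennreal (s m) * ennreal (3 * (real m + 1) / 16 * (1 / real N)\<^sup>2))"
    using s by (intro sum.cong refl ennreal_mult) auto
  also have "... \<le> (\<Sum>m\<in>\<Lambda>. ennreal (s m) * emeasure I11 (mid_ivl N m))"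
    using mid_ivl_length(2) L by (intro sum_mono mult_left_mono) auto
  also have "... = (\<Sum>m\<in>\<Lambda>. (\<integral>\<^sup>+x. ennreal (s m) * indicator (mid_ivl N m) x \<partial>I11))"
    using mid_ivl_length(1) L by (intro sum.cong refl nn_integral_cmult_indicator[symmetric]) auto
  also have "... = (\<integral>\<^sup>+x. (\<Sum>m\<in>\<Lambda>. ennreal (s m) * indicator (mid_ivl N m) x) \<partial>I11)"
    using mid_ivl_length(1)[OF L(2)]
    by (intro nn_integral_sum[symmetric] borel_measurable_times_ennreal borel_measurable_indicator) auto
  also have "... \<le> (\<integral>\<^sup>+x. ennreal (G x) \<partial>I11)"
  proof (rule nn_integral_mono)
    fix x
    show "(\<Sum>m\<in>\<Lambda>. ennreal (s m) * indicator (mid_ivl N m) x) \<le> ennreal (G x)"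
    proof (cases "\<exists>m\<in>\<Lambda>. x \<in> mid_ivl N m")
      case True
      then obtain m where m: "m \<in> \<Lambda>" "x \<in> mid_ivl N m" by blast
      have uniq: "m' = m" if m': "m' \<in> \<Lambda>" "x \<in> mid_ivl N m'" for m'
      proof -
        have "real m < real m' + 1" "real m' < real m + 1"
          using mid_ivl_nu[OF L(2)[OF m(1)] m(2)] mid_ivl_nu[OF L(2)[OF m'(1)] m'(2)] by linarith+
        then show ?thesis by linarith
      qed
      have "(\<Sum>m'\<in>\<Lambda>. ennreal (s m') * indicator (mid_ivl N m') x) = (\<Sum>m'\<in>\<Lambda>. if m' = m then ennreal (s m) else 0)"
      proof (rule sum.cong[OF refl])
        fix m' assume m': "m' \<in> \<Lambda>"
        have "indicator (mid_ivl N m') x = (if m' = m then 1 else 0 :: ennreal)"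
          by (metis m(2) m' uniq indicator_simps)
        then show "ennreal (s m') * indicator (mid_ivl N m') x = (if m' = m then ennreal (s m) else 0)"
          by simp
      qed
      also have "... = ennreal (s m)" using m L(1) by simp
      finally show ?thesis using G[OF m] by (simp add: ennreal_leI)
    next
      case False
      then have "(\<Sum>m\<in>\<Lambda>. ennreal (s m) * indicator (mid_ivl N m) x) = 0" by (intro sum.neutral) auto
      then show ?thesis by simp
    qed
  qed
  finally show ?thesis .
qed

lemma hh_le: "hh N m \<le> 4 * real m * (1 / real N)\<^sup>2"
proof -
  have "sin (real m * pi / real N) \<le> real m * pi / real N" by (intro sin_x_le_x) auto
  also have "... \<le> real m * 4 / real N" using pi_less_4 by (intro divide_right_mono mult_left_mono) auto
  finally have "hh N m \<le> (real m * 4 / real N) / real N" unfolding hh_def by (intro divide_right_mono) auto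
  then show ?thesis by (simp add: power2_eq_square mult_ac)
qed

lemma jw_tau_ge:
  assumes "2 * m \<le> N" "1 \<le> N" "0 \<le> \<alpha>" "0 \<le> \<beta>"
  shows "((real m / real N)\<^sup>2) powr \<beta> \<le> jw \<alpha> \<beta> (tau N m)"
proof -
  have t: "0 \<le> tau N m" using assms by (intro tau_half_nonneg) auto
  have "(real m / real N)\<^sup>2 \<le> 2 * (real m / real N)\<^sup>2" by simp
  also have "... \<le> 1 - tau N m" using assms by (intro one_minus_tau_ge) auto
  finally have "1 powr \<alpha> * ((real m / real N)\<^sup>2) powr \<beta> \<le> (1 + tau N m) powr \<alpha> * (1 - tau N m) powr \<beta>"
    using t assms by (intro mult_mono powr_mono2) auto
  then show ?thesis unfolding jw_def by simp
qed

lemma jw_le_max: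
  assumes "x \<in> {-1..1}" "0 \<le> \<alpha>" "0 \<le> \<beta>" "1 - x \<le> h"
  shows "jw \<alpha> \<beta> x \<le> 2 powr \<alpha> * h powr \<beta>"
  unfolding jw_def using assms by (intro mult_mono powr_mono2) auto

lemma dual_constsD:
  assumes d: "dual_consts \<alpha> \<beta> c0 c C" and n: "n \<ge> 1" and L: "finite \<Lambda>" "\<Lambda> \<subseteq> {1..<c0 * n}" "\<And>i. i \<in> \<Lambda> \<Longrightarrow> 0 \<le> v i"
  obtains \<kappa> where "degree \<kappa> + n + 2 \<le> c0 * n"
    "\<And>x. x \<in> {-1..1} \<Longrightarrow> 0 \<le> poly \<kappa> x \<and> poly \<kappa> x \<le> C * jw \<alpha> \<beta> x * (\<Sum>i\<in>\<Lambda>. v i / dst (c0 * n) i x ^ 4)"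
    "\<And>i x. i \<in> \<Lambda> \<Longrightarrow> x \<in> {-1..1} \<Longrightarrow> dst (c0 * n) i x \<le> 2 \<Longrightarrow> 1 / 4 \<le> real (c0 * n) * arccos x / pi \<Longrightarrow>
      real (c0 * n) * arccos x / pi \<le> real (c0 * n) - 1 / 4 \<Longrightarrow> c * v i * jw \<alpha> \<beta> (tau (c0 * n) i) \<le> poly \<kappa> x"
proof -
  have "\<forall>i\<in>\<Lambda>. 0 \<le> v i" using L(3) by blast
  from d[unfolded dual_consts_def, THEN conjunct2, THEN conjunct2, THEN conjunct2, THEN conjunct2, THEN spec, THEN mp, OF n,
      THEN spec, THEN spec, THEN mp, THEN mp, THEN mp, OF L(1,2) this]
  obtain \<kappa> where \<kappa>: "degree \<kappa> + n + 2 \<le> c0 * n \<and>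
      (\<forall>x\<in>{-1..1}. 0 \<le> poly \<kappa> x \<and> poly \<kappa> x \<le> C * jw \<alpha> \<beta> x * (\<Sum>i\<in>\<Lambda>. v i / dst (c0 * n) i x ^ 4)) \<and>
      (\<forall>i\<in>\<Lambda>. \<forall>x\<in>{-1..1}. dst (c0 * n) i x \<le> 2 \<longrightarrow> 1 / 4 \<le> real (c0 * n) * arccos x / pi \<longrightarrow>
        real (c0 * n) * arccos x / pi \<le> real (c0 * n) - 1 / 4 \<longrightarrow>
        c * v i * jw \<alpha> \<beta> (tau (c0 * n) i) \<le> poly \<kappa> x)" by (elim exE)
  show ?thesis
    by (rule that[of \<kappa>]; use \<kappa> in blast)
qed

section \<open>Lower bounds\<close>

text \<open>The truncated power at the first node lives on a cell of length about X = N^(-2). With g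
  = \<beta> + k - 1 its weighted norm is at most of order X^(g + 1/p), while the pairing with a
  single bump at that node is at least of order X^(g + 1). Balancing gives \<eta>^q at least of
  order X^(1 - q / p).\<close>

lemma Edev_lower_power:
  fixes q \<alpha> \<beta> :: real and p :: ereal and k :: nat
  assumes k: "1 \<le> k" and q: "1 \<le> q" and qp: "ereal q < p" and ab: "0 \<le> \<alpha>" "0 \<le> \<beta>"
  shows "\<exists>c>0. \<forall>n\<ge>1. ennreal (c * real n powr (- 2 / q + 2 * einv p)) \<le> Edev (Mset k \<inter> Bset p \<alpha> \<beta>) n (jw \<alpha> \<beta>) (ereal q)"
proof -
  note ei = einv_bounds[OF q qp]
  have p: "p = \<infinity> \<or> (\<exists>P>0. p = ereal P)" using q qp by (cases p) auto
  obtain c0 c C where dual: "dual_consts \<alpha> \<beta> c0 c C" using dual_poly[OF ab] by blast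
  have c0: "c0 \<ge> (8::nat)" and c: "c > 0" and C: "C > 0" using dual unfolding dual_consts_def by auto
  define g where "g = \<beta> + real (k - 1)"
  have g: "0 \<le> g" unfolding g_def using ab by simp
  \<comment> \<open>Chosen so that, with the level l = a X^g, the first term of
    \<open>dual_pairing\<close> is half of the lower bound \<open>S\<close>. The later lower bounds
    fix their levels in the same way.\<close>
  define a where "a = (3 * c / 32) / (64 * pi * C)"
  have a: "a > 0" unfolding a_def using c C by simp
  define c1 where "c1 = (3 * c / 32) / (8 * C) * a powr (q - 1)"
  define c2 where "c2 = (2 powr \<alpha> * 5 powr (g + einv p)) powr q"
  have c12: "c1 > 0" "c2 > 0" unfolding c1_def c2_def using c C a by auto
  define c3 where "c3 = (c1 / c2) powr (1 / q) * ((1 / real c0)\<^sup>2) powr (1 / q - einv p)"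
  have c3: "c3 > 0" unfolding c3_def using c12 c0 by simp
  have "ennreal (c3 * real n powr (- 2 / q + 2 * einv p)) \<le> Edev (Mset k \<inter> Bset p \<alpha> \<beta>) n (jw \<alpha> \<beta>) (ereal q)" if n: "n \<ge> 1" for n
  proof (rule ennreal_le_of_less)
    fix \<eta> assume \<eta>: "0 \<le> \<eta>" and less: "Edev (Mset k \<inter> Bset p \<alpha> \<beta>) n (jw \<alpha> \<beta>) (ereal q) < ennreal \<eta>"
    define N where "N = c0 * n"
    have N8: "N \<ge> 8" unfolding N_def using c0 n by (metis mult_le_mono mult.right_neutral)
    define X where "X = (1 / real N)\<^sup>2"
    have X: "X > 0" unfolding X_def using N8 by simp
    have "(1 / real N)\<^sup>2 \<le> (1 / 8)\<^sup>2" using N8 by (intro power_mono divide_left_mono) auto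
    then have X64: "X \<le> 1 / 64" unfolding X_def by (simp add: power2_eq_square)
    have L1: "finite {1 :: nat}" "{1} \<subseteq> {1..<c0 * n}" using N8 unfolding N_def by auto
    obtain \<kappa> where \<kappa>: "degree \<kappa> + n + 2 \<le> N"
      "\<And>x. x \<in> {-1..1} \<Longrightarrow> 0 \<le> poly \<kappa> x \<and> poly \<kappa> x \<le> C * jw \<alpha> \<beta> x * (\<Sum>i\<in>{1}. 1 / dst N i x ^ 4)"
      "\<And>i x. i \<in> {1} \<Longrightarrow> x \<in> {-1..1} \<Longrightarrow> dst N i x \<le> 2 \<Longrightarrow> 1 / 4 \<le> real N * arccos x / pi \<Longrightarrow>
        real N * arccos x / pi \<le> real N - 1 / 4 \<Longrightarrow> c * 1 * jw \<alpha> \<beta> (tau N i) \<le> poly \<kappa> x"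
      by (rule dual_constsD[OF dual n L1, of "\<lambda>_. 1", folded N_def], simp) (rule that)
    define t where "t = tau N 1"
    define h where "h = 1 - t"
    have hb: "2 * X \<le> h" "h \<le> 5 * X"
      using one_minus_tau_ge[of 1 N] one_minus_tau_upper[of N 1] N8 unfolding h_def t_def X_def by auto
    have h0: "0 < h" "h \<le> 2" using hb X X64 by linarith+
    define f where "f = tpow (k - 1) t"
    have fM: "f \<in> Mset k" using tpow_in_Mset[of "k - 1" t] k unfolding f_def by simp
    have m: "wmeas \<alpha> \<beta> f" unfolding f_def by (intro borel_I11) measurable
    have f0: "0 \<le> f x" for x unfolding f_def tpow_def by simp
    have fh: "f x \<le> h ^ (k - 1)" if "x \<le> 1" for x
      unfolding f_def tpow_def h_def using that h0 unfolding h_def by (auto intro!: power_mono)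
    have fh2: "f x \<le> 2 ^ (k - 1)" if "x \<le> 1" for x
      using fh[OF that] power_mono[OF h0(2), of "k - 1"] h0 by linarith
    have "Lp_norm p (\<lambda>x. jw \<alpha> \<beta> x * f x) \<le> ennreal (2 powr \<alpha> * h powr g * h powr einv p)"
    proof (rule Lp_norm_supported_le[OF m p h0])
      fix x :: real assume x: "x \<in> {-1..1}"
      show "\<bar>jw \<alpha> \<beta> x * f x\<bar> \<le> 2 powr \<alpha> * h powr g"
      proof (cases "x > t")
        case True
        have "jw \<alpha> \<beta> x * f x \<le> (2 powr \<alpha> * h powr \<beta>) * h ^ (k - 1)"
          using x True ab f0 fh[of x] jw_nonneg h0 by (intro mult_mono jw_le_max) (auto simp: h_def)
        also have "h ^ (k - 1) = h powr real (k - 1)" using h0 by (simp add: powr_realpow)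
        also have "(2 powr \<alpha> * h powr \<beta>) * h powr real (k - 1) = 2 powr \<alpha> * h powr g"
          unfolding g_def by (simp add: powr_add)
        finally show ?thesis using f0 jw_nonneg by simp
      qed (simp add: f_def tpow_def)
      show "jw \<alpha> \<beta> x * f x = 0" if "x < 1 - h" using that unfolding h_def f_def tpow_def by simp
    qed simp
    also have "2 powr \<alpha> * h powr g * h powr einv p \<le> 2 powr \<alpha> * (5 * X) powr (g + einv p)"
      unfolding mult.assoc powr_add[symmetric] using hb h0 g ei by (intro mult_left_mono powr_mono2) auto
    finally have B: "Lp_norm p (\<lambda>x. jw \<alpha> \<beta> x * f x) \<le> ennreal (2 powr \<alpha> * (5 * X) powr (g + einv p))"
      by (simp add: ennreal_leI)
    define B where "B = 2 powr \<alpha> * (5 * X) powr (g + einv p)"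
    have "\<exists>P. degree P \<le> n \<and> werr \<alpha> \<beta> q f P \<le> ennreal ((B * \<eta>) powr q)"
    proof (rule Edev_less_approx[OF q qp fM m _ _ _ _ _ _ less \<eta>, of B "1 - h / 2" "1 - h / 4"])
      show "-1 < 1 - h / 2" "1 - h / 2 < 1 - h / 4" "1 - h / 4 < 1" using h0 hb X64 by auto
      show "f x \<noteq> 0" if "1 - h / 2 \<le> x" for x
      proof -
        have "x > t" using that h0 h_def by linarith
        then show ?thesis unfolding f_def tpow_def by simp
      qed
    qed (use B in \<open>auto simp: B_def\<close>)
    then obtain P where P: "degree P \<le> n" "werr \<alpha> \<beta> q f P \<le> ennreal ((B * \<eta>) powr q)" by blast
    define l where "l = a * X powr g"
    have l: "l > 0" unfolding l_def using a X by simp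
    define S where "S = X ^ (k - 1) * (c * X powr \<beta>) * (1 / 2) * (3 / 16 * X)"
    have Xg: "X powr g = X powr \<beta> * X ^ (k - 1)" unfolding g_def powr_add using X by (simp add: powr_realpow)
    have S: "S = 3 * c / 32 * (X powr g * X)" unfolding S_def Xg by simp
    have mid1: "2 * 0 + 1 \<le> N" using N8 by simp
    have Sint: "ennreal S \<le> (\<integral>\<^sup>+x. ennreal (f x * (poly \<kappa> x * sin (real N * arccos x))) \<partial>I11)"
    proof -
      have "ennreal (\<Sum>m\<in>{0}. (X ^ (k - 1) * (c * X powr \<beta>) * (1 / 2)) * (3 * (real m + 1) / 16 * (1 / real N)\<^sup>2)) \<le>
        (\<integral>\<^sup>+x. ennreal (f x * (poly \<kappa> x * sin (real N * arccos x))) \<partial>I11)"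
      proof (rule nn_integral_mid_ge)
        fix m :: nat and x assume m: "m \<in> {0}" and x': "x \<in> mid_ivl N m"
        then have x: "x \<in> mid_ivl N 0" by simp
        note nu = mid_ivl_nu[OF mid1 x]
        \<comment> \<open>The part of cell 0 in use ends at the angle pi / (2 N), half a spacing
          before the node, so x - t is at least cos(pi / (2 N)) - cos(pi / N), which exceeds
          X.\<close>
        have fx: "X ^ (k - 1) \<le> f x"
        proof -
          have a: "0 \<le> arccos x" "arccos x \<le> 1 / 2 * pi / real N" "cos (arccos x) = x"
            using nu N8 by (auto simp: field_simps arccos_lbound)
          have sum: "1 / 2 * pi / real N + pi / real N \<le> pi" using N8 by (simp add: field_simps)
          have "2 * ((1 * pi / real N)\<^sup>2 - (1 / 2 * pi / real N)\<^sup>2) / pi\<^sup>2 \<le> cos (1 / 2 * pi / real N) - cos (1 * pi / real N)"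
            using N8 sum by (intro cos_diff_ge) (auto simp: field_simps)
          also have "2 * ((1 * pi / real N)\<^sup>2 - (1 / 2 * pi / real N)\<^sup>2) / pi\<^sup>2 = 3 / 2 * X"
            unfolding X_def using N8 by (simp add: field_simps power2_eq_square)
          also have "cos (1 / 2 * pi / real N) \<le> cos (arccos x)"
            using a N8 by (intro cos_monotone_0_pi_le) (auto simp: field_simps)
          finally have "3 / 2 * X \<le> x - t" using a unfolding t_def tau_def by simp
          then have "X \<le> x - t" using X by linarith
          then have "X ^ (k - 1) \<le> (x - t) ^ (k - 1)" "x > t" using X by (auto intro: power_mono)
          then show ?thesis unfolding f_def tpow_def by simp
        qed
        have "X powr \<beta> \<le> jw \<alpha> \<beta> (tau N 1)" using jw_tau_ge[of 1 N \<alpha> \<beta>] N8 ab unfolding X_def by simp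
        then have "c * X powr \<beta> \<le> c * jw \<alpha> \<beta> (tau N 1)" using c by simp
        also have "... = c * 1 * jw \<alpha> \<beta> (tau N 1)" by simp
        also have "... \<le> poly \<kappa> x"
        proof (rule \<kappa>(3)[of 1])
          show "dst N 1 x \<le> 2" using mid_ivl_dst[OF mid1 x, of 1] by simp
          have "8 \<le> real N" using N8 by simp
          then show "real N * arccos x / pi \<le> real N - 1 / 4" using nu(3) by linarith
        qed (use nu in auto)
        finally have "(c * X powr \<beta>) * (1 / 2) \<le> poly \<kappa> x * sin (real N * arccos x)"
          using mid_ivl_sin[OF mid1 _ x] c \<kappa>(2)[OF nu(1)] by (intro mult_mono) auto
        then have "X ^ (k - 1) * (c * X powr \<beta> * (1 / 2)) \<le> f x * (poly \<kappa> x * sin (real N * arccos x))"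
          using c X f0[of x] by (intro mult_mono[OF fx]) simp_all
        then show "X ^ (k - 1) * (c * X powr \<beta>) * (1 / 2) \<le> f x * (poly \<kappa> x * sin (real N * arccos x))"
          by (simp only: mult.assoc)
      qed (use N8 c X in auto)
      then show ?thesis unfolding S_def X_def by simp
    qed
    have "S \<le> C * (8 * pi * (\<Sum>i\<in>{1}. 1 * l * hh N i) + 4 * l powr (1 - q) * (B * \<eta>) powr q)"
    proof (rule dual_pairing[OF q \<kappa>(1) C _ _ _ _ \<kappa>(2) _ _ _ _ Sint P])
      show "f \<in> borel_measurable I11" unfolding f_def by (intro borel_I11) measurable
      fix x :: real assume x: "x \<in> {-1..1}"
      show "\<bar>f x\<bar> \<le> 2 ^ (k - 1)" using f0[of x] fh2[of x] x by simp
      show "0 \<le> f x * (poly \<kappa> x * sin (real N * arccos x))"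
      proof (cases "x > t")
        case True
        then have "0 \<le> sin (real N * arccos x)"
          using x N8 by (intro sin_cell_nonneg[of 0]) (auto simp: t_def tau_def)
        then show ?thesis using f0 \<kappa>(2)[OF x] by simp
      qed (simp add: f_def tpow_def)
    qed (use N8 l X c in \<open>auto simp: S_def\<close>)
    also have "... = 8 * pi * C * l * hh N 1 + 4 * C * l powr (1 - q) * (B * \<eta>) powr q" by (simp add: algebra_simps)
    also have "... \<le> 8 * pi * C * l * (4 * X) + 4 * C * l powr (1 - q) * (B * \<eta>) powr q"
      using hh_le[of N 1] C l unfolding X_def by (intro add_right_mono mult_left_mono) auto
    also have "8 * pi * C * l * (4 * X) = S / 2"
      unfolding S l_def a_def using C by (simp add: field_simps)
    finally have "S / 2 \<le> 4 * C * l powr (1 - q) * (B * \<eta>) powr q" by simp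
    then have "l powr (q - 1) * (S / 2) \<le> l powr (q - 1) * (4 * C * l powr (1 - q) * (B * \<eta>) powr q)"
      by (intro mult_left_mono) auto
    also have "... = (l powr (q - 1) * l powr (1 - q)) * (4 * C * (B * \<eta>) powr q)" by (simp add: mult_ac)
    also have "l powr (q - 1) * l powr (1 - q) = 1" unfolding powr_add[symmetric] using l by simp
    finally have "l powr (q - 1) * S / (8 * C) \<le> (B * \<eta>) powr q" using C by (simp add: field_simps)
    moreover have "l powr (q - 1) * S / (8 * C) = c1 * X powr (1 + g * q)"
    proof -
      have "X powr (1 + g * q) = X powr (g * (q - 1)) * (X powr g * X powr 1)"
        unfolding powr_add[symmetric] by (simp add: algebra_simps)
      then show ?thesis unfolding S c1_def l_def using X by (simp add: powr_mult powr_powr)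
    qed
    moreover have "(B * \<eta>) powr q = c2 * X powr (g * q + einv p * q) * \<eta> powr q"
      unfolding B_def c2_def by (simp add: powr_mult powr_powr algebra_simps)
    ultimately have "c1 * X powr (1 + g * q) \<le> c2 * X powr (g * q + einv p * q) * \<eta> powr q" by simp
    also have "X powr (1 + g * q) = X powr (1 - einv p * q) * X powr (g * q + einv p * q)"
      unfolding powr_add[symmetric] by simp
    finally have "(c1 * X powr (1 - einv p * q)) * X powr (g * q + einv p * q) \<le> (c2 * \<eta> powr q) * X powr (g * q + einv p * q)"
      by (simp add: mult_ac)
    then have "c1 * X powr (1 - einv p * q) \<le> c2 * \<eta> powr q" using X by simp
    then have "c1 / c2 * X powr (1 - einv p * q) \<le> \<eta> powr q" using c12 by (simp add: field_simps)
    then have "(c1 / c2 * X powr (1 - einv p * q)) powr (1 / q) \<le> (\<eta> powr q) powr (1 / q)"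
      using c12 q by (intro powr_mono2) auto
    also have "... = \<eta>" using \<eta> q by (simp add: powr_powr)
    also have "(c1 / c2 * X powr (1 - einv p * q)) powr (1 / q) = (c1 / c2) powr (1 / q) * X powr (1 / q - einv p)"
    proof -
      have "(1 - einv p * q) * (1 / q) = 1 / q - einv p" using q by (simp add: field_simps)
      then show ?thesis by (simp only: powr_mult powr_powr)
    qed
    also have "X = (1 / real c0)\<^sup>2 * real n powr (-2)"
      unfolding X_def N_def using n by (simp add: powr_minus_divide power_divide power_mult_distrib)
    also have "(c1 / c2) powr (1 / q) * ((1 / real c0)\<^sup>2 * real n powr (-2)) powr (1 / q - einv p) = c3 * real n powr (- 2 / q + 2 * einv p)"
      unfolding c3_def by (simp add: powr_mult powr_powr algebra_simps)
    finally show "c3 * real n powr (- 2 / q + 2 * einv p) \<le> \<eta>" .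
  qed
  then show ?thesis using c3 by blast
qed

section \<open>Sums of jumps at nodes\<close>

text \<open>The shift \<open>d\<close> is 0 or 1: the two values give two monotone functions whose
  difference is supported on the cells between the nodes m + 1 and m.\<close>

definition steps :: "nat \<Rightarrow> nat set \<Rightarrow> (nat \<Rightarrow> real) \<Rightarrow> nat \<Rightarrow> real \<Rightarrow> real" where
  "steps N \<Lambda> w d x = (\<Sum>m\<in>\<Lambda>. w m * tpow 0 (tau N (m + d)) x)"

lemma steps_measurable [measurable]: "steps N \<Lambda> w d \<in> borel_measurable borel"
proof -
  have "(\<lambda>x. \<Sum>m\<in>\<Lambda>. w m * tpow 0 (tau N (m + d)) x) \<in> borel_measurable borel" by measurable
  then show ?thesis unfolding steps_def[abs_def] .
qed

lemma steps_nonneg: "(\<And>m. m \<in> \<Lambda> \<Longrightarrow> 0 \<le> w m) \<Longrightarrow> 0 \<le> steps N \<Lambda> w d x"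
  unfolding steps_def tpow_def by (intro sum_nonneg) auto

lemma steps_in_Mset: "(\<And>m. m \<in> \<Lambda> \<Longrightarrow> 0 \<le> w m) \<Longrightarrow> steps N \<Lambda> w d \<in> Mset 1"
  by (rule Mset1I) (auto simp: steps_def tpow_def intro!: sum_mono mult_left_mono)

lemma steps_diff:
  assumes "\<And>m. m \<in> \<Lambda> \<Longrightarrow> Suc m \<le> N"
  shows "steps N \<Lambda> w 1 x - steps N \<Lambda> w 0 x = (\<Sum>m\<in>\<Lambda>. w m * indicator {tau N (Suc m)<..tau N m} x)"
  unfolding steps_def sum_subtractf[symmetric]
proof (rule sum.cong[OF refl])
  fix m assume "m \<in> \<Lambda>"
  then have "tau N (Suc m) \<le> tau N m" using assms by (intro tau_antimono) auto
  then show "w m * tpow 0 (tau N (m + 1)) x - w m * tpow 0 (tau N (m + 0)) x = w m * indicator {tau N (Suc m)<..tau N m} x"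
    by (auto simp: tpow_def split: split_indicator)
qed

text \<open>A single jump meets both signs of the oscillating factor. The difference of the two
  shifts lives on cells of even index, where that factor is nonnegative. It is no longer monotone,
  but both of its parts are approximable, so its error is at most that of the two together.\<close>

lemma steps_pairing:
  assumes dual: "dual_consts \<alpha> \<beta> c0 c C" and q: "1 \<le> q" and ab: "0 \<le> \<alpha>" "0 \<le> \<beta>" and n: "n \<ge> 1" and N: "N = c0 * n"
    and L: "finite \<Lambda>" "\<And>m. m \<in> \<Lambda> \<Longrightarrow> 1 \<le> m" "\<And>m. m \<in> \<Lambda> \<Longrightarrow> even m" "\<And>m. m \<in> \<Lambda> \<Longrightarrow> 2 * m + 2 \<le> N"
    and v: "\<And>m. m \<in> \<Lambda> \<Longrightarrow> 0 \<le> v m" and l: "\<And>m. m \<in> \<Lambda> \<Longrightarrow> 0 < l m" and w: "\<And>m. m \<in> \<Lambda> \<Longrightarrow> 0 \<le> w m"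
    and K: "\<And>m. m \<in> \<Lambda> \<Longrightarrow> v m * l m powr (1 - q) \<le> K" "0 \<le> K" and e: "0 \<le> e"
    and P: "degree P \<le> n" "werr \<alpha> \<beta> q (steps N \<Lambda> w 1) P \<le> ennreal e"
    and Q: "degree Q \<le> n" "werr \<alpha> \<beta> q (steps N \<Lambda> w 0) Q \<le> ennreal e"
  shows "(\<Sum>m\<in>\<Lambda>. w m * (c * v m * ((real m / real N)\<^sup>2) powr \<beta> * (1 / 2)) * (3 * (real m + 1) / 16 * (1 / real N)\<^sup>2)) \<le>
    C * (8 * pi * (\<Sum>m\<in>\<Lambda>. v m * l m * hh N m) + 4 * K * (2 * 2 powr q * e))"
proof -
  have c: "c > 0" and C: "C > 0" using dual unfolding dual_consts_def by auto
  have L1: "\<Lambda> \<subseteq> {1..<c0 * n}" using L(2,4) unfolding N by fastforce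
  obtain \<kappa> where \<kappa>: "degree \<kappa> + n + 2 \<le> N"
    "\<And>x. x \<in> {-1..1} \<Longrightarrow> 0 \<le> poly \<kappa> x \<and> poly \<kappa> x \<le> C * jw \<alpha> \<beta> x * (\<Sum>i\<in>\<Lambda>. v i / dst N i x ^ 4)"
    "\<And>i x. i \<in> \<Lambda> \<Longrightarrow> x \<in> {-1..1} \<Longrightarrow> dst N i x \<le> 2 \<Longrightarrow> 1 / 4 \<le> real N * arccos x / pi \<Longrightarrow>
      real N * arccos x / pi \<le> real N - 1 / 4 \<Longrightarrow> c * v i * jw \<alpha> \<beta> (tau N i) \<le> poly \<kappa> x"
    by (rule dual_constsD[OF dual n L(1) L1, of v, folded N]) (erule v, rule that)
  define u where "u x = steps N \<Lambda> w 1 x - steps N \<Lambda> w 0 x" for x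
  have u: "u x = (\<Sum>m\<in>\<Lambda>. w m * indicator {tau N (Suc m)<..tau N m} x)" for x
    unfolding u_def using L(4) by (intro steps_diff) force
  have u0: "0 \<le> u x" for x unfolding u using w by (intro sum_nonneg mult_nonneg_nonneg) auto
  have um: "u \<in> borel_measurable I11" unfolding u_def by (intro borel_I11) measurable
  define s where "s m = w m * (c * v m * ((real m / real N)\<^sup>2) powr \<beta> * (1 / 2))" for m
  have s0: "0 \<le> s m" if "m \<in> \<Lambda>" for m unfolding s_def using that v w c by (intro mult_nonneg_nonneg) auto
  define S where "S = (\<Sum>m\<in>\<Lambda>. s m * (3 * (real m + 1) / 16 * (1 / real N)\<^sup>2))"
  have S0: "0 \<le> S" unfolding S_def using s0 by (intro sum_nonneg mult_nonneg_nonneg) auto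
  have S: "ennreal S \<le> (\<integral>\<^sup>+x. ennreal (u x * (poly \<kappa> x * sin (real N * arccos x))) \<partial>I11)"
    unfolding S_def
  proof (rule nn_integral_mid_ge[OF L(1) _ s0])
    show mid1: "2 * m + 1 \<le> N" if "m \<in> \<Lambda>" for m using L(4)[OF that] by simp
    fix m x assume m: "m \<in> \<Lambda>" and x: "x \<in> mid_ivl N m"
    note nu = mid_ivl_nu[OF mid1[OF m] x]
    have mN: "1 \<le> real m" "2 * real m + 2 \<le> real N" using L(2)[OF m] L(4)[OF m] by linarith+
    have "w m = w m * indicator {tau N (Suc m)<..tau N m} x"
      using mid_ivl_tau[OF mid1[OF m] x] by simp
    also have "... \<le> u x" unfolding u using L(1) m w by (intro member_le_sum[where f = "\<lambda>m. w m * indicator {tau N (Suc m)<..tau N m} x"]) auto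
    finally have uw: "w m \<le> u x" .
    have "((real m / real N)\<^sup>2) powr \<beta> \<le> jw \<alpha> \<beta> (tau N m)" using L(4)[OF m] ab by (intro jw_tau_ge) auto
    then have "c * v m * ((real m / real N)\<^sup>2) powr \<beta> \<le> c * v m * jw \<alpha> \<beta> (tau N m)"
      using c v[OF m] by (intro mult_left_mono) auto
    also have "... \<le> poly \<kappa> x"
    proof (rule \<kappa>(3)[OF m nu(1)])
      show "dst N m x \<le> 2" using mid_ivl_dst[OF mid1[OF m] x, of m] by simp
      show "1 / 4 \<le> real N * arccos x / pi" "real N * arccos x / pi \<le> real N - 1 / 4" using nu mN by linarith+
    qed
    finally have "c * v m * ((real m / real N)\<^sup>2) powr \<beta> * (1 / 2) \<le> poly \<kappa> x * sin (real N * arccos x)"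
      using mid_ivl_sin[OF mid1[OF m] L(3)[OF m] x] \<kappa>(2)[OF nu(1)] by (intro mult_mono) auto
    then show "s m \<le> u x * (poly \<kappa> x * sin (real N * arccos x))"
      unfolding s_def using c v[OF m] u0 by (intro mult_mono[OF uw]) auto
  qed
  have ub: "\<bar>u x\<bar> \<le> (\<Sum>m\<in>\<Lambda>. w m)" for x
    unfolding abs_of_nonneg[OF u0] unfolding u using w by (intro sum_mono) (auto split: split_indicator)
  have ug: "0 \<le> u x * (poly \<kappa> x * sin (real N * arccos x))" if x: "x \<in> {-1..1}" for x
  proof (cases "\<exists>m\<in>\<Lambda>. x \<in> {tau N (Suc m)<..tau N m}")
    case True
    then obtain m where m: "m \<in> \<Lambda>" "x \<in> {tau N (Suc m)<..tau N m}" by blast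
    then have "0 \<le> sin (real N * arccos x)"
      using L(4)[OF m(1)] by (intro sin_cell_nonneg[OF _ L(3)[OF m(1)]]) auto
    then show ?thesis using \<kappa>(2)[OF x] u0 by (intro mult_nonneg_nonneg) auto
  next
    case False
    then have "u x = 0" unfolding u by (intro sum.neutral) auto
    then show ?thesis by simp
  qed
  have "degree (P - Q) \<le> n" using P(1) Q(1) by (simp add: degree_diff_le)
  moreover have "(\<integral>\<^sup>+x. ennreal (\<bar>jw \<alpha> \<beta> x * (u x - poly (P - Q) x)\<bar> powr q) \<partial>I11) \<le> ennreal (2 * 2 powr q * e)"
    unfolding u_def
  proof (rule diff_error_le[OF _ _ _ P(2) Q(2) e])
    show "(\<lambda>x. jw \<alpha> \<beta> x * steps N \<Lambda> w 1 x) \<in> borel_measurable I11" by (intro borel_I11) measurable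
    show "(\<lambda>x. jw \<alpha> \<beta> x * steps N \<Lambda> w 0 x) \<in> borel_measurable I11" by (intro borel_I11) measurable
  qed (use q in simp)
  ultimately have "S \<le> C * (8 * pi * (\<Sum>m\<in>\<Lambda>. v m * l m * hh N m) + 4 * K * (2 * 2 powr q * e))"
    using e L1[folded N] by (intro dual_pairing[OF q \<kappa>(1) C L(1) _ v l \<kappa>(2) um ub ug S0 S _ _ _ K]) auto
  then show ?thesis unfolding S_def s_def .
qed

lemma steps_approx:
  fixes q \<eta> B :: real and p :: ereal
  assumes q: "1 \<le> q" and qp: "ereal q < p" and L: "finite \<Lambda>" "m0 \<in> \<Lambda>" "1 \<le> m0 + d" "m0 + d < N"
    and w: "\<And>m. m \<in> \<Lambda> \<Longrightarrow> 0 < w m"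
    and B: "Lp_norm p (\<lambda>x. jw \<alpha> \<beta> x * steps N \<Lambda> w d x) \<le> ennreal B" "0 \<le> B"
    and E: "Edev (Mset 1 \<inter> Bset p \<alpha> \<beta>) n (jw \<alpha> \<beta>) (ereal q) < ennreal \<eta>" "0 \<le> \<eta>"
  shows "\<exists>P. degree P \<le> n \<and> werr \<alpha> \<beta> q (steps N \<Lambda> w d) P \<le> ennreal ((B * \<eta>) powr q)"
proof -
  define t where "t = tau N (m0 + d)"
  have t: "-1 < t" "t < 1" unfolding t_def using tau_bounds[OF L(3,4)] by auto
  have w0: "0 \<le> w m" if "m \<in> \<Lambda>" for m using w[OF that] by simp
  show ?thesis
  proof (rule Edev_less_approx[OF q qp steps_in_Mset[OF w0] _ B _ _ _ _ E, of "(1 + t) / 2" "(3 + t) / 4"])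
    show "(\<lambda>x. jw \<alpha> \<beta> x * steps N \<Lambda> w d x) \<in> borel_measurable I11" by (intro borel_I11) measurable
    show "-1 < (1 + t) / 2" "(1 + t) / 2 < (3 + t) / 4" "(3 + t) / 4 < 1" using t by auto
    fix x assume "(1 + t) / 2 \<le> x"
    then have "x > t" using t by simp
    then have "w m0 = w m0 * tpow 0 (tau N (m0 + d)) x" unfolding tpow_def t_def by simp
    also have "... \<le> steps N \<Lambda> w d x" unfolding steps_def using L w0
      by (intro member_le_sum[where f = "\<lambda>m. w m * tpow 0 (tau N (m + d)) x"]) (auto simp: tpow_def)
    finally show "steps N \<Lambda> w d x \<noteq> 0" using w[OF L(2)] by simp
  qed
qed

lemma steps_deviation:
  fixes q \<eta> B :: real and p :: ereal
  assumes dual: "dual_consts \<alpha> \<beta> c0 c C" and q: "1 \<le> q" and qp: "ereal q < p" and ab: "0 \<le> \<alpha>" "0 \<le> \<beta>" and n: "n \<ge> 1" and N: "N = c0 * n"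
    and L: "finite \<Lambda>" "\<Lambda> \<noteq> {}" "\<And>m. m \<in> \<Lambda> \<Longrightarrow> 1 \<le> m" "\<And>m. m \<in> \<Lambda> \<Longrightarrow> even m" "\<And>m. m \<in> \<Lambda> \<Longrightarrow> 2 * m + 2 \<le> N"
    and v: "\<And>m. m \<in> \<Lambda> \<Longrightarrow> 0 \<le> v m" and l: "\<And>m. m \<in> \<Lambda> \<Longrightarrow> 0 < l m" and w: "\<And>m. m \<in> \<Lambda> \<Longrightarrow> 0 < w m"
    and K: "\<And>m. m \<in> \<Lambda> \<Longrightarrow> v m * l m powr (1 - q) \<le> K" "0 \<le> K"
    and B: "\<And>d. d \<le> 1 \<Longrightarrow> Lp_norm p (\<lambda>x. jw \<alpha> \<beta> x * steps N \<Lambda> w d x) \<le> ennreal B" "0 \<le> B"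
    and E: "Edev (Mset 1 \<inter> Bset p \<alpha> \<beta>) n (jw \<alpha> \<beta>) (ereal q) < ennreal \<eta>" "0 \<le> \<eta>"
  shows "(\<Sum>m\<in>\<Lambda>. w m * (c * v m * ((real m / real N)\<^sup>2) powr \<beta> * (1 / 2)) * (3 * (real m + 1) / 16 * (1 / real N)\<^sup>2)) \<le>
    C * (8 * pi * (\<Sum>m\<in>\<Lambda>. v m * l m * hh N m) + 4 * K * (2 * 2 powr q * (B * \<eta>) powr q))"
proof -
  obtain m0 where m0: "m0 \<in> \<Lambda>" using L(2) by blast
  have m: "1 \<le> m0" "2 * m0 + 2 \<le> N" using L(3,5) m0 by auto
  obtain P where P: "degree P \<le> n" "werr \<alpha> \<beta> q (steps N \<Lambda> w 1) P \<le> ennreal ((B * \<eta>) powr q)"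
    using steps_approx[OF q qp L(1) m0 _ _ w B(1)[of 1] B(2) E] m by auto
  obtain Q where Q: "degree Q \<le> n" "werr \<alpha> \<beta> q (steps N \<Lambda> w 0) Q \<le> ennreal ((B * \<eta>) powr q)"
    using steps_approx[OF q qp L(1) m0 _ _ w B(1)[of 0] B(2) E] m by auto
  show ?thesis
    by (rule steps_pairing[OF dual q ab n N L(1,3,4,5) v l less_imp_le[OF w] K _ P Q]) auto
qed

text \<open>One jump near the middle of the interval: weight and norm are constants, and the cell
  has length about 1 / N, which is the order of the \<open>q\<close>-th power of the error.\<close>

lemma Edev_lower_jump:
  fixes q \<alpha> \<beta> :: real and p :: ereal
  assumes q: "1 \<le> q" and qp: "ereal q < p" and ab: "0 \<le> \<alpha>" "0 \<le> \<beta>"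
  shows "\<exists>c>0. \<forall>n\<ge>1. ennreal (c * real n powr (- 1 / q)) \<le> Edev (Mset 1 \<inter> Bset p \<alpha> \<beta>) n (jw \<alpha> \<beta>) (ereal q)"
proof -
  have p: "p = \<infinity> \<or> (\<exists>P>0. p = ereal P)" using q qp by (cases p) auto
  obtain c0 c C where dual: "dual_consts \<alpha> \<beta> c0 c C" using dual_poly[OF ab] by blast
  have c0: "c0 \<ge> (8::nat)" "4 dvd c0" and c: "c > 0" and C: "C > 0" using dual unfolding dual_consts_def by auto
  define S0 where "S0 = 3 * c * (1 / 16) powr \<beta> / 128"
  \<comment> \<open>Makes the term with \<open>hh\<close>, at most \<open>S0 / N / 2\<close>, absorb
    only half of the pairing.\<close>
  define l where "l = S0 / (16 * pi * C)"
  define B where "B = 2 powr \<alpha> * 2 powr \<beta> * 2 powr einv p"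
  define c1 where "c1 = S0 / (16 * C * l powr (1 - q) * 2 powr q * B powr q)"
  have S0: "S0 > 0" unfolding S0_def using c by simp
  have l: "l > 0" unfolding l_def using S0 C by simp
  have B: "B > 0" unfolding B_def by simp
  have c1: "c1 > 0" unfolding c1_def using S0 C l B by simp
  have "ennreal ((c1 / real c0) powr (1 / q) * real n powr (- 1 / q)) \<le> Edev (Mset 1 \<inter> Bset p \<alpha> \<beta>) n (jw \<alpha> \<beta>) (ereal q)" if n: "n \<ge> 1" for n
  proof (rule ennreal_le_of_less)
    fix \<eta> assume \<eta>: "0 \<le> \<eta>" and less: "Edev (Mset 1 \<inter> Bset p \<alpha> \<beta>) n (jw \<alpha> \<beta>) (ereal q) < ennreal \<eta>"
    define N where "N = c0 * n"
    have N8: "N \<ge> 8" unfolding N_def using c0 n by (metis mult_le_mono mult.right_neutral)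
    have "4 dvd N" unfolding N_def using c0 by simp
    then obtain j where j: "N = 4 * j" by blast
    \<comment> \<open>With N = 4 j this is even and lies between N / 4 and N / 2; the subtraction of
      2 gives \<open>2 * m + 2 \<le> N\<close>, and \<open>N \<ge> 8\<close> gives
      \<open>N \<le> 4 * m\<close>.\<close>
    define m where "m = 2 * j - 2"
    have m: "2 \<le> m" "even m" "2 * m + 2 \<le> N" "N \<le> 4 * m" using N8 unfolding m_def j by auto
    have nb: "Lp_norm p (\<lambda>x. jw \<alpha> \<beta> x * steps N {m} (\<lambda>_. 1) d x) \<le> ennreal B" for d
      unfolding B_def
    proof (rule Lp_norm_supported_le[OF _ p])
      show "(\<lambda>x. jw \<alpha> \<beta> x * steps N {m} (\<lambda>_. 1) d x) \<in> borel_measurable I11" by (intro borel_I11) measurable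
      fix x :: real assume x: "x \<in> {-1..1}"
      have "\<bar>jw \<alpha> \<beta> x * steps N {m} (\<lambda>_. 1) d x\<bar> \<le> jw \<alpha> \<beta> x"
        using jw_nonneg by (simp add: steps_def tpow_def)
      also have "... \<le> 2 powr \<alpha> * 2 powr \<beta>" using x ab by (intro jw_le_max) auto
      finally show "\<bar>jw \<alpha> \<beta> x * steps N {m} (\<lambda>_. 1) d x\<bar> \<le> 2 powr \<alpha> * 2 powr \<beta>" .
    qed auto
    have "(\<Sum>i\<in>{m}. 1 * (c * 1 * ((real i / real N)\<^sup>2) powr \<beta> * (1 / 2)) * (3 * (real i + 1) / 16 * (1 / real N)\<^sup>2)) \<le>
      C * (8 * pi * (\<Sum>i\<in>{m}. 1 * l * hh N i) + 4 * l powr (1 - q) * (2 * 2 powr q * (B * \<eta>) powr q))"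
      using m l B by (intro steps_deviation[OF dual q qp ab n N_def _ _ _ _ _ _ _ _ _ _ nb _ less \<eta>]) auto
    then have main: "c * ((real m / real N)\<^sup>2) powr \<beta> * (1 / 2) * (3 * (real m + 1) / 16 * (1 / real N)\<^sup>2) \<le>
      C * (8 * pi * (l * hh N m) + 4 * l powr (1 - q) * (2 * 2 powr q * (B powr q * \<eta> powr q)))" by (simp add: powr_mult)
    have Np: "real N > 0" using N8 by simp
    have mN: "real N \<le> 4 * real m" using m(4) by linarith
    have r: "1 / 4 \<le> real m / real N" using Np mN by (simp add: field_simps)
    have "(1 / 4)\<^sup>2 \<le> (real m / real N)\<^sup>2" using r by (intro power_mono) auto
    then have p1: "(1 / 16) powr \<beta> \<le> ((real m / real N)\<^sup>2) powr \<beta>" using ab by (intro powr_mono2) (auto simp: power2_eq_square)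
    have p2: "3 / 64 * (1 / real N) \<le> 3 * (real m + 1) / 16 * (1 / real N)\<^sup>2"
      using Np mN by (simp add: field_simps power2_eq_square)
    have "S0 / real N = c * (1 / 16) powr \<beta> * (1 / 2) * (3 / 64 * (1 / real N))" unfolding S0_def by simp
    also have "... \<le> c * ((real m / real N)\<^sup>2) powr \<beta> * (1 / 2) * (3 * (real m + 1) / 16 * (1 / real N)\<^sup>2)"
      by (rule mult_mono[OF mult_right_mono[OF mult_left_mono[OF p1]] p2]) (use c in auto)
    also note main
    also have "C * (8 * pi * (l * hh N m) + 4 * l powr (1 - q) * (2 * 2 powr q * (B powr q * \<eta> powr q))) \<le>
      C * (8 * pi * (l * (1 / real N)) + 4 * l powr (1 - q) * (2 * 2 powr q * (B powr q * \<eta> powr q)))"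
      using C l Np unfolding hh_def by (intro mult_left_mono add_right_mono divide_right_mono) auto
    also have "... = S0 / real N / 2 + (8 * C * l powr (1 - q) * 2 powr q * B powr q) * \<eta> powr q"
      using C unfolding l_def by (simp add: algebra_simps)
    finally have "S0 / real N / 2 \<le> (8 * C * l powr (1 - q) * 2 powr q * B powr q) * \<eta> powr q" by simp
    then have "S0 / real N / 2 / (8 * C * l powr (1 - q) * 2 powr q * B powr q) \<le> \<eta> powr q"
      using C l B by (subst pos_divide_le_eq) (auto simp: mult_ac)
    moreover have "S0 / real N / 2 / (8 * C * l powr (1 - q) * 2 powr q * B powr q) = c1 / real c0 * (1 / real n)"
      unfolding c1_def N_def by simp
    ultimately have "(c1 / real c0 * (1 / real n)) powr (1 / q) \<le> (\<eta> powr q) powr (1 / q)"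
      using q c1 by (intro powr_mono2) auto
    also have "... = \<eta>" using \<eta> q by (simp add: powr_powr)
    also have "1 / real n = real n powr (-1)" using n by (simp add: powr_minus_divide)
    also have "(c1 / real c0 * real n powr (-1)) powr (1 / q) = (c1 / real c0) powr (1 / q) * real n powr (- 1 / q)"
      by (simp only: powr_mult powr_powr) simp
    finally show "(c1 / real c0) powr (1 / q) * real n powr (- 1 / q) \<le> \<eta>" .
  qed
  moreover have "(c1 / real c0) powr (1 / q) > 0" using c1 c0 by simp
  ultimately show ?thesis by blast
qed

section \<open>Jumps at all dyadic nodes in the critical case\<close>

lemma dyadic_tail_sum_le:
  fixes s z :: real
  assumes s: "0 < s" and z: "0 < z" and A: "finite A" "\<And>j. j \<in> A \<Longrightarrow> z \<le> 2 ^ j"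
  shows "(\<Sum>j\<in>A. (2 ^ j) powr (- s)) \<le> 1 / (1 - 2 powr (- s)) * z powr (- s)"
proof -
  define r :: real where "r = 2 powr (- s)"
  have "2 powr (- s) < 2 powr (0 :: real)" using s by (intro powr_less_mono) auto
  then have r: "0 < r" "r < 1" unfolding r_def by auto
  have rj: "(2 ^ j) powr (- s) = r ^ j" for j :: nat
    unfolding r_def by (simp add: powr_realpow[symmetric] powr_powr powr_power mult.commute)
  show ?thesis
  proof (cases "A = {}")
    case True
    then show ?thesis using r unfolding r_def by simp
  next
    case False
    define j0 where "j0 = Min A"
    have j0: "j0 \<in> A" "\<And>j. j \<in> A \<Longrightarrow> j0 \<le> j" unfolding j0_def using A(1) False by auto
    define M where "M = Suc (Max A)"
    have "A \<subseteq> (\<lambda>i. j0 + i) ` {..<M}"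
    proof
      fix j assume j: "j \<in> A"
      then have "j \<le> Max A" using A(1) by simp
      then show "j \<in> (\<lambda>i. j0 + i) ` {..<M}" using j0(2)[OF j] unfolding M_def
        by (intro image_eqI[of _ _ "j - j0"]) auto
    qed
    then have "(\<Sum>j\<in>A. r ^ j) \<le> (\<Sum>j\<in>(\<lambda>i. j0 + i) ` {..<M}. r ^ j)"
      using r by (intro sum_mono2) auto
    also have "... = (\<Sum>i<M. r ^ (j0 + i))" by (subst sum.reindex) (auto simp: inj_on_def)
    also have "... = r ^ j0 * (\<Sum>i<M. r ^ i)" by (simp add: power_add sum_distrib_left)
    also have "(\<Sum>i<M. r ^ i) = (1 - r ^ M) / (1 - r)" using r by (subst sum_gp_strict) auto
    also have "r ^ j0 * ((1 - r ^ M) / (1 - r)) \<le> r ^ j0 * (1 / (1 - r))"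
      using r by (intro mult_left_mono divide_right_mono) auto
    also have "... \<le> z powr (- s) * (1 / (1 - r))"
    proof (intro mult_right_mono)
      show "r ^ j0 \<le> z powr (- s)"
        unfolding rj[symmetric] using A(2)[OF j0(1)] z s by (intro powr_mono2') auto
    qed (use r in auto)
    finally show ?thesis unfolding rj r_def by (simp add: mult.commute)
  qed
qed

lemma nn_integral_log:
  assumes a: "0 < a"
  shows "(\<integral>\<^sup>+x. ennreal (2 / (1 + a * (1 - x))) \<partial>I11) = ennreal (2 / a * ln (1 + 2 * a))"
proof -
  have pos: "1 + a * (1 - x) > 0" if "x \<in> {-1..1}" for x using a that by (intro add_pos_nonneg) auto
  have cont: "continuous_on {-1..1} (\<lambda>x. 2 / (1 + a * (1 - x)))"
    using pos by (intro continuous_intros) force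
  have "((\<lambda>x. 2 / (1 + a * (1 - x))) has_integral ((- 2 / a * ln (1 + a * (1 - 1))) - (- 2 / a * ln (1 + a * (1 - (-1)))))) {-1..1}"
  proof (rule fundamental_theorem_of_calculus)
    fix x :: real assume "x \<in> {-1..1}"
    note p = pos[OF this]
    have "((\<lambda>x. - 2 / a * ln (1 + a * (1 - x))) has_real_derivative - 2 / a * (1 / (1 + a * (1 - x)) * (- a))) (at x within {-1..1})"
      using p by (auto intro!: derivative_eq_intros)
    moreover have "- 2 / a * (1 / (1 + a * (1 - x)) * (- a)) = 2 / (1 + a * (1 - x))" using a by simp
    ultimately have "((\<lambda>x. - 2 / a * ln (1 + a * (1 - x))) has_real_derivative 2 / (1 + a * (1 - x))) (at x within {-1..1})"
      by (simp only:)
    then show "((\<lambda>x. - 2 / a * ln (1 + a * (1 - x))) has_vector_derivative 2 / (1 + a * (1 - x))) (at x within {-1..1})"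
      unfolding has_real_derivative_iff_has_vector_derivative .
  qed simp
  moreover have "(- 2 / a * ln (1 + a * (1 - 1))) - (- 2 / a * ln (1 + a * (1 - (-1)))) = 2 / a * ln (1 + 2 * a)"
    by (simp add: mult.commute)
  ultimately have I: "integral {-1..1} (\<lambda>x. 2 / (1 + a * (1 - x))) = 2 / a * ln (1 + 2 * a)"
    by (simp only: integral_unique)
  have "(\<integral>\<^sup>+x. ennreal (2 / (1 + a * (1 - x))) \<partial>I11) = ennreal (integral\<^sup>L I11 (\<lambda>x. 2 / (1 + a * (1 - x))))"
    using less_imp_le[OF pos] by (intro nn_integral_eq_integral continuous_I11(2)[OF cont] AE_I2) auto
  then show ?thesis unfolding continuous_I11(3)[OF cont] I .
qed

text \<open>Only jumps with 4^j at least N^2 (1 - x) / 20 are switched on at \<open>x\<close>, and a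
  geometric series is of the order of its first term. 20 = 5 * 2^2 comes from
  \<open>one_minus_tau_upper\<close> and the shift by \<open>d\<close>; the maximum with 1 covers
  the points near 1 where every jump is on.\<close>

lemma dyadic_steps_le:
  fixes s :: real
  assumes s: "0 < s" and d: "d \<le> 1" and N: "N \<ge> 1" and x: "x \<in> {-1..1}"
  shows "steps N ((\<lambda>j. 2 ^ j) ` {1..L}) (\<lambda>m. real m powr (- s)) d x \<le>
    1 / (1 - 2 powr (- s)) * max 1 ((real N)\<^sup>2 * (1 - x) / 20) powr (- (s / 2))"
proof -
  define Y where "Y = (real N)\<^sup>2 * (1 - x) / 20"
  define A where "A = {j \<in> {1..L}. x > tau N (2 ^ j + d)}"
  have inj: "inj_on (\<lambda>j. (2 :: nat) ^ j) {1..L}" by (auto simp: inj_on_def)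
  have "steps N ((\<lambda>j. 2 ^ j) ` {1..L}) (\<lambda>m. real m powr (- s)) d x = (\<Sum>j\<in>{1..L}. (2 ^ j) powr (- s) * tpow 0 (tau N (2 ^ j + d)) x)"
    unfolding steps_def by (subst sum.reindex[OF inj]) simp
  also have "... = (\<Sum>j\<in>A. (2 ^ j) powr (- s))"
    unfolding A_def by (intro sum.mono_neutral_cong_right) (auto simp: tpow_def)
  also have "... \<le> 1 / (1 - 2 powr (- s)) * sqrt (max 1 Y) powr (- s)"
  proof (rule dyadic_tail_sum_le[OF s])
    show "0 < sqrt (max 1 Y)" by simp
    show "finite A" unfolding A_def by simp
    fix j assume "j \<in> A"
    then have "1 - x \<le> 1 - tau N (2 ^ j + d)" unfolding A_def by simp
    also have "... \<le> 5 * (real (2 ^ j + d) / real N)\<^sup>2" by (rule one_minus_tau_upper)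
    also have "... \<le> 5 * ((2 * 2 ^ j) / real N)\<^sup>2"
    proof (intro mult_left_mono power_mono divide_right_mono)
      have "2 ^ j + d \<le> 2 * 2 ^ j" using d one_le_power[of "2 :: nat" j] by linarith
      then have "real (2 ^ j + d) \<le> real (2 * 2 ^ j)" by (rule of_nat_mono)
      then show "real (2 ^ j + d) \<le> 2 * 2 ^ j" by simp
    qed auto
    finally have "1 - x \<le> 5 * ((2 * 2 ^ j) / real N)\<^sup>2" .
    then have "Y \<le> (real N)\<^sup>2 * (5 * ((2 * 2 ^ j) / real N)\<^sup>2) / 20"
      unfolding Y_def by (intro divide_right_mono mult_left_mono) auto
    also have "... = (2 ^ j)\<^sup>2" using N by (simp add: power_divide power_mult_distrib)
    finally have "max 1 Y \<le> (2 ^ j)\<^sup>2" by (simp add: one_le_power)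
    then have "sqrt (max 1 Y) \<le> sqrt ((2 ^ j)\<^sup>2)" by (rule real_sqrt_le_mono)
    then show "sqrt (max 1 Y) \<le> 2 ^ j" by simp
  qed
  also have "sqrt (max 1 Y) powr (- s) = max 1 Y powr (- (s / 2))"
    by (simp add: powr_half_sqrt[symmetric] powr_powr)
  finally show ?thesis unfolding Y_def .
qed

text \<open>The exponent s = 2 \<beta> + 1 / q is the critical one: in the power 2 q the weight
  gives (1 - x)^(2 q \<beta>) and the jumps (1 - x)^(-2 q \<beta> - 1), so the integrand behaves
  like 1 / (1 - x) outside a neighbourhood of 1 of size N^(-2), and the integral is a
  logarithm.\<close>

lemma dyadic_steps_norm:
  fixes q \<alpha> \<beta> :: real
  assumes q: "1 \<le> q" and ab: "0 \<le> \<alpha>" "0 \<le> \<beta>" and N: "N \<ge> 1" and d: "d \<le> 1"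
  defines "s \<equiv> 2 * \<beta> + 1 / q"
  defines "D \<equiv> (2 powr \<alpha> * (1 / (1 - 2 powr (- s)))) powr (2 * q) * 20 powr (2 * q * \<beta>) * 40"
  shows "Lp_norm (ereal (2 * q)) (\<lambda>x. jw \<alpha> \<beta> x * steps N ((\<lambda>j. 2 ^ j) ` {1..L}) (\<lambda>m. real m powr (- s)) d x) \<le>
    ennreal ((D * ((1 / real N)\<^sup>2) powr (2 * q * \<beta> + 1) * ln (1 + (real N)\<^sup>2 / 10)) powr (1 / (2 * q)))"
proof -
  define X where "X = (1 / real N)\<^sup>2"
  have X: "X > 0" unfolding X_def using N by simp
  have NX: "(real N)\<^sup>2 = 1 / X" unfolding X_def by (simp add: power_divide)
  define a where "a = (real N)\<^sup>2 / 20"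
  have a: "a > 0" unfolding a_def using N by simp
  define Cs where "Cs = 1 / (1 - 2 powr (- s))"
  have s: "s > 0" unfolding s_def using q ab by (simp add: add_nonneg_pos)
  have "2 powr (- s) < 2 powr (0 :: real)" using s by (intro powr_less_mono) auto
  then have Cs: "Cs > 0" unfolding Cs_def by simp
  define F where "F x = jw \<alpha> \<beta> x * steps N ((\<lambda>j. 2 ^ j) ` {1..L}) (\<lambda>m. real m powr (- s)) d x" for x
  define D1 where "D1 = (2 powr \<alpha> * Cs) powr (2 * q) * 20 powr (2 * q * \<beta>) * X powr (2 * q * \<beta>)"
  have D1: "0 \<le> D1" unfolding D1_def by simp
  have pw: "\<bar>F x\<bar> powr (2 * q) \<le> D1 * (2 / (1 + a * (1 - x)))" if x: "x \<in> {-1..1}" for x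
  proof -
    define Y where "Y = a * (1 - x)"
    have Y: "0 \<le> Y" unfolding Y_def using a x by simp
    have xY: "1 - x = 20 * X * Y" unfolding Y_def a_def NX using X by simp
    have st0: "0 \<le> steps N ((\<lambda>j. 2 ^ j) ` {1..L}) (\<lambda>m. real m powr (- s)) d x" by (rule steps_nonneg) simp
    have F0: "0 \<le> F x" unfolding F_def using st0 jw_nonneg by simp
    have "F x \<le> (2 powr \<alpha> * (20 * X * Y) powr \<beta>) * (Cs * max 1 Y powr (- (s / 2)))"
      unfolding F_def
    proof (rule mult_mono)
      show "jw \<alpha> \<beta> x \<le> 2 powr \<alpha> * (20 * X * Y) powr \<beta>" using x ab xY by (intro jw_le_max) auto
      show "steps N ((\<lambda>j. 2 ^ j) ` {1..L}) (\<lambda>m. real m powr (- s)) d x \<le> Cs * max 1 Y powr (- (s / 2))"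
        using dyadic_steps_le[OF s d N x] unfolding Cs_def Y_def a_def by simp
    qed (use st0 in auto)
    then have "F x powr (2 * q) \<le> ((2 powr \<alpha> * (20 * X * Y) powr \<beta>) * (Cs * max 1 Y powr (- (s / 2)))) powr (2 * q)"
      using F0 q by (intro powr_mono2) auto
    also have "... = D1 * (Y powr (2 * q * \<beta>) * max 1 Y powr (- (s * q)))"
      unfolding D1_def by (simp add: powr_mult powr_powr mult_ac)
    also have "- (s * q) = - (2 * q * \<beta>) + (- 1)" unfolding s_def using q by (simp add: field_simps)
    also have "Y powr (2 * q * \<beta>) * max 1 Y powr (- (2 * q * \<beta>) + (- 1)) \<le> 2 / (1 + Y)"
    proof -
      have "Y powr (2 * q * \<beta>) \<le> max 1 Y powr (2 * q * \<beta>)" using Y q ab by (intro powr_mono2) auto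
      then have "Y powr (2 * q * \<beta>) * max 1 Y powr (- (2 * q * \<beta>) + (- 1)) \<le>
        max 1 Y powr (2 * q * \<beta>) * max 1 Y powr (- (2 * q * \<beta>) + (- 1))" by (intro mult_right_mono) auto
      also have "... = 1 / max 1 Y" unfolding powr_add[symmetric] by (simp add: powr_minus_divide)
      also have "... \<le> 2 / (1 + Y)" using Y by (simp add: field_simps max_def)
      finally show ?thesis .
    qed
    finally show ?thesis using F0 D1 unfolding Y_def by (simp add: mult_left_mono)
  qed
  have Fm: "F \<in> borel_measurable I11" unfolding F_def by (intro borel_I11) measurable
  have lm: "(\<lambda>x. 2 / (1 + a * (1 - x))) \<in> borel_measurable I11" by (intro borel_I11) measurable
  have "(\<integral>\<^sup>+x. ennreal (\<bar>F x\<bar> powr (2 * q)) \<partial>I11) \<le> (\<integral>\<^sup>+x. ennreal D1 * ennreal (2 / (1 + a * (1 - x))) \<partial>I11)"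
  proof (rule nn_integral_mono)
    fix x assume "x \<in> space I11"
    then have x: "x \<in> {-1..1}" by simp
    have "0 \<le> 2 / (1 + a * (1 - x))" using a x by (intro divide_nonneg_nonneg add_nonneg_nonneg) auto
    then show "ennreal (\<bar>F x\<bar> powr (2 * q)) \<le> ennreal D1 * ennreal (2 / (1 + a * (1 - x)))"
      using pw[OF x] D1 by (simp add: ennreal_leI flip: ennreal_mult)
  qed
  also have "... = ennreal D1 * ennreal (2 / a * ln (1 + 2 * a))"
    unfolding nn_integral_log[OF a, symmetric] by (intro nn_integral_cmult measurable_compose[OF lm measurable_ennreal])
  also have "... = ennreal (D1 * (2 / a * ln (1 + 2 * a)))"
    using D1 a by (intro ennreal_mult[symmetric]) auto
  also have "D1 * (2 / a * ln (1 + 2 * a)) = D * X powr (2 * q * \<beta> + 1) * ln (1 + (real N)\<^sup>2 / 10)"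
    unfolding D1_def D_def Cs_def[symmetric] powr_add using X by (simp add: a_def NX mult.commute)
  finally have "Lp_norm (ereal (2 * q)) F \<le> ennreal ((D * X powr (2 * q * \<beta> + 1) * ln (1 + (real N)\<^sup>2 / 10)) powr (1 / (2 * q)))"
    using Fm q by (intro Lp_norm_le) (auto simp: D_def)
  then show ?thesis unfolding F_def X_def .
qed

text \<open>Each of the \<open>L\<close> dyadic nodes, with \<open>L\<close> of order ln n,
  contributes the same amount to the pairing, whereas the norm raised to the power \<open>q\<close>
  grows only like the square root of ln n. Hence \<eta>^q is at least of order (ln n)^(1/2) /
  n.\<close>

lemma Edev_lower_crit:
  fixes q \<alpha> \<beta> :: real
  assumes q: "1 \<le> q" and ab: "0 \<le> \<alpha>" "0 \<le> \<beta>"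
  shows "\<exists>c>0. \<forall>n\<ge>1. ennreal (c * real n powr (- 1 / q) * ln (real n + 1) powr (1 / (2 * q))) \<le>
    Edev (Mset 1 \<inter> Bset (ereal (2 * q)) \<alpha> \<beta>) n (jw \<alpha> \<beta>) (ereal q)"
proof -
  have qp: "ereal q < ereal (2 * q)" using q by simp
  obtain c0 c C where dual: "dual_consts \<alpha> \<beta> c0 c C" using dual_poly[OF ab] by blast
  have c0: "c0 \<ge> (8::nat)" and c: "c > 0" and C: "C > 0" using dual unfolding dual_consts_def by auto
  define s where "s = 2 * \<beta> + 1 / q"
  define D where "D = (2 powr \<alpha> * (1 / (1 - 2 powr (- s)))) powr (2 * q) * 20 powr (2 * q * \<beta>) * 40"
  have s: "s > 0" unfolding s_def using q ab by (simp add: add_nonneg_pos)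
  have "2 powr (- s) < 2 powr (0 :: real)" using s by (intro powr_less_mono) auto
  then have "0 < (2 powr \<alpha> * (1 / (1 - 2 powr (- s)))) powr (2 * q)" using s by simp
  then have D: "D > 0" unfolding D_def by (intro mult_pos_pos) auto
  \<comment> \<open>Makes the first term of the pairing inequality half of the lower bound.\<close>
  define t0 where "t0 = (3 * c / 32) / (64 * pi * C)"
  have t0: "t0 > 0" unfolding t0_def using c C by simp
  define c6 where "c6 = 2 * ln (real c0) / ln 2 + 2"
  have c6: "c6 > 0" unfolding c6_def using c0 by (intro add_nonneg_pos divide_nonneg_nonneg mult_nonneg_nonneg) auto
  define M where "M = 8 * C * 2 powr q * (D * c6) powr (1 / 2)"
  have M: "M > 0" unfolding M_def using C D c6 by simp
  define c7 where "c7 = 3 * c / 64 * t0 powr (q - 1) / M / real c0"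
  have c7: "c7 > 0" unfolding c7_def using c t0 M c0 by simp
  have "ennreal (c7 powr (1 / q) * real n powr (- 1 / q) * ln (real n + 1) powr (1 / (2 * q))) \<le>
    Edev (Mset 1 \<inter> Bset (ereal (2 * q)) \<alpha> \<beta>) n (jw \<alpha> \<beta>) (ereal q)" if n: "n \<ge> 1" for n
  proof (rule ennreal_le_of_less)
    fix \<eta> assume \<eta>: "0 \<le> \<eta>" and less: "Edev (Mset 1 \<inter> Bset (ereal (2 * q)) \<alpha> \<beta>) n (jw \<alpha> \<beta>) (ereal q) < ennreal \<eta>"
    define N where "N = c0 * n"
    have N8: "8 * n \<le> N" unfolding N_def using c0 by simp
    have N1: "N \<ge> 1" using N8 n by simp
    define X where "X = (1 / real N)\<^sup>2"
    have X: "X > 0" unfolding X_def using N1 by simp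
    define Ln where "Ln = ln (real n + 1)"
    have Ln: "Ln > 0" unfolding Ln_def using n by (rule ln_Suc_pos)
    \<comment> \<open>All dyadic nodes up to 2^L, which is at most 2 n and hence at most N / 4, are
      used; \<open>L\<close> is at least ln(n + 1).\<close>
    obtain L where L: "2 ^ L \<le> 2 * n" "n < 2 ^ L"
    proof -
      define L where "L = (LEAST L. n < 2 ^ L)"
      have 1: "n < 2 ^ L" unfolding L_def by (rule LeastI[of _ n]) simp
      then obtain L' where L': "L = Suc L'" using n by (cases L) auto
      have "\<not> n < 2 ^ L'" using not_less_Least[of L' "\<lambda>L. n < 2 ^ L"] L' unfolding L_def by simp
      then show ?thesis using 1 L' by (intro that[of L]) auto
    qed
    have L1: "L \<ge> 1" using L n by (cases L) auto
    have LLn: "Ln \<le> real L"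
    proof -
      have "n + 1 \<le> 2 ^ L" using L(2) by simp
      then have "real (n + 1) \<le> real (2 ^ L)" by (rule of_nat_mono)
      then have "Ln \<le> ln (2 ^ L)" unfolding Ln_def by (subst ln_le_cancel_iff) auto
      also have "... = real L * ln 2" by (simp add: ln_realpow)
      also have "... \<le> real L * 1" using ln_2_less_1 by (intro mult_left_mono) auto
      finally show ?thesis by simp
    qed
    define \<Lambda> where "\<Lambda> = (\<lambda>j. (2 :: nat) ^ j) ` {1..L}"
    have inj: "inj_on (\<lambda>j. (2 :: nat) ^ j) {1..L}" by (auto simp: inj_on_def)
    have card: "card \<Lambda> = L" unfolding \<Lambda>_def card_image[OF inj] by simp
    have \<Lambda>: "finite \<Lambda>" "\<Lambda> \<noteq> {}" unfolding \<Lambda>_def using L1 by auto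
    have \<Lambda>1: "1 \<le> m" "even m" if "m \<in> \<Lambda>" for m using that unfolding \<Lambda>_def by auto
    have \<Lambda>2: "2 * m + 2 \<le> N" if m: "m \<in> \<Lambda>" for m
    proof -
      obtain j where j: "j \<le> L" "m = 2 ^ j" using m unfolding \<Lambda>_def by auto
      have "m \<le> 2 ^ L" unfolding j(2) using j(1) by (intro power_increasing) auto
      then show ?thesis using L(1) N8 n by linarith
    qed
    define B where "B = (D * X powr (2 * q * \<beta> + 1) * ln (1 + (real N)\<^sup>2 / 10)) powr (1 / (2 * q))"
    have B: "Lp_norm (ereal (2 * q)) (\<lambda>x. jw \<alpha> \<beta> x * steps N \<Lambda> (\<lambda>m. real m powr (- s)) d x) \<le> ennreal B" if "d \<le> 1" for d
      using dyadic_steps_norm[OF q ab N1 that, of L] unfolding s_def[symmetric] D_def[symmetric] B_def X_def \<Lambda>_def .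
    define t where "t = t0 * X powr \<beta>"
    have t: "t > 0" unfolding t_def using t0 X by simp
    \<comment> \<open>The exponents of \<open>v\<close> and \<open>l\<close> are determined by two
      balances: v l^(1 - q) and v l hh are both to be bounded independently of \<open>m\<close>.
      With the jump sizes m^(-s), every node then also contributes equally to the lower bound of the
      pairing.\<close>
    define v where "v m = real m powr (1 / q - 1)" for m
    define l where "l m = t * real m powr (- (1 / q))" for m
    have m0: "real m > 0" if "m \<in> \<Lambda>" for m using \<Lambda>1(1)[OF that] by simp
    have "(\<Sum>m\<in>\<Lambda>. real m powr (- s) * (c * v m * ((real m / real N)\<^sup>2) powr \<beta> * (1 / 2)) * (3 * (real m + 1) / 16 * (1 / real N)\<^sup>2)) \<le>
      C * (8 * pi * (\<Sum>m\<in>\<Lambda>. v m * l m * hh N m) + 4 * t powr (1 - q) * (2 * 2 powr q * (B * \<eta>) powr q))"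
    proof (rule steps_deviation[OF dual q qp ab n N_def \<Lambda> \<Lambda>1 \<Lambda>2 _ _ _ _ _ B _ less \<eta>])
      fix m assume m: "m \<in> \<Lambda>"
      show "0 < l m" unfolding l_def using t m0[OF m] by simp
      show "0 < real m powr (- s)" using m0[OF m] by simp
      have "v m * l m powr (1 - q) = t powr (1 - q) * (real m powr (1 / q - 1) * real m powr (- (1 / q) * (1 - q)))"
        unfolding v_def l_def by (simp add: powr_mult powr_powr)
      also have "real m powr (1 / q - 1) * real m powr (- (1 / q) * (1 - q)) = real m powr 0"
        unfolding powr_add[symmetric] using q by (simp add: field_simps)
      finally show "v m * l m powr (1 - q) \<le> t powr (1 - q)" using m0[OF m] by simp
    qed (auto simp: v_def B_def)
    moreover have "real L * (3 * c / 32 * (X powr \<beta> * X)) \<le>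
      (\<Sum>m\<in>\<Lambda>. real m powr (- s) * (c * v m * ((real m / real N)\<^sup>2) powr \<beta> * (1 / 2)) * (3 * (real m + 1) / 16 * (1 / real N)\<^sup>2))"
    proof -
      have ptw: "3 * c / 32 * (X powr \<beta> * X) \<le> real m powr (- s) * (c * v m * ((real m / real N)\<^sup>2) powr \<beta> * (1 / 2)) * (3 * (real m + 1) / 16 * (1 / real N)\<^sup>2)"
        if m: "m \<in> \<Lambda>" for m
      proof -
        have "(real m)\<^sup>2 = real m powr 2" using m0[OF m] by simp
        then have e1: "((real m / real N)\<^sup>2) powr \<beta> = real m powr (2 * \<beta>) * X powr \<beta>"
          unfolding X_def by (simp add: powr_mult[symmetric] powr_powr[symmetric] power_divide)
        have "real m powr (- s) * real m powr (1 / q - 1) * real m powr (2 * \<beta>) * real m powr 1 = real m powr 0"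
          unfolding powr_add[symmetric] s_def by simp
        then have e2: "real m powr (- s) * real m powr (1 / q - 1) * real m powr (2 * \<beta>) * real m = 1"
          using m0[OF m] by simp
        have "3 * c / 32 * (X powr \<beta> * X) = (real m powr (- s) * real m powr (1 / q - 1) * real m powr (2 * \<beta>) * real m) * (3 * c / 32 * (X powr \<beta> * X))"
          unfolding e2 by simp
        also have "... \<le> (real m powr (- s) * real m powr (1 / q - 1) * real m powr (2 * \<beta>) * (real m + 1)) * (3 * c / 32 * (X powr \<beta> * X))"
          using c X by (intro mult_right_mono mult_left_mono mult_nonneg_nonneg) auto
        also have "... = real m powr (- s) * (c * v m * ((real m / real N)\<^sup>2) powr \<beta> * (1 / 2)) * (3 * (real m + 1) / 16 * (1 / real N)\<^sup>2)"
          unfolding e1 v_def X_def[symmetric] by simp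
        finally show ?thesis .
      qed
      have "real L * (3 * c / 32 * (X powr \<beta> * X)) = (\<Sum>m\<in>\<Lambda>. 3 * c / 32 * (X powr \<beta> * X))"
        unfolding sum_constant card ..
      also have "... \<le> (\<Sum>m\<in>\<Lambda>. real m powr (- s) * (c * v m * ((real m / real N)\<^sup>2) powr \<beta> * (1 / 2)) * (3 * (real m + 1) / 16 * (1 / real N)\<^sup>2))"
        by (rule sum_mono) (rule ptw)
      finally show ?thesis .
    qed
    moreover have "(\<Sum>m\<in>\<Lambda>. v m * l m * hh N m) \<le> real L * (4 * t * X)"
    proof -
      have ptw: "v m * l m * hh N m \<le> 4 * t * X" if m: "m \<in> \<Lambda>" for m
      proof -
        have "v m * l m * hh N m \<le> v m * l m * (4 * real m * X)"
          unfolding X_def using t by (intro mult_left_mono hh_le) (auto simp: v_def l_def)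
        also have "... = 4 * t * X * (real m powr (1 / q - 1) * real m powr (- (1 / q)) * real m powr 1)"
          unfolding v_def l_def using m0[OF m] by simp
        also have "real m powr (1 / q - 1) * real m powr (- (1 / q)) * real m powr 1 = real m powr 0"
          unfolding powr_add[symmetric] by simp
        finally show ?thesis using m0[OF m] by simp
      qed
      have "(\<Sum>m\<in>\<Lambda>. v m * l m * hh N m) \<le> (\<Sum>m\<in>\<Lambda>. 4 * t * X)" by (rule sum_mono) (rule ptw)
      then show ?thesis unfolding sum_constant card .
    qed
    then have "C * (8 * pi * (\<Sum>m\<in>\<Lambda>. v m * l m * hh N m) + 4 * t powr (1 - q) * (2 * 2 powr q * (B * \<eta>) powr q)) \<le>
      C * (8 * pi * (real L * (4 * t * X)) + 4 * t powr (1 - q) * (2 * 2 powr q * (B * \<eta>) powr q))"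
      using C by (intro mult_left_mono add_right_mono) auto
    moreover have "C * (8 * pi * (real L * (4 * t * X)) + 4 * t powr (1 - q) * (2 * 2 powr q * (B * \<eta>) powr q)) =
      real L * (3 * c / 64 * (X powr \<beta> * X)) + 8 * C * t powr (1 - q) * 2 powr q * (B * \<eta>) powr q"
      unfolding t_def[of] t0_def using C by (simp add: field_simps)
    moreover have "real L * (3 * c / 32 * (X powr \<beta> * X)) = 2 * (real L * (3 * c / 64 * (X powr \<beta> * X)))" by simp
    ultimately have "real L * (3 * c / 64 * (X powr \<beta> * X)) \<le> 8 * C * t powr (1 - q) * 2 powr q * (B * \<eta>) powr q"
      by linarith
    then have "t powr (q - 1) * (real L * (3 * c / 64 * (X powr \<beta> * X))) \<le> t powr (q - 1) * (8 * C * t powr (1 - q) * 2 powr q * (B * \<eta>) powr q)"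
      by (intro mult_left_mono) auto
    also have "... = (t powr (q - 1) * t powr (1 - q)) * (8 * C * 2 powr q * (B * \<eta>) powr q)" by (simp add: mult_ac)
    also have "t powr (q - 1) * t powr (1 - q) = 1" unfolding powr_add[symmetric] using t by simp
    also have "(B * \<eta>) powr q = (D * X powr (2 * q * \<beta> + 1) * ln (1 + (real N)\<^sup>2 / 10)) powr (1 / 2) * \<eta> powr q"
      unfolding B_def powr_mult[of _ \<eta>] using q by (simp only: powr_powr) simp
    also have "1 * (8 * C * 2 powr q * ((D * X powr (2 * q * \<beta> + 1) * ln (1 + (real N)\<^sup>2 / 10)) powr (1 / 2) * \<eta> powr q)) \<le>
      1 * (8 * C * 2 powr q * ((D * X powr (2 * q * \<beta> + 1) * (c6 * Ln)) powr (1 / 2) * \<eta> powr q))"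
    proof (intro mult_left_mono mult_right_mono powr_mono2)
      have "1 + (real N)\<^sup>2 / 10 \<le> (real c0 * (real n + 1))\<^sup>2"
      proof -
        have "1 \<le> (real c0)\<^sup>2" using c0 by simp
        moreover have "(real N)\<^sup>2 / 10 \<le> (real c0)\<^sup>2 * (real n)\<^sup>2" unfolding N_def by (simp add: power_mult_distrib)
        moreover have "(real c0 * (real n + 1))\<^sup>2 = (real c0)\<^sup>2 * (real n)\<^sup>2 + (real c0)\<^sup>2 * (2 * real n) + (real c0)\<^sup>2"
          by (simp add: power2_eq_square algebra_simps)
        moreover have "0 \<le> (real c0)\<^sup>2 * (2 * real n)" by simp
        ultimately show ?thesis by linarith
      qed
      then have "ln (1 + (real N)\<^sup>2 / 10) \<le> ln ((real c0 * (real n + 1))\<^sup>2)"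
        using c0 by (subst ln_le_cancel_iff) (auto intro!: add_pos_nonneg)
      also have "... = 2 * ln (real c0) + 2 * Ln" unfolding Ln_def using c0 by (simp add: ln_realpow ln_mult)
      also have "2 * ln (real c0) \<le> 2 * ln (real c0) / ln 2 * Ln"
      proof -
        have "ln 2 \<le> Ln" unfolding Ln_def using n by (subst ln_le_cancel_iff) auto
        then have "2 * ln (real c0) / ln 2 * ln 2 \<le> 2 * ln (real c0) / ln 2 * Ln"
          using c0 by (intro mult_left_mono divide_nonneg_nonneg) auto
        then show ?thesis by simp
      qed
      finally show "ln (1 + (real N)\<^sup>2 / 10) \<le> c6 * Ln" unfolding c6_def by (simp add: distrib_right)
    qed (use C D X in auto)
    also have "... = M * (X powr (q * \<beta> + 1 / 2) * Ln powr (1 / 2) * \<eta> powr q)"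
      unfolding M_def by (simp add: powr_mult powr_powr add_divide_distrib)
    also have "t powr (q - 1) * (real L * (3 * c / 64 * (X powr \<beta> * X))) = 3 * c / 64 * t0 powr (q - 1) * real L * X powr (q * \<beta> + 1)"
    proof -
      have "X powr (q * \<beta> + 1) = X powr (\<beta> * (q - 1)) * (X powr \<beta> * X powr 1)"
      proof -
        have "\<beta> * (q - 1) + (\<beta> + 1) = q * \<beta> + 1" by (simp add: algebra_simps)
        then show ?thesis by (simp only: powr_add[symmetric])
      qed
      then show ?thesis unfolding t_def using X by (simp add: powr_mult powr_powr)
    qed
    also have "X powr (q * \<beta> + 1) = X powr (q * \<beta> + 1 / 2) * X powr (1 / 2)"
    proof -
      have "(q * \<beta> + 1 / 2) + 1 / 2 = q * \<beta> + 1" by simp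
      then show ?thesis by (simp only: powr_add[symmetric])
    qed
    also have "X powr (1 / 2) = 1 / real N" unfolding X_def by (simp add: powr_half_sqrt)
    finally have "X powr (q * \<beta> + 1 / 2) * (3 * c / 64 * t0 powr (q - 1) * real L * (1 / real N)) \<le>
      X powr (q * \<beta> + 1 / 2) * (M * (Ln powr (1 / 2) * \<eta> powr q))" by (simp add: mult_ac)
    then have "3 * c / 64 * t0 powr (q - 1) * real L * (1 / real N) \<le> M * (Ln powr (1 / 2) * \<eta> powr q)"
      by (rule mult_left_le_imp_le) (use X in simp)
    then have "3 * c / 64 * t0 powr (q - 1) * real L * (1 / real N) / M \<le> Ln powr (1 / 2) * \<eta> powr q"
      by (metis M mult.commute pos_divide_le_eq)
    moreover have "c7 * (1 / real n) * Ln \<le> c7 * (1 / real n) * real L" using LLn c7 by (intro mult_left_mono) auto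
    moreover have "3 * c / 64 * t0 powr (q - 1) * real L * (1 / real N) / M = c7 * (1 / real n) * real L"
      unfolding c7_def N_def by simp
    moreover have "Ln = Ln powr (1 / 2) * Ln powr (1 / 2)" unfolding powr_add[symmetric] using Ln by simp
    ultimately have "Ln powr (1 / 2) * (c7 * (1 / real n) * Ln powr (1 / 2)) \<le> Ln powr (1 / 2) * \<eta> powr q"
      by (simp add: mult_ac)
    then have "c7 * (1 / real n) * Ln powr (1 / 2) \<le> \<eta> powr q"
      by (rule mult_left_le_imp_le) (use Ln in simp)
    then have "(c7 * (1 / real n) * Ln powr (1 / 2)) powr (1 / q) \<le> (\<eta> powr q) powr (1 / q)"
      using q c7 by (intro powr_mono2) auto
    also have "... = \<eta>" using \<eta> q by (simp add: powr_powr)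
    also have "1 / real n = real n powr (-1)" using n by (simp add: powr_minus_divide)
    also have "(c7 * real n powr (-1) * Ln powr (1 / 2)) powr (1 / q) = c7 powr (1 / q) * real n powr (- 1 / q) * ln (real n + 1) powr (1 / (2 * q))"
      unfolding Ln_def by (simp only: powr_mult powr_powr) simp
    finally show "c7 powr (1 / q) * real n powr (- 1 / q) * ln (real n + 1) powr (1 / (2 * q)) \<le> \<eta>" .
  qed
  moreover have "c7 powr (1 / q) > 0" using c7 by simp
  ultimately show ?thesis by blast
qed

section \<open>Assembly of the cases\<close>

text \<open>The lower bound holds for every \<open>n\<close> and tends to infinity, so already the
  limes inferior is infinite.\<close>

lemma limsup_eq_top:
  fixes X :: "nat \<Rightarrow> ennreal"
  assumes c: "0 < c" and e: "0 < \<epsilon>" and X: "\<And>n. n \<ge> 1 \<Longrightarrow> ennreal (c * ln (real n + 1) powr \<epsilon>) \<le> X n"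
  shows "limsup X = \<infinity>"
proof -
  have le: "ennreal K \<le> limsup X" if K: "0 \<le> K" for K
  proof -
    define Z where "Z = (K / c) powr (1 / \<epsilon>)"
    have "eventually (\<lambda>n. ennreal K \<le> X n) sequentially"
      using eventually_ge_at_top[of "max 1 (nat \<lceil>exp Z\<rceil>)"]
    proof eventually_elim
      fix n :: nat assume n: "max 1 (nat \<lceil>exp Z\<rceil>) \<le> n"
      have "exp Z \<le> real n + 1" using n by linarith
      then have "ln (exp Z) \<le> ln (real n + 1)" by (subst ln_le_cancel_iff) auto
      then have "Z powr \<epsilon> \<le> ln (real n + 1) powr \<epsilon>" using e unfolding Z_def by (intro powr_mono2) auto
      moreover have "Z powr \<epsilon> = K / c" unfolding Z_def using e K c by (simp add: powr_powr)
      ultimately have "K \<le> c * ln (real n + 1) powr \<epsilon>" using c by (simp add: field_simps)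
      then have "ennreal K \<le> ennreal (c * ln (real n + 1) powr \<epsilon>)" by (rule ennreal_leI)
      also have "... \<le> X n" using n by (intro X) simp
      finally show "ennreal K \<le> X n" .
    qed
    then have "ennreal K \<le> liminf X" by (rule Liminf_bounded)
    also have "... \<le> limsup X" by (rule Liminf_le_Limsup) simp
    finally show ?thesis .
  qed
  show ?thesis
  proof (cases "limsup X")
    case (real r)
    then have "ennreal (r + 1) \<le> ennreal r" using le[of "r + 1"] by simp
    then show ?thesis using real(1) by (simp add: ennreal_le_iff)
  qed simp
qed

lemma two_sided:
  assumes "\<exists>c>0. \<forall>n\<ge>1. ennreal (g c n) \<le> E n" "\<exists>c>0. \<forall>n\<ge>1. E n \<le> ennreal (h c n)"
  shows "\<exists>c1 c2 :: real. c1 > 0 \<and> c2 > 0 \<and> (\<forall>n :: nat. n \<ge> 1 \<longrightarrow> ennreal (g c1 n) \<le> E n \<and> E n \<le> ennreal (h c2 n))"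
proof -
  obtain c1 where "c1 > 0" "\<forall>n\<ge>1. ennreal (g c1 n) \<le> E n" using assms(1) by (elim exE conjE)
  moreover obtain c2 where "c2 > 0" "\<forall>n\<ge>1. E n \<le> ennreal (h c2 n)" using assms(2) by (elim exE conjE)
  ultimately show ?thesis by (intro exI[of _ c1] exI[of _ c2]) simp
qed

theorem theorem1p5:
  fixes q :: real and p :: ereal and k :: nat and \<alpha> \<beta> :: real
  assumes "1 \<le> q" and "ereal q < p" and "k \<ge> 1" and "\<alpha> \<ge> 0" and "\<beta> \<ge> 0"
  defines "\<E> \<equiv> (\<lambda>n. Edev (Mset k \<inter> Bset p \<alpha> \<beta>) n (jw \<alpha> \<beta>) (ereal q))"
  shows
   "(k \<ge> 2 \<and> \<not> (k = 2 \<and> q = 1 \<and> p = \<infinity>) \<longrightarrow>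
      (\<exists>c1 c2. c1 > 0 \<and> c2 > 0 \<and> (\<forall>n::nat. n \<ge> 1 \<longrightarrow>
         ennreal (c1 * real n powr (- 2 / q + 2 * einv p)) \<le> \<E> n \<and>
         \<E> n \<le> ennreal (c2 * real n powr (- 2 / q + 2 * einv p)))))
    \<and> (k = 2 \<and> q = 1 \<and> p = \<infinity> \<and> \<alpha> = 0 \<and> \<beta> = 0 \<longrightarrow>
      (\<exists>c1 c2. c1 > 0 \<and> c2 > 0 \<and> (\<forall>n::nat. n \<ge> 1 \<longrightarrow>
         ennreal (c1 * real n powr (- 2)) \<le> \<E> n \<and>
         \<E> n \<le> ennreal (c2 * real n powr (- 2)))))
    \<and> (k = 1 \<and> p \<noteq> ereal (2 * q) \<longrightarrow>
      (\<exists>c1 c2. c1 > 0 \<and> c2 > 0 \<and> (\<forall>n::nat. n \<ge> 1 \<longrightarrow>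
         ennreal (c1 * real n powr (- min (2 / q - 2 * einv p) (1 / q))) \<le> \<E> n \<and>
         \<E> n \<le> ennreal (c2 * real n powr (- min (2 / q - 2 * einv p) (1 / q))))))
    \<and> (k = 2 \<and> q = 1 \<and> p = \<infinity> \<and> (\<alpha>, \<beta>) \<noteq> (0, 0) \<longrightarrow>
      (\<exists>c1 c2. c1 > 0 \<and> c2 > 0 \<and> (\<forall>n::nat. n \<ge> 1 \<longrightarrow>
         ennreal (c1 * real n powr (- 2)) \<le> \<E> n \<and>
         \<E> n \<le> ennreal (c2 * real n powr (- 2) * ln (real n + 1)))))
    \<and> (k = 1 \<and> p = ereal (2 * q) \<longrightarrow>
      (\<exists>c1 c2. c1 > 0 \<and> c2 > 0 \<and> (\<forall>n::nat. n \<ge> 1 \<longrightarrow>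
         ennreal (c1 * real n powr (- 1 / q)) \<le> \<E> n \<and>
         \<E> n \<le> ennreal (c2 * real n powr (- 1 / q) * ln (real n + 1) powr (1 / (2 * q))))))
    \<and> (k = 1 \<and> p = ereal (2 * q) \<and> q > 1 \<longrightarrow>
      (\<forall>\<epsilon>::real. \<epsilon> > 0 \<longrightarrow>
         limsup (\<lambda>n::nat. ennreal (real n powr (1 / q) * ln (real n + 1) powr (- 1 / (2 * q) + \<epsilon>)) * \<E> n)
           = \<infinity>))"
proof (intro conjI impI allI)
  note q = assms(1) and qp = assms(2) and k = assms(3) and ab = assms(4,5)
  note ei = einv_bounds[OF q qp]
  have low: "\<exists>c>0. \<forall>n\<ge>1. ennreal (c * real n powr (- 2 / q + 2 * einv p)) \<le> \<E> n"
    unfolding \<E>_def by (rule Edev_lower_power[OF k q qp ab])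
  {
    assume A: "k \<ge> 2 \<and> \<not> (k = 2 \<and> q = 1 \<and> p = \<infinity>)"
    \<comment> \<open>\<rho> is positive for \<open>k \<ge> 2\<close> apart from the excluded
      triple: for \<open>k = 2\<close> and \<open>q = 1\<close> the first summand vanishes and a
      finite \<open>p\<close> makes the second positive; in all other cases the first is
      positive.\<close>
    have "(real (k - 1) * q - 1) / 2 + q * einv p > 0"
    proof (cases "k = 2 \<and> q = 1")
      case True
      then obtain r where "p = ereal r" "1 < r" using A qp by (cases p) auto
      then have "einv p > 0" unfolding einv_def by simp
      then show ?thesis using True by simp
    next
      case False
      have "1 < real (k - 1) * q"
      proof (cases "k = 2")
        case True
        then show ?thesis using False q by simp
      next
        case False
        then have "2 \<le> real (k - 1)" using A by simp
        then have "2 * 1 \<le> real (k - 1) * q" using q by (intro mult_mono) auto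
        then show ?thesis by linarith
      qed
      moreover have "0 \<le> q * einv p" using q ei by simp
      ultimately show ?thesis by (intro add_pos_nonneg divide_pos_pos; linarith)
    qed
    then have "\<exists>c>0. \<forall>n\<ge>1. \<E> n \<le> ennreal (c * real n powr (- 2 / q + 2 * einv p))"
      unfolding \<E>_def by (intro Edev_upper_pos[OF k q qp ab])
    with low show "\<exists>c1 c2. c1 > 0 \<and> c2 > 0 \<and> (\<forall>n::nat. n \<ge> 1 \<longrightarrow>
         ennreal (c1 * real n powr (- 2 / q + 2 * einv p)) \<le> \<E> n \<and>
         \<E> n \<le> ennreal (c2 * real n powr (- 2 / q + 2 * einv p)))"
      by (rule two_sided)
  next
    assume A: "k = 2 \<and> q = 1 \<and> p = \<infinity> \<and> \<alpha> = 0 \<and> \<beta> = 0"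
    have "\<exists>c>0. \<forall>n\<ge>1. ennreal (c * real n powr (- 2)) \<le> \<E> n" using low A by (simp add: einv_def)
    moreover have "\<exists>c>0. \<forall>n\<ge>1. \<E> n \<le> ennreal (c * real n powr (- 2))"
      using Edev_upper_convex A unfolding \<E>_def by simp
    ultimately show "\<exists>c1 c2. c1 > 0 \<and> c2 > 0 \<and> (\<forall>n::nat. n \<ge> 1 \<longrightarrow>
         ennreal (c1 * real n powr (- 2)) \<le> \<E> n \<and> \<E> n \<le> ennreal (c2 * real n powr (- 2)))"
      by (rule two_sided)
  next
    assume A: "k = 1 \<and> p \<noteq> ereal (2 * q)"
    then have k1: "k = 1" by simp
    have jump: "\<exists>c>0. \<forall>n\<ge>1. ennreal (c * real n powr (- 1 / q)) \<le> \<E> n"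
      unfolding \<E>_def k1 by (rule Edev_lower_jump[OF q qp ab])
    show "\<exists>c1 c2. c1 > 0 \<and> c2 > 0 \<and> (\<forall>n::nat. n \<ge> 1 \<longrightarrow>
         ennreal (c1 * real n powr (- min (2 / q - 2 * einv p) (1 / q))) \<le> \<E> n \<and>
         \<E> n \<le> ennreal (c2 * real n powr (- min (2 / q - 2 * einv p) (1 / q))))"
    \<comment> \<open>For \<open>k = 1\<close> this decides the sign of \<rho>, and at the same time
      which term of the minimum is the smaller one. The lower bound is given by the jump if \<rho> <
      0 and by the endpoint cell if \<rho> > 0.\<close>
    proof (cases "2 * q * einv p < 1")
      case True
      then have "2 * einv p \<le> 1 / q" using q by (simp add: field_simps)
      then have "1 / q \<le> 2 / q - 2 * einv p" by (simp add: field_simps)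
      then have e: "- min (2 / q - 2 * einv p) (1 / q) = - 1 / q" by simp
      have "\<exists>c>0. \<forall>n\<ge>1. \<E> n \<le> ennreal (c * real n powr (- 1 / q))"
        unfolding \<E>_def k1 by (rule Edev_upper_neg[OF q qp ab True])
      with jump show ?thesis unfolding e by (rule two_sided)
    next
      case False
      have ne: "2 * q * einv p \<noteq> 1"
      proof
        assume E: "2 * q * einv p = 1"
        then obtain r where r: "p = ereal r" using qp by (cases p) (auto simp: einv_def)
        then have "r > 0" using q qp by simp
        then have "r = 2 * q" using E r unfolding einv_def by (simp add: field_simps)
        then show False using A r by simp
      qed
      then have gt: "2 * q * einv p > 1" using False by simp
      then have "1 / q \<le> 2 * einv p" using q by (simp add: field_simps)
      then have "2 / q - 2 * einv p \<le> 1 / q" by (simp add: field_simps)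
      then have e: "- min (2 / q - 2 * einv p) (1 / q) = - 2 / q + 2 * einv p" by simp
      have "(real (1 - 1) * q - 1) / 2 + q * einv p > 0" using gt by simp
      then have "\<exists>c>0. \<forall>n\<ge>1. \<E> n \<le> ennreal (c * real n powr (- 2 / q + 2 * einv p))"
        unfolding \<E>_def k1 by (intro Edev_upper_pos[OF order.refl q qp ab])
      with low show ?thesis unfolding e by (rule two_sided)
    qed
  next
    assume A: "k = 2 \<and> q = 1 \<and> p = \<infinity> \<and> (\<alpha>, \<beta>) \<noteq> (0, 0)"
    then have eq: "k = 2" "q = 1" "p = \<infinity>" by auto
    have "\<exists>c>0. \<forall>n\<ge>1. ennreal (c * real n powr (- 2)) \<le> \<E> n" using low A by (simp add: einv_def)
    moreover have "\<exists>c>0. \<forall>n\<ge>1. \<E> n \<le> ennreal (c * real n powr (- 2) * ln (real n + 1))"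
      unfolding \<E>_def eq by (rule Edev_upper_zero[OF ab])
    ultimately show "\<exists>c1 c2. c1 > 0 \<and> c2 > 0 \<and> (\<forall>n::nat. n \<ge> 1 \<longrightarrow>
         ennreal (c1 * real n powr (- 2)) \<le> \<E> n \<and>
         \<E> n \<le> ennreal (c2 * real n powr (- 2) * ln (real n + 1)))"
      by (rule two_sided)
  next
    assume A: "k = 1 \<and> p = ereal (2 * q)"
    then have eq: "k = 1" "p = ereal (2 * q)" by auto
    have "\<exists>c>0. \<forall>n\<ge>1. ennreal (c * real n powr (- 1 / q)) \<le> \<E> n"
      unfolding \<E>_def eq(1) by (rule Edev_lower_jump[OF q qp ab])
    moreover have "\<exists>c>0. \<forall>n\<ge>1. \<E> n \<le> ennreal (c * real n powr (- 1 / q) * ln (real n + 1) powr (1 / (2 * q)))"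
      unfolding \<E>_def eq by (rule Edev_upper_crit[OF q ab])
    ultimately show "\<exists>c1 c2. c1 > 0 \<and> c2 > 0 \<and> (\<forall>n::nat. n \<ge> 1 \<longrightarrow>
         ennreal (c1 * real n powr (- 1 / q)) \<le> \<E> n \<and>
         \<E> n \<le> ennreal (c2 * real n powr (- 1 / q) * ln (real n + 1) powr (1 / (2 * q))))"
      by (rule two_sided)
  next
    fix \<epsilon> :: real
    assume A: "k = 1 \<and> p = ereal (2 * q) \<and> q > 1" and \<epsilon>: "\<epsilon> > 0"
    then have eq: "k = 1" "p = ereal (2 * q)" by auto
    \<comment> \<open>The lower bound carries the full logarithmic factor, so after normalisation
      the power \<epsilon> of the logarithm is left over for every \<open>n\<close>.\<close>
    have "\<exists>c>0. \<forall>n\<ge>1. ennreal (c * real n powr (- 1 / q) * ln (real n + 1) powr (1 / (2 * q))) \<le> \<E> n"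
      unfolding \<E>_def eq by (rule Edev_lower_crit[OF q ab])
    then obtain c where c: "c > 0" and
      E: "\<forall>n\<ge>1. ennreal (c * real n powr (- 1 / q) * ln (real n + 1) powr (1 / (2 * q))) \<le> \<E> n" by (elim exE conjE)
    show "limsup (\<lambda>n::nat. ennreal (real n powr (1 / q) * ln (real n + 1) powr (- 1 / (2 * q) + \<epsilon>)) * \<E> n) = \<infinity>"
    proof (rule limsup_eq_top[OF c \<epsilon>])
      fix n :: nat assume n: "n \<ge> 1"
      define a where "a = real n powr (1 / q) * ln (real n + 1) powr (- 1 / (2 * q) + \<epsilon>)"
      define b where "b = c * real n powr (- 1 / q) * ln (real n + 1) powr (1 / (2 * q))"
      have ab0: "0 \<le> a" "0 \<le> b" unfolding a_def b_def using c by auto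
      have "a * b = c * (real n powr (1 / q) * real n powr (- 1 / q)) *
        (ln (real n + 1) powr (- 1 / (2 * q) + \<epsilon>) * ln (real n + 1) powr (1 / (2 * q)))"
        unfolding a_def b_def by simp
      also have "real n powr (1 / q) * real n powr (- 1 / q) = 1" unfolding powr_add[symmetric] using n by simp
      also have "ln (real n + 1) powr (- 1 / (2 * q) + \<epsilon>) * ln (real n + 1) powr (1 / (2 * q)) = ln (real n + 1) powr \<epsilon>"
        unfolding powr_add[symmetric] by simp
      finally have "ennreal (c * ln (real n + 1) powr \<epsilon>) = ennreal (a * b)" by simp
      also have "\<dots> = ennreal a * ennreal b" using ab0 by (rule ennreal_mult)
      also have "\<dots> \<le> ennreal a * \<E> n" using E n unfolding b_def by (intro mult_left_mono) auto
      finally show "ennreal (c * ln (real n + 1) powr \<epsilon>) \<le>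
        ennreal (real n powr (1 / q) * ln (real n + 1) powr (- 1 / (2 * q) + \<epsilon>)) * \<E> n" unfolding a_def .
    qed
  }
qed

end
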